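(* Let $m\ge 1$ and let $s\mapsto h_s$, $(-S,S)\to \mathrm{Diff}^{2,1}_\Box(\bar Y)$, $S>0$, be a $C^m$-curve with $h_0=\mathrm{id}_{\bar Y}$. Let $Y\setminus\bar{\mathcal P}\subset Y$ be an open set of class $C^{2,1}$ which is compactly contained in $Y$, and let $u\in H^2_{\#,0}(\mathcal P)$ satisfy $F(u,0)=(0,0)$. Let $V\subset(-S,S)$ be a neighborhood of zero and $g:V\to H^2_{\#,0}(\mathcal P)$ a $C^m$-function with $g(0)=u$ and $F(g(s),s)=(0,0)$ for all $s\in V$. Then the mapping $$R:V\to\mathbb R^d,\qquad s\mapsto\int_{h_s(\mathcal P)}\nabla\big((h_s^* )^{-1}g(s)\big)\,dy$$ is $m$-times continuously differentiable. Therefore, the diffusion tensor depends $C^m$-regularly on variations of the domain $\mathcal P$ along the path of diffeomorphisms: $s\mapsto\mathbb D(h_s(\mathcal P))\in\mathbb R^{d\times d}$ is of class $C^m$ in a neighborhood of zero.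
   Context: Let $d\in\{2,3\}$, $Y=(-\frac12,\frac12)^d$. A solid inclusion is compactly contained in $Y$; $\mathcal P\subset Y$ is the remaining (open, connected) fluid domain, so the inclusion is $Y\setminus\bar{\mathcal P}$, and $\partial^{\rm int}\mathcal P$ is the interior boundary (the boundary of the inclusion). $\nu_{\mathcal P}$ is the unit normal on the interior boundary, outer with respect to $\mathcal P$. The same notation is used for $h(\mathcal P)$, with interior boundary $h(\partial^{\rm int}\mathcal P)$. Spaces: $H^k_\#(\mathcal P)$ is the closure in the $H^k(\mathcal P)$-norm of the $Y$-periodic functions in $C^\infty(\mathcal P_{\rm ext})$, where $\mathcal P_{\rm ext}$ is the periodic extension of $\mathcal P$ to $\mathbb R^d$; $H^k_{\#,0}(\mathcal P)=\{v\in H^k_\#(\mathcal P):\int_{\mathcal P}v\,dy=0\}$ with the $H^k(\mathcal P)$-norm; $L^2_0(\mathcal P)$ is the space of $L^2(\mathcal P)$ functions of zero mean. Diffusion tensor of $\mathcal P$: $\mathbb D_{ij}(\mathcal P)=\int_{\mathcal P}(\partial_{y_i}\zeta_j+\delta_{ij})\,dy$, $i,j\in\{1,\dots,d\}$, where $\zeta_j\in H^1_{\#,0}(\mathcal P)$ is the weak solution of $-\Delta\zeta_j=0$ in $\mathcal P$, $\nabla\zeta_j\cdot\nu=-e_j\cdot\nu$ on $\partial^{\rm int}\mathcal P$, $\zeta_j$ periodic with zero mean. Diffeomorphisms: $\mathrm{Diff}^{k,\alpha}(\bar Y)$ is the set of injective $h\in C^{k,\alpha}(\bar Y,\mathbb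 R^d)$ with $h^{-1}\in C^{k,\alpha}(h(\bar Y),\bar Y)$, with the topology of $C^{k,\alpha}(\bar Y,\mathbb R^d)$. For a fixed neighborhood $U\subset\bar Y$ of $\partial Y$, $\mathrm{Diff}^{k,\alpha}_\Box(\bar Y)=\{h\in\mathrm{Diff}^{k,\alpha}(\bar Y):h(\bar Y)=\bar Y,\ h|_U=\mathrm{id}_U\}$. A $C^m$-curve in this set is one that is $C^m$ as a map into the Banach space $C^{k,\alpha}(\bar Y,\mathbb R^d)$. The pullback is $h^*l(x)=l(h(x))$, with inverse $(h^* )^{-1}l=l\circ h^{-1}$. The map $F:H^2_{\#,0}(\mathcal P)\times(-S,S)\to L^2_0(\mathcal P)\times H^{1/2}(\partial^{\rm int}\mathcal P)$ is $$F(u,s)=\Big(h_s^*\Delta (h_s^* )^{-1}u-\frac1{|\mathcal P|}\int_{\mathcal P}h_s^*\Delta (h_s^* )^{-1}u\,dy,\ \ h_s^*\,\mathrm{Tr}_{h_s(\mathcal P)}\big(\nu_{h_s(\mathcal P)}\cdot(\nabla (h_s^* )^{-1}u+e_1)\big)\Big),$$ where $\mathrm{Tr}_{h_s(\mathcal P)}$ is the trace onto $h_s(\partial^{\rm int}\mathcal P)$. (Such $V$ and $g$ exist under the stated hypotheses; the directions $e_2,\dots,e_d$ are treated in the same way as $e_1$.) *)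

theory Defs
  imports "HOL-Analysis.Analysis"
begin

section \<open>Classical differentiability\<close>

text \<open>For open \<open>S\<close> in a finite-dimensional space: all directional derivatives of order up to
  \<open>k\<close> exist (as directional components of Frechet derivatives) and are continuous.\<close>

primrec Ck_on :: "nat \<Rightarrow> ('a::euclidean_space \<Rightarrow> 'b::real_normed_vector) \<Rightarrow> 'a set \<Rightarrow> bool" where
  "Ck_on 0 f S \<longleftrightarrow> continuous_on S f"
| "Ck_on (Suc k) f S \<longleftrightarrow>
     (\<exists>f'. (\<forall>x\<in>S. (f has_derivative f' x) (at x)) \<and> (\<forall>v. Ck_on k (\<lambda>x. f' x v) S))"

definition smooth_on :: "('a::euclidean_space \<Rightarrow> 'b::real_normed_vector) \<Rightarrow> 'a set \<Rightarrow> bool" where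
  "smooth_on f S \<longleftrightarrow> (\<forall>k. Ck_on k f S)"

text \<open>\<open>partials [i\<^sub>1, \<dots>, i\<^sub>k] f\<close> is the iterated partial derivative in the coordinate directions
  \<open>i\<^sub>1, \<dots>, i\<^sub>k\<close>. Lists of indices play the role of multi-indices throughout; in the norms below,
  a mixed derivative is therefore counted once for every order of differentiation, which changes
  the norms only up to equivalence.\<close>

primrec partials :: "'n list \<Rightarrow> (real^'n \<Rightarrow> 'b::real_normed_vector) \<Rightarrow> real^'n \<Rightarrow> 'b" where
  "partials [] f = f"
| "partials (i # is) f = (\<lambda>x. frechet_derivative (partials is f) (at x) (axis i 1))"


section \<open>Hoelder spaces and \<open>C\<^sup>m\<close> curves in function spaces\<close>

text \<open>\<open>C\<^bsup>k,\<alpha>\<^esup>(K)\<close> for a compact set \<open>K\<close> that is the closure of its interior: derivatives are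
  taken in the interior and have to extend continuously to \<open>K\<close>. Values outside \<open>K\<close> are
  irrelevant.\<close>

definition holder_space ::
    "nat \<Rightarrow> real \<Rightarrow> (real^'n) set \<Rightarrow> (real^'n \<Rightarrow> 'b::real_normed_vector) set" where
  "holder_space k \<alpha> K = {f.
     continuous_on K f \<and> Ck_on k f (interior K) \<and>
     (\<forall>is. length is \<le> k \<longrightarrow>
        (\<exists>e. continuous_on K e \<and> (\<forall>x\<in>interior K. e x = partials is f x))) \<and>
     (\<forall>is. length is = k \<longrightarrow>
        (\<exists>L. \<forall>x\<in>interior K. \<forall>y\<in>interior K.
           norm (partials is f x - partials is f y) \<le> L * dist x y powr \<alpha>))}"

definition holder_norm ::
    "nat \<Rightarrow> real \<Rightarrow> (real^'n) set \<Rightarrow> (real^'n \<Rightarrow> 'b::real_normed_vector) \<Rightarrow> real" where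
  "holder_norm k \<alpha> K f =
     (\<Sum>is | length is \<le> k. SUP x\<in>interior K. norm (partials is f x)) +
     (\<Sum>is | length is = k.
        SUP (x, y)\<in>{(x, y). x \<in> interior K \<and> y \<in> interior K \<and> x \<noteq> y}.
          norm (partials is f x - partials is f y) / dist x y powr \<alpha>)"

text \<open>\<open>C\<^sup>m\<close> curves, defined on an open set \<open>J\<close> of reals, in the normed space \<open>(X, N)\<close>. The points of
  \<open>X\<close> are represented by functions, \<open>N\<close> is the norm of the function represented, and all limits
  are limits with respect to \<open>N\<close>.\<close>

primrec Cm_curve :: "nat \<Rightarrow> ('a \<Rightarrow> 'b::real_vector) set \<Rightarrow> (('a \<Rightarrow> 'b) \<Rightarrow> real) \<Rightarrow>
    real set \<Rightarrow> (real \<Rightarrow> 'a \<Rightarrow> 'b) \<Rightarrow> bool" where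
  "Cm_curve 0 X N J c \<longleftrightarrow>
     (\<forall>s\<in>J. c s \<in> X) \<and>
     (\<forall>s\<in>J. ((\<lambda>t. N (\<lambda>x. c t x - c s x)) \<longlongrightarrow> 0) (at s))"
| "Cm_curve (Suc m) X N J c \<longleftrightarrow>
     (\<forall>s\<in>J. c s \<in> X) \<and>
     (\<exists>c'. Cm_curve m X N J c' \<and>
       (\<forall>s\<in>J. ((\<lambda>t. N (\<lambda>x. (c t x - c s x) /\<^sub>R (t - s) - c' s x)) \<longlongrightarrow> 0) (at s)))"


section \<open>Diffeomorphisms of the closed reference cell\<close>

definition cell :: "(real^'n) set" where
  "cell = box (\<chi> i. - 1/2) (\<chi> i. 1/2)"

abbreviation cell_inverse :: "(real^'n \<Rightarrow> real^'n) \<Rightarrow> real^'n \<Rightarrow> real^'n" where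
  "cell_inverse h \<equiv> inv_into (closure cell) h"

definition Diff :: "nat \<Rightarrow> real \<Rightarrow> (real^'n \<Rightarrow> real^'n) set" where
  "Diff k \<alpha> = {h. inj_on h (closure cell) \<and> h \<in> holder_space k \<alpha> (closure cell) \<and>
     cell_inverse h \<in> holder_space k \<alpha> (h ` closure cell)}"

definition Diff_box :: "nat \<Rightarrow> real \<Rightarrow> (real^'n) set \<Rightarrow> (real^'n \<Rightarrow> real^'n) set" where
  "Diff_box k \<alpha> U = {h \<in> Diff k \<alpha>. h ` closure cell = closure cell \<and> (\<forall>x\<in>U. h x = x)}"

definition pull :: "('a \<Rightarrow> 'b) \<Rightarrow> ('b \<Rightarrow> 'c) \<Rightarrow> 'a \<Rightarrow> 'c" where
  "pull h l = (\<lambda>x. l (h x))"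

definition push :: "(real^'n \<Rightarrow> real^'n) \<Rightarrow> (real^'n \<Rightarrow> 'c) \<Rightarrow> real^'n \<Rightarrow> 'c" where
  "push h l = l \<circ> cell_inverse h"


section \<open>Geometry of the perforated cell\<close>

definition inclusion :: "(real^'n) set \<Rightarrow> (real^'n) set" where
  "inclusion P = cell - closure P"

definition interior_boundary :: "(real^'n) set \<Rightarrow> (real^'n) set" where
  "interior_boundary P = frontier (inclusion P)"

text \<open>Locally the set is, in suitable Euclidean coordinates, the strict epigraph of a \<open>C\<^bsup>k,\<alpha>\<^esup>\<close>
  function. Here \<open>n\<close> is the vertical direction, and \<open>\<gamma>\<close>, being constant along \<open>n\<close>, is a function of
  the \<open>d - 1\<close> remaining coordinates.\<close>

definition holder_domain :: "nat \<Rightarrow> real \<Rightarrow> (real^'n) set \<Rightarrow> bool" where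
  "holder_domain k \<alpha> D \<longleftrightarrow> open D \<and>
     (\<forall>x\<in>frontier D. \<exists>r>0. \<exists>n \<gamma>. norm n = 1 \<and>
        (\<forall>y t. \<gamma> (y + t *\<^sub>R n) = \<gamma> y) \<and>
        \<gamma> \<in> holder_space k \<alpha> (cball x r) \<and>
        D \<inter> ball x r = {y \<in> ball x r. \<gamma> y < y \<bullet> n})"

definition fluid_domain :: "nat \<Rightarrow> real \<Rightarrow> (real^'n) set \<Rightarrow> bool" where
  "fluid_domain k \<alpha> P \<longleftrightarrow> open P \<and> connected P \<and> P = cell - closure (inclusion P) \<and>
     closure (inclusion P) \<subseteq> cell \<and> holder_domain k \<alpha> (inclusion P)"

definition is_outer_normal :: "(real^'n) set \<Rightarrow> real^'n \<Rightarrow> real^'n \<Rightarrow> bool" where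
  "is_outer_normal P x n \<longleftrightarrow> (\<exists>r>0. \<exists>\<phi> G.
     Ck_on 1 \<phi> (ball x r) \<and> P \<inter> ball x r = {y \<in> ball x r. \<phi> y < (0::real)} \<and> \<phi> x = 0 \<and>
     (\<phi> has_derivative (\<lambda>v. G \<bullet> v)) (at x) \<and> G \<noteq> 0 \<and> n = G /\<^sub>R norm G)"

definition outer_normal :: "(real^'n) set \<Rightarrow> real^'n \<Rightarrow> real^'n" where
  "outer_normal P x = (THE n. is_outer_normal P x n)"

text \<open>Normalised Hausdorff measure, used in dimension \<open>d - 1\<close> as surface measure.\<close>

definition hausdorff_outer :: "real \<Rightarrow> 'a::metric_space set \<Rightarrow> ennreal" where
  "hausdorff_outer s A = (SUP \<delta>\<in>{0<..}.
     INF C\<in>{C :: nat \<Rightarrow> 'a set. A \<subseteq> (\<Union>n. C n) \<and> (\<forall>n. bounded (C n) \<and> diameter (C n) \<le> \<delta>)}.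
       (\<Sum>n. ennreal (unit_ball_vol s * (diameter (C n) / 2) powr s)))"

definition hausdorff_measure :: "real \<Rightarrow> 'a::metric_space measure" where
  "hausdorff_measure s = measure_of UNIV (sets borel) (hausdorff_outer s)"

definition surface_measure :: "(real^'n) set \<Rightarrow> (real^'n) measure" where
  "surface_measure \<Gamma> = restrict_space (hausdorff_measure (real CARD('n) - 1)) \<Gamma>"


section \<open>Sobolev spaces\<close>

text \<open>Elements of Lebesgue and Sobolev spaces are represented by functions; two functions represent
  the same element if they agree almost everywhere.\<close>

definition L2 :: "'a measure \<Rightarrow> ('a \<Rightarrow> real) set" where
  "L2 M = {u \<in> borel_measurable M. integrable M (\<lambda>x. (u x)\<^sup>2)}"

definition locally_integrable :: "(real^'n) set \<Rightarrow> (real^'n \<Rightarrow> real) \<Rightarrow> bool" where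
  "locally_integrable \<Omega> u \<longleftrightarrow> (\<forall>K. compact K \<and> K \<subseteq> \<Omega> \<longrightarrow> integrable (lebesgue_on K) u)"

definition test_function :: "(real^'n) set \<Rightarrow> (real^'n \<Rightarrow> real) \<Rightarrow> bool" where
  "test_function \<Omega> \<phi> \<longleftrightarrow> smooth_on \<phi> UNIV \<and> (\<exists>K. compact K \<and> K \<subseteq> \<Omega> \<and> (\<forall>x. x \<notin> K \<longrightarrow> \<phi> x = 0))"

definition is_weak_deriv ::
    "(real^'n) set \<Rightarrow> 'n list \<Rightarrow> (real^'n \<Rightarrow> real) \<Rightarrow> (real^'n \<Rightarrow> real) \<Rightarrow> bool" where
  "is_weak_deriv \<Omega> is u w \<longleftrightarrow> locally_integrable \<Omega> u \<and> locally_integrable \<Omega> w \<and>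
     (\<forall>\<phi>. test_function \<Omega> \<phi> \<longrightarrow>
        (LINT x|lebesgue_on \<Omega>. u x * partials is \<phi> x) =
        (-1) ^ length is * (LINT x|lebesgue_on \<Omega>. w x * \<phi> x))"

text \<open>A representative of the weak derivative, which is unique up to null sets.\<close>

definition weak_deriv ::
    "(real^'n) set \<Rightarrow> 'n list \<Rightarrow> (real^'n \<Rightarrow> real) \<Rightarrow> real^'n \<Rightarrow> real" where
  "weak_deriv \<Omega> is u = (SOME w. is_weak_deriv \<Omega> is u w)"

definition weak_grad :: "(real^'n) set \<Rightarrow> (real^'n \<Rightarrow> real) \<Rightarrow> real^'n \<Rightarrow> real^'n" where
  "weak_grad \<Omega> u x = (\<chi> i. weak_deriv \<Omega> [i] u x)"

definition weak_laplacian :: "(real^'n) set \<Rightarrow> (real^'n \<Rightarrow> real) \<Rightarrow> real^'n \<Rightarrow> real" where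
  "weak_laplacian \<Omega> u x = (\<Sum>i\<in>UNIV. weak_deriv \<Omega> [i, i] u x)"

definition sobolev :: "nat \<Rightarrow> (real^'n) set \<Rightarrow> (real^'n \<Rightarrow> real) set" where
  "sobolev k \<Omega> = {u \<in> L2 (lebesgue_on \<Omega>).
     \<forall>is. length is \<le> k \<longrightarrow> (\<exists>w\<in>L2 (lebesgue_on \<Omega>). is_weak_deriv \<Omega> is u w)}"

definition sobolev_norm :: "nat \<Rightarrow> (real^'n) set \<Rightarrow> (real^'n \<Rightarrow> real) \<Rightarrow> real" where
  "sobolev_norm k \<Omega> u =
     sqrt (\<Sum>is | length is \<le> k. LINT x|lebesgue_on \<Omega>. (weak_deriv \<Omega> is u x)\<^sup>2)"

definition lattice_points :: "(real^'n) set" where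
  "lattice_points = {z. \<forall>i. z $ i \<in> \<int>}"

text \<open>The complement of all translates of the closed solid part. In contrast to the union of the
  translates of \<open>P\<close>, this open set contains the faces between adjacent cells, so that functions that
  are smooth on it do not jump there.\<close>

definition periodic_extension :: "(real^'n) set \<Rightarrow> (real^'n) set" where
  "periodic_extension P = {x. \<forall>z\<in>lattice_points. x - z \<notin> closure (inclusion P)}"

definition smooth_periodic :: "(real^'n) set \<Rightarrow> (real^'n \<Rightarrow> real) set" where
  "smooth_periodic P = {\<phi>. smooth_on \<phi> (periodic_extension P) \<and>
     (\<forall>x\<in>periodic_extension P. \<forall>z\<in>lattice_points. \<phi> (x + z) = \<phi> x)}"

definition sobolev_per :: "nat \<Rightarrow> (real^'n) set \<Rightarrow> (real^'n \<Rightarrow> real) set" where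
  "sobolev_per k P = {u \<in> sobolev k P.
     \<forall>\<epsilon>>0. \<exists>\<phi>\<in>smooth_periodic P \<inter> sobolev k P. sobolev_norm k P (\<lambda>x. u x - \<phi> x) < \<epsilon>}"

definition sobolev_per0 :: "nat \<Rightarrow> (real^'n) set \<Rightarrow> (real^'n \<Rightarrow> real) set" where
  "sobolev_per0 k P = {u \<in> sobolev_per k P. (LINT x|lebesgue_on P. u x) = 0}"

text \<open>The trace on the interior boundary is the continuous extension of the restriction of
  smooth functions, with respect to the \<open>H\<^sup>1\<close>-norm on \<open>\<Omega>\<close> and the \<open>L\<^sup>2\<close>-norm on the boundary.\<close>

definition is_trace :: "(real^'n) set \<Rightarrow> (real^'n \<Rightarrow> real) \<Rightarrow> (real^'n \<Rightarrow> real) \<Rightarrow> bool" where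
  "is_trace \<Omega> w t \<longleftrightarrow> w \<in> sobolev 1 \<Omega> \<and> t \<in> L2 (surface_measure (interior_boundary \<Omega>)) \<and>
     (\<exists>\<phi> :: nat \<Rightarrow> real^'n \<Rightarrow> real.
        (\<forall>k. smooth_on (\<phi> k) UNIV) \<and>
        (\<lambda>k. sobolev_norm 1 \<Omega> (\<lambda>x. \<phi> k x - w x)) \<longlonglongrightarrow> 0 \<and>
        (\<lambda>k. \<integral>\<^sup>+x. ennreal ((\<phi> k x - t x)\<^sup>2) \<partial>surface_measure (interior_boundary \<Omega>)) \<longlonglongrightarrow> 0)"

definition trace_of :: "(real^'n) set \<Rightarrow> (real^'n \<Rightarrow> real) \<Rightarrow> real^'n \<Rightarrow> real" where
  "trace_of \<Omega> w = (SOME t. is_trace \<Omega> w t)"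


section \<open>Cell problem and diffusion tensor\<close>

text \<open>Weak form of \<open>- div (\<nabla>\<zeta> + e\<^sub>j) = 0\<close> in \<open>P\<close> with \<open>(\<nabla>\<zeta> + e\<^sub>j) \<cdot> \<nu> = 0\<close> on the interior
  boundary and periodicity on the outer boundary: with these conditions no boundary terms remain.\<close>

definition is_cell_solution :: "(real^'n) set \<Rightarrow> 'n \<Rightarrow> (real^'n \<Rightarrow> real) \<Rightarrow> bool" where
  "is_cell_solution P j \<zeta> \<longleftrightarrow> \<zeta> \<in> sobolev_per0 1 P \<and>
     (\<forall>\<phi>\<in>sobolev_per 1 P.
        (LINT y|lebesgue_on P. (weak_grad P \<zeta> y + axis j 1) \<bullet> weak_grad P \<phi> y) = 0)"

definition cell_solution :: "(real^'n) set \<Rightarrow> 'n \<Rightarrow> real^'n \<Rightarrow> real" where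
  "cell_solution P j = (SOME \<zeta>. is_cell_solution P j \<zeta>)"

definition diffusion_tensor :: "(real^'n) set \<Rightarrow> real^'n^'n" where
  "diffusion_tensor P = (\<chi> i j. LINT y|lebesgue_on P.
     weak_deriv P [i] (cell_solution P j) y + (if i = j then 1 else 0))"

text \<open>The map \<open>F\<close> for the direction \<open>e\<^sub>j\<close>, as a function of \<open>u\<close> and of the diffeomorphism \<open>h = h\<^sub>s\<close>.
  Its second component is only meaningful on the interior boundary. As the normal is defined only
  there, the trace of \<open>\<nu> \<cdot> (\<nabla>v + e\<^sub>j)\<close> is \<open>\<nu>\<close> times the componentwise trace of \<open>\<nabla>v + e\<^sub>j\<close>.\<close>

definition F :: "(real^'n) set \<Rightarrow> 'n \<Rightarrow> (real^'n \<Rightarrow> real) \<Rightarrow> (real^'n \<Rightarrow> real^'n) \<Rightarrow>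
    (real^'n \<Rightarrow> real) \<times> (real^'n \<Rightarrow> real)" where
  "F P j u h =
     (let L = pull h (weak_laplacian (h ` P) (push h u));
          B = (\<lambda>x. \<Sum>i\<in>UNIV. outer_normal (h ` P) x $ i *
                 trace_of (h ` P) (\<lambda>y. (weak_grad (h ` P) (push h u) y + axis j 1) $ i) x)
      in ((\<lambda>y. L y - (LINT x|lebesgue_on P. L x) / measure lebesgue P), pull h B))"

text \<open>Vanishing as an element of \<open>L\<^sup>2\<^sub>0(P) \<times> H\<^bsup>1/2\<^esup>(\<partial>\<^bsup>int\<^esup>P)\<close>, i.e.\ almost everywhere.\<close>

definition is_zero_pair ::
    "(real^'n) set \<Rightarrow> (real^'n \<Rightarrow> real) \<times> (real^'n \<Rightarrow> real) \<Rightarrow> bool" where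
  "is_zero_pair P p \<longleftrightarrow> (AE y in lebesgue_on P. fst p y = 0) \<and>
     (AE y in surface_measure (interior_boundary P). snd p y = 0)"

end

theory Submission
  imports Defs
begin

text \<open>If \<open>v\<close> is the gradient of \<open>u\<close> on \<open>P\<close>, then the gradient of \<open>push (h s) u\<close> at \<open>h s x\<close> is
  \<open>v x v* N s x\<close>, and the volume element becomes \<open>det (D s)\<close>, where \<open>D s\<close> is the Jacobian of \<open>h s\<close> and \<open>N s\<close> its inverse matrix, so that all
  integrals are taken over the fixed domain \<open>P\<close>. Bounded bilinear operations preserve \<open>C\<^sup>m\<close> curves, and so
  does solving a linear equation \<open>p (A s) (v s) = B s\<close> that is coercive and solvable: the difference quotients
  of \<open>v\<close> satisfy an equation with the same operator. The latter is applied twice. In the space of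
  bounded continuous matrix fields, \<open>D s ** N s = mat 1\<close> makes \<open>N\<close> a \<open>C\<^sup>m\<close> curve. In the space of
  gradients of periodic functions on \<open>P\<close>, which is closed by the Poincare inequality, the cell problem on \<open>h s ` P\<close>
  becomes a variational problem with the coefficient matrix \<open>det (D s) *\<^sub>R (N s ** transpose (N s))\<close>,
  which is symmetric and coercive, so that the gradients of the transported cell solutions are \<open>C\<^sup>m\<close> curves.\<close>

section \<open>Calculus of \<open>Ck_on\<close>\<close>

text \<open>The unknown is the gradient of the cell solution rather than the solution itself: the
  tensor sees nothing else, and the zero mean normalisation, which changes with the domain, drops
  out. A weak equation is an identity between functionals of a test gradient; a functional is itself
  a function, so the dual space fits into the same frame of seminormed function spaces as all other
  spaces here. The norms are seminorms on representatives, hence equations hold up to an error of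
  seminorm zero. The obstacle is regularity under transport: the periodic Sobolev space is a closure
  of smooth functions, and composition with a diffeomorphism of class C^{2,1} destroys smoothness.
  The space is therefore described as the closure of periodic \<open>C^1\<close> functions, which
  transport respects, and a Meyers--Serrin argument shows that both closures agree. Periodicity
  survives because the diffeomorphisms are the identity near the outer boundary; this also fixes the
  sign of the Jacobian determinant. Coercivity is used at one \<open>s\<close> at a time, and the
  Poincare inequality is that of the fixed domain.\<close>

declare Ck_on.simps(2) [simp del]

lemma Ck_on_SucI:
  assumes "\<And>x. x \<in> S \<Longrightarrow> (f has_derivative f' x) (at x)" "\<And>v. Ck_on k (\<lambda>x. f' x v) S"
  shows "Ck_on (Suc k) f S"
  unfolding Ck_on.simps using assms by (intro exI[of _ f']) blast

lemma Ck_on_SucE: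
  assumes "Ck_on (Suc k) f S"
  obtains f' where "\<And>x. x \<in> S \<Longrightarrow> (f has_derivative f' x) (at x)" "\<And>v. Ck_on k (\<lambda>x. f' x v) S"
  using assms unfolding Ck_on.simps by (elim exE) blast

lemma Ck_on_cong:
  assumes "open S" "Ck_on k f S" "\<And>x. x \<in> S \<Longrightarrow> f x = g x"
  shows "Ck_on k g S"
proof (cases k)
  case 0
  with assms show ?thesis by (metis Ck_on.simps(1) continuous_on_cong)
next
  case (Suc n)
  from assms(2)[unfolded Suc] obtain f' where f': "\<And>x. x \<in> S \<Longrightarrow> (f has_derivative f' x) (at x)"
    and n: "\<And>v. Ck_on n (\<lambda>x. f' x v) S" by (rule Ck_on_SucE) (rule that)
  have "(g has_derivative f' x) (at x)" if "x \<in> S" for x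
    using f'[OF that] assms(1) that assms(3) by (rule has_derivative_transform_within_open)
  then show ?thesis unfolding Suc by (rule Ck_on_SucI[OF _ n])
qed

text \<open>Derivatives on an open set are unique, so the existentially quantified derivative may be
  taken to be \<open>frechet_derivative\<close>. This removes the choice of a derivative when local
  statements are glued in \<open>Ck_on_local\<close>.\<close>

lemma Ck_on_Suc_iff:
  "Ck_on (Suc k) f S \<longleftrightarrow> (\<forall>x\<in>S. f differentiable (at x)) \<and>
     (\<forall>v. Ck_on k (\<lambda>x. frechet_derivative f (at x) v) S)" if "open S"
proof
  assume "Ck_on (Suc k) f S"
  then obtain f' where f': "\<And>x. x \<in> S \<Longrightarrow> (f has_derivative f' x) (at x)"
    and k: "\<And>v. Ck_on k (\<lambda>x. f' x v) S" by (rule Ck_on_SucE) (rule that)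
  have eq: "frechet_derivative f (at x) = f' x" if "x \<in> S" for x
    using frechet_derivative_at[OF f'[OF that]] by simp
  have "Ck_on k (\<lambda>x. frechet_derivative f (at x) v) S" for v
    by (rule Ck_on_cong[OF that k[of v]]) (simp add: eq)
  then show "(\<forall>x\<in>S. f differentiable (at x)) \<and>
     (\<forall>v. Ck_on k (\<lambda>x. frechet_derivative f (at x) v) S)"
    using f' by (metis differentiable_def)
next
  assume "(\<forall>x\<in>S. f differentiable (at x)) \<and>
     (\<forall>v. Ck_on k (\<lambda>x. frechet_derivative f (at x) v) S)"
  then show "Ck_on (Suc k) f S"
    unfolding frechet_derivative_works by (intro Ck_on_SucI[where f'="\<lambda>x. frechet_derivative f (at x)"]) auto
qed

lemma Ck_on_subset: "Ck_on k f S \<Longrightarrow> T \<subseteq> S \<Longrightarrow> Ck_on k f T"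
proof (induction k arbitrary: f)
  case 0
  then show ?case by (auto intro: continuous_on_subset)
next
  case (Suc k)
  from Suc.prems(1) obtain f' where f': "\<And>x. x \<in> S \<Longrightarrow> (f has_derivative f' x) (at x)"
    "\<And>v. Ck_on k (\<lambda>x. f' x v) S" by (rule Ck_on_SucE) (rule that)
  show ?case
    by (rule Ck_on_SucI[where f'=f']) (use f' Suc in auto)
qed

lemma Ck_on_Suc_imp: "Ck_on (Suc k) f S \<Longrightarrow> Ck_on k f S"
proof (induction k arbitrary: f)
  case 0
  from 0 obtain f' where f': "\<And>x. x \<in> S \<Longrightarrow> (f has_derivative f' x) (at x)"
    "\<And>v. Ck_on 0 (\<lambda>x. f' x v) S" by (rule Ck_on_SucE) (rule that)
  have "isCont f x" if "x \<in> S" for x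
    using has_derivative_continuous[OF f'(1)[OF that]] .
  then have "continuous_on S f" by (simp add: continuous_at_imp_continuous_on)
  then show ?case by simp
next
  case (Suc k)
  from Suc.prems(1) obtain f' where f': "\<And>x. x \<in> S \<Longrightarrow> (f has_derivative f' x) (at x)"
    "\<And>v. Ck_on (Suc k) (\<lambda>x. f' x v) S" by (rule Ck_on_SucE) (rule that)
  show ?case
    by (rule Ck_on_SucI[where f'=f']) (use f' Suc in auto)
qed

lemma Ck_on_mono: "l \<le> k \<Longrightarrow> Ck_on k f S \<Longrightarrow> Ck_on l f S"
  by (induction rule: inc_induct) (auto intro: Ck_on_Suc_imp)

lemma Ck_on_local:
  assumes "open S" "\<And>x. x \<in> S \<Longrightarrow> \<exists>T. open T \<and> x \<in> T \<and> Ck_on k f T"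
  shows "Ck_on k f S"
  using assms(2)
proof (induction k arbitrary: f)
  case 0
  then show ?case
    by (metis Ck_on.simps(1) continuous_at_imp_continuous_on continuous_on_interior interior_open)
next
  case (Suc k)
  have *: "\<exists>T. open T \<and> x \<in> T \<and> f differentiable (at x) \<and>
      (\<forall>v. Ck_on k (\<lambda>x. frechet_derivative f (at x) v) T)" if "x \<in> S" for x
  proof -
    obtain T where T: "open T" "x \<in> T" "Ck_on (Suc k) f T" using Suc.prems[OF \<open>x \<in> S\<close>] by blast
    then show ?thesis using Ck_on_Suc_iff[OF T(1), of k f] by blast
  qed
  have "\<forall>x\<in>S. f differentiable (at x)" using * by blast
  moreover have "Ck_on k (\<lambda>x. frechet_derivative f (at x) v) S" for v
    by (rule Suc.IH) (use * in blast)
  ultimately show ?case unfolding Ck_on_Suc_iff[OF assms(1)] by blast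
qed

lemma Ck_on_const [intro, simp]: "Ck_on k (\<lambda>x. c) S"
  by (induction k arbitrary: c) (auto intro!: Ck_on_SucI[where f'="\<lambda>_ _. 0"])

lemma Ck_on_add: "Ck_on k f S \<Longrightarrow> Ck_on k g S \<Longrightarrow> Ck_on k (\<lambda>x. f x + g x) S"
proof (induction k arbitrary: f g)
  case 0
  then show ?case by (auto intro: continuous_intros)
next
  case (Suc k)
  from Suc.prems(1) obtain f' where f': "\<And>x. x \<in> S \<Longrightarrow> (f has_derivative f' x) (at x)"
    "\<And>v. Ck_on k (\<lambda>x. f' x v) S" by (rule Ck_on_SucE) (rule that)
  from Suc.prems(2) obtain g' where g': "\<And>x. x \<in> S \<Longrightarrow> (g has_derivative g' x) (at x)"
    "\<And>v. Ck_on k (\<lambda>x. g' x v) S" by (rule Ck_on_SucE) (rule that)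
  show ?case
    by (rule Ck_on_SucI[where f'="\<lambda>x v. f' x v + g' x v"]) (use f' g' Suc.IH in \<open>auto intro: has_derivative_add\<close>)
qed

lemma Ck_on_sum: "(\<And>i. i \<in> I \<Longrightarrow> Ck_on k (f i) S) \<Longrightarrow> Ck_on k (\<lambda>x. \<Sum>i\<in>I. f i x) S"
  by (induction I rule: infinite_finite_induct) (auto intro: Ck_on_add)

lemma Ck_on_bilinear:
  assumes "bounded_bilinear p"
  shows "Ck_on k f S \<Longrightarrow> Ck_on k g S \<Longrightarrow> Ck_on k (\<lambda>x. p (f x) (g x)) S"
proof (induction k arbitrary: f g)
  case 0
  then show ?case using bounded_bilinear.continuous_on[OF assms] by auto
next
  case (Suc k)
  from Suc.prems(1) obtain f' where f': "\<And>x. x \<in> S \<Longrightarrow> (f has_derivative f' x) (at x)"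
    "\<And>v. Ck_on k (\<lambda>x. f' x v) S" by (rule Ck_on_SucE) (rule that)
  from Suc.prems(2) obtain g' where g': "\<And>x. x \<in> S \<Longrightarrow> (g has_derivative g' x) (at x)"
    "\<And>v. Ck_on k (\<lambda>x. g' x v) S" by (rule Ck_on_SucE) (rule that)
  have fg: "Ck_on k f S" "Ck_on k g S" using Suc.prems Ck_on_Suc_imp by blast+
  show ?case
    by (rule Ck_on_SucI[where f'="\<lambda>x v. p (f x) (g' x v) + p (f' x v) (g x)"])
      (use f' g' fg Suc.IH in \<open>auto intro!: Ck_on_add bounded_bilinear.FDERIV[OF assms]\<close>)
qed

lemma Ck_on_mult:
  fixes f g :: "'a::euclidean_space \<Rightarrow> 'b::real_normed_algebra"
  shows "Ck_on k f S \<Longrightarrow> Ck_on k g S \<Longrightarrow> Ck_on k (\<lambda>x. f x * g x) S"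
  by (rule Ck_on_bilinear[OF bounded_bilinear_mult])

lemma Ck_on_cmult:
  fixes f :: "'a::euclidean_space \<Rightarrow> 'b::real_normed_algebra"
  shows "Ck_on k f S \<Longrightarrow> Ck_on k (\<lambda>x. c * f x) S"
  by (rule Ck_on_mult) auto

lemma Ck_on_diff:
  fixes f g :: "'a::euclidean_space \<Rightarrow> real"
  shows "Ck_on k f S \<Longrightarrow> Ck_on k g S \<Longrightarrow> Ck_on k (\<lambda>x. f x - g x) S"
  using Ck_on_add[of k f S "\<lambda>x. (-1) * g x"] Ck_on_cmult[of k g S "-1"] by simp

lemma Ck_on_prod:
  fixes f :: "'i \<Rightarrow> 'a::euclidean_space \<Rightarrow> real"
  shows "(\<And>i. i \<in> I \<Longrightarrow> Ck_on k (f i) S) \<Longrightarrow> Ck_on k (\<lambda>x. \<Prod>i\<in>I. f i x) S"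
  by (induction I rule: infinite_finite_induct) (auto intro: Ck_on_mult)

lemma Ck_on_bounded_linear: "bounded_linear L \<Longrightarrow> Ck_on k L S"
  by (cases k) (auto intro!: Ck_on_SucI[where f'="\<lambda>_. L"] linear_continuous_on bounded_linear_imp_has_derivative)

lemma Ck_on_linear_compose:
  assumes "bounded_linear L"
  shows "Ck_on k f S \<Longrightarrow> Ck_on k (\<lambda>x. L (f x)) S"
proof (induction k arbitrary: f)
  case 0
  then show ?case using bounded_linear.continuous_on[OF assms] by auto
next
  case (Suc k)
  from Suc.prems(1) obtain f' where f': "\<And>x. x \<in> S \<Longrightarrow> (f has_derivative f' x) (at x)"
    "\<And>v. Ck_on k (\<lambda>x. f' x v) S" by (rule Ck_on_SucE) (rule that)
  show ?case
    by (rule Ck_on_SucI[where f'="\<lambda>x v. L (f' x v)"]) (use f' Suc.IH in \<open>auto intro!: bounded_linear.has_derivative[OF assms]\<close>)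
qed

lemma Ck_on_translate:
  "Ck_on k f S \<Longrightarrow> Ck_on k (\<lambda>x. f (x + a)) {x. x + a \<in> S}"
proof (induction k arbitrary: f)
  case 0
  then show ?case
    by (auto intro!: continuous_on_compose2[of S f] continuous_intros)
next
  case (Suc k)
  from Suc.prems(1) obtain f' where f': "\<And>x. x \<in> S \<Longrightarrow> (f has_derivative f' x) (at x)"
    "\<And>v. Ck_on k (\<lambda>x. f' x v) S" by (rule Ck_on_SucE) (rule that)
  have "((\<lambda>x. f (x + a)) has_derivative f' (x + a)) (at x)" if "x + a \<in> S" for x
  proof -
    have "((\<lambda>x. x + a) has_derivative (\<lambda>v. v)) (at x)" by (auto intro!: derivative_eq_intros)
    from diff_chain_at[OF this f'(1)[OF that]] show ?thesis by (simp add: o_def)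
  qed
  then show ?case using Suc.IH f'(2) by (auto intro!: Ck_on_SucI[where f'="\<lambda>x. f' (x + a)"])
qed

text \<open>\<open>D\<close> lists all derivatives of \<open>D 0\<close>. The chain rule turns
  \<open>D i\<close> into \<open>D (Suc i)\<close>, so the induction has to run over all members of
  the list at once.\<close>

lemma Ck_on_compose_real:
  fixes D :: "nat \<Rightarrow> real \<Rightarrow> real"
  assumes D: "\<And>i t. (D i has_real_derivative D (Suc i) t) (at t)"
  shows "Ck_on k q S \<Longrightarrow> Ck_on k (\<lambda>x. D i (q x)) S"
proof (induction k arbitrary: i)
  case 0
  have "continuous_on UNIV (D i)"
    using D by (auto intro!: continuous_at_imp_continuous_on DERIV_isCont)
  with 0 show ?case by (auto intro: continuous_on_compose2)
next
  case (Suc k)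
  from Suc.prems(1) obtain q' where q': "\<And>x. x \<in> S \<Longrightarrow> (q has_derivative q' x) (at x)"
    "\<And>v. Ck_on k (\<lambda>x. q' x v) S" by (rule Ck_on_SucE) (rule that)
  have "((\<lambda>x. D i (q x)) has_derivative (\<lambda>v. D (Suc i) (q x) * q' x v)) (at x)" if "x \<in> S" for x
    using diff_chain_at[OF q'(1)[OF that] D[of i "q x", unfolded has_field_derivative_def]]
    by (simp add: o_def)
  moreover have "Ck_on k (\<lambda>x. D (Suc i) (q x) * q' x v) S" for v
    using Suc.IH Suc.prems q'(2) Ck_on_Suc_imp by (intro Ck_on_mult) blast+
  ultimately show ?case by (rule Ck_on_SucI)
qed

section \<open>Smooth cut-off functions and test functions\<close>

definition exp_cutoff :: "real \<Rightarrow> real" where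
  "exp_cutoff t = (if t > 0 then exp (- 1 / t) else 0)"

lemma exp_cutoff_bounds: "0 \<le> exp_cutoff t" "exp_cutoff t \<le> 1"
  "exp_cutoff t > 0 \<longleftrightarrow> t > 0" "t \<le> 0 \<Longrightarrow> exp_cutoff t = 0"
  by (auto simp: exp_cutoff_def)

text \<open>With x = 1/t, differentiation turns p(x) exp(-x) into x^2 (p - p')(x) exp(-x). The
  family is thus closed under derivatives and contains all derivatives of
  \<open>exp_cutoff\<close>.\<close>

definition poly_cutoff :: "real poly \<Rightarrow> real \<Rightarrow> real" where
  "poly_cutoff p t = (if t > 0 then poly p (1 / t) * exp (- 1 / t) else 0)"

lemma poly_times_exp_at_top: "((\<lambda>x::real. poly p x * exp (- x)) \<longlongrightarrow> 0) at_top"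
proof -
  have "((\<lambda>x::real. \<Sum>i\<le>degree p. coeff p i * (x ^ i / exp x)) \<longlongrightarrow> (\<Sum>i\<le>degree p. coeff p i * 0)) at_top"
    by (intro tendsto_sum tendsto_mult tendsto_const tendsto_power_div_exp_0)
  moreover have "(\<lambda>x::real. \<Sum>i\<le>degree p. coeff p i * (x ^ i / exp x)) = (\<lambda>x. poly p x * exp (- x))"
    by (auto simp: poly_altdef sum_distrib_right exp_minus field_simps sum_divide_distrib)
  ultimately show ?thesis by simp
qed

lemma poly_cutoff_deriv:
  fixes t :: real
  shows "(poly_cutoff p has_real_derivative poly_cutoff ([:0, 0, 1:] * (p - pderiv p)) t) (at t)"
proof -
  consider "t > 0" | "t < 0" | "t = 0" by linarith
  then show ?thesis
  proof cases
    case 1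
    have "((\<lambda>t. poly p (1 / t) * exp (- 1 / t)) has_real_derivative
        poly_cutoff ([:0, 0, 1:] * (p - pderiv p)) t) (at t)"
      using 1 unfolding poly_cutoff_def
      by (auto intro!: derivative_eq_intros poly_DERIV[THEN DERIV_chain2] simp: field_simps power2_eq_square)
    then show ?thesis
      using 1 by (rule_tac has_field_derivative_transform_within_open[where S="{0<..}"])
        (auto simp: poly_cutoff_def)
  next
    case 2
    have "((\<lambda>t. 0) has_real_derivative poly_cutoff ([:0, 0, 1:] * (p - pderiv p)) t) (at t)"
      using 2 by (auto simp: poly_cutoff_def)
    then show ?thesis
      using 2 by (rule_tac has_field_derivative_transform_within_open[where S="{..<0}"])
        (auto simp: poly_cutoff_def)
  next
    case 3
    \<comment> \<open>The difference quotient at zero is p(1/h) exp(-1/h) / h; the factor 1/h is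
      absorbed into the polynomial as one more factor X.\<close>
    have "((\<lambda>x::real. poly ([:0,1:] * p) x * exp (- x)) \<longlongrightarrow> 0) at_top" by (rule poly_times_exp_at_top)
    then have "((\<lambda>h. poly ([:0,1:] * p) (inverse h) * exp (- inverse h)) \<longlongrightarrow> 0) (at_right 0)"
      by (rule filterlim_compose) (rule filterlim_inverse_at_top_right)
    then have r: "((\<lambda>h. (poly_cutoff p (0 + h) - poly_cutoff p 0) / h) \<longlongrightarrow> 0) (at_right 0)"
      by (rule Lim_transform_eventually)
        (auto simp: eventually_at_right_field poly_cutoff_def field_simps intro!: exI[of _ "1::real"])
    have l: "((\<lambda>h. (poly_cutoff p (0 + h) - poly_cutoff p 0) / h) \<longlongrightarrow> 0) (at_left 0)"
    proof (rule Lim_transform_eventually[OF tendsto_const])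
      show "\<forall>\<^sub>F h in at_left 0. 0 = (poly_cutoff p (0 + h) - poly_cutoff p 0) / h"
        unfolding eventually_at_left_field by (intro exI[of _ "-1::real"]) (auto simp: poly_cutoff_def)
    qed
    show ?thesis
      unfolding DERIV_def using filterlim_split_at[OF l r] 3 by (simp add: poly_cutoff_def)
  qed
qed

lemma Ck_on_exp_cutoff: "Ck_on k q S \<Longrightarrow> Ck_on k (\<lambda>x. exp_cutoff (q x)) S"
proof -
  define D where "D i = poly_cutoff (((\<lambda>p. [:0, 0, 1:] * (p - pderiv p)) ^^ i) 1)" for i
  have "D 0 = exp_cutoff" by (auto simp: D_def poly_cutoff_def exp_cutoff_def)
  moreover have "(D i has_real_derivative D (Suc i) t) (at t)" for i t
    unfolding D_def using poly_cutoff_deriv by simp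
  ultimately show "Ck_on k q S \<Longrightarrow> Ck_on k (\<lambda>x. exp_cutoff (q x)) S"
    using Ck_on_compose_real[of D k q S 0] by simp
qed

text \<open>Since \<open>exp (- 1 / (n t)) \<longrightarrow> 1\<close> for \<open>t > 0\<close>, these approximate the indicator of the open box.\<close>

definition box_bump :: "real^'n \<Rightarrow> real^'n \<Rightarrow> nat \<Rightarrow> real^'n \<Rightarrow> real" where
  "box_bump a b n x = (\<Prod>i\<in>UNIV. exp_cutoff (Suc n * (x $ i - a $ i)) * exp_cutoff (Suc n * (b $ i - x $ i)))"

lemma Ck_on_nth: "Ck_on k (\<lambda>x::real^'n. x $ i) S"
  by (rule Ck_on_bounded_linear) (rule bounded_linear_vec_nth)

lemma smooth_box_bump: "smooth_on (box_bump a b n) S"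
  unfolding smooth_on_def box_bump_def
  by (intro allI Ck_on_prod Ck_on_mult Ck_on_exp_cutoff Ck_on_cmult Ck_on_diff Ck_on_nth Ck_on_const)

lemma box_bump_bounds: "0 \<le> box_bump a b n x" "box_bump a b n x \<le> 1"
  unfolding box_bump_def
  by (auto intro!: prod_nonneg prod_le_1 mult_le_one mult_nonneg_nonneg simp: exp_cutoff_bounds)

lemma box_bump_outside:
  assumes "x \<notin> box a b"
  shows "box_bump a b n x = 0"
proof -
  from assms obtain i where "x $ i \<le> a $ i \<or> b $ i \<le> x $ i"
    unfolding mem_box_cart by (auto simp: not_less)
  then have "exp_cutoff (Suc n * (x $ i - a $ i)) * exp_cutoff (Suc n * (b $ i - x $ i)) = 0"
    by (auto simp: exp_cutoff_def zero_less_mult_iff)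
  then show ?thesis unfolding box_bump_def by (intro prod_zero) auto
qed

lemma box_bump_pos: "x \<in> box a b \<Longrightarrow> box_bump a b n x > 0"
  by (auto simp: box_bump_def mem_box_cart exp_cutoff_def intro!: prod_pos)

lemma box_bump_tendsto:
  fixes a b x :: "real^'n"
  shows "(\<lambda>n. box_bump a b n x) \<longlonglongrightarrow> indicator (box a b) x"
proof (cases "x \<in> box a b")
  case True
  have *: "(\<lambda>n. exp_cutoff (Suc n * t)) \<longlonglongrightarrow> 1" if "t > 0" for t :: real
  proof -
    have "(\<lambda>n. exp (- (inverse (real (Suc n)) * (1 / t)))) \<longlonglongrightarrow> exp (- (0 * (1 / t)))"
      by (intro tendsto_intros LIMSEQ_inverse_real_of_nat)
    then show ?thesis
      unfolding mult_zero_left minus_zero exp_zero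
      by (rule Lim_transform_eventually)
        (use that in \<open>auto simp: exp_cutoff_def divide_simps zero_less_mult_iff intro!: always_eventually\<close>)
  qed
  have "(\<lambda>n. box_bump a b n x) \<longlonglongrightarrow> (\<Prod>i\<in>(UNIV::'n set). 1 * 1)"
    unfolding box_bump_def using True by (intro tendsto_prod tendsto_mult *) (auto simp: mem_box_cart)
  then show ?thesis using True by simp
qed (simp add: box_bump_outside)

lemma test_function_box_bump:
  assumes "cbox a b \<subseteq> U"
  shows "test_function U (box_bump a b n)"
  unfolding test_function_def
  using assms smooth_box_bump box_subset_cbox box_bump_outside
  by (intro conjI exI[of _ "cbox a b"]) (auto, blast+)

section \<open>The fundamental lemma of the calculus of variations\<close>

text \<open>The positive and the negative part of \<open>g\<close> are densities of two finite
  measures. These agree on boxes, an intersection-stable generator of the Borel sets, so they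
  coincide and the two parts are equal almost everywhere.\<close>

lemma AE_zero_if_box_integrals_zero_borel:
  fixes g :: "'a::euclidean_space \<Rightarrow> real"
  assumes g: "integrable lborel g"
    and zero: "\<And>c d. (LINT x|lborel. indicator (box c d) x * g x) = 0"
  shows "AE x in lborel. g x = 0"
proof -
  have [measurable]: "g \<in> borel_measurable borel" using g by auto
  have "density lborel (\<lambda>x. ennreal (g x)) = density lborel (\<lambda>x. ennreal (- g x))"
    (is "?M = ?N")
  proof (rule measure_eqI_generator_eq[where E="range (\<lambda>(a, b). box a b)" and \<Omega>=UNIV
        and A="\<lambda>n. box (- (real n *\<^sub>R One)) (real n *\<^sub>R One)"])
    show "Int_stable (range (\<lambda>(a, b). box a b :: 'a set))"
      by (auto simp: Int_stable_def box_Int_box)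
    show "sets ?M = sigma_sets UNIV (range (\<lambda>(a, b). box a b))"
      "sets ?N = sigma_sets UNIV (range (\<lambda>(a, b). box a b))"
      by (simp_all add: borel_eq_box)
    show "(\<Union>n. box (- (real n *\<^sub>R One)) (real n *\<^sub>R One)) = (UNIV :: 'a set)"
      unfolding UN_box_eq_UNIV[symmetric] ..
    have fin: "(\<integral>\<^sup>+ x. ennreal (g x) \<partial>lborel) < \<infinity>" "(\<integral>\<^sup>+ x. ennreal (- g x) \<partial>lborel) < \<infinity>"
      using g by (auto simp: real_integrable_def less_top)
    have le: "emeasure ?M X \<le> (\<integral>\<^sup>+ x. ennreal (g x) \<partial>lborel)" if "X \<in> sets borel" for X
      using that by (auto simp: emeasure_density intro!: nn_integral_mono split: split_indicator)
    then show "emeasure ?M (box (- (real n *\<^sub>R One)) (real n *\<^sub>R One)) \<noteq> \<infinity>" for n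
      using fin(1) by (metis borel_open infinity_ennreal_def leD open_box)
    fix X :: "'a set" assume "X \<in> range (\<lambda>(a, b). box a b)"
    then obtain c d where X: "X = box c d" by auto
    have int: "integrable lborel (\<lambda>x. indicator X x * g x)"
      using integrable_mult_indicator[of X lborel g] g X by simp
    have "emeasure ?M X = (\<integral>\<^sup>+ x. ennreal (indicator X x * g x) \<partial>lborel)"
      "emeasure ?N X = (\<integral>\<^sup>+ x. ennreal (- (indicator X x * g x)) \<partial>lborel)"
      using X by (auto simp: emeasure_density intro!: nn_integral_cong split: split_indicator)
    moreover have "enn2real (\<integral>\<^sup>+ x. ennreal (indicator X x * g x) \<partial>lborel) =
      enn2real (\<integral>\<^sup>+ x. ennreal (- (indicator X x * g x)) \<partial>lborel)"
      using real_lebesgue_integral_def[OF int] zero[of c d] X by simp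
    ultimately show "emeasure ?M X = emeasure ?N X"
      using int by (metis ennreal_enn2real infinity_ennreal_def less_top real_integrable_def)
  qed auto
  then have "AE x in lborel. ennreal (g x) = ennreal (- g x)"
    by (intro sigma_finite_measure.density_unique[OF sigma_finite_lborel]) auto
  then show ?thesis
  proof eventually_elim
    case (elim x)
    then show ?case by (cases "g x \<ge> 0") (auto simp: ennreal_neg ennreal_eq_0_iff)
  qed
qed

lemma AE_zero_if_box_integrals_zero:
  fixes g :: "'a::euclidean_space \<Rightarrow> real"
  assumes g: "integrable lebesgue g"
    and zero: "\<And>c d. (LINT x|lebesgue. indicator (box c d) x * g x) = 0"
  shows "AE x in lebesgue. g x = 0"
proof -
  obtain g' where g'[measurable]: "g' \<in> borel_measurable lborel" and eq: "AE x in lborel. g x = g' x"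
    using completion_ex_borel_measurable_real[of g lborel] g by auto
  have eq': "AE x in lebesgue. g x = g' x" using eq by (rule AE_completion)
  have "integrable lebesgue g'"
    by (rule integrable_cong_AE_imp[OF g]) (use eq' in \<open>auto simp: measurable_completion\<close>)
  then have "integrable lborel g'" using integrable_completion[of g' lborel] by simp
  moreover have "(LINT x|lborel. indicator (box c d) x * g' x) = 0" for c d
  proof -
    have "(LINT x|lborel. indicator (box c d) x * g' x) = (LINT x|lebesgue. indicator (box c d) x * g' x)"
      by (intro integral_completion[symmetric]) auto
    also have "\<dots> = (LINT x|lebesgue. indicator (box c d) x * g x)"
    proof (rule integral_cong_AE)
      show "(\<lambda>x. indicator (box c d) x * g' x) \<in> borel_measurable lebesgue"
        by (rule measurable_completion) simp
      show "(\<lambda>x. indicator (box c d) x * g x) \<in> borel_measurable lebesgue"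
        using g by (intro borel_measurable_times borel_measurable_indicator) auto
    qed (use eq' in eventually_elim, simp)
    finally show ?thesis using zero by simp
  qed
  ultimately have "AE x in lborel. g' x = 0" by (rule AE_zero_if_box_integrals_zero_borel)
  then have "AE x in lebesgue. g' x = 0" by (rule AE_completion)
  with eq' show ?thesis by eventually_elim simp
qed

lemma test_function_mult:
  "test_function U \<phi> \<Longrightarrow> smooth_on \<psi> UNIV \<Longrightarrow> test_function U (\<lambda>x. \<phi> x * \<psi> x)"
  unfolding test_function_def smooth_on_def by (auto intro!: Ck_on_mult)

lemma integral_lebesgue_on_cutoff:
  fixes f :: "real^'n \<Rightarrow> real"
  assumes "open U" "\<And>x. x \<notin> U \<Longrightarrow> f x = 0"
  shows "(LINT x|lebesgue_on U. f x) = (LINT x|lebesgue. f x)"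
    "integrable (lebesgue_on U) f \<longleftrightarrow> integrable lebesgue f"
proof -
  have *: "(\<lambda>x. indicator U x *\<^sub>R f x) = f" using assms(2) by (auto split: split_indicator)
  have s: "U \<inter> space lebesgue \<in> sets lebesgue" using assms(1) by auto
  show "(LINT x|lebesgue_on U. f x) = (LINT x|lebesgue. f x)"
    using integral_restrict_space[OF s, of f] * by simp
  show "integrable (lebesgue_on U) f \<longleftrightarrow> integrable lebesgue f"
    using integrable_restrict_space[OF s, of f] * by simp
qed

lemma test_function_bounded:
  assumes "test_function U \<phi>"
  shows "\<exists>B. \<forall>x. \<bar>\<phi> x\<bar> \<le> B"
proof -
  obtain K where K: "compact K" "\<And>x. x \<notin> K \<Longrightarrow> \<phi> x = 0" "continuous_on UNIV \<phi>"
    using assms unfolding test_function_def smooth_on_def by (metis Ck_on.simps(1))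
  have "compact (\<phi> ` K)" using K by (intro compact_continuous_image) (auto intro: continuous_on_subset)
  then obtain B where B: "\<And>y. y \<in> \<phi> ` K \<Longrightarrow> norm y \<le> B" using compact_imp_bounded bounded_iff by metis
  have "\<bar>\<phi> x\<bar> \<le> max B 0" for x using B[of "\<phi> x"] K(2)[of x] by (cases "x \<in> K") auto
  then show ?thesis by blast
qed

lemma integrable_test_function:
  fixes w :: "real^'n \<Rightarrow> real"
  assumes w: "locally_integrable U w" and \<phi>: "test_function U \<phi>"
  shows "integrable lebesgue (\<lambda>x. w x * \<phi> x)"
proof -
  obtain K where K: "compact K" "K \<subseteq> U" "\<And>x. x \<notin> K \<Longrightarrow> \<phi> x = 0" and c: "continuous_on UNIV \<phi>"
    using \<phi> unfolding test_function_def smooth_on_def by (metis Ck_on.simps(1))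
  obtain B where B: "\<And>x. \<bar>\<phi> x\<bar> \<le> B" using test_function_bounded[OF \<phi>] by blast
  have Ks: "K \<inter> space lebesgue \<in> sets lebesgue" using K(1) by (simp add: borel_compact)
  have iw: "integrable lebesgue (\<lambda>x. indicator K x *\<^sub>R w x)"
    using w K integrable_restrict_space[OF Ks, of w] unfolding locally_integrable_def by auto
  have "\<phi> \<in> borel_measurable lebesgue"
    using c by (intro measurable_completion) (simp add: borel_measurable_continuous_onI)
  then have "integrable lebesgue (\<lambda>x. \<phi> x * (indicator K x *\<^sub>R w x))"
    using iw B by (intro Bochner_Integration.integrable_bound[OF integrable_mult_right[OF iw, of B]])
      (auto simp: abs_mult intro!: mult_right_mono AE_I2 intro: order_trans[OF _ abs_ge_self])
  moreover have "(\<lambda>x. \<phi> x * (indicator K x *\<^sub>R w x)) = (\<lambda>x. w x * \<phi> x)"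
    using K(3) by (auto split: split_indicator)
  ultimately show ?thesis by simp
qed

text \<open>Since \<open>w\<close> is only locally integrable, it is first multiplied by a bump
  \<open>\<phi>\<close> that is positive on a small box, which makes it integrable on the whole
  space. The products of \<open>\<phi>\<close> with bumps that approximate the indicator of a box
  are test functions, so \<open>w x * \<phi> x\<close> has integral zero over every box.\<close>

lemma fundamental_lemma:
  fixes w :: "real^'n \<Rightarrow> real"
  assumes "open U" and w: "locally_integrable U w"
    and zero: "\<And>\<phi>. test_function U \<phi> \<Longrightarrow> (LINT x|lebesgue_on U. w x * \<phi> x) = 0"
  shows "AE x in lebesgue_on U. w x = 0"
proof -
  have loc: "AE x in lebesgue. x \<in> box a b \<longrightarrow> w x = 0" if ab: "cbox a b \<subseteq> U" for a b
  proof -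
    define \<phi> where "\<phi> = box_bump a b 0"
    have \<phi>: "test_function U \<phi>" unfolding \<phi>_def by (rule test_function_box_bump[OF ab])
    have int: "integrable lebesgue (\<lambda>x. w x * \<phi> x)" by (rule integrable_test_function[OF w \<phi>])
    have "AE x in lebesgue. w x * \<phi> x = 0"
    proof (rule AE_zero_if_box_integrals_zero[OF int])
      fix c d :: "real^'n"
      have t: "test_function U (\<lambda>x. \<phi> x * box_bump c d n x)" for n
        by (rule test_function_mult[OF \<phi> smooth_box_bump])
      have z: "(LINT x|lebesgue. box_bump c d n x * (w x * \<phi> x)) = 0" for n
      proof -
        have "\<phi> x = 0" if "x \<notin> U" for x
          using \<phi> that unfolding test_function_def by blast
        then have "(LINT x|lebesgue_on U. w x * (\<phi> x * box_bump c d n x)) =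
            (LINT x|lebesgue. w x * (\<phi> x * box_bump c d n x))"
          using assms(1) by (intro integral_lebesgue_on_cutoff) auto
        then show ?thesis using zero[OF t] by (simp add: ac_simps)
      qed
      have m: "box_bump c d n \<in> borel_measurable lebesgue" for n
      proof -
        have "continuous_on UNIV (box_bump c d n)"
          using smooth_box_bump[of c d n UNIV] unfolding smooth_on_def by (metis Ck_on.simps(1))
        then show ?thesis
          by (intro measurable_completion) (simp add: borel_measurable_continuous_onI)
      qed
      have "(\<lambda>n. LINT x|lebesgue. box_bump c d n x * (w x * \<phi> x)) \<longlonglongrightarrow>
          (LINT x|lebesgue. indicator (box c d) x * (w x * \<phi> x))"
      proof (rule integral_dominated_convergence[OF _ _ integrable_abs[OF int]])
        show "(\<lambda>x. indicator (box c d) x * (w x * \<phi> x)) \<in> borel_measurable lebesgue"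
          by (rule borel_measurable_times[OF borel_measurable_indicator borel_measurable_integrable[OF int]]) simp
        show "(\<lambda>x. box_bump c d n x * (w x * \<phi> x)) \<in> borel_measurable lebesgue" for n
          using m borel_measurable_integrable[OF int] by (rule borel_measurable_times)
        show "AE x in lebesgue. (\<lambda>n. box_bump c d n x * (w x * \<phi> x)) \<longlonglongrightarrow>
            indicator (box c d) x * (w x * \<phi> x)"
          by (intro AE_I2 tendsto_mult box_bump_tendsto tendsto_const)
        show "AE x in lebesgue. norm (box_bump c d n x * (w x * \<phi> x)) \<le> \<bar>w x * \<phi> x\<bar>" for n
          using box_bump_bounds[of c d n] by (intro AE_I2) (auto simp: abs_mult intro!: mult_left_le_one_le)
      qed
      then show "(LINT x|lebesgue. indicator (box c d) x * (w x * \<phi> x)) = 0"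
        using z LIMSEQ_unique[OF _ tendsto_const] by simp
    qed
    then show ?thesis
      by eventually_elim (auto simp: \<phi>_def dest!: box_bump_pos[where n=0])
  qed
  \<comment> \<open>Exceptional null sets may be united over countably many boxes only, so the boxes
    inside \<open>U\<close> are thinned out to a countable family with the same union.\<close>
  define \<F> where "\<F> = {box a b | a b. cbox a b \<subseteq> U}"
  have "open X" if "X \<in> \<F>" for X using that by (auto simp: \<F>_def)
  then obtain \<G> where \<G>: "\<G> \<subseteq> \<F>" "countable \<G>" "\<Union>\<G> = \<Union>\<F>"
    using Lindelof by metis
  have "\<forall>X\<in>\<G>. AE x in lebesgue. x \<in> X \<longrightarrow> w x = 0"
    using \<G>(1) loc by (auto simp: \<F>_def)
  then have "AE x in lebesgue. \<forall>X\<in>\<G>. x \<in> X \<longrightarrow> w x = 0"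
    by (subst AE_ball_countable[OF \<G>(2)])
  moreover have "\<exists>X\<in>\<G>. x \<in> X" if x: "x \<in> U" for x
  proof -
    obtain a b where "cbox a b \<subseteq> U" "x \<in> box a b" "\<forall>i\<in>Basis. a \<bullet> i < b \<bullet> i"
      using open_contains_cbox[OF assms(1) x] .
    then have "x \<in> \<Union>\<F>" unfolding \<F>_def by (intro UnionI[of "box a b"]) auto
    then show ?thesis using \<G>(3) by blast
  qed
  ultimately have "AE x in lebesgue. x \<in> U \<longrightarrow> w x = 0" by (auto elim!: eventually_mono)
  then show ?thesis using assms(1) by (subst AE_restrict_space_iff) auto
qed

section \<open>Square integrable functions\<close>

definition L2v :: "'a measure \<Rightarrow> ('a \<Rightarrow> 'b::euclidean_space) set" where
  "L2v M = {f \<in> borel_measurable M. integrable M (\<lambda>x. (norm (f x))\<^sup>2)}"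

definition L2n :: "'a measure \<Rightarrow> ('a \<Rightarrow> 'b::euclidean_space) \<Rightarrow> real" where
  "L2n M f = sqrt (LINT x|M. (norm (f x))\<^sup>2)"

lemma L2_eq_L2v: "L2 M = L2v M"
  by (simp add: L2_def L2v_def)

lemma L2n_nonneg [simp]: "0 \<le> L2n M f"
  by (simp add: L2n_def)

lemma L2n_power2: "(L2n M f)\<^sup>2 = (LINT x|M. (norm (f x))\<^sup>2)"
  by (simp add: L2n_def)

lemma L2v_measurable: "f \<in> L2v M \<Longrightarrow> f \<in> borel_measurable M"
  by (simp add: L2v_def)

lemma L2v_iff_nn:
  "f \<in> L2v M \<longleftrightarrow> f \<in> borel_measurable M \<and> (\<integral>\<^sup>+x. ennreal ((norm (f x))\<^sup>2) \<partial>M) < \<infinity>"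
  by (auto simp: L2v_def integrable_iff_bounded)

lemma nn_integral_L2n:
  "f \<in> L2v M \<Longrightarrow> (\<integral>\<^sup>+x. ennreal ((norm (f x))\<^sup>2) \<partial>M) = ennreal ((L2n M f)\<^sup>2)"
  unfolding L2n_power2 L2v_def by (simp add: nn_integral_eq_integral)

text \<open>Membership and bound come together from one inequality between nonnegative integrals,
  where no integrability has to be known beforehand.\<close>

lemma L2n_le_iff_nn:
  assumes "f \<in> borel_measurable M" "0 \<le> c"
  shows "f \<in> L2v M \<and> L2n M f \<le> c \<longleftrightarrow> (\<integral>\<^sup>+x. ennreal ((norm (f x))\<^sup>2) \<partial>M) \<le> ennreal (c\<^sup>2)"
proof
  assume "f \<in> L2v M \<and> L2n M f \<le> c"
  then show "(\<integral>\<^sup>+x. ennreal ((norm (f x))\<^sup>2) \<partial>M) \<le> ennreal (c\<^sup>2)"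
    by (simp add: nn_integral_L2n ennreal_leI power_mono)
next
  assume *: "(\<integral>\<^sup>+x. ennreal ((norm (f x))\<^sup>2) \<partial>M) \<le> ennreal (c\<^sup>2)"
  then have f: "f \<in> L2v M"
    using assms(1) unfolding L2v_iff_nn by (auto intro: le_less_trans)
  then have "(L2n M f)\<^sup>2 \<le> c\<^sup>2" using * by (simp add: nn_integral_L2n)
  then show "f \<in> L2v M \<and> L2n M f \<le> c" using f assms(2) power2_le_imp_le by blast
qed

lemma L2v_zero [simp]: "(\<lambda>x. 0) \<in> L2v M" and L2n_zero [simp]: "L2n M (\<lambda>x. 0) = 0"
  by (simp_all add: L2v_def L2n_def)

lemma L2v_dominated:
  assumes "f \<in> L2v M" "g \<in> borel_measurable M" "AE x in M. norm (g x) \<le> K * norm (f x)" "0 \<le> K"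
  shows "g \<in> L2v M" "L2n M g \<le> K * L2n M f"
proof -
  have "(\<integral>\<^sup>+x. ennreal ((norm (g x))\<^sup>2) \<partial>M) \<le> (\<integral>\<^sup>+x. ennreal (K\<^sup>2) * ennreal ((norm (f x))\<^sup>2) \<partial>M)"
    using assms(3) by (intro nn_integral_mono_AE)
      (auto elim!: eventually_mono simp: ennreal_mult[symmetric] power_mult_distrib[symmetric] intro!: ennreal_leI power_mono)
  also have "\<dots> = ennreal (K\<^sup>2) * ennreal ((L2n M f)\<^sup>2)"
    using assms(1) by (subst nn_integral_cmult) (auto simp: nn_integral_L2n L2v_def)
  also have "\<dots> = ennreal ((K * L2n M f)\<^sup>2)"
    by (simp add: ennreal_mult power_mult_distrib)
  finally have "g \<in> L2v M \<and> L2n M g \<le> K * L2n M f"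
    using assms(2,4) by (subst L2n_le_iff_nn) auto
  then show "g \<in> L2v M" "L2n M g \<le> K * L2n M f" by auto
qed

lemma L2v_cong_AE:
  assumes "f \<in> L2v M" "g \<in> borel_measurable M" "AE x in M. f x = g x"
  shows "g \<in> L2v M" "L2n M g = L2n M f"
proof -
  show g: "g \<in> L2v M" using assms(3) by (intro L2v_dominated[OF assms(1,2), of 1]) auto
  show "L2n M g = L2n M f" unfolding L2n_def
    using assms by (intro arg_cong[of _ _ sqrt] integral_cong_AE) (auto simp: L2v_def)
qed

lemma L2n_cong: "(\<And>x. x \<in> space M \<Longrightarrow> f x = g x) \<Longrightarrow> L2n M f = L2n M g"
  unfolding L2n_def by (intro arg_cong[of _ _ sqrt] Bochner_Integration.integral_cong) auto

lemma L2v_scale: "f \<in> L2v M \<Longrightarrow> (\<lambda>x. c *\<^sub>R f x) \<in> L2v M"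
  by (auto simp: L2v_def power_mult_distrib)

lemma L2n_scale: "L2n M (\<lambda>x. c *\<^sub>R f x) = \<bar>c\<bar> * L2n M f"
  by (simp add: L2n_def power_mult_distrib real_sqrt_mult)

lemma L2v_add:
  assumes "f \<in> L2v M" "g \<in> L2v M"
  shows "(\<lambda>x. f x + g x) \<in> L2v M"
proof -
  have "(norm (f x + g x))\<^sup>2 \<le> 2 * (norm (f x))\<^sup>2 + 2 * (norm (g x))\<^sup>2" for x
  proof -
    have "(norm (f x + g x))\<^sup>2 \<le> (norm (f x) + norm (g x))\<^sup>2"
      by (intro power_mono norm_triangle_ineq) auto
    also have "\<dots> \<le> 2 * (norm (f x))\<^sup>2 + 2 * (norm (g x))\<^sup>2"
      using zero_le_power2[of "norm (f x) - norm (g x)"] by (simp add: power2_sum power2_diff)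
    finally show ?thesis .
  qed
  note le = this
  have int: "integrable M (\<lambda>x. 2 * (norm (f x))\<^sup>2 + 2 * (norm (g x))\<^sup>2)"
    using assms unfolding L2v_def by auto
  have [measurable]: "f \<in> borel_measurable M" "g \<in> borel_measurable M"
    using assms by (auto simp: L2v_def)
  have "integrable M (\<lambda>x. (norm (f x + g x))\<^sup>2)"
    by (rule Bochner_Integration.integrable_bound[OF int]) (use le in \<open>auto intro!: AE_I2\<close>)
  then show ?thesis by (simp add: L2v_def)
qed

lemma L2v_diff: "f \<in> L2v M \<Longrightarrow> g \<in> L2v M \<Longrightarrow> (\<lambda>x. f x - g x) \<in> L2v M"
  using L2v_add[of f M "\<lambda>x. (-1) *\<^sub>R g x"] L2v_scale[of g M "-1"] by simp

lemma L2v_inner: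
  assumes "f \<in> L2v M" "g \<in> L2v M"
  shows "integrable M (\<lambda>x. f x \<bullet> g x)" "\<bar>LINT x|M. f x \<bullet> g x\<bar> \<le> L2n M f * L2n M g"
proof -
  have m[measurable]: "f \<in> borel_measurable M" "g \<in> borel_measurable M"
    using assms by (auto simp: L2v_def)
  have le: "norm (f x) * norm (g x) \<le> (norm (f x))\<^sup>2 + (norm (g x))\<^sup>2" for x
    using zero_le_power2[of "norm (f x) - norm (g x)"] zero_le_power2[of "norm (f x)"]
      zero_le_power2[of "norm (g x)"] unfolding power2_diff by linarith
  have "integrable M (\<lambda>x. (norm (f x))\<^sup>2 + (norm (g x))\<^sup>2)"
    using assms unfolding L2v_def by auto
  then have int: "integrable M (\<lambda>x. norm (f x) * norm (g x))"
    by (rule Bochner_Integration.integrable_bound) (use le in \<open>auto intro!: AE_I2 simp: abs_mult\<close>)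
  show i: "integrable M (\<lambda>x. f x \<bullet> g x)"
    by (rule Bochner_Integration.integrable_bound[OF int]) (auto simp: Cauchy_Schwarz_ineq2)
  \<comment> \<open>Cauchy--Schwarz is applied in squared form to nonnegative integrals of the
    norms, and the result is translated back.\<close>
  define I where "I = (LINT x|M. norm (f x) * norm (g x))"
  have I0: "0 \<le> I" unfolding I_def by simp
  have "\<bar>LINT x|M. f x \<bullet> g x\<bar> \<le> (LINT x|M. \<bar>f x \<bullet> g x\<bar>)" by (rule integral_abs_bound)
  also have "\<dots> \<le> I" unfolding I_def
    using i int by (intro integral_mono) (auto simp: Cauchy_Schwarz_ineq2)
  also have "ennreal (I\<^sup>2) \<le> ennreal ((L2n M f * L2n M g)\<^sup>2)"
  proof -
    have "ennreal (I\<^sup>2) = (\<integral>\<^sup>+x. ennreal (norm (f x)) * ennreal (norm (g x)) \<partial>M)\<^sup>2"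
      unfolding I_def using int I0[unfolded I_def]
      by (simp add: nn_integral_eq_integral ennreal_mult[symmetric] ennreal_power)
    also have "\<dots> \<le> (\<integral>\<^sup>+x. (ennreal (norm (f x)))\<^sup>2 \<partial>M) * (\<integral>\<^sup>+x. (ennreal (norm (g x)))\<^sup>2 \<partial>M)"
      by (rule Cauchy_Schwarz_nn_integral) auto
    also have "\<dots> = ennreal ((L2n M f * L2n M g)\<^sup>2)"
      using assms by (simp add: ennreal_power nn_integral_L2n ennreal_mult[symmetric] power_mult_distrib)
    finally show ?thesis .
  qed
  then have "I \<le> L2n M f * L2n M g"
    using power2_le_imp_le[of I "L2n M f * L2n M g"] by (simp add: mult_nonneg_nonneg)
  finally show "\<bar>LINT x|M. f x \<bullet> g x\<bar> \<le> L2n M f * L2n M g" .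
qed

lemma L2n_add:
  assumes "f \<in> L2v M" "g \<in> L2v M"
  shows "L2n M (\<lambda>x. f x + g x) \<le> L2n M f + L2n M g"
proof -
  have "(L2n M (\<lambda>x. f x + g x))\<^sup>2 = (LINT x|M. (norm (f x))\<^sup>2 + 2 * (f x \<bullet> g x) + (norm (g x))\<^sup>2)"
    unfolding L2n_power2
    by (intro Bochner_Integration.integral_cong) (auto simp: power2_norm_eq_inner algebra_simps inner_commute)
  also have "\<dots> = (L2n M f)\<^sup>2 + 2 * (LINT x|M. f x \<bullet> g x) + (L2n M g)\<^sup>2"
    using assms L2v_inner(1)[OF assms] unfolding L2n_power2 L2v_def by simp
  also have "\<dots> \<le> (L2n M f + L2n M g)\<^sup>2"
    using L2v_inner(2)[OF assms] by (simp add: power2_sum)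
  finally show ?thesis by (rule power2_le_imp_le) simp
qed

lemma L2n_minus_commute: "L2n M (\<lambda>x. f x - g x) = L2n M (\<lambda>x. g x - f x)"
  by (simp add: L2n_def norm_minus_commute)

lemma L2n_triangle:
  assumes "f \<in> L2v M" "g \<in> L2v M" "h \<in> L2v M"
  shows "L2n M (\<lambda>x. f x - h x) \<le> L2n M (\<lambda>x. f x - g x) + L2n M (\<lambda>x. g x - h x)"
  using L2n_add[OF L2v_diff[OF assms(1,2)] L2v_diff[OF assms(2,3)]] by simp

lemma integral_inner_tendsto:
  assumes "\<And>k. f k \<in> L2v M" "G \<in> L2v M" "g \<in> L2v M"
    and lim: "(\<lambda>k. L2n M (\<lambda>x. f k x - G x)) \<longlonglongrightarrow> 0"
  shows "(\<lambda>k. LINT x|M. f k x \<bullet> g x) \<longlonglongrightarrow> (LINT x|M. G x \<bullet> g x)"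
proof (rule LIM_zero_cancel, rule Lim_null_comparison)
  show "(\<lambda>k. L2n M (\<lambda>x. f k x - G x) * L2n M g) \<longlonglongrightarrow> 0"
    using lim by (rule tendsto_mult_left_zero)
  show "\<forall>\<^sub>F k in sequentially. norm ((LINT x|M. f k x \<bullet> g x) - (LINT x|M. G x \<bullet> g x))
      \<le> L2n M (\<lambda>x. f k x - G x) * L2n M g"
  proof (rule always_eventually, rule allI)
    fix k
    have "(LINT x|M. f k x \<bullet> g x) - (LINT x|M. G x \<bullet> g x) = (LINT x|M. (f k x - G x) \<bullet> g x)"
      using assms by (simp add: inner_diff_left L2v_inner(1))
    then show "norm ((LINT x|M. f k x \<bullet> g x) - (LINT x|M. G x \<bullet> g x)) \<le> L2n M (\<lambda>x. f k x - G x) * L2n M g"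
      using L2v_inner(2)[OF L2v_diff[OF assms(1,2)] assms(3), of k] by simp
  qed
qed

text \<open>Riesz--Fischer: on a finite measure space a Cauchy sequence in the square norm is Cauchy
  in mean, so a subsequence converges almost everywhere. Its limit is the limit of the whole
  sequence in the square norm.\<close>

theorem L2v_complete:
  fixes f :: "nat \<Rightarrow> 'a \<Rightarrow> 'b::euclidean_space"
  assumes fin: "finite_measure M" and f: "\<And>n. f n \<in> L2v M"
    and cauchy: "\<And>e. e > 0 \<Longrightarrow> \<exists>N. \<forall>m\<ge>N. \<forall>n\<ge>N. L2n M (\<lambda>x. f m x - f n x) < e"
  obtains g where "g \<in> L2v M" "(\<lambda>n. L2n M (\<lambda>x. f n x - g x)) \<longlonglongrightarrow> 0"
proof -
  have m[measurable]: "f n \<in> borel_measurable M" for n using f by (auto simp: L2v_def)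
  have one: "(\<lambda>x. 1::real) \<in> L2v M" using finite_measure.integrable_const[OF fin] by (simp add: L2v_def)
  have L1: "integrable M (\<lambda>x. norm (u x)) \<and> (LINT x|M. norm (u x)) \<le> L2n M u * L2n M (\<lambda>x. 1::real)"
    if u: "u \<in> L2v M" for u :: "'a \<Rightarrow> 'b"
  proof -
    have "(\<lambda>x. norm (u x)) \<in> L2v M" "L2n M (\<lambda>x. norm (u x)) = L2n M u" using u by (auto simp: L2v_def L2n_def)
    then show ?thesis using L2v_inner[OF _ one, of "\<lambda>x. norm (u x)"] by auto
  qed
  obtain r where r: "strict_mono r" "AE x in M. Cauchy (\<lambda>i. f (r i) x)"
  proof (rule cauchy_L1_AE_cauchy_subseq)
    show "integrable M (f n)" for n using L1[OF f[of n]] by (simp add: integrable_norm_iff)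
    fix e :: real assume e: "e > 0"
    then obtain N where N: "\<forall>m\<ge>N. \<forall>n\<ge>N. L2n M (\<lambda>x. f m x - f n x) < e / (L2n M (\<lambda>x. 1::real) + 1)"
      using cauchy[of "e / (L2n M (\<lambda>x. 1::real) + 1)"] by (auto simp: add_nonneg_pos)
    have "(LINT x|M. norm (f i x - f j x)) < e" if ij: "i \<ge> N" "j \<ge> N" for i j
    proof -
      have "L2n M (\<lambda>x. f i x - f j x) * L2n M (\<lambda>x. 1::real) \<le> L2n M (\<lambda>x. f i x - f j x) * (L2n M (\<lambda>x. 1::real) + 1)"
        by (intro mult_left_mono) auto
      also have "\<dots> < e" using N ij by (subst pos_less_divide_eq[symmetric]) (auto simp: add_nonneg_pos)
      finally show ?thesis using L1[OF L2v_diff[OF f f], of i j] by linarith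
    qed
    then show "\<exists>N. \<forall>i\<ge>N. \<forall>j\<ge>N. (LINT x|M. norm (f i x - f j x)) < e" by blast
  qed
  have conv: "AE x in M. convergent (\<lambda>k. f (r k) x)"
    using r(2) by eventually_elim (simp add: Cauchy_convergent_iff)
  have rk: "k \<le> r k" for k by (rule seq_suble[OF r(1)])
  define g where "g x = lim (\<lambda>k. f (r k) x)" for x
  have gm[measurable]: "g \<in> borel_measurable M" unfolding g_def by measurable
  have lim: "AE x in M. (\<lambda>k. f (r k) x) \<longlonglongrightarrow> g x"
    using conv by eventually_elim (simp add: g_def convergent_LIMSEQ_iff)
  \<comment> \<open>Fatou's lemma along the subsequence \<open>r\<close>, with \<open>n\<close>
    fixed, carries the Cauchy bound over to the limit \<open>g\<close>.\<close>
  have bound: "(\<lambda>x. f n x - g x) \<in> L2v M \<and> L2n M (\<lambda>x. f n x - g x) \<le> e"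
    if "e > 0" "\<And>m. m \<ge> N \<Longrightarrow> L2n M (\<lambda>x. f n x - f m x) \<le> e" for n N e
  proof -
    have "(\<integral>\<^sup>+x. ennreal ((norm (f n x - g x))\<^sup>2) \<partial>M) \<le>
        (\<integral>\<^sup>+x. liminf (\<lambda>k. ennreal ((norm (f n x - f (r k) x))\<^sup>2)) \<partial>M)"
      using lim
    proof (intro nn_integral_mono_AE, eventually_elim)
      case (elim x)
      then have "(\<lambda>k. ennreal ((norm (f n x - f (r k) x))\<^sup>2)) \<longlonglongrightarrow> ennreal ((norm (f n x - g x))\<^sup>2)"
        by (intro tendsto_intros) auto
      from lim_imp_Liminf[OF _ this] show ?case by simp
    qed
    also have "\<dots> \<le> liminf (\<lambda>k. \<integral>\<^sup>+x. ennreal ((norm (f n x - f (r k) x))\<^sup>2) \<partial>M)"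
      by (rule nn_integral_liminf) measurable
    also have "\<dots> \<le> ennreal (e\<^sup>2)"
    proof (rule order_trans[OF Liminf_le_Limsup], simp, rule Limsup_bounded)
      show "\<forall>\<^sub>F k in sequentially. (\<integral>\<^sup>+x. ennreal ((norm (f n x - f (r k) x))\<^sup>2) \<partial>M) \<le> ennreal (e\<^sup>2)"
        using eventually_ge_at_top[of N]
      proof eventually_elim
        case (elim k)
        then have "L2n M (\<lambda>x. f n x - f (r k) x) \<le> e" using that(2) rk[of k] by auto
        then show ?case
          using that(1) L2v_diff[OF f f, of n "r k"] by (subst L2n_le_iff_nn[symmetric]) auto
      qed
    qed
    finally show ?thesis using that(1) by (subst L2n_le_iff_nn) auto
  qed
  obtain n0 where n0: "\<And>m. m \<ge> n0 \<Longrightarrow> L2n M (\<lambda>x. f n0 x - f m x) \<le> 1"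
    using cauchy[of 1] by (metis less_eq_real_def order_refl zero_less_one)
  have "(\<lambda>x. f n0 x - g x) \<in> L2v M" using bound[of 1 n0 n0] n0 by auto
  from L2v_diff[OF f[of n0] this] have "g \<in> L2v M" by simp
  moreover have "(\<lambda>n. L2n M (\<lambda>x. f n x - g x)) \<longlonglongrightarrow> 0"
  proof (rule LIMSEQ_I)
    fix e :: real assume "e > 0"
    then obtain N where N: "\<And>m n. m \<ge> N \<Longrightarrow> n \<ge> N \<Longrightarrow> L2n M (\<lambda>x. f m x - f n x) < e / 2"
      using cauchy[of "e/2"] by (auto simp: )
    have "L2n M (\<lambda>x. f n x - g x) \<le> e / 2" if "n \<ge> N" for n
      using bound[of "e/2" N n] N[OF that] \<open>e > 0\<close> less_imp_le by auto
    note * = this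
    have "norm (L2n M (\<lambda>x. f n x - g x) - 0) < e" if "n \<ge> N" for n
      using *[OF that] \<open>e > 0\<close> by simp
    then show "\<exists>no. \<forall>n\<ge>no. norm (L2n M (\<lambda>x. f n x - g x) - 0) < e" by blast
  qed
  ultimately show thesis by (rule that)
qed

section \<open>Weak derivatives\<close>

definition grad :: "(real^'n \<Rightarrow> real) \<Rightarrow> real^'n \<Rightarrow> real^'n" where
  "grad f x = (\<chi> i. frechet_derivative f (at x) (axis i 1))"

definition C1_on :: "(real^'n \<Rightarrow> real) \<Rightarrow> (real^'n) set \<Rightarrow> bool" where
  "C1_on f S \<longleftrightarrow> (\<forall>x\<in>S. (f has_derivative (\<lambda>v. grad f x \<bullet> v)) (at x)) \<and> continuous_on S (grad f)"

lemma partials_grad: "partials [i] f x = grad f x $ i"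
  by (simp add: grad_def)

lemma grad_eqI:
  assumes "(f has_derivative (\<lambda>v. G \<bullet> v)) (at x)"
  shows "grad f x = G"
  using frechet_derivative_at[OF assms, symmetric] by (simp add: grad_def vec_eq_iff inner_axis)

lemma has_derivative_grad:
  assumes "f differentiable (at x)"
  shows "(f has_derivative (\<lambda>v. grad f x \<bullet> v)) (at x)"
proof -
  have d: "(f has_derivative frechet_derivative f (at x)) (at x)"
    using assms frechet_derivative_works by blast
  then interpret bounded_linear "frechet_derivative f (at x)" by (rule has_derivative_bounded_linear)
  have "frechet_derivative f (at x) v = grad f x \<bullet> v" for v
  proof -
    have "frechet_derivative f (at x) v = frechet_derivative f (at x) (\<Sum>i\<in>UNIV. v $ i *\<^sub>R axis i 1)"
      by (simp add: basis_expansion flip: scalar_mult_eq_scaleR)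
    also have "\<dots> = grad f x \<bullet> v"
      by (simp add: sum scaleR inner_vec_def grad_def mult.commute)
    finally show ?thesis .
  qed
  then have "frechet_derivative f (at x) = (\<lambda>v. grad f x \<bullet> v)" by (rule ext)
  with d show ?thesis by simp
qed

lemma C1_onI:
  assumes "\<And>x. x \<in> S \<Longrightarrow> (f has_derivative (\<lambda>v. G x \<bullet> v)) (at x)" "continuous_on S G"
  shows "C1_on f S"
proof -
  have "grad f x = G x" if "x \<in> S" for x using grad_eqI assms(1)[OF that] by blast
  then show ?thesis unfolding C1_on_def using assms by (metis continuous_on_cong)
qed

lemma C1_on_deriv: "C1_on f S \<Longrightarrow> x \<in> S \<Longrightarrow> (f has_derivative (\<lambda>v. grad f x \<bullet> v)) (at x)"
  by (simp add: C1_on_def)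

lemma C1_on_continuous: "C1_on f S \<Longrightarrow> continuous_on S f"
  unfolding C1_on_def
  by (meson continuous_at_imp_continuous_on has_derivative_continuous)

lemma C1_on_subset: "C1_on f S \<Longrightarrow> T \<subseteq> S \<Longrightarrow> C1_on f T"
  unfolding C1_on_def by (auto intro: continuous_on_subset)

lemma continuous_on_grad: "continuous_on S (grad f) \<longleftrightarrow> (\<forall>i. continuous_on S (\<lambda>x. grad f x $ i))"
proof
  assume "\<forall>i. continuous_on S (\<lambda>x. grad f x $ i)"
  then have "continuous_on S (\<lambda>x. \<chi> i. grad f x $ i)" by (intro continuous_on_vec_lambda) auto
  then show "continuous_on S (grad f)" by simp
qed (auto intro: continuous_intros)

lemma Ck_on_1_iff_C1_on: "open S \<Longrightarrow> Ck_on 1 f S \<longleftrightarrow> C1_on f S"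
proof
  assume S: "open S" and "Ck_on 1 f S"
  then have d: "\<And>x. x \<in> S \<Longrightarrow> f differentiable (at x)"
    and c: "\<And>v. continuous_on S (\<lambda>x. frechet_derivative f (at x) v)"
    using Ck_on_Suc_iff[OF S, of 0 f] by auto
  have "continuous_on S (grad f)" unfolding continuous_on_grad using c by (simp add: grad_def)
  then show "C1_on f S" unfolding C1_on_def using d by (auto intro: has_derivative_grad)
next
  assume S: "open S" and "C1_on f S"
  then show "Ck_on 1 f S" unfolding One_nat_def C1_on_def
    by (intro Ck_on_SucI[where f'="\<lambda>x v. grad f x \<bullet> v"]) (auto intro: continuous_intros)
qed

lemma smooth_on_C1_on: "open S \<Longrightarrow> smooth_on f S \<Longrightarrow> C1_on f S"
  unfolding smooth_on_def using Ck_on_1_iff_C1_on by blast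

lemma grad_cong:
  assumes "open S" "x \<in> S" "\<And>y. y \<in> S \<Longrightarrow> f y = g y"
  shows "grad f x = grad g x"
proof -
  have "(f has_derivative D) (at x) = (g has_derivative D) (at x)" for D
    using has_derivative_transform_within_open[of f D x UNIV S g]
      has_derivative_transform_within_open[of g D x UNIV S f] assms by auto
  then show ?thesis by (simp add: grad_def frechet_derivative_def)
qed

lemma C1_on_cong:
  assumes "open S" "C1_on f S" "\<And>x. x \<in> S \<Longrightarrow> f x = g x"
  shows "C1_on g S"
  using Ck_on_cong[OF assms(1) _ assms(3)] assms by (simp only: Ck_on_1_iff_C1_on[symmetric])

lemma grad_mult:
  assumes "(f has_derivative (\<lambda>v. grad f x \<bullet> v)) (at x)" "(g has_derivative (\<lambda>v. grad g x \<bullet> v)) (at x)"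
  shows "((\<lambda>x. f x * g x) has_derivative (\<lambda>v. (f x *\<^sub>R grad g x + g x *\<^sub>R grad f x) \<bullet> v)) (at x)"
    "grad (\<lambda>x. f x * g x) x = f x *\<^sub>R grad g x + g x *\<^sub>R grad f x"
proof -
  show *: "((\<lambda>x. f x * g x) has_derivative (\<lambda>v. (f x *\<^sub>R grad g x + g x *\<^sub>R grad f x) \<bullet> v)) (at x)"
    using has_derivative_mult[OF assms] by (simp add: inner_add_left algebra_simps)
  show "grad (\<lambda>x. f x * g x) x = f x *\<^sub>R grad g x + g x *\<^sub>R grad f x"
    by (rule grad_eqI[OF *])
qed

lemma C1_on_mult: "C1_on f S \<Longrightarrow> C1_on g S \<Longrightarrow> C1_on (\<lambda>x. f x * g x) S"
  by (rule C1_onI[where G="\<lambda>x. f x *\<^sub>R grad g x + g x *\<^sub>R grad f x"])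
    (auto intro!: grad_mult C1_on_deriv continuous_intros C1_on_continuous simp: C1_on_def)

lemma C1_on_diff: "C1_on f S \<Longrightarrow> C1_on g S \<Longrightarrow> C1_on (\<lambda>x. f x - g x) S"
  by (rule C1_onI[where G="\<lambda>x. grad f x - grad g x"])
    (auto simp: C1_on_def inner_diff_left intro!: has_derivative_diff continuous_intros)

text \<open>The open sets \<open>S\<close> and \<open>- K\<close> cover the space and
  \<open>f\<close> vanishes on the second; being \<open>C^1\<close> is a local property.\<close>

lemma C1_on_Un_zero:
  fixes f :: "real^'n \<Rightarrow> real"
  assumes "open S" "closed K" "K \<subseteq> S" "C1_on f S" "\<And>x. x \<notin> K \<Longrightarrow> f x = 0"
  shows "C1_on f UNIV" "\<And>x. x \<notin> K \<Longrightarrow> grad f x = 0"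
proof -
  have z: "Ck_on 1 f (- K)"
    by (rule Ck_on_cong[where f="\<lambda>_. 0"]) (use assms in \<open>auto simp: open_Compl\<close>)
  have "Ck_on 1 f UNIV"
  proof (rule Ck_on_local)
    fix x :: "real^'n"
    show "\<exists>T. open T \<and> x \<in> T \<and> Ck_on 1 f T"
    proof (cases "x \<in> S")
      case True
      then show ?thesis using assms Ck_on_1_iff_C1_on by blast
    next
      case False
      then show ?thesis using z assms by (intro exI[of _ "- K"]) (auto simp: open_Compl)
    qed
  qed auto
  then show "C1_on f UNIV" by (simp only: Ck_on_1_iff_C1_on[OF open_UNIV])
  show "grad f x = 0" if "x \<notin> K" for x
    by (rule grad_eqI, rule has_derivative_transform_within_open[where f="\<lambda>_. 0" and s="- K"])
      (use assms that in \<open>auto simp: open_Compl\<close>)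
qed

lemma inner_derivative_bound:
  fixes f :: "real^'n \<Rightarrow> real"
  assumes "convex S" and f: "\<And>y. y \<in> S \<Longrightarrow> (f has_derivative (\<lambda>v. G y \<bullet> v)) (at y within S)"
    and B: "\<And>y. y \<in> S \<Longrightarrow> norm (G y) \<le> B" and xz: "x \<in> S" "z \<in> S"
  shows "\<bar>f x - f z\<bar> \<le> B * norm (x - z)"
proof -
  have "onorm (\<lambda>v. G y \<bullet> v) \<le> B" if "y \<in> S" for y
    using order_trans[OF norm_ge_zero B[OF that]] mult_right_mono[OF B[OF that] norm_ge_zero]
    by (intro onorm_bound) (auto intro: order_trans[OF Cauchy_Schwarz_ineq2])
  from differentiable_bound[OF assms(1) f this xz] show ?thesis by simp
qed

text \<open>By translation invariance every difference quotient of \<open>f\<close> has integral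
  zero. The quotients converge to the partial derivative, and the mean value inequality dominates
  them by a bound of the gradient on a compact set.\<close>

lemma integral_grad_compact_support:
  fixes f :: "real^'n \<Rightarrow> real"
  assumes f: "C1_on f UNIV" and K: "compact K" "\<And>x. x \<notin> K \<Longrightarrow> f x = 0"
  shows "(LINT x|lborel. grad f x $ i) = 0"
proof -
  \<comment> \<open>The increments have length at most 1, so the closed 1-neighbourhood of
    \<open>K\<close> contains the supports of all difference quotients.\<close>
  define K' where "K' = {x + y | x y. x \<in> K \<and> y \<in> cball 0 (1::real)}"
  have K': "compact K'" unfolding K'_def by (intro compact_sums K compact_cball)
  have KK': "x \<in> K'" if "x \<in> K" for x
  proof -
    have "x + 0 \<in> K'" unfolding K'_def using that by (intro CollectI exI conjI refl) auto
    then show ?thesis by simp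
  qed
  have cg: "continuous_on UNIV (grad f)" using f by (simp add: C1_on_def)
  have cf: "continuous_on UNIV f" using f by (rule C1_on_continuous)
  have [measurable]: "f \<in> borel_measurable borel" "grad f \<in> borel_measurable borel"
    using cf cg by (auto intro: borel_measurable_continuous_onI)
  have [measurable]: "(\<lambda>x. grad f x $ i) \<in> borel_measurable borel"
    using cg by (intro borel_measurable_continuous_onI continuous_intros)
  have g0: "grad f x = 0" if "x \<notin> K" for x
    by (rule grad_eqI, rule has_derivative_transform_within_open[where f="\<lambda>_. 0" and s="- K"])
      (use K that in \<open>auto simp: open_Compl compact_imp_closed\<close>)
  have "compact (grad f ` K)" using K cg by (intro compact_continuous_image) (auto intro: continuous_on_subset)
  then obtain B0 where B0: "\<And>y. y \<in> grad f ` K \<Longrightarrow> norm y \<le> B0" using compact_imp_bounded bounded_iff by metis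
  define B where "B = max B0 0"
  have B: "norm (grad f x) \<le> B" for x
    using B0[of "grad f x"] g0[of x] by (cases "x \<in> K") (auto simp: B_def)
  define q where "q n x = (f (x + (1 / Suc n) *\<^sub>R axis i 1) - f x) * Suc n" for n x
  have [measurable]: "q n \<in> borel_measurable borel" for n
    unfolding q_def using cf
    by (intro borel_measurable_continuous_onI continuous_intros continuous_on_compose2[OF cf]) auto
  have fint: "integrable lborel f"
  proof -
    have "integrable lborel (\<lambda>x. indicator K x *\<^sub>R f x)"
      using borel_integrable_compact[OF K(1), of f] cf
      by (auto simp: set_integrable_def intro: continuous_on_subset)
    moreover have "(\<lambda>x. indicator K x *\<^sub>R f x) = f" using K(2) by (auto split: split_indicator)
    ultimately show ?thesis by simp
  qed
  have qz: "(LINT x|lborel. q n x) = 0" for n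
  proof -
    define c :: "real^'n" where "c = (1 / Suc n) *\<^sub>R axis i 1"
    have "(LINT x|lborel. f x) = (LINT x|distr lborel borel ((+) c). f x)" by (simp add: lborel_distr_plus)
    also have "\<dots> = (LINT x|lborel. f (c + x))" by (rule integral_distr) auto
    finally have e: "(LINT x|lborel. f (c + x)) = (LINT x|lborel. f x)" ..
    have i: "integrable lborel (\<lambda>x. f (c + x))"
      using fint integrable_distr_eq[of "(+) c" lborel borel f] by (simp add: lborel_distr_plus)
    have "(LINT x|lborel. q n x) = (LINT x|lborel. (f (c + x) - f x) * Suc n)"
      unfolding q_def c_def by (simp add: add.commute)
    also have "\<dots> = 0" using i fint e by simp
    finally show ?thesis .
  qed
  have "(\<lambda>n. LINT x|lborel. q n x) \<longlonglongrightarrow> (LINT x|lborel. grad f x $ i)"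
  proof (rule integral_dominated_convergence[where w="\<lambda>x. indicator K' x * B"])
    have "emeasure lborel K' < \<infinity>" using emeasure_bounded_finite[OF compact_imp_bounded[OF K']] by simp
    then show "integrable lborel (\<lambda>x. indicator K' x * B)"
      using K' by (intro integrable_mult_left integrable_real_indicator) (auto simp: borel_compact)
    show "AE x in lborel. (\<lambda>n. q n x) \<longlonglongrightarrow> grad f x $ i"
    proof (rule AE_I2)
      fix x :: "real^'n"
      have "((\<lambda>t. f (x + t *\<^sub>R axis i 1)) has_derivative (\<lambda>t. grad f x \<bullet> (t *\<^sub>R axis i 1))) (at 0)"
      proof -
        have l: "((\<lambda>t::real. x + t *\<^sub>R axis i (1::real)) has_derivative (\<lambda>t. t *\<^sub>R axis i 1)) (at 0)"
          by (auto intro!: derivative_eq_intros)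
        have "(f has_derivative (\<lambda>v. grad f x \<bullet> v)) (at (x + 0 *\<^sub>R axis i 1))"
          using f by (simp add: C1_on_def)
        from diff_chain_at[OF l this] show ?thesis by (simp add: o_def)
      qed
      then have "((\<lambda>t. f (x + t *\<^sub>R axis i 1)) has_real_derivative grad f x $ i) (at 0)"
        unfolding has_field_derivative_def by (rule has_derivative_eq_rhs) (auto simp: inner_axis)
      then have "((\<lambda>t. (f (x + (0 + t) *\<^sub>R axis i 1) - f (x + 0 *\<^sub>R axis i 1)) / t) \<longlongrightarrow> grad f x $ i) (at 0)"
        unfolding DERIV_def .
      moreover have "filterlim (\<lambda>n. 1 / real (Suc n)) (at 0) sequentially"
        unfolding filterlim_at using LIMSEQ_inverse_real_of_nat by (auto simp: inverse_eq_divide)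
      ultimately have "(\<lambda>n. (f (x + (0 + 1 / real (Suc n)) *\<^sub>R axis i 1) - f (x + 0 *\<^sub>R axis i 1)) / (1 / real (Suc n)))
          \<longlonglongrightarrow> grad f x $ i"
        by (rule filterlim_compose)
      then show "(\<lambda>n. q n x) \<longlonglongrightarrow> grad f x $ i" unfolding q_def by simp
    qed
    show "AE x in lborel. norm (q n x) \<le> indicator K' x * B" for n
    proof (rule AE_I2)
      fix x :: "real^'n"
      define c :: "real^'n" where "c = (1 / Suc n) *\<^sub>R axis i 1"
      have nc: "norm c = 1 / Suc n" by (simp add: c_def)
      have qc: "q n x = (f (x + c) - f x) * Suc n" by (simp add: q_def c_def)
      show "norm (q n x) \<le> indicator K' x * B"
      proof (cases "x \<in> K'")
        case True
        have "norm (f (x + c) - f x) \<le> B * norm (x + c - x)"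
          unfolding real_norm_def by (rule inner_derivative_bound[OF convex_UNIV _ B]) (use f in \<open>auto simp: C1_on_def\<close>)
        then have "norm (f (x + c) - f x) * Suc n \<le> B * norm c * Suc n" by (intro mult_right_mono) auto
        then show ?thesis using True nc by (simp add: qc abs_mult)
      next
        case False
        have "x \<notin> K" using False KK' by blast
        moreover have "x + c \<notin> K"
        proof
          assume "x + c \<in> K"
          moreover have "- c \<in> cball 0 1" using nc by simp
          ultimately have "(x + c) + (- c) \<in> K'" unfolding K'_def by blast
          then show False using False by simp
        qed
        ultimately show ?thesis using False K(2) by (simp add: qc)
      qed
    qed
  qed auto
  then show ?thesis using qz LIMSEQ_unique[OF _ tendsto_const] by simp
qed

lemma smooth_on_partials: "smooth_on f UNIV \<Longrightarrow> smooth_on (partials is f) UNIV"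
proof (induction "is")
  case (Cons i "is")
  then have "\<And>k. Ck_on (Suc k) (partials is f) UNIV" by (simp add: smooth_on_def)
  then show ?case unfolding smooth_on_def partials.simps using Ck_on_Suc_iff[OF open_UNIV] by blast
qed simp

lemma test_function_partials:
  assumes "test_function U \<phi>"
  shows "test_function U (partials is \<phi>)"
proof -
  obtain K where K: "compact K" "K \<subseteq> U" "\<And>x. x \<notin> K \<Longrightarrow> \<phi> x = 0" and s: "smooth_on \<phi> UNIV"
    using assms unfolding test_function_def by blast
  have "partials is \<phi> x = 0" if "x \<notin> K" for x
    using that
  proof (induction "is" arbitrary: x)
    case (Cons i "is")
    have "(partials is \<phi> has_derivative (\<lambda>_. 0)) (at x)"
      by (rule has_derivative_transform_within_open[OF has_derivative_const, where s="- K"])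
        (use Cons K(1) in \<open>auto simp: open_Compl compact_imp_closed\<close>)
    from frechet_derivative_at[OF this, symmetric] show ?case by simp
  qed (simp add: K(3))
  then show ?thesis using K smooth_on_partials[OF s] unfolding test_function_def by blast
qed

lemma test_function_C1_on: "test_function U \<phi> \<Longrightarrow> C1_on \<phi> UNIV"
  unfolding test_function_def by (auto intro: smooth_on_C1_on)

lemma locally_integrable_continuous:
  assumes "continuous_on U f"
  shows "locally_integrable U f"
  unfolding locally_integrable_def
proof (intro allI impI)
  fix K assume K: "compact K \<and> K \<subseteq> U"
  then have "set_integrable lborel K f"
    using borel_integrable_compact[of K f] assms continuous_on_subset
    by (auto simp: set_integrable_def)
  then have "set_integrable lebesgue K f"
    unfolding set_integrable_def by (simp add: integrable_completion)
  then show "integrable (lebesgue_on K) f"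
    using K integrable_restrict_space[of K lebesgue f] by (auto simp: set_integrable_def borel_compact)
qed

text \<open>Integration by parts: the product \<open>p\<close> of \<open>f\<close> and the test
  function vanishes outside a compact subset of \<open>U\<close>, so it is \<open>C^1\<close> on the
  whole space and its partial derivative has integral zero.\<close>

lemma is_weak_deriv_classical:
  assumes "open U" and f: "C1_on f U"
  shows "is_weak_deriv U [i] f (\<lambda>x. grad f x $ i)"
  unfolding is_weak_deriv_def
proof (intro conjI allI impI)
  show "locally_integrable U f" "locally_integrable U (\<lambda>x. grad f x $ i)"
    using f C1_on_continuous[OF f] by (auto intro!: locally_integrable_continuous continuous_intros simp: C1_on_def)
  fix \<phi> :: "real^'a \<Rightarrow> real" assume \<phi>: "test_function U \<phi>"
  then obtain K where K: "compact K" "K \<subseteq> U" "\<And>x. x \<notin> K \<Longrightarrow> \<phi> x = 0"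
    unfolding test_function_def by blast
  have \<phi>1: "C1_on \<phi> UNIV" by (rule test_function_C1_on[OF \<phi>])
  define p where "p x = f x * \<phi> x" for x
  have p: "C1_on p U" unfolding p_def by (intro C1_on_mult f C1_on_subset[OF \<phi>1]) auto
  have p0: "p x = 0" if "x \<notin> K" for x using K(3)[OF that] by (simp add: p_def)
  note pU = C1_on_Un_zero[OF assms(1) compact_imp_closed[OF K(1)] K(2) p p0]
  have gp: "grad p x = f x *\<^sub>R grad \<phi> x + \<phi> x *\<^sub>R grad f x" if "x \<in> U" for x
    unfolding p_def using that f \<phi>1 by (intro grad_mult) (auto simp: C1_on_def)
  have t: "test_function U (partials [i] \<phi>)" by (rule test_function_partials[OF \<phi>])
  have z: "\<phi> x = 0" "partials [i] \<phi> x = 0" if "x \<notin> U" for x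
    using \<phi> t that unfolding test_function_def by blast+
  have i1: "integrable lebesgue (\<lambda>x. f x * partials [i] \<phi> x)"
    by (rule integrable_test_function[OF _ t]) (auto intro: locally_integrable_continuous C1_on_continuous f)
  have i2: "integrable lebesgue (\<lambda>x. grad f x $ i * \<phi> x)"
    by (rule integrable_test_function[OF _ \<phi>])
      (use f in \<open>auto intro!: locally_integrable_continuous continuous_intros simp: C1_on_def\<close>)
  have "(LINT x|lebesgue. f x * partials [i] \<phi> x + grad f x $ i * \<phi> x) = (LINT x|lebesgue. grad p x $ i)"
  proof (rule Bochner_Integration.integral_cong[OF refl])
    fix x
    show "f x * partials [i] \<phi> x + grad f x $ i * \<phi> x = grad p x $ i"
    proof (cases "x \<in> U")
      case True
      then show ?thesis using gp by (simp add: partials_grad del: partials.simps)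
    next
      case False
      then have "x \<notin> K" using K(2) by blast
      then show ?thesis using z[OF False] pU(2) by (simp del: partials.simps)
    qed
  qed
  also have "\<dots> = (LINT x|lborel. grad p x $ i)"
    using pU(1) by (intro integral_completion) (auto simp: C1_on_def intro!: borel_measurable_continuous_onI continuous_intros)
  also have "\<dots> = 0" by (rule integral_grad_compact_support[OF pU(1) K(1) p0])
  finally have "(LINT x|lebesgue. f x * partials [i] \<phi> x) = - (LINT x|lebesgue. grad f x $ i * \<phi> x)"
    using i1 i2 by (simp del: partials.simps)
  then show "(LINT x|lebesgue_on U. f x * partials [i] \<phi> x) =
      (- 1) ^ length [i] * (LINT x|lebesgue_on U. grad f x $ i * \<phi> x)"
    using integral_lebesgue_on_cutoff(1)[OF assms(1), of "\<lambda>x. f x * partials [i] \<phi> x"]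
      integral_lebesgue_on_cutoff(1)[OF assms(1), of "\<lambda>x. grad f x $ i * \<phi> x"] z
    by (simp del: partials.simps)
qed

lemma integrable_test_function_on:
  assumes "open U" "locally_integrable U w" "test_function U \<phi>"
  shows "integrable (lebesgue_on U) (\<lambda>x. w x * \<phi> x)"
proof -
  have "\<phi> x = 0" if "x \<notin> U" for x using assms(3) that unfolding test_function_def by blast
  then show ?thesis
    using integral_lebesgue_on_cutoff(2)[OF assms(1), of "\<lambda>x. w x * \<phi> x"]
      integrable_test_function[OF assms(2,3)] by simp
qed

lemma locally_integrable_add_scale:
  "locally_integrable U u \<Longrightarrow> locally_integrable U v \<Longrightarrow> locally_integrable U (\<lambda>x. u x + c * v x)"
  unfolding locally_integrable_def by auto

lemma is_weak_deriv_add_scale: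
  assumes "open U" "is_weak_deriv U is u v" "is_weak_deriv U is u' v'"
  shows "is_weak_deriv U is (\<lambda>x. u x + c * u' x) (\<lambda>x. v x + c * v' x)"
proof -
  have l: "locally_integrable U u" "locally_integrable U v" "locally_integrable U u'" "locally_integrable U v'"
    using assms unfolding is_weak_deriv_def by auto
  have "(LINT x|lebesgue_on U. (u x + c * u' x) * partials is \<phi> x) =
      (-1) ^ length is * (LINT x|lebesgue_on U. (v x + c * v' x) * \<phi> x)" if \<phi>: "test_function U \<phi>" for \<phi>
  proof -
    note t = test_function_partials[OF \<phi>, of "is"]
    have "(LINT x|lebesgue_on U. (u x + c * u' x) * partials is \<phi> x) =
        (LINT x|lebesgue_on U. u x * partials is \<phi> x + c * (u' x * partials is \<phi> x))"
      by (simp add: algebra_simps)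
    also have "\<dots> = (LINT x|lebesgue_on U. u x * partials is \<phi> x) + c * (LINT x|lebesgue_on U. u' x * partials is \<phi> x)"
      using integrable_test_function_on[OF assms(1) _ t] l by simp
    also have "\<dots> = (-1) ^ length is * ((LINT x|lebesgue_on U. v x * \<phi> x) + c * (LINT x|lebesgue_on U. v' x * \<phi> x))"
      using assms \<phi> unfolding is_weak_deriv_def by (simp add: algebra_simps)
    also have "(LINT x|lebesgue_on U. v x * \<phi> x) + c * (LINT x|lebesgue_on U. v' x * \<phi> x) =
        (LINT x|lebesgue_on U. v x * \<phi> x + c * (v' x * \<phi> x))"
      using integrable_test_function_on[OF assms(1) _ \<phi>] l by simp
    also have "\<dots> = (LINT x|lebesgue_on U. (v x + c * v' x) * \<phi> x)"
      by (simp add: algebra_simps)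
    finally show ?thesis .
  qed
  then show ?thesis using l unfolding is_weak_deriv_def by (auto intro: locally_integrable_add_scale)
qed

lemma is_weak_deriv_diff:
  "open U \<Longrightarrow> is_weak_deriv U is u v \<Longrightarrow> is_weak_deriv U is u' v' \<Longrightarrow>
   is_weak_deriv U is (\<lambda>x. u x - u' x) (\<lambda>x. v x - v' x)"
  using is_weak_deriv_add_scale[of U "is" u v u' v' "-1"] by simp

lemma is_weak_deriv_unique:
  assumes "open U" "is_weak_deriv U is u v" "is_weak_deriv U is u w"
  shows "AE x in lebesgue_on U. v x = w x"
proof -
  have d: "is_weak_deriv U is (\<lambda>x. 0) (\<lambda>x. v x - w x)"
    using is_weak_deriv_diff[OF assms] by simp
  have "AE x in lebesgue_on U. v x - w x = 0"
    by (rule fundamental_lemma[OF assms(1)]) (use d in \<open>auto simp: is_weak_deriv_def\<close>)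
  then show ?thesis by simp
qed

lemma weak_deriv_AE:
  assumes "open U" "is_weak_deriv U is u w"
  shows "is_weak_deriv U is u (weak_deriv U is u)" "AE x in lebesgue_on U. weak_deriv U is u x = w x"
proof -
  show *: "is_weak_deriv U is u (weak_deriv U is u)"
    unfolding weak_deriv_def by (rule someI[where P="is_weak_deriv U is u"]) (rule assms(2))
  show "AE x in lebesgue_on U. weak_deriv U is u x = w x"
    by (rule is_weak_deriv_unique[OF assms(1) * assms(2)])
qed

lemma is_weak_deriv_Nil: "locally_integrable U u \<Longrightarrow> is_weak_deriv U [] u u"
  by (simp add: is_weak_deriv_def)

lemma locally_integrable_L2v:
  assumes "open U" "u \<in> L2v (lebesgue_on U)"
  shows "locally_integrable U u"
  unfolding locally_integrable_def
proof (intro allI impI)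
  fix K assume K: "compact K \<and> K \<subseteq> U"
  then have Ks: "K \<in> sets lebesgue" by (simp add: borel_compact)
  have Os: "U \<in> sets lebesgue" using assms(1) by simp
  have "emeasure lebesgue K < \<infinity>" using K emeasure_compact_finite[of K] by (simp add: borel_compact)
  then have fin: "finite_measure (lebesgue_on K)"
    using Ks by (intro finite_measureI) (simp add: emeasure_restrict_space space_restrict_space)
  have m: "u \<in> borel_measurable (lebesgue_on K)"
    using L2v_measurable[OF assms(2)] K by (auto intro: measurable_restrict_mono)
  have "integrable (lebesgue_on U) (\<lambda>x. (u x)\<^sup>2)" using assms(2) by (simp add: L2v_def)
  then have "set_integrable lebesgue U (\<lambda>x. (u x)\<^sup>2)"
    using Os by (simp add: set_integrable_def integrable_restrict_space)
  then have "set_integrable lebesgue K (\<lambda>x. (u x)\<^sup>2)" using K Ks by (auto intro: set_integrable_subset)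
  then have "integrable (lebesgue_on K) (\<lambda>x. (u x)\<^sup>2)"
    using Ks by (simp add: set_integrable_def integrable_restrict_space)
  then show "integrable (lebesgue_on K) u"
    using finite_measure.square_integrable_imp_integrable[OF fin m] by simp
qed

text \<open>Completeness of Lebesgue measure makes a function measurable as soon as it agrees almost
  everywhere with a measurable one. Representatives can thus be exchanged below, for instance the
  chosen \<open>weak_deriv\<close> for an explicit formula.\<close>

lemma measurable_lebesgue_on_cong_AE:
  fixes f g :: "real^'n \<Rightarrow> 'b::euclidean_space"
  assumes "U \<in> sets lebesgue" "f \<in> borel_measurable (lebesgue_on U)" "AE x in lebesgue_on U. f x = g x"
  shows "g \<in> borel_measurable (lebesgue_on U)"
proof -
  have "(\<lambda>x. if x \<in> U then f x else 0) \<in> borel_measurable lebesgue"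
    using assms borel_measurable_if by blast
  moreover have "AE x in lebesgue. (if x \<in> U then f x else 0) = (if x \<in> U then g x else 0)"
  proof -
    have "AE x in lebesgue. x \<in> U \<longrightarrow> f x = g x"
      using assms by (simp add: AE_restrict_space_iff)
    then show ?thesis by eventually_elim auto
  qed
  ultimately have "(\<lambda>x. if x \<in> U then g x else 0) \<in> borel_measurable lebesgue"
    by (rule borel_measurable_AE)
  then show ?thesis using assms borel_measurable_if by blast
qed

lemma L2v_cong_AE_lebesgue_on:
  fixes f g :: "real^'n \<Rightarrow> 'b::euclidean_space"
  assumes "U \<in> sets lebesgue" "f \<in> L2v (lebesgue_on U)" "AE x in lebesgue_on U. f x = g x"
  shows "g \<in> L2v (lebesgue_on U)" "L2n (lebesgue_on U) g = L2n (lebesgue_on U) f"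
  using L2v_cong_AE[OF assms(2) measurable_lebesgue_on_cong_AE[OF assms(1) L2v_measurable[OF assms(2)] assms(3)] assms(3)]
  by auto

section \<open>Weak gradients and the Sobolev space of first order\<close>

definition is_weak_grad :: "(real^'n) set \<Rightarrow> (real^'n \<Rightarrow> real) \<Rightarrow> (real^'n \<Rightarrow> real^'n) \<Rightarrow> bool" where
  "is_weak_grad U u v \<longleftrightarrow> (\<forall>i. is_weak_deriv U [i] u (\<lambda>x. v x $ i))"

lemma test_function_L2v:
  assumes "open U" "test_function U \<phi>"
  shows "\<phi> \<in> L2v (lebesgue_on U)"
proof -
  have c: "continuous_on UNIV \<phi>" using C1_on_continuous[OF test_function_C1_on[OF assms(2)]] .
  have "\<phi> \<in> borel_measurable (lebesgue_on U)"
    using c by (intro measurable_restrict_space1 measurable_completion) (simp add: borel_measurable_continuous_onI)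
  moreover have "integrable (lebesgue_on U) (\<lambda>x. \<phi> x * \<phi> x)"
    using c by (intro integrable_test_function_on[OF assms(1) _ assms(2)])
      (auto intro: locally_integrable_continuous continuous_on_subset)
  ultimately show ?thesis by (simp add: L2v_def power2_eq_square)
qed

text \<open>Each side of the defining identity is an inner product with a fixed square integrable
  function, hence continuous in the square norm.\<close>

lemma is_weak_deriv_limit:
  assumes "open U" and u: "\<And>k. u k \<in> L2v (lebesgue_on U)" "u0 \<in> L2v (lebesgue_on U)"
    and w: "\<And>k. w k \<in> L2v (lebesgue_on U)" "w0 \<in> L2v (lebesgue_on U)"
    and weak: "\<And>k. is_weak_deriv U is (u k) (w k)"
    and lim: "(\<lambda>k. L2n (lebesgue_on U) (\<lambda>x. u k x - u0 x)) \<longlonglongrightarrow> 0"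
      "(\<lambda>k. L2n (lebesgue_on U) (\<lambda>x. w k x - w0 x)) \<longlonglongrightarrow> 0"
  shows "is_weak_deriv U is u0 w0"
  unfolding is_weak_deriv_def
proof (intro conjI allI impI locally_integrable_L2v assms(1) u(2) w(2))
  fix \<phi> :: "real^'a \<Rightarrow> real" assume \<phi>: "test_function U \<phi>"
  have 1: "(\<lambda>k. LINT x|lebesgue_on U. u k x \<bullet> partials is \<phi> x) \<longlonglongrightarrow> (LINT x|lebesgue_on U. u0 x \<bullet> partials is \<phi> x)"
    by (intro integral_inner_tendsto u lim test_function_L2v[OF assms(1)] test_function_partials \<phi>)
  have "(\<lambda>k. LINT x|lebesgue_on U. w k x \<bullet> \<phi> x) \<longlonglongrightarrow> (LINT x|lebesgue_on U. w0 x \<bullet> \<phi> x)"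
    by (intro integral_inner_tendsto w lim test_function_L2v[OF assms(1)] \<phi>)
  then have "(\<lambda>k. (-1) ^ length is * (LINT x|lebesgue_on U. w k x \<bullet> \<phi> x)) \<longlonglongrightarrow>
      (-1) ^ length is * (LINT x|lebesgue_on U. w0 x \<bullet> \<phi> x)"
    by (intro tendsto_mult tendsto_const)
  moreover have e: "(\<lambda>k. (-1) ^ length is * (LINT x|lebesgue_on U. w k x \<bullet> \<phi> x)) =
      (\<lambda>k. LINT x|lebesgue_on U. u k x \<bullet> partials is \<phi> x)"
    using weak \<phi> unfolding is_weak_deriv_def by simp
  ultimately have "(\<lambda>k. LINT x|lebesgue_on U. u k x \<bullet> partials is \<phi> x) \<longlonglongrightarrow>
      (-1) ^ length is * (LINT x|lebesgue_on U. w0 x \<bullet> \<phi> x)" by (simp only:)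
  from LIMSEQ_unique[OF 1 this]
  show "(LINT x|lebesgue_on U. u0 x * partials is \<phi> x) = (-1) ^ length is * (LINT x|lebesgue_on U. w0 x * \<phi> x)"
    by simp
qed

lemma L2v_component:
  fixes v :: "'a \<Rightarrow> real^'n"
  assumes "v \<in> L2v M"
  shows "(\<lambda>x. v x $ i) \<in> L2v M" "L2n M (\<lambda>x. v x $ i) \<le> L2n M v"
proof -
  have [measurable]: "v \<in> borel_measurable M" by (rule L2v_measurable[OF assms])
  have m: "(\<lambda>x. v x $ i) \<in> borel_measurable M"
    by (rule borel_measurable_continuous_on[where f="\<lambda>y. y $ i"]) (auto intro: continuous_intros)
  show "(\<lambda>x. v x $ i) \<in> L2v M" "L2n M (\<lambda>x. v x $ i) \<le> L2n M v"
    using L2v_dominated[OF assms m, of 1] by (auto simp: component_le_norm_cart)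
qed

lemma borel_measurable_vec_iff:
  fixes v :: "'a \<Rightarrow> real^'n"
  shows "v \<in> borel_measurable M \<longleftrightarrow> (\<forall>i. (\<lambda>x. v x $ i) \<in> borel_measurable M)"
proof
  assume "\<forall>i. (\<lambda>x. v x $ i) \<in> borel_measurable M"
  then have "(\<lambda>x. \<Sum>i\<in>UNIV. v x $ i *\<^sub>R axis i (1::real)) \<in> borel_measurable M"
    by (auto intro!: borel_measurable_sum borel_measurable_scaleR)
  moreover have "(\<lambda>x. \<Sum>i\<in>UNIV. v x $ i *\<^sub>R axis i (1::real)) = v"
    by (rule ext) (simp add: basis_expansion flip: scalar_mult_eq_scaleR)
  ultimately show "v \<in> borel_measurable M" by simp
next
  assume v: "v \<in> borel_measurable M"
  show "\<forall>i. (\<lambda>x. v x $ i) \<in> borel_measurable M"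
    by (intro allI borel_measurable_continuous_on[where f="\<lambda>y. y $ _", OF _ v]) (auto intro: continuous_intros)
qed

lemma norm_vec_power2: "(norm (x :: real^'n))\<^sup>2 = (\<Sum>i\<in>UNIV. (x $ i)\<^sup>2)"
  unfolding power2_norm_eq_inner inner_vec_def by (simp add: power2_eq_square)

lemma L2v_vec_iff:
  fixes v :: "'a \<Rightarrow> real^'n"
  shows "v \<in> L2v M \<longleftrightarrow> (\<forall>i. (\<lambda>x. v x $ i) \<in> L2v M)"
proof
  assume *: "\<forall>i. (\<lambda>x. v x $ i) \<in> L2v M"
  then have "integrable M (\<lambda>x. \<Sum>i\<in>UNIV. (v x $ i)\<^sup>2)"
    by (intro Bochner_Integration.integrable_sum) (auto simp: L2v_def)
  then show "v \<in> L2v M" using * unfolding L2v_def mem_Collect_eq borel_measurable_vec_iff[of v]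
    by (simp add: norm_vec_power2)
qed (auto intro: L2v_component)

lemma L2n_vec:
  fixes v :: "'a \<Rightarrow> real^'n"
  assumes "v \<in> L2v M"
  shows "(L2n M v)\<^sup>2 = (\<Sum>i\<in>UNIV. (L2n M (\<lambda>x. v x $ i))\<^sup>2)"
proof -
  have "integrable M (\<lambda>x. (v x $ i)\<^sup>2)" for i
    using L2v_component(1)[OF assms, of i] by (simp add: L2v_def)
  then show ?thesis unfolding L2n_power2 by (simp add: norm_vec_power2)
qed

lemma is_weak_grad_classical: "open U \<Longrightarrow> C1_on f U \<Longrightarrow> is_weak_grad U f (grad f)"
  unfolding is_weak_grad_def by (auto intro: is_weak_deriv_classical)

lemma is_weak_grad_diff:
  "open U \<Longrightarrow> is_weak_grad U f f' \<Longrightarrow> is_weak_grad U g g' \<Longrightarrow>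
   is_weak_grad U (\<lambda>x. f x - g x) (\<lambda>x. f' x - g' x)"
  unfolding is_weak_grad_def using is_weak_deriv_diff by fastforce

lemma is_weak_grad_limit:
  assumes "open U" and u: "\<And>k. u k \<in> L2v (lebesgue_on U)" "u0 \<in> L2v (lebesgue_on U)"
    and w: "\<And>k. w k \<in> L2v (lebesgue_on U)" "w0 \<in> L2v (lebesgue_on U)"
    and weak: "\<And>k. is_weak_grad U (u k) (w k)"
    and lim: "(\<lambda>k. L2n (lebesgue_on U) (\<lambda>x. u k x - u0 x)) \<longlonglongrightarrow> 0"
      "(\<lambda>k. L2n (lebesgue_on U) (\<lambda>x. w k x - w0 x)) \<longlonglongrightarrow> 0"
  shows "is_weak_grad U u0 w0"
  unfolding is_weak_grad_def
proof
  fix i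
  have le: "L2n (lebesgue_on U) (\<lambda>x. w k x $ i - w0 x $ i) \<le> L2n (lebesgue_on U) (\<lambda>x. w k x - w0 x)" for k
    using L2v_component(2)[OF L2v_diff[OF w(1) w(2)], of k i] by simp
  have "(\<lambda>k. L2n (lebesgue_on U) (\<lambda>x. w k x $ i - w0 x $ i)) \<longlonglongrightarrow> 0"
    by (rule tendsto_sandwich[OF _ _ tendsto_const lim(2)]) (use le in auto)
  note lim' = this
  have "is_weak_deriv U [i] (u k) (\<lambda>x. w k x $ i)" for k
    using weak[of k] unfolding is_weak_grad_def by blast
  from is_weak_deriv_limit[OF assms(1) u(1) u(2) L2v_component(1)[OF w(1)] L2v_component(1)[OF w(2)] this lim(1) lim']
  show "is_weak_deriv U [i] u0 (\<lambda>x. w0 x $ i)" .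
qed

lemma weak_grad_AE:
  assumes "open U" "is_weak_grad U u v"
  shows "AE x in lebesgue_on U. weak_grad U u x = v x"
proof -
  have "AE x in lebesgue_on U. weak_deriv U [i] u x = v x $ i" for i
    using weak_deriv_AE(2)[OF assms(1)] assms(2) unfolding is_weak_grad_def by blast
  then have "AE x in lebesgue_on U. \<forall>i. weak_deriv U [i] u x = v x $ i"
    by (rule eventually_all_finite)
  then show ?thesis by eventually_elim (simp add: weak_grad_def vec_eq_iff)
qed

lemma is_weak_grad_unique:
  assumes "open U" "is_weak_grad U u v" "is_weak_grad U u w"
  shows "AE x in lebesgue_on U. v x = w x"
  using weak_grad_AE[OF assms(1,2)] weak_grad_AE[OF assms(1,3)] by eventually_elim simp

lemma sobolev_1_iff:
  assumes "open U"
  shows "u \<in> sobolev 1 U \<longleftrightarrow> u \<in> L2v (lebesgue_on U) \<and> (\<exists>v\<in>L2v (lebesgue_on U). is_weak_grad U u v)"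
    (is "?l \<longleftrightarrow> ?r")
proof
  assume ?l
  then have u: "u \<in> L2v (lebesgue_on U)"
    and *: "\<And>is. length is \<le> 1 \<Longrightarrow> \<exists>w\<in>L2v (lebesgue_on U). is_weak_deriv U is u w"
    unfolding sobolev_def L2_eq_L2v by blast+
  have "\<forall>i. \<exists>w. w \<in> L2v (lebesgue_on U) \<and> is_weak_deriv U [i] u w"
  proof
    fix i show "\<exists>w. w \<in> L2v (lebesgue_on U) \<and> is_weak_deriv U [i] u w" using *[of "[i]"] by auto
  qed
  then obtain w where "\<And>i. w i \<in> L2v (lebesgue_on U) \<and> is_weak_deriv U [i] u (w i)" by metis
  then show ?r using u
    by (intro conjI bexI[of _ "\<lambda>x. \<chi> i. w i x"]) (auto simp: is_weak_grad_def L2v_vec_iff)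
next
  assume ?r
  then obtain v where u: "u \<in> L2v (lebesgue_on U)" and v: "v \<in> L2v (lebesgue_on U)" "is_weak_grad U u v"
    by blast
  show ?l unfolding sobolev_def L2_eq_L2v
  proof (intro CollectI conjI allI impI u)
    fix "is" :: "'a list" assume "length is \<le> 1"
    then consider "is = []" | i where "is = [i]" by (cases "is") auto
    then show "\<exists>w\<in>L2v (lebesgue_on U). is_weak_deriv U is u w"
    proof cases
      case 1
      then show ?thesis using u assms is_weak_deriv_Nil locally_integrable_L2v by blast
    next
      case 2
      then show ?thesis using v L2v_component(1)[OF v(1), of i] unfolding is_weak_grad_def by blast
    qed
  qed
qed

lemma sobolev_mono: "l \<le> k \<Longrightarrow> sobolev k U \<subseteq> sobolev l U"
  unfolding sobolev_def by auto

lemma lists_le_1: "{is :: 'n list. length is \<le> 1} = insert [] ((\<lambda>i. [i]) ` UNIV)"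
proof -
  have "is = [] \<or> (\<exists>i. is = [i])" if "length is \<le> 1" for "is" :: "'n list"
    using that by (cases "is") auto
  then show ?thesis by auto
qed

text \<open>\<open>sobolev_norm\<close> refers to chosen representatives of the weak derivatives,
  even for the empty multi-index; almost everywhere uniqueness lets the given \<open>u\<close> and
  \<open>v\<close> take their place.\<close>

lemma sobolev_norm_1:
  assumes "open U" "u \<in> L2v (lebesgue_on U)" "v \<in> L2v (lebesgue_on U)" "is_weak_grad U u v"
  shows "(sobolev_norm 1 U u)\<^sup>2 = (L2n (lebesgue_on U) u)\<^sup>2 + (L2n (lebesgue_on U) v)\<^sup>2"
proof -
  let ?M = "lebesgue_on U"
  have e: "(LINT x|?M. (weak_deriv U is u x)\<^sup>2) = (L2n ?M w)\<^sup>2"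
    if "is_weak_deriv U is u w" "w \<in> L2v ?M" for "is" w
  proof -
    have ae: "AE x in ?M. w x = weak_deriv U is u x"
      using weak_deriv_AE(2)[OF assms(1) that(1)] by eventually_elim simp
    have "L2n ?M (weak_deriv U is u) = L2n ?M w"
      by (rule L2v_cong_AE_lebesgue_on(2)[OF _ that(2) ae]) (use assms(1) in auto)
    then show ?thesis using L2n_power2[of ?M "weak_deriv U is u"] by simp
  qed
  have "(sobolev_norm 1 U u)\<^sup>2 = (\<Sum>is | length is \<le> 1. LINT x|?M. (weak_deriv U is u x)\<^sup>2)"
    unfolding sobolev_norm_def by (intro real_sqrt_pow2 sum_nonneg) auto
  also have "\<dots> = (LINT x|?M. (weak_deriv U [] u x)\<^sup>2) + (\<Sum>i\<in>UNIV. LINT x|?M. (weak_deriv U [i] u x)\<^sup>2)"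
    unfolding lists_le_1 by (subst sum.insert) (auto simp: sum.reindex inj_on_def)
  also have "\<dots> = (L2n ?M u)\<^sup>2 + (\<Sum>i\<in>UNIV. (L2n ?M (\<lambda>x. v x $ i))\<^sup>2)"
    using assms by (subst e[OF is_weak_deriv_Nil[OF locally_integrable_L2v]])
      (auto intro!: sum.cong e L2v_component simp: is_weak_grad_def)
  also have "\<dots> = (L2n ?M u)\<^sup>2 + (L2n ?M v)\<^sup>2" by (simp add: L2n_vec[OF assms(3)])
  finally show ?thesis .
qed

lemma sobolev_norm_mono:
  assumes "l \<le> k"
  shows "sobolev_norm l U (u :: real^'n \<Rightarrow> real) \<le> sobolev_norm k U u"
proof -
  have "finite {is :: 'n list. length is \<le> k}"
    using finite_lists_length_le[of "UNIV :: 'n set" k] by simp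
  then show ?thesis unfolding sobolev_norm_def using assms
    by (intro real_sqrt_le_mono sum_mono2) auto
qed

lemma sobolev_norm_nonneg [simp]: "0 \<le> sobolev_norm k U u"
  unfolding sobolev_norm_def by (intro real_sqrt_ge_zero sum_nonneg) auto

lemma L2n_le_sobolev_norm_1:
  assumes "open U" "u \<in> L2v (lebesgue_on U)" "v \<in> L2v (lebesgue_on U)" "is_weak_grad U u v"
  shows "L2n (lebesgue_on U) u \<le> sobolev_norm 1 U u" "L2n (lebesgue_on U) v \<le> sobolev_norm 1 U u"
proof -
  have "(L2n (lebesgue_on U) u)\<^sup>2 \<le> (sobolev_norm 1 U u)\<^sup>2" "(L2n (lebesgue_on U) v)\<^sup>2 \<le> (sobolev_norm 1 U u)\<^sup>2"
    unfolding sobolev_norm_1[OF assms] by simp_all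
  then show "L2n (lebesgue_on U) u \<le> sobolev_norm 1 U u" "L2n (lebesgue_on U) v \<le> sobolev_norm 1 U u"
    by (simp_all only: power2_le_imp_le sobolev_norm_nonneg)
qed

lemma sobolev_weak_grad:
  assumes "open U" "u \<in> sobolev k U" "1 \<le> k"
  shows "u \<in> L2v (lebesgue_on U)" "weak_grad U u \<in> L2v (lebesgue_on U)" "is_weak_grad U u (weak_grad U u)"
proof -
  have "u \<in> sobolev 1 U" using subsetD[OF sobolev_mono[OF assms(3)] assms(2)] .
  then obtain v where u: "u \<in> L2v (lebesgue_on U)" and v: "v \<in> L2v (lebesgue_on U)" "is_weak_grad U u v"
    unfolding sobolev_1_iff[OF assms(1)] by blast
  show "u \<in> L2v (lebesgue_on U)" by (rule u)
  have ae: "AE x in lebesgue_on U. v x = weak_grad U u x"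
    using weak_grad_AE[OF assms(1) v(2)] by eventually_elim simp
  show "weak_grad U u \<in> L2v (lebesgue_on U)"
    by (rule L2v_cong_AE_lebesgue_on(1)[OF _ v(1) ae]) (use assms(1) in auto)
  show "is_weak_grad U u (weak_grad U u)"
    using v(2) weak_deriv_AE(1)[OF assms(1)] unfolding is_weak_grad_def by (auto simp: weak_grad_def)
qed

section \<open>Periodic Sobolev functions\<close>

locale perforated_cell =
  fixes P :: "(real^'n) set"
  assumes open_P: "open P" and P_eq: "P = cell - closure (inclusion P)"
    and inclusion_subset: "closure (inclusion P) \<subseteq> cell"
begin

abbreviation "M \<equiv> lebesgue_on P"

lemma P_subset_cell: "P \<subseteq> cell"
  using P_eq by blast

lemma mem_cell: "x \<in> cell \<longleftrightarrow> (\<forall>i. - 1/2 < x $ i \<and> x $ i < 1/2)"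
  by (simp add: cell_def mem_box_cart)

lemma cell_lattice:
  assumes "x \<in> cell" "x - z \<in> cell" "z \<in> lattice_points"
  shows "z = 0"
proof -
  have "z $ i = 0" for i
  proof -
    have "z $ i \<in> \<int>" using assms(3) by (simp add: lattice_points_def)
    then obtain k where k: "z $ i = of_int k" by (elim Ints_cases)
    have "- 1 < z $ i \<and> z $ i < 1" using assms(1,2) unfolding mem_cell by (auto dest!: spec[of _ i])
    then have "- 1 < k \<and> k < 1" unfolding k by linarith
    then show ?thesis using k by simp
  qed
  then show ?thesis by (simp add: vec_eq_iff)
qed

lemma P_subset_extension: "P \<subseteq> periodic_extension P"
proof
  fix x assume x: "x \<in> P"
  have "x - z \<notin> closure (inclusion P)" if z: "z \<in> lattice_points" for z
  proof
    assume a: "x - z \<in> closure (inclusion P)"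
    then have "z = 0" using cell_lattice[of x z] x z inclusion_subset P_subset_cell by blast
    then show False using a x P_eq by auto
  qed
  then show "x \<in> periodic_extension P" by (simp add: periodic_extension_def)
qed

lemma extension_Int_cell: "periodic_extension P \<inter> cell = P"
proof -
  have "0 \<in> lattice_points" by (simp add: lattice_points_def)
  then have "x \<in> P" if "x \<in> periodic_extension P" "x \<in> cell" for x
  proof -
    have "x - 0 \<notin> closure (inclusion P)"
      using that(1) \<open>0 \<in> lattice_points\<close> unfolding periodic_extension_def by blast
    then show ?thesis using that(2) by (subst P_eq) simp
  qed
  then show ?thesis using P_subset_extension P_subset_cell by auto
qed

lemma closed_lattice: "closed (lattice_points :: (real^'m) set)"
proof -
  have "lattice_points = (\<Inter>i. (\<lambda>z::real^'m. z $ i) -` \<int>)" by (auto simp: lattice_points_def)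
  moreover have "closed (\<Inter>i. (\<lambda>z::real^'m. z $ i) -` \<int>)"
    by (intro closed_INT ballI continuous_closed_vimage closed_Ints) (auto intro: continuous_intros)
  ultimately show ?thesis by (simp only:)
qed

lemma compact_inclusion: "compact (closure (inclusion P))"
  by (metis cell_def bounded_box bounded_subset closed_closure compact_eq_bounded_closed inclusion_subset)

text \<open>The complement is the sum of a compact and a closed set, hence closed.\<close>

lemma open_extension: "open (periodic_extension P)"
proof -
  have "- periodic_extension P = (\<Union>x\<in>closure (inclusion P). \<Union>y\<in>lattice_points. {x + y})"
    unfolding periodic_extension_def by force
  moreover have "closed (\<Union>x\<in>closure (inclusion P). \<Union>y\<in>lattice_points. {x + y})"
    by (rule compact_closed_sums[OF compact_inclusion closed_lattice])
  ultimately have "closed (- periodic_extension P)" by (simp only:)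
  then show ?thesis by (simp add: open_closed)
qed

lemma lattice_add: "z \<in> lattice_points \<Longrightarrow> z' \<in> lattice_points \<Longrightarrow> z + z' \<in> lattice_points"
  by (simp add: lattice_points_def)

lemma lattice_minus: "z \<in> lattice_points \<Longrightarrow> - z \<in> lattice_points"
  by (simp add: lattice_points_def)

lemma extension_translate:
  assumes "z \<in> lattice_points"
  shows "x + z \<in> periodic_extension P \<longleftrightarrow> x \<in> periodic_extension P"
proof -
  have *: "x + z \<in> periodic_extension P" if "x \<in> periodic_extension P" "z \<in> lattice_points" for x z
    unfolding periodic_extension_def
  proof (intro CollectI ballI)
    fix w :: "real^'n" assume "w \<in> lattice_points"
    then have "w + - z \<in> lattice_points" using that(2) by (intro lattice_add lattice_minus)
    then have "x - (w + - z) \<notin> closure (inclusion P)"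
      using that(1) unfolding periodic_extension_def by blast
    then show "x + z - w \<notin> closure (inclusion P)" by (simp add: algebra_simps)
  qed
  show ?thesis using *[of x z] *[of "x + z" "- z"] assms lattice_minus by auto
qed

text \<open>Square integrability is a separate demand because a \<open>C^1\<close> function on the
  open set \<open>periodic_extension P\<close> may blow up at the inclusion.\<close>

definition C1_per :: "(real^'n \<Rightarrow> real) \<Rightarrow> bool" where
  "C1_per \<phi> \<longleftrightarrow> C1_on \<phi> (periodic_extension P) \<and>
     (\<forall>x\<in>periodic_extension P. \<forall>z\<in>lattice_points. \<phi> (x + z) = \<phi> x) \<and>
     \<phi> \<in> L2v M \<and> grad \<phi> \<in> L2v M"

text \<open>In contrast to \<open>sobolev_per 1 P\<close>, the approximating functions need only be \<open>C\<^sup>1\<close>, so that the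
  relation is transported by diffeomorphisms of class \<open>C\<^sup>1\<close>.\<close>

definition H1_per :: "(real^'n \<Rightarrow> real) \<Rightarrow> (real^'n \<Rightarrow> real^'n) \<Rightarrow> bool" where
  "H1_per u v \<longleftrightarrow> u \<in> L2v M \<and> v \<in> L2v M \<and>
     (\<forall>e>0. \<exists>\<phi>. C1_per \<phi> \<and> L2n M (\<lambda>x. \<phi> x - u x) < e \<and> L2n M (\<lambda>x. grad \<phi> x - v x) < e)"

lemma C1_per_C1_on: "C1_per \<phi> \<Longrightarrow> C1_on \<phi> P"
  unfolding C1_per_def using P_subset_extension C1_on_subset by blast

lemma C1_per_H1_per: "C1_per \<phi> \<Longrightarrow> H1_per \<phi> (grad \<phi>)"
  unfolding H1_per_def using C1_per_def by fastforce

lemma H1_per_sequence: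
  assumes "H1_per u v"
  obtains \<phi> where "\<And>k. C1_per (\<phi> k)" "(\<lambda>k. L2n M (\<lambda>x. \<phi> k x - u x)) \<longlonglongrightarrow> 0"
    "(\<lambda>k. L2n M (\<lambda>x. grad (\<phi> k) x - v x)) \<longlonglongrightarrow> 0"
proof -
  have "\<forall>k. \<exists>\<phi>. C1_per \<phi> \<and> L2n M (\<lambda>x. \<phi> x - u x) < inverse (real (Suc k)) \<and>
      L2n M (\<lambda>x. grad \<phi> x - v x) < inverse (real (Suc k))"
    using assms unfolding H1_per_def by simp
  from choice[OF this] obtain \<phi> where "\<forall>k. C1_per (\<phi> k) \<and> L2n M (\<lambda>x. \<phi> k x - u x) < inverse (real (Suc k)) \<and>
      L2n M (\<lambda>x. grad (\<phi> k) x - v x) < inverse (real (Suc k))" ..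
  then have \<phi>: "\<And>k. C1_per (\<phi> k)" "\<And>k. L2n M (\<lambda>x. \<phi> k x - u x) < inverse (real (Suc k))"
    "\<And>k. L2n M (\<lambda>x. grad (\<phi> k) x - v x) < inverse (real (Suc k))" by simp_all
  have "(\<lambda>k. L2n M (\<lambda>x. \<phi> k x - u x)) \<longlonglongrightarrow> 0"
    by (rule tendsto_sandwich[OF _ _ tendsto_const LIMSEQ_inverse_real_of_nat])
      (intro always_eventually allI L2n_nonneg less_imp_le \<phi>)+
  moreover have "(\<lambda>k. L2n M (\<lambda>x. grad (\<phi> k) x - v x)) \<longlonglongrightarrow> 0"
    by (rule tendsto_sandwich[OF _ _ tendsto_const LIMSEQ_inverse_real_of_nat])
      (intro always_eventually allI L2n_nonneg less_imp_le \<phi>)+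
  ultimately show thesis using that \<phi>(1) by blast
qed

lemma H1_perI:
  assumes "u \<in> L2v M" "v \<in> L2v M" and "\<And>k. C1_per (\<phi> k)"
    and "\<And>k. L2n M (\<lambda>x. \<phi> k x - u x) \<le> a k" "\<And>k. L2n M (\<lambda>x. grad (\<phi> k) x - v x) \<le> b k"
    and "a \<longlonglongrightarrow> 0" "b \<longlonglongrightarrow> 0"
  shows "H1_per u v"
  unfolding H1_per_def
proof (intro conjI allI impI assms(1,2))
  fix e :: real assume "e > 0"
  then have "\<forall>\<^sub>F k in sequentially. a k < e \<and> b k < e"
    using order_tendstoD(2)[OF assms(6)] order_tendstoD(2)[OF assms(7)] by (auto intro: eventually_conj)
  then obtain k where "a k < e" "b k < e" using eventually_happens' sequentially_bot by blast
  then show "\<exists>\<phi>. C1_per \<phi> \<and> L2n M (\<lambda>x. \<phi> x - u x) < e \<and> L2n M (\<lambda>x. grad \<phi> x - v x) < e"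
    using assms(3-5) by (meson le_less_trans)
qed

lemma H1_per_is_weak_grad: "H1_per u v \<Longrightarrow> is_weak_grad P u v"
proof -
  assume *: "H1_per u v"
  then obtain \<phi> where \<phi>: "\<And>k. C1_per (\<phi> k)" "(\<lambda>k. L2n M (\<lambda>x. \<phi> k x - u x)) \<longlonglongrightarrow> 0"
    "(\<lambda>k. L2n M (\<lambda>x. grad (\<phi> k) x - v x)) \<longlonglongrightarrow> 0" by (rule H1_per_sequence) blast
  show ?thesis
    by (rule is_weak_grad_limit[OF open_P, where u=\<phi> and w="\<lambda>k. grad (\<phi> k)"])
      (use \<phi> * in \<open>auto simp: H1_per_def C1_per_def intro!: is_weak_grad_classical[OF open_P] C1_on_subset[OF _ P_subset_extension]\<close>)
qed

lemma H1_per_closed: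
  assumes "u \<in> L2v M" "v \<in> L2v M"
    and "\<And>e. e > 0 \<Longrightarrow> \<exists>u' v'. H1_per u' v' \<and> L2n M (\<lambda>x. u' x - u x) < e \<and> L2n M (\<lambda>x. v' x - v x) < e"
  shows "H1_per u v"
  unfolding H1_per_def
proof (intro conjI assms(1,2) allI impI)
  fix e :: real assume "e > 0"
  then obtain u' v' where H: "H1_per u' v'" and d: "L2n M (\<lambda>x. u' x - u x) < e / 2" "L2n M (\<lambda>x. v' x - v x) < e / 2"
    using assms(3)[of "e / 2"] by auto
  then obtain \<phi> where \<phi>: "C1_per \<phi>" "L2n M (\<lambda>x. \<phi> x - u' x) < e / 2" "L2n M (\<lambda>x. grad \<phi> x - v' x) < e / 2"
    unfolding H1_per_def using half_gt_zero[OF \<open>e > 0\<close>] by blast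
  have "L2n M (\<lambda>x. \<phi> x - u x) \<le> L2n M (\<lambda>x. \<phi> x - u' x) + L2n M (\<lambda>x. u' x - u x)"
    "L2n M (\<lambda>x. grad \<phi> x - v x) \<le> L2n M (\<lambda>x. grad \<phi> x - v' x) + L2n M (\<lambda>x. v' x - v x)"
    using H \<phi>(1) assms(1,2) by (auto intro!: L2n_triangle simp: H1_per_def C1_per_def)
  then show "\<exists>\<phi>. C1_per \<phi> \<and> L2n M (\<lambda>x. \<phi> x - u x) < e \<and> L2n M (\<lambda>x. grad \<phi> x - v x) < e"
    using \<phi> d by (intro exI[of _ \<phi>]) auto
qed

lemma C1_per_add_scale:
  assumes "C1_per \<phi>" "C1_per \<psi>"
  shows "C1_per (\<lambda>x. \<phi> x + c * \<psi> x)" "x \<in> P \<Longrightarrow> grad (\<lambda>x. \<phi> x + c * \<psi> x) x = grad \<phi> x + c *\<^sub>R grad \<psi> x"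
proof -
  have d: "((\<lambda>x. \<phi> x + c * \<psi> x) has_derivative (\<lambda>v. (grad \<phi> x + c *\<^sub>R grad \<psi> x) \<bullet> v)) (at x)"
    if "x \<in> periodic_extension P" for x
    using assms that unfolding C1_per_def C1_on_def
    by (auto simp: inner_add_left intro!: has_derivative_add has_derivative_mult_right)
  show g: "grad (\<lambda>x. \<phi> x + c * \<psi> x) x = grad \<phi> x + c *\<^sub>R grad \<psi> x" if "x \<in> P" for x
    using that P_subset_extension by (intro grad_eqI d) auto
  have "C1_on (\<lambda>x. \<phi> x + c * \<psi> x) (periodic_extension P)"
    using assms by (intro C1_onI[OF d]) (auto simp: C1_per_def C1_on_def intro!: continuous_intros)
  moreover have "(\<lambda>x. \<phi> x + c * \<psi> x) \<in> L2v M"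
    using assms L2v_add[of \<phi> M "\<lambda>x. c *\<^sub>R \<psi> x"] L2v_scale[of \<psi> M c] by (simp add: C1_per_def)
  moreover have "grad (\<lambda>x. \<phi> x + c * \<psi> x) \<in> L2v M"
  proof (rule L2v_cong_AE_lebesgue_on)
    show "(\<lambda>x. grad \<phi> x + c *\<^sub>R grad \<psi> x) \<in> L2v M"
      using assms by (intro L2v_add L2v_scale) (auto simp: C1_per_def)
    show "AE x in M. grad \<phi> x + c *\<^sub>R grad \<psi> x = grad (\<lambda>x. \<phi> x + c * \<psi> x) x"
      using g by (intro AE_I2) auto
  qed (use open_P in auto)
  ultimately show "C1_per (\<lambda>x. \<phi> x + c * \<psi> x)" using assms by (auto simp: C1_per_def)
qed

lemma H1_per_add_scale:
  assumes "H1_per u v" "H1_per u' v'"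
  shows "H1_per (\<lambda>x. u x + c * u' x) (\<lambda>x. v x + c *\<^sub>R v' x)"
proof -
  have L: "u \<in> L2v M" "v \<in> L2v M" "u' \<in> L2v M" "v' \<in> L2v M" using assms by (auto simp: H1_per_def)
  obtain \<phi> where \<phi>: "\<And>k. C1_per (\<phi> k)" "(\<lambda>k. L2n M (\<lambda>x. \<phi> k x - u x)) \<longlonglongrightarrow> 0"
    "(\<lambda>k. L2n M (\<lambda>x. grad (\<phi> k) x - v x)) \<longlonglongrightarrow> 0" by (rule H1_per_sequence[OF assms(1)]) (rule that)
  obtain \<psi> where \<psi>: "\<And>k. C1_per (\<psi> k)" "(\<lambda>k. L2n M (\<lambda>x. \<psi> k x - u' x)) \<longlonglongrightarrow> 0"
    "(\<lambda>k. L2n M (\<lambda>x. grad (\<psi> k) x - v' x)) \<longlonglongrightarrow> 0" by (rule H1_per_sequence[OF assms(2)]) (rule that)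
  have L': "\<phi> k \<in> L2v M" "grad (\<phi> k) \<in> L2v M" "\<psi> k \<in> L2v M" "grad (\<psi> k) \<in> L2v M" for k
    using \<phi>(1) \<psi>(1) by (auto simp: C1_per_def)
  show ?thesis
  proof (rule H1_perI)
    show "(\<lambda>x. u x + c * u' x) \<in> L2v M" using L2v_add[OF L(1) L2v_scale[OF L(3), of c]] by simp
    show "(\<lambda>x. v x + c *\<^sub>R v' x) \<in> L2v M" by (intro L2v_add L2v_scale L)
    show "(\<lambda>k. L2n M (\<lambda>x. \<phi> k x - u x) + \<bar>c\<bar> * L2n M (\<lambda>x. \<psi> k x - u' x)) \<longlonglongrightarrow> 0"
      "(\<lambda>k. L2n M (\<lambda>x. grad (\<phi> k) x - v x) + \<bar>c\<bar> * L2n M (\<lambda>x. grad (\<psi> k) x - v' x)) \<longlonglongrightarrow> 0"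
      by (intro tendsto_add_zero tendsto_mult_right_zero \<phi> \<psi>)+
    fix k
    show "C1_per (\<lambda>x. \<phi> k x + c * \<psi> k x)" by (rule C1_per_add_scale(1)[OF \<phi>(1) \<psi>(1)])
    have "L2n M (\<lambda>x. (\<phi> k x + c * \<psi> k x) - (u x + c * u' x)) = L2n M (\<lambda>x. (\<phi> k x - u x) + c *\<^sub>R (\<psi> k x - u' x))"
      by (simp add: algebra_simps)
    also have "\<dots> \<le> L2n M (\<lambda>x. \<phi> k x - u x) + \<bar>c\<bar> * L2n M (\<lambda>x. \<psi> k x - u' x)"
      unfolding L2n_scale[symmetric] by (intro L2n_add L2v_diff L2v_scale L L')
    finally show "L2n M (\<lambda>x. (\<phi> k x + c * \<psi> k x) - (u x + c * u' x)) \<le> \<dots>" .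
    have "L2n M (\<lambda>x. grad (\<lambda>x. \<phi> k x + c * \<psi> k x) x - (v x + c *\<^sub>R v' x)) =
        L2n M (\<lambda>x. (grad (\<phi> k) x - v x) + c *\<^sub>R (grad (\<psi> k) x - v' x))"
      by (rule L2n_cong) (simp add: C1_per_add_scale(2)[OF \<phi>(1) \<psi>(1)] algebra_simps)
    also have "\<dots> \<le> L2n M (\<lambda>x. grad (\<phi> k) x - v x) + \<bar>c\<bar> * L2n M (\<lambda>x. grad (\<psi> k) x - v' x)"
      unfolding L2n_scale[symmetric] by (intro L2n_add L2v_diff L2v_scale L L')
    finally show "L2n M (\<lambda>x. grad (\<lambda>x. \<phi> k x + c * \<psi> k x) x - (v x + c *\<^sub>R v' x)) \<le> \<dots>" .
  qed
qed

lemma finite_measure_M: "finite_measure M"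
proof -
  have "bounded P" using P_subset_cell bounded_box bounded_subset unfolding cell_def by blast
  then have "emeasure lebesgue P < \<infinity>" using emeasure_bounded_finite[of P] open_P by simp
  then show ?thesis
    using open_P by (intro finite_measureI) (simp add: emeasure_restrict_space space_restrict_space)
qed

lemma const_L2v: "(\<lambda>x. c) \<in> L2v M"
  using finite_measure.integrable_const[OF finite_measure_M] by (simp add: L2v_def)

lemma C1_per_const: "C1_per (\<lambda>x. c)" and grad_const: "grad (\<lambda>x. c) = (\<lambda>x. 0)"
proof -
  show g: "grad (\<lambda>x. c) = (\<lambda>x. 0)" by (rule ext, rule grad_eqI) auto
  show "C1_per (\<lambda>x. c)" unfolding C1_per_def g using const_L2v
    by (auto intro!: C1_onI[where G="\<lambda>_. 0"])
qed

text \<open>The smooth approximants themselves serve as \<open>C^1\<close> approximants; only their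
  weak gradients have to be identified with the classical ones. The converse is
  \<open>H1_per_sobolev_per\<close>.\<close>

lemma sobolev_per_H1_per:
  assumes "u \<in> sobolev_per k P" "1 \<le> k"
  shows "H1_per u (weak_grad P u)"
proof -
  have uk: "u \<in> sobolev k P" using assms by (simp add: sobolev_per_def)
  note u = sobolev_weak_grad[OF open_P uk assms(2)]
  show ?thesis unfolding H1_per_def
  proof (intro conjI allI impI u)
    fix e :: real assume "e > 0"
    then obtain \<phi> where \<phi>: "\<phi> \<in> smooth_periodic P" "\<phi> \<in> sobolev k P" "sobolev_norm k P (\<lambda>x. u x - \<phi> x) < e"
      using assms unfolding sobolev_per_def by blast
    note w = sobolev_weak_grad[OF open_P \<phi>(2) assms(2)]
    have C1: "C1_on \<phi> (periodic_extension P)"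
      using \<phi>(1) smooth_on_C1_on[OF open_extension] by (simp add: smooth_periodic_def)
    have ae: "AE x in M. weak_grad P \<phi> x = grad \<phi> x"
      by (intro weak_grad_AE is_weak_grad_classical open_P C1_on_subset[OF C1 P_subset_extension])
    have gL: "grad \<phi> \<in> L2v M"
      by (rule L2v_cong_AE_lebesgue_on(1)[OF _ w(2) ae]) (use open_P in auto)
    have "is_weak_grad P (\<lambda>x. u x - \<phi> x) (\<lambda>x. weak_grad P u x - grad \<phi> x)"
      by (intro is_weak_grad_diff u open_P is_weak_grad_classical C1_on_subset[OF C1 P_subset_extension])
    from L2n_le_sobolev_norm_1[OF open_P L2v_diff[OF u(1) w(1)] L2v_diff[OF u(2) gL] this]
    have "L2n M (\<lambda>x. u x - \<phi> x) < e" "L2n M (\<lambda>x. weak_grad P u x - grad \<phi> x) < e"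
      using sobolev_norm_mono[OF assms(2), of P "\<lambda>x. u x - \<phi> x"] \<phi>(3) by linarith+
    then show "\<exists>\<phi>. C1_per \<phi> \<and> L2n M (\<lambda>x. \<phi> x - u x) < e \<and> L2n M (\<lambda>x. grad \<phi> x - weak_grad P u x) < e"
      using C1 \<phi>(1) w(1) gL unfolding C1_per_def smooth_periodic_def
      by (subst (1 2) L2n_minus_commute) blast
  qed
qed

end

lemma fluid_domain_perforated_cell: "fluid_domain k \<alpha> P \<Longrightarrow> perforated_cell P"
  unfolding fluid_domain_def perforated_cell_def by blast

section \<open>Curves in seminormed function spaces\<close>

text \<open>The functions represent equivalence classes, so \<open>N\<close> may vanish on nonzero
  functions; limits and solutions are determined only up to distance zero.\<close>

locale seminormed_space =
  fixes X :: "('a \<Rightarrow> 'b::real_vector) set" and N :: "('a \<Rightarrow> 'b) \<Rightarrow> real"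
  assumes add_scale: "\<And>f g c. f \<in> X \<Longrightarrow> g \<in> X \<Longrightarrow> (\<lambda>x. f x + c *\<^sub>R g x) \<in> X"
    and zero: "(\<lambda>x. 0) \<in> X"
    and triangle: "\<And>f g. f \<in> X \<Longrightarrow> g \<in> X \<Longrightarrow> N (\<lambda>x. f x + g x) \<le> N f + N g"
    and homogeneous: "\<And>f c. f \<in> X \<Longrightarrow> N (\<lambda>x. c *\<^sub>R f x) = \<bar>c\<bar> * N f"
begin

lemma add: "f \<in> X \<Longrightarrow> g \<in> X \<Longrightarrow> (\<lambda>x. f x + g x) \<in> X"
  using add_scale[of f g 1] by simp

lemma diff: "f \<in> X \<Longrightarrow> g \<in> X \<Longrightarrow> (\<lambda>x. f x - g x) \<in> X"
  using add_scale[of f g "-1"] by simp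

lemma scale: "f \<in> X \<Longrightarrow> (\<lambda>x. c *\<^sub>R f x) \<in> X"
  using add_scale[OF zero, of f c] by simp

lemma N_zero: "N (\<lambda>x. 0) = 0"
  using homogeneous[OF zero, of 0] by simp

lemma nonneg: "f \<in> X \<Longrightarrow> 0 \<le> N f"
  using triangle[of f "\<lambda>x. (-1) *\<^sub>R f x"] homogeneous[of f "-1"] scale[of f "-1"] by (simp add: N_zero)

lemma triangle_diff: "f \<in> X \<Longrightarrow> g \<in> X \<Longrightarrow> N (\<lambda>x. f x - g x) \<le> N f + N g"
  using triangle[of f "\<lambda>x. (-1) *\<^sub>R g x"] homogeneous[of g "-1"] scale[of g "-1"] by simp

lemma le_add_diff: "f \<in> X \<Longrightarrow> g \<in> X \<Longrightarrow> N f \<le> N g + N (\<lambda>x. f x - g x)"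
  using triangle[of g "\<lambda>x. f x - g x"] diff[of f g] by simp

text \<open>The laws for \<open>N\<close> hold on \<open>X\<close> only, so membership near
  \<open>s\<close> is carried along with the limit.\<close>

definition null :: "(real \<Rightarrow> 'a \<Rightarrow> 'b) \<Rightarrow> real \<Rightarrow> bool" where
  "null e s \<longleftrightarrow> (\<forall>\<^sub>F t in at s. e t \<in> X) \<and> ((\<lambda>t. N (e t)) \<longlongrightarrow> 0) (at s)"

lemma null_bound:
  assumes "\<forall>\<^sub>F t in at s. e t \<in> X \<and> N (e t) \<le> r t" "(r \<longlongrightarrow> 0) (at s)"
  shows "null e s"
  unfolding null_def
proof
  show "\<forall>\<^sub>F t in at s. e t \<in> X" using assms(1) by eventually_elim simp
  show "((\<lambda>t. N (e t)) \<longlongrightarrow> 0) (at s)"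
    by (rule Lim_null_comparison[OF _ assms(2)]) (use assms(1) nonneg in \<open>auto elim: eventually_mono\<close>)
qed

lemma null_cong: "null e s \<Longrightarrow> \<forall>\<^sub>F t in at s. d t = e t \<Longrightarrow> null d s"
  by (rule null_bound[where r = "\<lambda>t. N (e t)"]) (auto simp: null_def elim: eventually_elim2)

lemma null_add_scale:
  assumes "null e s" "null d s" shows "null (\<lambda>t x. e t x + c *\<^sub>R d t x) s"
proof (rule null_bound)
  have "((\<lambda>t. N (e t) + \<bar>c\<bar> * N (d t)) \<longlongrightarrow> 0 + \<bar>c\<bar> * 0) (at s)"
    using assms by (intro tendsto_intros) (auto simp: null_def)
  then show "((\<lambda>t. N (e t) + \<bar>c\<bar> * N (d t)) \<longlongrightarrow> 0) (at s)" by simp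
  have "\<forall>\<^sub>F t in at s. e t \<in> X" "\<forall>\<^sub>F t in at s. d t \<in> X" using assms by (auto simp: null_def)
  then show "\<forall>\<^sub>F t in at s. (\<lambda>x. e t x + c *\<^sub>R d t x) \<in> X \<and> N (\<lambda>x. e t x + c *\<^sub>R d t x) \<le> N (e t) + \<bar>c\<bar> * N (d t)"
  proof eventually_elim
    case (elim t)
    show ?case using add_scale[OF elim] triangle[OF elim(1) scale[OF elim(2), of c]] homogeneous[OF elim(2), of c] by simp
  qed
qed

lemma null_add: "null e s \<Longrightarrow> null d s \<Longrightarrow> null (\<lambda>t x. e t x + d t x) s"
  using null_add_scale[of e s d 1] by simp

lemma null_diff: "null e s \<Longrightarrow> null d s \<Longrightarrow> null (\<lambda>t x. e t x - d t x) s"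
  using null_add_scale[of e s d "-1"] by simp

lemma null_zero: "\<forall>\<^sub>F t in at s. e t \<in> X \<and> N (e t) = 0 \<Longrightarrow> null e s"
  by (rule null_bound[where r = "\<lambda>t. 0"]) (auto elim: eventually_mono)

lemma Cm_curve_mem: "Cm_curve m X N J c \<Longrightarrow> s \<in> J \<Longrightarrow> c s \<in> X"
  by (cases m) auto

lemma Cm_curve_0I:
  "(\<And>s. s \<in> J \<Longrightarrow> c s \<in> X) \<Longrightarrow> (\<And>s. s \<in> J \<Longrightarrow> null (\<lambda>t x. c t x - c s x) s) \<Longrightarrow> Cm_curve 0 X N J c"
  by (simp add: null_def)

lemma Cm_curve_SucI:
  assumes "\<And>s. s \<in> J \<Longrightarrow> c s \<in> X" "Cm_curve m X N J c'"
    "\<And>s. s \<in> J \<Longrightarrow> null (\<lambda>t x. (c t x - c s x) /\<^sub>R (t - s) - c' s x) s"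
  shows "Cm_curve (Suc m) X N J c"
  using assms unfolding Cm_curve.simps null_def by blast

lemma Cm_curve_const: "f \<in> X \<Longrightarrow> Cm_curve m X N J (\<lambda>s. f)"
proof (induction m arbitrary: f)
  case 0 then show ?case by (simp add: N_zero)
next
  case (Suc m)
  then show ?case using Suc.IH[OF zero] by (auto simp: N_zero intro!: exI[of _ "\<lambda>s x. 0"])
qed

context
  fixes J :: "real set"
  assumes J: "open J"
begin

lemma Cm_curve_SucE:
  assumes "Cm_curve (Suc m) X N J c"
  obtains c' where "Cm_curve m X N J c'"
    "\<And>s. s \<in> J \<Longrightarrow> null (\<lambda>t x. (c t x - c s x) /\<^sub>R (t - s) - c' s x) s"
proof -
  obtain c' where c': "Cm_curve m X N J c'"
    "\<forall>s\<in>J. ((\<lambda>t. N (\<lambda>x. (c t x - c s x) /\<^sub>R (t - s) - c' s x)) \<longlongrightarrow> 0) (at s)"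
    using assms by auto
  have "null (\<lambda>t x. (c t x - c s x) /\<^sub>R (t - s) - c' s x) s" if s: "s \<in> J" for s
  proof -
    have "\<forall>\<^sub>F t in at s. (\<lambda>x. (c t x - c s x) /\<^sub>R (t - s) - c' s x) \<in> X"
      using eventually_at_in_open'[OF J s]
      by eventually_elim (intro diff scale Cm_curve_mem[OF assms] Cm_curve_mem[OF c'(1)] s)
    then show ?thesis using c'(2) s by (simp add: null_def)
  qed
  with c'(1) show thesis by (rule that)
qed

lemma Cm_curve_0D:
  assumes "Cm_curve 0 X N J c" "s \<in> J"
  shows "null (\<lambda>t x. c t x - c s x) s"
proof -
  have "\<forall>\<^sub>F t in at s. (\<lambda>x. c t x - c s x) \<in> X"
    using eventually_at_in_open'[OF J assms(2)] by eventually_elim (use assms diff in simp)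
  then show ?thesis using assms by (simp add: null_def)
qed

lemma Cm_curve_Suc_imp: "Cm_curve (Suc m) X N J c \<Longrightarrow> Cm_curve m X N J c"
proof (induction m arbitrary: c)
  case 0
  obtain c' where c': "Cm_curve 0 X N J c'" "\<And>s. s \<in> J \<Longrightarrow> null (\<lambda>t x. (c t x - c s x) /\<^sub>R (t - s) - c' s x) s"
    by (rule Cm_curve_SucE[OF 0]) (rule that)
  have "null (\<lambda>t x. c t x - c s x) s" if s: "s \<in> J" for s
  proof -
    define q where "q t = (\<lambda>x. (c t x - c s x) /\<^sub>R (t - s) - c' s x)" for t
    have q: "null q s" using c'(2)[OF s] unfolding q_def[abs_def] .
    have c's: "c' s \<in> X" by (rule Cm_curve_mem[OF c'(1) s])
    have "null (\<lambda>t x. (t - s) *\<^sub>R (q t x + c' s x)) s"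
    proof (rule null_bound)
      have "((\<lambda>t. \<bar>t - s\<bar> * (N (q t) + N (c' s))) \<longlongrightarrow> \<bar>s - s\<bar> * (0 + N (c' s))) (at s)"
        using q by (intro tendsto_intros) (auto simp: null_def)
      then show "((\<lambda>t. \<bar>t - s\<bar> * (N (q t) + N (c' s))) \<longlongrightarrow> 0) (at s)" by simp
      have "\<forall>\<^sub>F t in at s. q t \<in> X" using q by (simp add: null_def)
      then show "\<forall>\<^sub>F t in at s. (\<lambda>x. (t - s) *\<^sub>R (q t x + c' s x)) \<in> X \<and>
          N (\<lambda>x. (t - s) *\<^sub>R (q t x + c' s x)) \<le> \<bar>t - s\<bar> * (N (q t) + N (c' s))"
        by eventually_elim (simp add: homogeneous add c's scale mult_left_mono triangle)
    qed
    then show ?thesis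
      by (rule null_cong) (use eventually_neq_at_within[of s s UNIV] in \<open>eventually_elim, simp add: q_def\<close>)
  qed
  then show ?case using Cm_curve_mem[OF 0] by (intro Cm_curve_0I)
next
  case (Suc m)
  obtain c' where c': "Cm_curve (Suc m) X N J c'" "\<And>s. s \<in> J \<Longrightarrow> null (\<lambda>t x. (c t x - c s x) /\<^sub>R (t - s) - c' s x) s"
    by (rule Cm_curve_SucE[OF Suc.prems]) (rule that)
  show ?case by (rule Cm_curve_SucI[OF Cm_curve_mem[OF Suc.prems] Suc.IH[OF c'(1)] c'(2)])
qed

lemma Cm_curve_imp_0: "Cm_curve m X N J c \<Longrightarrow> Cm_curve 0 X N J c"
  by (induction m) (auto dest: Cm_curve_Suc_imp simp del: Cm_curve.simps)

lemma Cm_curve_add_scale: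
  "Cm_curve m X N J c \<Longrightarrow> Cm_curve m X N J d \<Longrightarrow> Cm_curve m X N J (\<lambda>s x. c s x + k *\<^sub>R d s x)"
proof (induction m arbitrary: c d)
  case 0
  have "null (\<lambda>t x. (c t x + k *\<^sub>R d t x) - (c s x + k *\<^sub>R d s x)) s" if s: "s \<in> J" for s
    by (rule null_cong[OF null_add_scale[OF Cm_curve_0D[OF 0(1) s] Cm_curve_0D[OF 0(2) s], of k]])
      (simp add: algebra_simps)
  then show ?case using add_scale[OF Cm_curve_mem[OF 0(1)] Cm_curve_mem[OF 0(2)]] by (intro Cm_curve_0I)
next
  case (Suc m)
  obtain c' where c': "Cm_curve m X N J c'" "\<And>s. s \<in> J \<Longrightarrow> null (\<lambda>t x. (c t x - c s x) /\<^sub>R (t - s) - c' s x) s"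
    by (rule Cm_curve_SucE[OF Suc.prems(1)]) (rule that)
  obtain d' where d': "Cm_curve m X N J d'" "\<And>s. s \<in> J \<Longrightarrow> null (\<lambda>t x. (d t x - d s x) /\<^sub>R (t - s) - d' s x) s"
    by (rule Cm_curve_SucE[OF Suc.prems(2)]) (rule that)
  show ?case
  proof (rule Cm_curve_SucI[OF _ Suc.IH[OF c'(1) d'(1)]])
    fix s assume s: "s \<in> J"
    show "(\<lambda>x. c s x + k *\<^sub>R d s x) \<in> X" using Suc.prems s by (intro add_scale) (auto dest: Cm_curve_mem)
    show "null (\<lambda>t x. ((c t x + k *\<^sub>R d t x) - (c s x + k *\<^sub>R d s x)) /\<^sub>R (t - s) - (c' s x + k *\<^sub>R d' s x)) s"
      by (rule null_cong[OF null_add_scale[OF c'(2)[OF s] d'(2)[OF s], of k]]) (simp add: algebra_simps)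
  qed
qed

end

end

section \<open>Bilinear operations and linear equations along curves\<close>

locale bilinear_spaces =
  S1: seminormed_space X1 N1 + S2: seminormed_space X2 N2 + S3: seminormed_space X3 N3
  for X1 :: "('a1 \<Rightarrow> 'b1::real_vector) set" and N1 and X2 :: "('a2 \<Rightarrow> 'b2::real_vector) set" and N2
    and X3 :: "('a3 \<Rightarrow> 'b3::real_vector) set" and N3 +
  fixes p :: "('a1 \<Rightarrow> 'b1) \<Rightarrow> ('a2 \<Rightarrow> 'b2) \<Rightarrow> ('a3 \<Rightarrow> 'b3)" and K :: real
  assumes p_mem: "\<And>f g. f \<in> X1 \<Longrightarrow> g \<in> X2 \<Longrightarrow> p f g \<in> X3"
    and p_left: "\<And>f f' g c. f \<in> X1 \<Longrightarrow> f' \<in> X1 \<Longrightarrow> g \<in> X2 \<Longrightarrow>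
      p (\<lambda>x. f x + c *\<^sub>R f' x) g = (\<lambda>y. p f g y + c *\<^sub>R p f' g y)"
    and p_right: "\<And>f g g' c. f \<in> X1 \<Longrightarrow> g \<in> X2 \<Longrightarrow> g' \<in> X2 \<Longrightarrow>
      p f (\<lambda>x. g x + c *\<^sub>R g' x) = (\<lambda>y. p f g y + c *\<^sub>R p f g' y)"
    and p_bound: "\<And>f g. f \<in> X1 \<Longrightarrow> g \<in> X2 \<Longrightarrow> N3 (p f g) \<le> K * N1 f * N2 g"
    and K_nonneg: "0 \<le> K"
begin

lemma p_left_diff: "f \<in> X1 \<Longrightarrow> f' \<in> X1 \<Longrightarrow> g \<in> X2 \<Longrightarrow> p (\<lambda>x. f x - f' x) g = (\<lambda>y. p f g y - p f' g y)"
  using p_left[of f f' g "-1"] by simp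

lemma p_right_diff: "f \<in> X1 \<Longrightarrow> g \<in> X2 \<Longrightarrow> g' \<in> X2 \<Longrightarrow> p f (\<lambda>x. g x - g' x) = (\<lambda>y. p f g y - p f g' y)"
  using p_right[of f g g' "-1"] by simp

lemma p_left_scale: "f \<in> X1 \<Longrightarrow> g \<in> X2 \<Longrightarrow> p (\<lambda>x. c *\<^sub>R f x) g = (\<lambda>y. c *\<^sub>R p f g y)"
  using p_left[of "\<lambda>x. 0" f g c] p_left[of "\<lambda>x. 0" "\<lambda>x. 0" g 1] S1.zero by (auto simp: fun_eq_iff)

lemma p_right_scale: "f \<in> X1 \<Longrightarrow> g \<in> X2 \<Longrightarrow> p f (\<lambda>x. c *\<^sub>R g x) = (\<lambda>y. c *\<^sub>R p f g y)"
  using p_right[of f "\<lambda>x. 0" g c] p_right[of f "\<lambda>x. 0" "\<lambda>x. 0" 1] S2.zero by (auto simp: fun_eq_iff)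

lemma null_p_left:
  assumes a: "S1.null a s" and b: "S2.null (\<lambda>t x. b t x - b0 x) s" "b0 \<in> X2"
  shows "S3.null (\<lambda>t. p (a t) (b t)) s"
proof (rule S3.null_bound)
  define d where "d t = (\<lambda>x. b t x - b0 x)" for t
  have lim: "((\<lambda>t. N1 (a t)) \<longlongrightarrow> 0) (at s)" "((\<lambda>t. N2 (d t)) \<longlongrightarrow> 0) (at s)"
    and ev: "\<forall>\<^sub>F t in at s. a t \<in> X1" "\<forall>\<^sub>F t in at s. d t \<in> X2"
    using a b(1) by (simp_all add: S1.null_def S2.null_def d_def)
  have "((\<lambda>t. K * N1 (a t) * (N2 b0 + N2 (d t))) \<longlongrightarrow> K * 0 * (N2 b0 + 0)) (at s)" by (intro tendsto_intros lim)
  then show "((\<lambda>t. K * N1 (a t) * (N2 b0 + N2 (d t))) \<longlongrightarrow> 0) (at s)" by simp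
  from ev show "\<forall>\<^sub>F t in at s. p (a t) (b t) \<in> X3 \<and> N3 (p (a t) (b t)) \<le> K * N1 (a t) * (N2 b0 + N2 (d t))"
  proof eventually_elim
    case (elim t)
    have bt: "b t \<in> X2" using S2.add[OF elim(2) b(2)] by (simp add: d_def)
    have "N3 (p (a t) (b t)) \<le> K * N1 (a t) * N2 (b t)" by (rule p_bound[OF elim(1) bt])
    also have "\<dots> \<le> K * N1 (a t) * (N2 b0 + N2 (d t))"
      using S2.le_add_diff[OF bt b(2)] S1.nonneg[OF elim(1)] K_nonneg by (intro mult_left_mono) (auto simp: d_def)
    finally show ?case using p_mem[OF elim(1) bt] by simp
  qed
qed

lemma null_p_right:
  assumes a: "a \<in> X1" and b: "S2.null b s"
  shows "S3.null (\<lambda>t. p a (b t)) s"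
proof (rule S3.null_bound)
  show "((\<lambda>t. K * N1 a * N2 (b t)) \<longlongrightarrow> 0) (at s)"
    using b by (intro tendsto_mult_right_zero) (simp add: S2.null_def)
  have "\<forall>\<^sub>F t in at s. b t \<in> X2" using b by (simp add: S2.null_def)
  then show "\<forall>\<^sub>F t in at s. p a (b t) \<in> X3 \<and> N3 (p a (b t)) \<le> K * N1 a * N2 (b t)"
    by eventually_elim (simp add: p_mem p_bound a)
qed

context
  fixes J :: "real set"
  assumes J: "open J"
begin

text \<open>Product rule: the error of the difference quotient is \<open>p (qa t) (b t)\<close>,
  plus \<open>p (a' s)\<close> applied to the increment of \<open>b\<close>, plus
  \<open>p (a s) (qb t)\<close>, where \<open>qa\<close> and \<open>qb\<close> are the errors of the
  factors. In each summand one argument tends to zero while the other stays bounded.\<close>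

lemma Cm_curve_bilinear:
  "Cm_curve m X1 N1 J a \<Longrightarrow> Cm_curve m X2 N2 J b \<Longrightarrow> Cm_curve m X3 N3 J (\<lambda>s. p (a s) (b s))"
proof (induction m arbitrary: a b)
  case 0
  note mem = S1.Cm_curve_mem[OF 0(1)] S2.Cm_curve_mem[OF 0(2)]
  have "S3.null (\<lambda>t y. p (a t) (b t) y - p (a s) (b s) y) s" if s: "s \<in> J" for s
  proof (rule S3.null_cong[OF S3.null_add])
    show "S3.null (\<lambda>t. p (\<lambda>x. a t x - a s x) (b t)) s"
      by (rule null_p_left[OF S1.Cm_curve_0D[OF J 0(1) s] S2.Cm_curve_0D[OF J 0(2) s] mem(2)[OF s]])
    show "S3.null (\<lambda>t. p (a s) (\<lambda>x. b t x - b s x)) s"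
      by (rule null_p_right[OF mem(1)[OF s] S2.Cm_curve_0D[OF J 0(2) s]])
    show "\<forall>\<^sub>F t in at s. (\<lambda>y. p (a t) (b t) y - p (a s) (b s) y) =
        (\<lambda>y. p (\<lambda>x. a t x - a s x) (b t) y + p (a s) (\<lambda>x. b t x - b s x) y)"
      using eventually_at_in_open'[OF J s] by eventually_elim (simp add: p_left_diff p_right_diff mem s)
  qed
  then show ?case using p_mem[OF mem] by (intro S3.Cm_curve_0I)
next
  case (Suc m)
  note mem = S1.Cm_curve_mem[OF Suc.prems(1)] S2.Cm_curve_mem[OF Suc.prems(2)]
  obtain a' where a': "Cm_curve m X1 N1 J a'" "\<And>s. s \<in> J \<Longrightarrow> S1.null (\<lambda>t x. (a t x - a s x) /\<^sub>R (t - s) - a' s x) s"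
    by (rule S1.Cm_curve_SucE[OF J Suc.prems(1)]) (rule that)
  obtain b' where b': "Cm_curve m X2 N2 J b'" "\<And>s. s \<in> J \<Longrightarrow> S2.null (\<lambda>t x. (b t x - b s x) /\<^sub>R (t - s) - b' s x) s"
    by (rule S2.Cm_curve_SucE[OF J Suc.prems(2)]) (rule that)
  note b0 = S2.Cm_curve_0D[OF J S2.Cm_curve_imp_0[OF J Suc.prems(2)]]
  show ?case
  proof (rule S3.Cm_curve_SucI)
    have "Cm_curve m X3 N3 J (\<lambda>s y. p (a' s) (b s) y + 1 *\<^sub>R p (a s) (b' s) y)"
      by (intro S3.Cm_curve_add_scale[OF J Suc.IH[OF a'(1) S2.Cm_curve_Suc_imp[OF J Suc.prems(2)]]
            Suc.IH[OF S1.Cm_curve_Suc_imp[OF J Suc.prems(1)] b'(1)]])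
    then show "Cm_curve m X3 N3 J (\<lambda>s y. p (a' s) (b s) y + p (a s) (b' s) y)" by simp
    fix s assume s: "s \<in> J"
    show "p (a s) (b s) \<in> X3" by (intro p_mem mem s)
    note ms = mem[OF s] S1.Cm_curve_mem[OF a'(1) s] S2.Cm_curve_mem[OF b'(1) s]
    define qa qb where "qa t = (\<lambda>x. (a t x - a s x) /\<^sub>R (t - s) - a' s x)"
      and "qb t = (\<lambda>x. (b t x - b s x) /\<^sub>R (t - s) - b' s x)" for t
    show "S3.null (\<lambda>t y. (p (a t) (b t) y - p (a s) (b s) y) /\<^sub>R (t - s) - (p (a' s) (b s) y + p (a s) (b' s) y)) s"
    proof (rule S3.null_cong[OF S3.null_add[OF S3.null_add]])
      show "S3.null (\<lambda>t. p (qa t) (b t)) s"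
        using null_p_left[OF a'(2)[OF s] b0[OF s] ms(2)] by (simp add: qa_def)
      show "S3.null (\<lambda>t. p (a' s) (\<lambda>x. b t x - b s x)) s" by (rule null_p_right[OF ms(3) b0[OF s]])
      show "S3.null (\<lambda>t. p (a s) (qb t)) s" using null_p_right[OF ms(1) b'(2)[OF s]] by (simp add: qb_def)
      show "\<forall>\<^sub>F t in at s. (\<lambda>y. (p (a t) (b t) y - p (a s) (b s) y) /\<^sub>R (t - s) - (p (a' s) (b s) y + p (a s) (b' s) y)) =
          (\<lambda>y. (p (qa t) (b t) y + p (a' s) (\<lambda>x. b t x - b s x) y) + p (a s) (qb t) y)"
        using eventually_at_in_open'[OF J s]
      proof eventually_elim
        case (elim t)
        note da = S1.diff[OF mem(1)[OF elim] ms(1)] and db = S2.diff[OF mem(2)[OF elim] ms(2)]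
        show ?case unfolding qa_def qb_def
          by (simp add: p_left_diff p_right_diff p_left_scale p_right_scale mem elim ms da db S1.scale S2.scale) (simp add: algebra_simps)
      qed
    qed
  qed
qed

text \<open>Formal differentiation of the equation gives \<open>p (A s) (v' s) = R s\<close> with
  \<open>R s = B' s - p (A' s) (v s)\<close>. Solvability provides \<open>v'\<close>, coercivity
  makes the difference quotients of \<open>v\<close> converge to it, and the induction hypothesis
  for \<open>v'\<close> gives its regularity. The coercivity constant may depend on
  \<open>s\<close>.\<close>

theorem Cm_curve_solve:
  assumes coercive: "\<And>s. s \<in> J \<Longrightarrow> \<exists>C. \<forall>v\<in>X2. N2 v \<le> C * N3 (p (A s) v)"
    and solvable: "\<And>s b. s \<in> J \<Longrightarrow> b \<in> X3 \<Longrightarrow> \<exists>v\<in>X2. N3 (\<lambda>y. p (A s) v y - b y) = 0"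
    and A: "Cm_curve m X1 N1 J A" and B: "Cm_curve m X3 N3 J B"
    and v: "\<And>s. s \<in> J \<Longrightarrow> v s \<in> X2" "\<And>s. s \<in> J \<Longrightarrow> N3 (\<lambda>y. p (A s) (v s) y - B s y) = 0"
  shows "Cm_curve m X2 N2 J v"
proof -
  have As: "A s \<in> X1" if "s \<in> J" for s by (rule S1.Cm_curve_mem[OF A that])
  have coercive': "\<exists>C\<ge>0. \<forall>w\<in>X2. N2 w \<le> C * N3 (p (A s) w)" if s: "s \<in> J" for s
  proof -
    obtain C where C: "\<forall>w\<in>X2. N2 w \<le> C * N3 (p (A s) w)" using coercive[OF s] by blast
    have "N2 w \<le> max C 0 * N3 (p (A s) w)" if w: "w \<in> X2" for w
      using C w mult_right_mono[of C "max C 0" "N3 (p (A s) w)"] S3.nonneg[OF p_mem[OF As[OF s] w]] by fastforce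
    then show ?thesis by (intro exI[of _ "max C 0"]) simp
  qed
  have nullD: "S2.null w s" if s: "s \<in> J" and w: "\<forall>\<^sub>F t in at s. w t \<in> X2" "S3.null (\<lambda>t. p (A s) (w t)) s" for w s
  proof -
    obtain C where C: "\<forall>w\<in>X2. N2 w \<le> C * N3 (p (A s) w)" using coercive[OF s] by blast
    show ?thesis
    proof (rule S2.null_bound)
      show "((\<lambda>t. C * N3 (p (A s) (w t))) \<longlongrightarrow> 0) (at s)"
        using w(2) by (intro tendsto_mult_right_zero) (simp add: S3.null_def)
      show "\<forall>\<^sub>F t in at s. w t \<in> X2 \<and> N2 (w t) \<le> C * N3 (p (A s) (w t))"
        using w(1) by eventually_elim (use C in simp)
    qed
  qed
  show ?thesis
    using A B v
  proof (induction m arbitrary: B v)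
    case 0
    note Bm = S3.Cm_curve_mem[OF 0(2)]
    have "S2.null (\<lambda>t x. v t x - v s x) s" if s: "s \<in> J" for s
    proof -
      define w where "w t = (\<lambda>x. v t x - v s x)" for t
      define dA where "dA t = (\<lambda>x. A t x - A s x)" for t
      have w: "w t \<in> X2" if "t \<in> J" for t unfolding w_def by (intro S2.diff 0 that s)
      have dA: "dA t \<in> X1" if "t \<in> J" for t unfolding dA_def by (intro S1.diff As that s)
      \<comment> \<open>This is \<open>p (A t)\<close> applied to the increment \<open>w t\<close>.
        The equations at \<open>t\<close> and \<open>s\<close> turn it into the increment of
        \<open>B\<close> minus \<open>p (dA t) (v s)\<close>, up to an error of seminorm zero, and
        this tends to zero.\<close>
      define z where "z t = (\<lambda>y. p (A s) (w t) y + p (dA t) (w t) y)" for t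
      have z: "S3.null z s"
      proof (rule S3.null_cong[OF S3.null_add[OF S3.null_diff S3.null_zero]])
        show "S3.null (\<lambda>t y. B t y - B s y) s" by (rule S3.Cm_curve_0D[OF J 0(2) s])
        show "S3.null (\<lambda>t. p (dA t) (v s)) s"
          using S1.Cm_curve_0D[OF J 0(1) s] S2.N_zero 0(3)[OF s] S2.zero unfolding dA_def
          by (intro null_p_left[where ?b0.0 = "v s"] S2.null_zero) auto
        show "\<forall>\<^sub>F t in at s. (\<lambda>y. (p (A t) (v t) y - B t y) - (p (A s) (v s) y - B s y)) \<in> X3 \<and>
            N3 (\<lambda>y. (p (A t) (v t) y - B t y) - (p (A s) (v s) y - B s y)) = 0"
          using eventually_at_in_open'[OF J s]
        proof eventually_elim
          case (elim t)
          have e: "(\<lambda>y. p (A t) (v t) y - B t y) \<in> X3" if "t \<in> J" for t by (intro S3.diff p_mem As Bm 0(3) that)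
          show ?case using S3.diff[OF e[OF elim] e[OF s]] S3.nonneg[OF S3.diff[OF e[OF elim] e[OF s]]]
              S3.triangle_diff[OF e[OF elim] e[OF s]] 0(4)[OF elim] 0(4)[OF s] by simp
        qed
        show "\<forall>\<^sub>F t in at s. z t = (\<lambda>y. ((B t y - B s y) - p (dA t) (v s) y) +
            ((p (A t) (v t) y - B t y) - (p (A s) (v s) y - B s y)))"
          using eventually_at_in_open'[OF J s]
        proof eventually_elim
          case (elim t)
          have "w t \<in> X2" by (rule w[OF elim])
          then show ?case unfolding z_def dA_def
            by (simp add: p_left_diff As elim s 0(3)) (simp add: w_def p_right_diff As elim s 0(3))
        qed
      qed
      obtain C where C: "0 \<le> C" "\<forall>w\<in>X2. N2 w \<le> C * N3 (p (A s) w)" using coercive'[OF s] by blast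
      have "((\<lambda>t. C * K * N1 (dA t)) \<longlongrightarrow> C * K * 0) (at s)"
        using S1.Cm_curve_0D[OF J 0(1) s] by (intro tendsto_intros) (simp add: S1.null_def dA_def)
      \<comment> \<open>The part \<open>p (dA t) (w t)\<close> of \<open>z t\<close> is absorbed:
        for t near s it contributes at most half of \<open>N2 (w t)\<close>, whence the factor 2 in
        the bound below.\<close>
      then have small: "\<forall>\<^sub>F t in at s. C * K * N1 (dA t) < 1 / 2" by (rule order_tendstoD) simp
      have "S2.null w s"
      proof (rule S2.null_bound)
        show "((\<lambda>t. (2 * C) * N3 (z t)) \<longlongrightarrow> 0) (at s)"
          using z by (intro tendsto_mult_right_zero) (simp add: S3.null_def)
        show "\<forall>\<^sub>F t in at s. w t \<in> X2 \<and> N2 (w t) \<le> (2 * C) * N3 (z t)"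
          using eventually_at_in_open'[OF J s] small
        proof eventually_elim
          case (elim t)
          note wt = w[OF elim(1)] and m = p_mem[OF As[OF s] w[OF elim(1)]] p_mem[OF dA[OF elim(1)] w[OF elim(1)]]
          have "N3 (p (A s) (w t)) \<le> N3 (z t) + K * N1 (dA t) * N2 (w t)"
            using S3.triangle_diff[OF S3.add[OF m] m(2)] p_bound[OF dA[OF elim(1)] wt] by (simp add: z_def)
          then have "C * N3 (p (A s) (w t)) \<le> C * N3 (z t) + (C * K * N1 (dA t)) * N2 (w t)"
            using mult_left_mono[OF _ C(1)] by (fastforce simp: algebra_simps)
          moreover have "(C * K * N1 (dA t)) * N2 (w t) \<le> 1 / 2 * N2 (w t)"
            using elim(2) S2.nonneg[OF wt] by (intro mult_right_mono) auto
          ultimately show ?case using C(2) wt by fastforce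
        qed
      qed
      then show ?thesis by (simp add: w_def[abs_def])
    qed
    then show ?case using 0(3) by (intro S2.Cm_curve_0I)
  next
    case (Suc m)
    obtain A' where A': "Cm_curve m X1 N1 J A'" "\<And>s. s \<in> J \<Longrightarrow> S1.null (\<lambda>t x. (A t x - A s x) /\<^sub>R (t - s) - A' s x) s"
      by (rule S1.Cm_curve_SucE[OF J Suc.prems(1)]) (rule that)
    obtain B' where B': "Cm_curve m X3 N3 J B'" "\<And>s. s \<in> J \<Longrightarrow> S3.null (\<lambda>t x. (B t x - B s x) /\<^sub>R (t - s) - B' s x) s"
      by (rule S3.Cm_curve_SucE[OF J Suc.prems(2)]) (rule that)
    note Am = S1.Cm_curve_Suc_imp[OF J Suc.prems(1)] and Bm = S3.Cm_curve_mem[OF Suc.prems(2)]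
    \<comment> \<open>The induction hypothesis is used twice: here for \<open>v\<close>, which makes
      the right-hand side \<open>R\<close> a \<open>C^m\<close> curve, and then for
      \<open>v'\<close>.\<close>
    have vm: "Cm_curve m X2 N2 J v"
      by (rule Suc.IH[OF Am S3.Cm_curve_Suc_imp[OF J Suc.prems(2)] Suc.prems(3,4)])
    define R where "R s = (\<lambda>y. B' s y - p (A' s) (v s) y)" for s
    have "Cm_curve m X3 N3 J (\<lambda>s y. B' s y + (-1) *\<^sub>R p (A' s) (v s) y)"
      by (rule S3.Cm_curve_add_scale[OF J B'(1) Cm_curve_bilinear[OF A'(1) vm]])
    then have R: "Cm_curve m X3 N3 J R" by (simp add: R_def[abs_def])
    define v' where "v' s = (SOME w. w \<in> X2 \<and> N3 (\<lambda>y. p (A s) w y - R s y) = 0)" for s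
    have v': "v' s \<in> X2 \<and> N3 (\<lambda>y. p (A s) (v' s) y - R s y) = 0" if "s \<in> J" for s
      using solvable[OF that S3.Cm_curve_mem[OF R that]] unfolding v'_def Bex_def by (rule someI_ex)
    note v0 = S2.Cm_curve_0D[OF J S2.Cm_curve_imp_0[OF J vm]]
    show ?case
    proof (rule S2.Cm_curve_SucI[OF Suc.prems(3)])
      show "Cm_curve m X2 N2 J v'" by (rule Suc.IH[OF Am R]) (use v' in auto)
      fix s assume s: "s \<in> J"
      define q where "q t = (\<lambda>x. (v t x - v s x) /\<^sub>R (t - s) - v' s x)" for t
      define qA qB where "qA t = (\<lambda>x. (A t x - A s x) /\<^sub>R (t - s) - A' s x)"
        and "qB t = (\<lambda>x. (B t x - B s x) /\<^sub>R (t - s) - B' s x)" for t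
      define e where "e t = (\<lambda>y. p (A t) (v t) y - B t y)" for t
      \<comment> \<open>\<open>E\<close> collects the errors that the equations for
        \<open>v t\<close>, \<open>v s\<close> and \<open>v' s\<close> leave open; its seminorm is
        zero.\<close>
      define E where "E t = (\<lambda>y. (e t y - e s y) /\<^sub>R (t - s) - (p (A s) (v' s) y - R s y))" for t
      note ms = As[OF s] Suc.prems(3)[OF s] conjunct1[OF v'[OF s]] S1.Cm_curve_mem[OF A'(1) s] S3.Cm_curve_mem[OF R s]
      have q: "q t \<in> X2" if "t \<in> J" for t unfolding q_def by (intro S2.diff S2.scale Suc.prems(3) that s ms)
      have "S2.null q s"
      proof (rule nullD[OF s])
        show "\<forall>\<^sub>F t in at s. q t \<in> X2" using eventually_at_in_open'[OF J s] by eventually_elim (rule q)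
        show "S3.null (\<lambda>t. p (A s) (q t)) s"
        proof (rule S3.null_cong[OF S3.null_add[OF S3.null_diff[OF S3.null_diff] S3.null_zero]])
          show "S3.null qB s" using B'(2)[OF s] by (simp add: qB_def[abs_def])
          show "S3.null (\<lambda>t. p (qA t) (v t)) s" using null_p_left[OF A'(2)[OF s] v0[OF s] ms(2)] by (simp add: qA_def)
          show "S3.null (\<lambda>t. p (A' s) (\<lambda>x. v t x - v s x)) s" by (rule null_p_right[OF ms(4) v0[OF s]])
          show "\<forall>\<^sub>F t in at s. E t \<in> X3 \<and> N3 (E t) = 0"
            using eventually_at_in_open'[OF J s]
          proof eventually_elim
            case (elim t)
            have em: "e t \<in> X3" if "t \<in> J" for t unfolding e_def by (intro S3.diff p_mem As Bm Suc.prems(3) that)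
            note de = S3.diff[OF em[OF elim] em[OF s]] and d' = S3.diff[OF p_mem[OF ms(1) ms(3)] ms(5)]
            have E: "E t \<in> X3" unfolding E_def by (intro S3.diff[OF S3.scale[OF de] d'])
            have "N3 (\<lambda>y. e t y - e s y) \<le> 0"
              using S3.triangle_diff[OF em[OF elim] em[OF s]] Suc.prems(4)[OF elim] Suc.prems(4)[OF s] by (simp add: e_def)
            then have "N3 (\<lambda>y. e t y - e s y) = 0" using S3.nonneg[OF de] by simp
            then have "N3 (E t) \<le> 0"
              using S3.triangle_diff[OF S3.scale[OF de, of "inverse (t - s)"] d'] S3.homogeneous[OF de] v'[OF s]
              unfolding E_def by simp
            then show ?case using E S3.nonneg[OF E] by simp
          qed
          show "\<forall>\<^sub>F t in at s. p (A s) (q t) =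
              (\<lambda>y. ((qB t y - p (qA t) (v t) y) - p (A' s) (\<lambda>x. v t x - v s x) y) + E t y)"
            using eventually_at_in_open'[OF J s]
          proof eventually_elim
            case (elim t)
            note mt = As[OF elim] Suc.prems(3)[OF elim]
            note dA = S1.diff[OF mt(1) ms(1)] and dv = S2.diff[OF mt(2) ms(2)]
            show ?case unfolding q_def qA_def qB_def E_def e_def R_def
              by (simp add: p_left_diff p_right_diff p_left_scale p_right_scale ms mt dA dv S1.scale S2.scale) (simp add: algebra_simps)
          qed
        qed
      qed
      then show "S2.null (\<lambda>t x. (v t x - v s x) /\<^sub>R (t - s) - v' s x) s" by (simp add: q_def[abs_def])
    qed
  qed
qed

end

end

section \<open>Smoothing of \<open>C\<^sup>1\<close> functions\<close>

lemma mollifier_exists: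
  assumes "r > 0"
  obtains \<eta> :: "real^'n \<Rightarrow> real" where "smooth_on \<eta> UNIV" "\<forall>x. 0 \<le> \<eta> x" "\<forall>x. r < norm x \<longrightarrow> \<eta> x = 0"
    "integrable lborel \<eta>" "(LINT x|lborel. \<eta> x) = 1"
proof -
  \<comment> \<open>A cube of half side r / d lies in the ball of radius r, because the Euclidean
    norm is at most the sum of the absolute values of the coordinates.\<close>
  define a :: "real^'n" where "a = (\<chi> i. r / CARD('n))"
  have sub: "cbox (- a) a \<subseteq> cball 0 r"
  proof
    fix x assume "x \<in> cbox (- a) a"
    then have *: "\<bar>x $ i\<bar> \<le> r / CARD('n)" for i
      unfolding mem_box_cart a_def by (auto simp: abs_le_iff dest!: spec[of _ i])
    have "norm x \<le> (\<Sum>i\<in>UNIV. \<bar>x $ i\<bar>)" by (rule norm_le_l1_cart)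
    also have "\<dots> \<le> (\<Sum>i\<in>(UNIV::'n set). r / CARD('n))" by (intro sum_mono *)
    finally show "x \<in> cball 0 r" by simp
  qed
  define b where "b = box_bump (- a) a 0"
  have t: "test_function UNIV b" unfolding b_def by (rule test_function_box_bump) simp
  have cb: "continuous_on UNIV b" by (rule C1_on_continuous[OF test_function_C1_on[OF t]])
  then have bm[measurable]: "b \<in> borel_measurable borel" by (rule borel_measurable_continuous_onI)
  have "integrable lebesgue (\<lambda>x. 1 * b x)"
    by (rule integrable_test_function[OF _ t]) (auto intro: locally_integrable_continuous)
  then have ib: "integrable lborel b" by (simp add: integrable_completion)
  have pos: "(LINT x|lborel. b x) > 0"
  proof (rule ccontr)
    have nn: "0 \<le> b x" for x unfolding b_def by (rule box_bump_bounds)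
    assume "\<not> (LINT x|lborel. b x) > 0"
    then have "(LINT x|lborel. b x) = 0" using Bochner_Integration.integral_nonneg[of lborel b] nn by (simp add: antisym)
    then have "AE x in lborel. b x = 0" using integral_nonneg_eq_0_iff_AE[OF ib] nn by simp
    then have "AE x in lborel. x \<notin> box (- a) a"
      by eventually_elim (auto simp: b_def dest!: box_bump_pos[where n=0])
    then have "emeasure lborel (box (- a) a) = 0"
      by (subst (asm) AE_iff_measurable[of "box (- a) a"]) auto
    moreover have "emeasure lborel (box (- a) a) = ennreal (\<Prod>i\<in>Basis. (a - (- a)) \<bullet> i)"
      using assms by (intro emeasure_lborel_box) (auto simp: a_def Basis_vec_def inner_axis)
    moreover have "(\<Prod>i\<in>Basis. (a - (- a)) \<bullet> i) > 0"
      using assms by (intro prod_pos) (auto simp: a_def Basis_vec_def inner_axis)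
    ultimately show False by (metis ennreal_eq_0_iff not_le)
  qed
  define \<eta> where "\<eta> x = (1 / (LINT x|lborel. b x)) * b x" for x
  show thesis
  proof
    show "smooth_on \<eta> UNIV" unfolding \<eta>_def smooth_on_def b_def
      using smooth_box_bump[of "- a" a 0 UNIV] unfolding smooth_on_def by (intro allI Ck_on_cmult) blast
    show "\<forall>x. 0 \<le> \<eta> x"
      unfolding \<eta>_def b_def using pos[unfolded b_def] box_bump_bounds(1)[of "- a" a 0] by simp
    show "\<forall>x. r < norm x \<longrightarrow> \<eta> x = 0"
    proof (intro allI impI)
      fix x :: "real^'n" assume "r < norm x"
      then have "x \<notin> cball 0 r" by simp
      then have "x \<notin> box (- a) a" using sub box_subset_cbox[of "- a" a] by blast
      then show "\<eta> x = 0" by (simp add: \<eta>_def b_def box_bump_outside)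
    qed
    show "integrable lborel \<eta>" unfolding \<eta>_def using ib by (intro integrable_mult_right)
    show "(LINT x|lborel. \<eta> x) = 1" unfolding \<eta>_def using pos by simp
  qed
qed

section \<open>Convolution with smooth compactly supported kernels\<close>

lemma lborel_integral_reflect:
  fixes g :: "real^'n \<Rightarrow> real"
  assumes [measurable]: "g \<in> borel_measurable borel"
  shows "(LINT y|lborel. g (x - y)) = (LINT y|lborel. g y)"
    "integrable lborel (\<lambda>y. g (x - y)) \<longleftrightarrow> integrable lborel g"
proof -
  have e: "(lborel :: (real^'n) measure) = distr lborel borel (\<lambda>y. x - y)"
    using lborel_affine[of "-1" x] by (simp add: density_1)
  show "(LINT y|lborel. g (x - y)) = (LINT y|lborel. g y)"
    by (subst (2) e, subst integral_distr) auto
  show "integrable lborel (\<lambda>y. g (x - y)) \<longleftrightarrow> integrable lborel g"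
    by (subst (2) e, subst integrable_distr_eq) auto
qed

definition conv :: "(real^'n \<Rightarrow> real) \<Rightarrow> (real^'n \<Rightarrow> real) \<Rightarrow> real^'n \<Rightarrow> real" where
  "conv \<eta> f x = (LINT y|lborel. f y * \<eta> (x - y))"

definition bdd_borel :: "(real^'n \<Rightarrow> real) \<Rightarrow> bool" where
  "bdd_borel f \<longleftrightarrow> f \<in> borel_measurable borel \<and> (\<exists>B. \<forall>x. \<bar>f x\<bar> \<le> B)"

text \<open>Sign and total mass are left out so that directional derivatives of a kernel are kernels
  again, which drives the induction in \<open>conv_smooth\<close>.\<close>

definition kernel :: "real \<Rightarrow> (real^'n \<Rightarrow> real) \<Rightarrow> bool" where
  "kernel r \<eta> \<longleftrightarrow> smooth_on \<eta> UNIV \<and> (\<forall>x. r < norm x \<longrightarrow> \<eta> x = 0)"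

lemma kernel_test_function: "kernel r \<eta> \<Longrightarrow> test_function UNIV \<eta>"
  unfolding kernel_def test_function_def by (force intro!: exI[of _ "cball 0 r"])

lemma kernel_C1: "kernel r \<eta> \<Longrightarrow> C1_on \<eta> UNIV"
  using kernel_test_function test_function_C1_on by blast

lemma kernel_continuous: "kernel r \<eta> \<Longrightarrow> continuous_on UNIV \<eta>"
  by (intro C1_on_continuous kernel_C1)

lemma kernel_measurable: "kernel r \<eta> \<Longrightarrow> \<eta> \<in> borel_measurable borel"
  by (intro borel_measurable_continuous_onI kernel_continuous)

lemma kernel_integrable: "kernel r \<eta> \<Longrightarrow> integrable lborel \<eta>"
proof -
  assume k: "kernel r \<eta>"
  have "integrable lebesgue (\<lambda>x. 1 * \<eta> x)"
    by (rule integrable_test_function[OF _ kernel_test_function[OF k]]) (auto intro: locally_integrable_continuous)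
  then show ?thesis using kernel_measurable[OF k] by (simp add: integrable_completion)
qed

lemma conv_integrable:
  assumes "kernel r \<eta>" "bdd_borel f"
  shows "integrable lborel (\<lambda>y. f y * \<eta> (x - y))"
proof -
  obtain B where B: "\<And>x. \<bar>f x\<bar> \<le> B" using assms(2) by (auto simp: bdd_borel_def)
  have [measurable]: "f \<in> borel_measurable borel" "\<eta> \<in> borel_measurable borel"
    using assms kernel_measurable by (auto simp: bdd_borel_def)
  have i: "integrable lborel (\<lambda>y. B * \<eta> (x - y))"
    using kernel_integrable[OF assms(1)] by (intro integrable_mult_right) (simp add: lborel_integral_reflect)
  show ?thesis
    by (rule Bochner_Integration.integrable_bound[OF i])
      (use B in \<open>auto intro!: AE_I2 mult_right_mono simp: abs_mult intro: order_trans[OF _ abs_ge_self]\<close>)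
qed

lemma kernel_partials:
  assumes "kernel r \<eta>"
  shows "kernel r (\<lambda>x. grad \<eta> x \<bullet> v)"
proof -
  have "test_function UNIV (partials [i] \<eta>)" for i
    by (rule test_function_partials[OF kernel_test_function[OF assms]])
  then have s: "smooth_on (\<lambda>x. grad \<eta> x $ i) UNIV" for i
    by (simp add: test_function_def grad_def)
  have "smooth_on (\<lambda>x. \<Sum>i\<in>UNIV. v $ i * (grad \<eta> x $ i)) UNIV"
    using s unfolding smooth_on_def by (auto intro!: Ck_on_sum Ck_on_cmult)
  moreover have "grad \<eta> x = 0" if "r < norm x" for x
    using C1_on_Un_zero(2)[OF open_UNIV closed_cball[of 0 r] _ kernel_C1[OF assms]] assms that
    by (auto simp: kernel_def)
  ultimately show ?thesis by (simp add: kernel_def inner_vec_def mult.commute)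
qed

lemma kernel_grad_uniformly_continuous:
  assumes "kernel r \<eta>" "e > 0"
  shows "\<exists>d>0. \<forall>x y. norm (x - y) < d \<longrightarrow> norm (grad \<eta> x - grad \<eta> y) \<le> e"
proof -
  define K where "K = cball (0::real^'a) (\<bar>r\<bar> + 1)"
  have c: "continuous_on UNIV (grad \<eta>)" using kernel_C1[OF assms(1)] by (simp add: C1_on_def)
  have z: "grad \<eta> x = 0" if "r < norm x" for x
    using C1_on_Un_zero(2)[OF open_UNIV closed_cball[of 0 r] _ kernel_C1[OF assms(1)]] assms(1) that
    by (auto simp: kernel_def)
  have "uniformly_continuous_on K (grad \<eta>)"
    unfolding K_def by (rule compact_uniformly_continuous) (auto intro: continuous_on_subset[OF c])
  then obtain d where d: "d > 0" "\<And>x y. x \<in> K \<Longrightarrow> y \<in> K \<Longrightarrow> dist y x < d \<Longrightarrow> dist (grad \<eta> y) (grad \<eta> x) < e"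
    unfolding uniformly_continuous_on_def using assms(2) by blast
  have "norm (grad \<eta> x - grad \<eta> y) \<le> e" if n: "norm (x - y) < min d 1" for x y
  proof (cases "x \<in> K \<and> y \<in> K")
    case True
    then have "dist (grad \<eta> x) (grad \<eta> y) < e" using n by (intro d(2)) (auto simp: dist_norm)
    then show ?thesis by (simp add: dist_norm)
  next
    case False
    have "norm x \<le> norm y + norm (x - y)" by (rule norm_triangle_sub)
    moreover have "norm y \<le> norm x + norm (x - y)"
      using norm_triangle_sub[of y x] by (simp only: norm_minus_commute[of y x])
    moreover have "\<bar>r\<bar> + 1 < norm x \<or> \<bar>r\<bar> + 1 < norm y" using False by (auto simp: K_def)
    ultimately have "r < norm x" "r < norm y" using n by linarith+
    then show ?thesis using z assms(2) by simp
  qed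
  then show ?thesis using d(1) by (intro exI[of _ "min d 1"]) auto
qed

text \<open>The remainder is small uniformly in the base point, as it will be integrated over the
  base point in a convolution.\<close>

lemma kernel_Taylor:
  assumes "kernel r \<eta>" "e > 0"
  shows "\<exists>d>0. \<forall>x v. norm v < d \<longrightarrow> \<bar>\<eta> (x + v) - \<eta> x - grad \<eta> x \<bullet> v\<bar> \<le> e * norm v"
proof -
  obtain d where d: "d > 0" "\<And>x y. norm (x - y) < d \<Longrightarrow> norm (grad \<eta> x - grad \<eta> y) \<le> e"
    using kernel_grad_uniformly_continuous[OF assms] by blast
  have "\<bar>\<eta> (x + v) - \<eta> x - grad \<eta> x \<bullet> v\<bar> \<le> e * norm v" if v: "norm v < d" for x v
  proof -
    define q where "q y = \<eta> y - grad \<eta> x \<bullet> y" for y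
    have "\<bar>q (x + v) - q x\<bar> \<le> e * norm (x + v - x)"
    proof (rule inner_derivative_bound[where S = "ball x d" and G = "\<lambda>y. grad \<eta> y - grad \<eta> x"])
      show "(q has_derivative (\<lambda>w. (grad \<eta> y - grad \<eta> x) \<bullet> w)) (at y within ball x d)" for y
        unfolding q_def inner_diff_left
        by (intro has_derivative_diff bounded_linear_imp_has_derivative bounded_linear_inner_right
            has_derivative_at_withinI[OF C1_on_deriv[OF kernel_C1[OF assms(1)] UNIV_I]])
    qed (use v d in \<open>auto simp: dist_norm norm_minus_commute\<close>)
    then show ?thesis by (simp add: q_def inner_add_right)
  qed
  then show ?thesis using d(1) by blast
qed

text \<open>The first-order Taylor remainder of the kernel is uniformly small, and for increments
  shorter than 1 it vanishes for \<open>z\<close> outside the ball \<open>K\<close>. Integrated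
  against the bounded \<open>f\<close> it bounds the remainder of the convolution; \<open>L\<close>
  is the resulting factor, with 1 added to keep it positive.\<close>

lemma conv_has_derivative:
  assumes k: "kernel r \<eta>" and f: "bdd_borel f"
  shows "(conv \<eta> f has_derivative (\<lambda>v. conv (\<lambda>z. grad \<eta> z \<bullet> v) f x)) (at x)"
  unfolding has_derivative_at_alt
proof (intro conjI allI impI)
  obtain B0 where B0: "\<And>x. \<bar>f x\<bar> \<le> B0" using f by (auto simp: bdd_borel_def)
  define B where "B = max B0 0"
  have B: "\<bar>f x\<bar> \<le> B" "0 \<le> B" for x using B0[of x] by (auto simp: B_def)
  note k' = kernel_partials[OF k]
  show "bounded_linear (\<lambda>v. conv (\<lambda>z. grad \<eta> z \<bullet> v) f x)"
  proof (rule linear_conv_bounded_linear[THEN iffD1], rule linearI)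
    fix v w :: "real^'a" and c :: real
    have "conv (\<lambda>z. grad \<eta> z \<bullet> (v + w)) f x =
        (LINT y|lborel. f y * (grad \<eta> (x - y) \<bullet> v) + f y * (grad \<eta> (x - y) \<bullet> w))"
      by (simp add: conv_def inner_add_right distrib_left)
    also have "\<dots> = conv (\<lambda>z. grad \<eta> z \<bullet> v) f x + conv (\<lambda>z. grad \<eta> z \<bullet> w) f x"
      unfolding conv_def using conv_integrable[OF k' f]
      by (intro Bochner_Integration.integral_add) auto
    finally show "conv (\<lambda>z. grad \<eta> z \<bullet> (v + w)) f x =
      conv (\<lambda>z. grad \<eta> z \<bullet> v) f x + conv (\<lambda>z. grad \<eta> z \<bullet> w) f x" .
    have "conv (\<lambda>z. grad \<eta> z \<bullet> (c *\<^sub>R v)) f x = (LINT y|lborel. c * (f y * (grad \<eta> (x - y) \<bullet> v)))"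
      by (simp add: conv_def algebra_simps)
    also have "\<dots> = c *\<^sub>R conv (\<lambda>z. grad \<eta> z \<bullet> v) f x" unfolding conv_def by simp
    finally show "conv (\<lambda>z. grad \<eta> z \<bullet> (c *\<^sub>R v)) f x = c *\<^sub>R conv (\<lambda>z. grad \<eta> z \<bullet> v) f x" .
  qed
  fix e :: real assume e: "e > 0"
  define K where "K = cball x (\<bar>r\<bar> + 1)"
  define L where "L = B * measure lborel K + 1"
  have L: "L > 0" unfolding L_def using B(2) by (intro add_nonneg_pos mult_nonneg_nonneg) auto
  obtain d where d: "d > 0" "\<And>x v. norm v < d \<Longrightarrow> \<bar>\<eta> (x + v) - \<eta> x - grad \<eta> x \<bullet> v\<bar> \<le> (e / L) * norm v"
    using kernel_Taylor[OF k, of "e / L"] e L by auto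
  have "norm (conv \<eta> f y - conv \<eta> f x - conv (\<lambda>z. grad \<eta> z \<bullet> (y - x)) f x) \<le> e * norm (y - x)"
    if y: "norm (y - x) < min d 1" for y
  proof -
    define E where "E z = f z * (\<eta> (y - z) - \<eta> (x - z) - grad \<eta> (x - z) \<bullet> (y - x))" for z
    have "conv \<eta> f y - conv \<eta> f x - conv (\<lambda>z. grad \<eta> z \<bullet> (y - x)) f x = (LINT z|lborel. E z)"
      unfolding conv_def E_def right_diff_distrib
      using conv_integrable[OF k f] conv_integrable[OF k' f] by simp
    also have "norm \<dots> \<le> (LINT z|lborel. indicator K z * (B * ((e / L) * norm (y - x))))"
    proof (rule Bochner_Integration.integral_norm_bound_integral)
      show "integrable lborel E" unfolding E_def right_diff_distrib
        using conv_integrable[OF k f] conv_integrable[OF k' f] by (intro Bochner_Integration.integrable_diff)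
      have "emeasure lborel K < \<infinity>" unfolding K_def using emeasure_bounded_finite[of "cball x (\<bar>r\<bar> + 1)"] by simp
      then show "integrable lborel (\<lambda>z. indicator K z * (B * ((e / L) * norm (y - x))))"
        by (intro integrable_mult_left integrable_real_indicator) (auto simp: K_def)
      fix z
      show "norm (E z) \<le> indicator K z * (B * ((e / L) * norm (y - x)))"
      proof (cases "z \<in> K")
        case True
        have "\<bar>\<eta> (y - z) - \<eta> (x - z) - grad \<eta> (x - z) \<bullet> (y - x)\<bar> \<le> (e / L) * norm (y - x)"
          using d(2)[of "y - x" "x - z"] y by simp
        then have "\<bar>f z\<bar> * \<bar>\<eta> (y - z) - \<eta> (x - z) - grad \<eta> (x - z) \<bullet> (y - x)\<bar> \<le> B * ((e / L) * norm (y - x))"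
          using B by (intro mult_mono) auto
        moreover have "norm (E z) = \<bar>f z\<bar> * \<bar>\<eta> (y - z) - \<eta> (x - z) - grad \<eta> (x - z) \<bullet> (y - x)\<bar>"
          unfolding E_def by (simp only: real_norm_def abs_mult)
        ultimately show ?thesis using True by (simp only: indicator_simps mult_1)
      next
        case False
        then have xz: "\<bar>r\<bar> + 1 < norm (x - z)" by (simp add: K_def dist_norm)
        have "norm (x - z) \<le> norm (y - z) + norm (y - x)"
          using norm_triangle_ineq4[of "y - z" "y - x"] by simp
        then have "\<eta> (y - z) = 0" "\<eta> (x - z) = 0" "grad \<eta> (x - z) \<bullet> (y - x) = 0"
          using xz y k k'[of "y - x"] unfolding kernel_def by auto
        then show ?thesis using False by (simp add: E_def)
      qed
    qed
    also have "\<dots> = (B * measure lborel K) * ((e / L) * norm (y - x))" by (simp add: K_def)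
    also have "\<dots> \<le> L * ((e / L) * norm (y - x))"
      using e L by (intro mult_right_mono) (auto simp: L_def)
    also have "\<dots> = e * norm (y - x)" using L by simp
    finally show ?thesis .
  qed
  then show "\<exists>d>0. \<forall>y. norm (y - x) < d \<longrightarrow>
      norm (conv \<eta> f y - conv \<eta> f x - conv (\<lambda>z. grad \<eta> z \<bullet> (y - x)) f x) \<le> e * norm (y - x)"
    using d(1) by (intro exI[of _ "min d 1"]) auto
qed

lemma conv_smooth:
  assumes "kernel r \<eta>" "bdd_borel f"
  shows "smooth_on (conv \<eta> f) UNIV"
proof -
  have "Ck_on k (conv \<eta> f) UNIV" if "kernel r \<eta>" for k \<eta>
    using that
  proof (induction k arbitrary: \<eta>)
    case 0
    have "isCont (conv \<eta> f) x" for x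
      by (rule has_derivative_continuous[OF conv_has_derivative[OF 0 assms(2)]])
    then show ?case by (simp add: continuous_at_imp_continuous_on)
  next
    case (Suc k)
    show ?case
      by (rule Ck_on_SucI[OF conv_has_derivative[OF Suc.prems assms(2)] Suc.IH[OF kernel_partials[OF Suc.prems]]])
  qed
  then show ?thesis using assms(1) by (simp add: smooth_on_def)
qed

text \<open>Integration by parts moves the derivative from the kernel to \<open>f\<close>: the
  function \<open>q\<close> has compact support, so its partial derivative has integral
  zero.\<close>

lemma conv_grad:
  fixes f :: "real^'n \<Rightarrow> real"
  assumes k: "kernel r \<eta>" and f: "bdd_borel f" "C1_on f UNIV" "bdd_borel (\<lambda>y. grad f y $ i)"
  shows "grad (conv \<eta> f) x $ i = conv \<eta> (\<lambda>y. grad f y $ i) x"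
proof -
  have "grad (conv \<eta> f) x $ i = conv (\<lambda>z. grad \<eta> z \<bullet> axis i 1) f x"
    using frechet_derivative_at[OF conv_has_derivative[OF k f(1), of x], symmetric]
    by (simp add: grad_def)
  define q where "q y = f y * \<eta> (x - y)" for y
  have de: "((\<lambda>y. \<eta> (x - y)) has_derivative (\<lambda>v. (- grad \<eta> (x - y)) \<bullet> v)) (at y)" for y
  proof -
    have "((\<lambda>y. x - y) has_derivative (\<lambda>v. - v)) (at y)" by (auto intro!: derivative_eq_intros)
    from diff_chain_at[OF this C1_on_deriv[OF kernel_C1[OF k], of "x - y"]]
    show ?thesis by (simp add: o_def)
  qed
  have C1e: "C1_on (\<lambda>y. \<eta> (x - y)) UNIV"
    using kernel_C1[OF k] by (intro C1_onI[OF de])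
      (auto simp: C1_on_def intro!: continuous_intros intro: continuous_on_compose2)
  have q: "C1_on q UNIV" unfolding q_def by (intro C1_on_mult f(2) C1e)
  have gq: "grad q y = f y *\<^sub>R (- grad \<eta> (x - y)) + \<eta> (x - y) *\<^sub>R grad f y" for y
    unfolding q_def using grad_mult(2)[OF C1_on_deriv[OF f(2)] C1_on_deriv[OF C1e]] grad_eqI[OF de] by simp
  have "(LINT y|lborel. grad q y $ i) = 0"
  proof (rule integral_grad_compact_support[OF q compact_cball[of x r]])
    fix y assume "y \<notin> cball x r"
    then show "q y = 0" using k by (auto simp: q_def kernel_def dist_norm)
  qed
  moreover have "grad q y $ i = grad f y $ i * \<eta> (x - y) - f y * (grad \<eta> (x - y) \<bullet> axis i 1)" for y
    unfolding gq by (simp add: inner_axis)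
  ultimately have "conv \<eta> (\<lambda>y. grad f y $ i) x - conv (\<lambda>z. grad \<eta> z \<bullet> axis i 1) f x = 0"
    unfolding conv_def using conv_integrable[OF k f(3)] conv_integrable[OF kernel_partials[OF k] f(1)] by simp
  then show ?thesis using \<open>grad (conv \<eta> f) x $ i = conv (\<lambda>z. grad \<eta> z \<bullet> axis i 1) f x\<close> by simp
qed

text \<open>A nonnegative kernel of mass 1 makes the convolution at \<open>x\<close> a weighted
  average of the values of \<open>f\<close> at distance at most \<open>r\<close> from
  \<open>x\<close>.\<close>

lemma conv_error:
  assumes k: "kernel r \<eta>" and \<eta>: "\<And>x. 0 \<le> \<eta> x" "(LINT x|lborel. \<eta> x) = 1" and f: "bdd_borel f"
    and le: "\<And>y. norm (x - y) \<le> r \<Longrightarrow> \<bar>f y - c\<bar> \<le> e"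
  shows "\<bar>conv \<eta> f x - c\<bar> \<le> e"
proof -
  note km[measurable] = kernel_measurable[OF k]
  have i: "integrable lborel (\<lambda>y. \<eta> (x - y))" "(LINT y|lborel. \<eta> (x - y)) = 1"
    using kernel_integrable[OF k] \<eta>(2) by (simp_all add: lborel_integral_reflect)
  have "conv \<eta> f x - c = (LINT y|lborel. f y * \<eta> (x - y)) - (LINT y|lborel. c * \<eta> (x - y))"
    using i by (simp add: conv_def)
  also have "\<dots> = (LINT y|lborel. f y * \<eta> (x - y) - c * \<eta> (x - y))"
    using conv_integrable[OF k f] i by simp
  also have "\<bar>\<dots>\<bar> \<le> (LINT y|lborel. e * \<eta> (x - y))"
  proof -
    have "norm (LINT y|lborel. f y * \<eta> (x - y) - c * \<eta> (x - y)) \<le> (LINT y|lborel. e * \<eta> (x - y))"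
    proof (rule Bochner_Integration.integral_norm_bound_integral)
      show "integrable lborel (\<lambda>y. f y * \<eta> (x - y) - c * \<eta> (x - y))" "integrable lborel (\<lambda>y. e * \<eta> (x - y))"
        using conv_integrable[OF k f] i by auto
      fix y
      have "norm (f y * \<eta> (x - y) - c * \<eta> (x - y)) = \<bar>f y - c\<bar> * \<eta> (x - y)"
        using \<eta>(1)[of "x - y"] by (simp add: abs_mult flip: left_diff_distrib)
      also have "\<dots> \<le> e * \<eta> (x - y)"
        using le[of y] \<eta>(1)[of "x - y"] k unfolding kernel_def
        by (cases "norm (x - y) \<le> r") (auto intro!: mult_right_mono)
      finally show "norm (f y * \<eta> (x - y) - c * \<eta> (x - y)) \<le> e * \<eta> (x - y)" .
    qed
    then show ?thesis by simp
  qed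
  finally show ?thesis using i by simp
qed

section \<open>Periodic functions and their smooth approximation\<close>

definition periodic :: "(real^'n \<Rightarrow> 'b) \<Rightarrow> bool" where
  "periodic f \<longleftrightarrow> (\<forall>x. \<forall>z\<in>lattice_points. f (x + z) = f x)"

lemma conv_periodic:
  assumes "kernel r \<eta>" "bdd_borel f" "periodic f"
  shows "periodic (conv \<eta> f)"
  unfolding periodic_def
proof (intro allI ballI)
  fix x z :: "real^'a" assume z: "z \<in> lattice_points"
  have [measurable]: "f \<in> borel_measurable borel" "\<eta> \<in> borel_measurable borel"
    using assms kernel_measurable by (auto simp: bdd_borel_def)
  have "conv \<eta> f (x + z) = (LINT y|distr lborel borel ((+) z). f y * \<eta> (x + z - y))"
    by (simp add: conv_def lborel_distr_plus)
  also have "\<dots> = (LINT y|lborel. f (z + y) * \<eta> (x + z - (z + y)))" by (rule integral_distr) auto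
  also have "\<dots> = conv \<eta> f x" unfolding conv_def
    using assms(3) z by (simp add: periodic_def add.commute)
  finally show "conv \<eta> f (x + z) = conv \<eta> f x" .
qed

lemma lattice_shift:
  fixes x :: "real^'n"
  obtains z where "z \<in> lattice_points" "\<forall>i. 0 \<le> (x - z) $ i \<and> (x - z) $ i < 1"
proof -
  have "(\<chi> i. of_int \<lfloor>x $ i\<rfloor>) \<in> (lattice_points :: (real^'n) set)" by (simp add: lattice_points_def)
  moreover have "\<forall>i. 0 \<le> (x - (\<chi> i. of_int \<lfloor>x $ i\<rfloor>)) $ i \<and> (x - (\<chi> i. of_int \<lfloor>x $ i\<rfloor>)) $ i < 1"
  proof
    fix i show "0 \<le> (x - (\<chi> i. of_int \<lfloor>x $ i\<rfloor>)) $ i \<and> (x - (\<chi> i. of_int \<lfloor>x $ i\<rfloor>)) $ i < 1"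
      using floor_correct[of "x $ i"] by (simp, linarith)
  qed
  ultimately show thesis by (rule that)
qed

lemma periodic_uniformly_continuous:
  fixes f :: "real^'n \<Rightarrow> 'b::real_normed_vector"
  assumes "periodic f" "continuous_on UNIV f" "e > 0"
  shows "\<exists>d>0. \<forall>x y. norm (x - y) \<le> d \<longrightarrow> norm (f x - f y) \<le> e"
proof -
  \<comment> \<open>A lattice shift brings \<open>x\<close> into the unit cube; a point at distance
    at most 1 from it then lies in this larger cube.\<close>
  define K :: "(real^'n) set" where "K = cbox (\<chi> i. - 1) (\<chi> i. 2)"
  have "uniformly_continuous_on K f"
    unfolding K_def by (rule compact_uniformly_continuous) (auto intro: continuous_on_subset[OF assms(2)])
  then obtain d where d: "d > 0" "\<And>x y. x \<in> K \<Longrightarrow> y \<in> K \<Longrightarrow> dist y x < d \<Longrightarrow> dist (f y) (f x) < e"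
    unfolding uniformly_continuous_on_def using assms(3) by blast
  have "norm (f x - f y) \<le> e" if n: "norm (x - y) \<le> min (d / 2) 1" for x y
  proof -
    obtain z where z: "z \<in> lattice_points" "\<forall>i. 0 \<le> (x - z) $ i \<and> (x - z) $ i < 1"
      by (rule lattice_shift)
    have "x - z \<in> K" "y - z \<in> K"
    proof -
      have "- 1 \<le> (x - z) $ i \<and> (x - z) $ i \<le> 2 \<and> - 1 \<le> (y - z) $ i \<and> (y - z) $ i \<le> 2" for i
      proof -
        have "\<bar>(x - y) $ i\<bar> \<le> 1" using component_le_norm_cart[of "x - y" i] n by linarith
        then have "\<bar>x $ i - y $ i\<bar> \<le> 1" by simp
        moreover have "0 \<le> x $ i - z $ i" "x $ i - z $ i < 1" using z(2) by (auto dest: spec[of _ i])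
        ultimately show ?thesis by (simp add: abs_le_iff)
      qed
      then show "x - z \<in> K" "y - z \<in> K" unfolding K_def mem_box_cart by simp_all
    qed
    then have "dist (f (x - z)) (f (y - z)) < e" using n d(1) by (intro d(2)) (auto simp: dist_norm)
    moreover have "f (x - z + z) = f (x - z)" "f (y - z + z) = f (y - z)"
      using assms(1) z(1) unfolding periodic_def by blast+
    ultimately show ?thesis by (simp add: dist_norm less_imp_le)
  qed
  then show ?thesis using d(1) by (intro exI[of _ "min (d / 2) 1"]) auto
qed

lemma periodic_continuous_bounded:
  fixes f :: "real^'n \<Rightarrow> 'b::real_normed_vector"
  assumes "periodic f" "continuous_on UNIV f"
  shows "\<exists>B. \<forall>x. norm (f x) \<le> B"
proof -
  have "compact (f ` cbox (\<chi> i. 0) (\<chi> i. 1))"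
    by (intro compact_continuous_image continuous_on_subset[OF assms(2)]) auto
  then have "bounded (f ` cbox (\<chi> i. 0) (\<chi> i. 1))" by (rule compact_imp_bounded)
  then obtain B where B: "\<forall>y\<in>f ` cbox (\<chi> i. 0) (\<chi> i. 1). norm y \<le> B" unfolding bounded_iff ..
  have "norm (f x) \<le> B" for x
  proof -
    obtain z where z: "z \<in> lattice_points" "\<forall>i. 0 \<le> (x - z) $ i \<and> (x - z) $ i < 1"
      by (rule lattice_shift)
    have "f (x - z + z) = f (x - z)" using assms(1) z(1) unfolding periodic_def by blast
    then have "f x = f (x - z)" by simp
    moreover have "x - z \<in> cbox (\<chi> i. 0) (\<chi> i. 1)" using z(2) unfolding mem_box_cart by (simp add: less_imp_le)
    ultimately show ?thesis using B by simp
  qed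
  then show ?thesis by blast
qed

lemma periodic_grad:
  assumes "periodic f" "C1_on f UNIV"
  shows "periodic (grad f)"
  unfolding periodic_def
proof (intro allI ballI)
  fix x z :: "real^'a" assume z: "z \<in> lattice_points"
  have "((\<lambda>y. y + z) has_derivative (\<lambda>v. v)) (at x)" by (auto intro!: derivative_eq_intros)
  from diff_chain_at[OF this C1_on_deriv[OF assms(2), of "x + z"]]
  have "((\<lambda>y. f (y + z)) has_derivative (\<lambda>v. grad f (x + z) \<bullet> v)) (at x)" by (simp add: o_def)
  moreover have "(\<lambda>y. f (y + z)) = f" using assms(1) z by (auto simp: periodic_def)
  ultimately show "grad f (x + z) = grad f x" using grad_eqI by metis
qed

lemma bdd_borel_periodic: "periodic f \<Longrightarrow> continuous_on UNIV f \<Longrightarrow> bdd_borel f"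
  using periodic_continuous_bounded[of f] by (auto simp: bdd_borel_def intro: borel_measurable_continuous_onI)

text \<open>The last property says that smoothing enlarges the support by at most \<open>r\<close>;
  this keeps an infinite sum of smoothed pieces locally finite.\<close>

lemma smooth_approximation:
  fixes f :: "real^'n \<Rightarrow> real"
  assumes f: "C1_on f UNIV" "periodic f" and "e > 0" "\<delta> > 0"
  obtains g r where "smooth_on g UNIV" "periodic g" "0 < r" "r \<le> \<delta>" "\<And>x. \<bar>g x - f x\<bar> \<le> e"
    "\<And>x. norm (grad g x - grad f x) \<le> e" "\<And>x. (\<forall>y. norm (x - y) \<le> r \<longrightarrow> f y = 0) \<Longrightarrow> g x = 0"
proof -
  have cf: "continuous_on UNIV f" and cg: "continuous_on UNIV (grad f)"
    using f C1_on_continuous by (auto simp: C1_on_def)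
  note pg = periodic_grad[OF f(2,1)]
  have e': "e / CARD('n) > 0" using assms(3) by simp
  obtain d1 where d1: "d1 > 0" "\<And>x y. norm (x - y) \<le> d1 \<Longrightarrow> norm (f x - f y) \<le> e"
    using periodic_uniformly_continuous[OF f(2) cf assms(3)] by blast
  obtain d2 where d2: "d2 > 0" "\<And>x y. norm (x - y) \<le> d2 \<Longrightarrow> norm (grad f x - grad f y) \<le> e / CARD('n)"
    using periodic_uniformly_continuous[OF pg cg e'] by blast
  define r where "r = min \<delta> (min d1 d2)"
  have r: "r > 0" "r \<le> \<delta>" "r \<le> d1" "r \<le> d2" using d1 d2 assms(4) by (auto simp: r_def)
  obtain \<eta> :: "real^'n \<Rightarrow> real" where \<eta>': "smooth_on \<eta> UNIV" "\<forall>x. 0 \<le> \<eta> x" "\<forall>x. r < norm x \<longrightarrow> \<eta> x = 0"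
    "integrable lborel \<eta>" "(LINT x|lborel. \<eta> x) = 1"
    by (rule mollifier_exists[OF r(1)])
  note \<eta> = \<eta>'(1) \<eta>'(2)[rule_format] \<eta>'(3)[rule_format] \<eta>'(4,5)
  have k: "kernel r \<eta>" using \<eta> by (simp add: kernel_def)
  have bf: "bdd_borel f" by (rule bdd_borel_periodic[OF f(2) cf])
  have bg: "bdd_borel (\<lambda>y. grad f y $ i)" for i
    by (rule bdd_borel_periodic) (use pg cg in \<open>auto simp: periodic_def intro!: continuous_intros\<close>)
  show thesis
  proof
    show "smooth_on (conv \<eta> f) UNIV" by (rule conv_smooth[OF k bf])
    show "periodic (conv \<eta> f)" by (rule conv_periodic[OF k bf f(2)])
    show "\<bar>conv \<eta> f x - f x\<bar> \<le> e" for x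
      using d1(2)[of x] r(3) by (intro conv_error[OF k \<eta>(2,5) bf]) (auto simp: abs_minus_commute)
    show "norm (grad (conv \<eta> f) x - grad f x) \<le> e" for x
    proof -
      have "\<bar>(grad (conv \<eta> f) x - grad f x) $ i\<bar> \<le> e / CARD('n)" for i
      proof -
        have "\<bar>grad f y $ i - grad f x $ i\<bar> \<le> e / CARD('n)" if "norm (x - y) \<le> r" for y
        proof -
          have "norm (grad f y - grad f x) \<le> e / CARD('n)"
            using d2(2)[of y x] that r(4) by (simp add: norm_minus_commute)
          then show ?thesis using component_le_norm_cart[of "grad f y - grad f x" i] by simp
        qed
        then have "\<bar>conv \<eta> (\<lambda>y. grad f y $ i) x - grad f x $ i\<bar> \<le> e / CARD('n)"
          by (rule conv_error[OF k \<eta>(2,5) bg])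
        then show ?thesis by (simp add: conv_grad[OF k bf f(1) bg])
      qed
      then have "(\<Sum>i\<in>UNIV. \<bar>(grad (conv \<eta> f) x - grad f x) $ i\<bar>) \<le> (\<Sum>i\<in>(UNIV::'n set). e / CARD('n))"
        by (intro sum_mono)
      then show ?thesis using norm_le_l1_cart[of "grad (conv \<eta> f) x - grad f x"] by simp
    qed
    show "conv \<eta> f x = 0" if "\<forall>y. norm (x - y) \<le> r \<longrightarrow> f y = 0" for x
      using conv_error[OF k \<eta>(2,5) bf, of x 0 0] that by simp
  qed (use r in auto)
qed

text \<open>The case distinction is needed because \<open>infdist x {} = 0\<close>.\<close>

definition bdist :: "(real^'n) set \<Rightarrow> real^'n \<Rightarrow> real" where
  "bdist U x = (if - U = {} then 1 else min 1 (infdist x (- U)))"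

lemma bdist_Lipschitz: "\<bar>bdist U x - bdist U y\<bar> \<le> norm (x - y)"
proof -
  have "infdist x A \<le> infdist y A + norm (x - y)" "infdist y A \<le> infdist x A + norm (x - y)" for A
    using infdist_triangle[of x A y] infdist_triangle[of y A x] by (simp_all add: dist_norm norm_minus_commute)
  from this[of "- U"] show ?thesis unfolding bdist_def by auto
qed

lemma continuous_on_bdist: "continuous_on S (bdist U)"
  unfolding bdist_def by (cases "- U = {}") (auto intro!: continuous_intros)

lemma bdist_pos:
  assumes "open U"
  shows "bdist U x > 0 \<longleftrightarrow> x \<in> U"
proof (cases "- U = {}")
  case True
  then show ?thesis by (auto simp: bdist_def)
next
  case False
  have "x \<in> - U \<longleftrightarrow> infdist x (- U) = 0"
    using assms False by (intro in_closed_iff_infdist_zero) auto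
  then show ?thesis using False infdist_nonneg[of x "- U"] by (auto simp: bdist_def less_le min_def split: if_splits)
qed

lemma bdist_periodic:
  assumes "\<And>x z. z \<in> lattice_points \<Longrightarrow> x + z \<in> U \<longleftrightarrow> x \<in> U"
  shows "periodic (bdist U)"
  unfolding periodic_def
proof (intro allI ballI)
  fix x z :: "real^'a" assume z: "z \<in> lattice_points"
  have le: "infdist (x + z) (- U) \<le> infdist x (- U)"
    if "z \<in> lattice_points" "- U \<noteq> {}" for x z
  proof -
    have "infdist (x + z) (- U) \<le> dist x a" if a: "a \<in> - U" for a
    proof -
      have "a + z \<in> - U" using assms \<open>z \<in> lattice_points\<close> a by simp
      then have "infdist (x + z) (- U) \<le> dist (x + z) (a + z)" by (rule infdist_le)
      then show ?thesis by simp
    qed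
    then show ?thesis unfolding infdist_notempty[OF that(2), of x]
      using that(2) by (intro cINF_greatest) auto
  qed
  have "- z \<in> lattice_points" using z by (simp add: lattice_points_def)
  then show "bdist U (x + z) = bdist U x"
    using le[OF z, of x] le[of "- z" "x + z"] unfolding bdist_def by (cases "- U = {}") (simp_all add: antisym)
qed

lemma smooth_cutoff:
  fixes U :: "(real^'n) set"
  assumes per: "\<And>x z. z \<in> lattice_points \<Longrightarrow> x + z \<in> U \<longleftrightarrow> x \<in> U" and "c > 0"
  obtains \<xi> :: "real^'n \<Rightarrow> real" where "smooth_on \<xi> UNIV" "periodic \<xi>"
    "\<forall>x. 2 * c \<le> bdist U x \<longrightarrow> \<xi> x = 1" "\<forall>x. bdist U x \<le> c \<longrightarrow> \<xi> x = 0"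
proof -
  \<comment> \<open>The threshold 3c/2 has distance c/2 from both c and 2c. As \<open>bdist\<close>
    is 1-Lipschitz, mollification with radius c/4 leaves the values 0 and 1 intact at these two
    levels.\<close>
  define f :: "real^'n \<Rightarrow> real" where "f = indicator {x. 3 / 2 * c \<le> bdist U x}"
  have "{x. 3 / 2 * c \<le> bdist U x} \<in> sets borel"
    by (intro borel_closed closed_Collect_le continuous_on_bdist continuous_intros)
  then have bf: "bdd_borel f" unfolding bdd_borel_def f_def
    by (intro conjI borel_measurable_indicator exI[of _ 1]) (auto split: split_indicator)
  have pf: "periodic f" using bdist_periodic[OF per] by (auto simp: periodic_def f_def indicator_def)
  have r: "c / 4 > 0" using assms(2) by simp
  obtain \<eta> :: "real^'n \<Rightarrow> real" where \<eta>': "smooth_on \<eta> UNIV" "\<forall>x. 0 \<le> \<eta> x" "\<forall>x. c / 4 < norm x \<longrightarrow> \<eta> x = 0"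
    "integrable lborel \<eta>" "(LINT x|lborel. \<eta> x) = 1"
    by (rule mollifier_exists[OF r])
  note \<eta> = \<eta>'(1) \<eta>'(2)[rule_format] \<eta>'(3)[rule_format] \<eta>'(4,5)
  have k: "kernel (c / 4) \<eta>" using \<eta> by (simp add: kernel_def)
  show thesis
  proof
    show "smooth_on (conv \<eta> f) UNIV" by (rule conv_smooth[OF k bf])
    show "periodic (conv \<eta> f)" by (rule conv_periodic[OF k bf pf])
    show "\<forall>x. 2 * c \<le> bdist U x \<longrightarrow> conv \<eta> f x = 1"
    proof (intro allI impI)
      fix x :: "real^'n" assume "2 * c \<le> bdist U x"
      have "f y = 1" if y: "norm (x - y) \<le> c / 4" for y
      proof -
        have "3 / 2 * c \<le> bdist U y"
          using \<open>2 * c \<le> bdist U x\<close> y bdist_Lipschitz[of U x y] assms(2) by linarith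
        then show ?thesis by (simp add: f_def)
      qed
      then show "conv \<eta> f x = 1" using conv_error[OF k \<eta>(2,5) bf, of x 1 0] by simp
    qed
    show "\<forall>x. bdist U x \<le> c \<longrightarrow> conv \<eta> f x = 0"
    proof (intro allI impI)
      fix x :: "real^'n" assume "bdist U x \<le> c"
      have "f y = 0" if y: "norm (x - y) \<le> c / 4" for y
      proof -
        have "\<not> 3 / 2 * c \<le> bdist U y"
          using \<open>bdist U x \<le> c\<close> y bdist_Lipschitz[of U x y] assms(2) by linarith
        then show ?thesis by (simp add: f_def)
      qed
      then show "conv \<eta> f x = 0" using conv_error[OF k \<eta>(2,5) bf, of x 0 0] by simp
    qed
  qed
qed

lemma has_derivative_sum_grad:
  assumes "\<And>k. k < n \<Longrightarrow> (f k has_derivative (\<lambda>v. grad (f k) x \<bullet> v)) (at x)"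
  shows "((\<lambda>x. \<Sum>k<n. f k x) has_derivative (\<lambda>v. (\<Sum>k<n. grad (f k) x) \<bullet> v)) (at x)"
  using has_derivative_sum[of "{..<n}" f "\<lambda>k v. grad (f k) x \<bullet> v" "at x"] assms
  by (simp add: inner_sum_left)

text \<open>The Meyers--Serrin argument: \<open>f\<close> is cut into pieces supported in the shells where \<open>bdist\<close> is
  comparable to \<open>2\<^bsup>-k\<^esup>\<close>, and the \<open>k\<close>-th piece is smoothed with error \<open>e 2\<^bsup>-k-1\<^esup>\<close> and a radius so small
  that the sum of the smoothed pieces is still locally finite in \<open>U\<close>.\<close>

theorem periodic_smooth_approximation:
  fixes f :: "real^'n \<Rightarrow> real"
  assumes U: "open U" "\<And>x z. z \<in> lattice_points \<Longrightarrow> x + z \<in> U \<longleftrightarrow> x \<in> U"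
    and f: "C1_on f U" "\<And>x z. x \<in> U \<Longrightarrow> z \<in> lattice_points \<Longrightarrow> f (x + z) = f x" and e: "e > 0"
  obtains g where "smooth_on g U" "periodic g"
    "\<And>x. x \<in> U \<Longrightarrow> \<bar>g x - f x\<bar> \<le> e" "\<And>x. x \<in> U \<Longrightarrow> norm (grad g x - grad f x) \<le> e"
proof -
  define c :: "nat \<Rightarrow> real" where "c k = (1/2) ^ k" for k
  have c: "c k > 0" "c (Suc k) = c k / 2" for k by (auto simp: c_def)
  have cmono: "c l \<le> c k" if "k \<le> l" for k l unfolding c_def using that by (intro power_decreasing) auto
  have "\<forall>k. \<exists>\<xi>::real^'n \<Rightarrow> real. smooth_on \<xi> UNIV \<and> periodic \<xi> \<and>
      (\<forall>x. c k \<le> bdist U x \<longrightarrow> \<xi> x = 1) \<and> (\<forall>x. bdist U x \<le> c (Suc k) \<longrightarrow> \<xi> x = 0)"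
  proof
    fix k
    obtain \<xi> :: "real^'n \<Rightarrow> real" where "smooth_on \<xi> UNIV" "periodic \<xi>"
      "\<forall>x. 2 * c (Suc k) \<le> bdist U x \<longrightarrow> \<xi> x = 1" "\<forall>x. bdist U x \<le> c (Suc k) \<longrightarrow> \<xi> x = 0"
      by (rule smooth_cutoff[OF U(2) c(1)[of "Suc k"]])
    then show "\<exists>\<xi>::real^'n \<Rightarrow> real. smooth_on \<xi> UNIV \<and> periodic \<xi> \<and>
      (\<forall>x. c k \<le> bdist U x \<longrightarrow> \<xi> x = 1) \<and> (\<forall>x. bdist U x \<le> c (Suc k) \<longrightarrow> \<xi> x = 0)"
      using c(2)[of k] by (intro exI[of _ \<xi>]) auto
  qed
  from choice[OF this] obtain X :: "nat \<Rightarrow> real^'n \<Rightarrow> real" where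
    "\<forall>k. smooth_on (X k) UNIV \<and> periodic (X k) \<and>
      (\<forall>x. c k \<le> bdist U x \<longrightarrow> X k x = 1) \<and> (\<forall>x. bdist U x \<le> c (Suc k) \<longrightarrow> X k x = 0)" ..
  then have X: "smooth_on (X k) UNIV" "periodic (X k)" "c k \<le> bdist U x \<Longrightarrow> X k x = 1"
    "bdist U x \<le> c (Suc k) \<Longrightarrow> X k x = 0" for k x by auto
  \<comment> \<open>Differences of consecutive cut-offs: \<open>\<theta> k\<close> lives where
    \<open>bdist\<close> lies between \<open>c (Suc k)\<close> and \<open>c (k - 1)\<close>, and the
    sums telescope to a single cut-off.\<close>
  define \<theta> where "\<theta> k x = (if k = 0 then X 0 x else X k x - X (k - 1) x)" for k x
  have \<theta>sum: "(\<Sum>k<Suc n. \<theta> k x) = X n x" for n x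
    by (induction n) (auto simp: \<theta>_def)
  have \<theta>C1: "C1_on (\<theta> k) UNIV" for k
    unfolding \<theta>_def using smooth_on_C1_on[OF open_UNIV X(1)] by (cases "k = 0") (auto intro: C1_on_diff)
  have \<theta>0: "\<theta> k x = 0" if "bdist U x \<le> c (Suc k)" for k x
    using X(4)[OF that] X(4)[of x "k - 1"] that cmono[of k "Suc k"] unfolding \<theta>_def by (cases k) auto
  have \<theta>1: "\<theta> k x = 0" if "k > 0" "c (k - 1) \<le> bdist U x" for k x
    using X(3)[of "k - 1" x] X(3)[of k x] that cmono[of "k - 1" k] unfolding \<theta>_def by auto
  define F' where "F' k x = (if x \<in> U then \<theta> k x * f x else 0)" for k x
  have F'0: "F' k x = 0" if "bdist U x \<le> c (Suc k) \<or> k > 0 \<and> c (k - 1) \<le> bdist U x" for k x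
    using that \<theta>0 \<theta>1 by (auto simp: F'_def)
  have F'C1U: "C1_on (F' k) U" for k
    by (rule C1_on_cong[OF U(1) C1_on_mult[OF C1_on_subset[OF \<theta>C1[of k]] f(1)]]) (auto simp: F'_def)
  have F'C1: "C1_on (F' k) UNIV" for k
  proof (rule C1_on_Un_zero(1)[OF U(1) _ _ F'C1U])
    show "closed {x. c (Suc k) \<le> bdist U x}" by (intro closed_Collect_le continuous_on_bdist continuous_intros)
    show "{x. c (Suc k) \<le> bdist U x} \<subseteq> U"
      using bdist_pos[OF U(1)] c(1)[of "Suc k"] by (auto intro: less_le_trans)
    show "F' k x = 0" if "x \<notin> {x. c (Suc k) \<le> bdist U x}" for x using F'0[of x k] that by auto
  qed
  have \<theta>per: "periodic (\<theta> k)" for k using X(2) by (auto simp: periodic_def \<theta>_def)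
  have F'per: "periodic (F' k)" for k
    unfolding periodic_def F'_def using U(2) f(2) \<theta>per[of k] by (auto simp: periodic_def)
  have "\<forall>k. \<exists>g. smooth_on g UNIV \<and> periodic g \<and> (\<forall>x. \<bar>g x - F' k x\<bar> \<le> e * c (Suc k)) \<and>
      (\<forall>x. norm (grad g x - grad (F' k) x) \<le> e * c (Suc k)) \<and>
      (\<forall>x. (\<forall>y. norm (x - y) \<le> c (Suc k) \<longrightarrow> F' k y = 0) \<longrightarrow> g x = 0)"
  proof
    fix k
    have ek: "e * c (Suc k) > 0" using e c(1) by simp
    obtain g r where g: "smooth_on g UNIV" "periodic g" "0 < r" "r \<le> c (Suc k)" "\<And>x. \<bar>g x - F' k x\<bar> \<le> e * c (Suc k)"
      "\<And>x. norm (grad g x - grad (F' k) x) \<le> e * c (Suc k)"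
      "\<And>x. (\<forall>y. norm (x - y) \<le> r \<longrightarrow> F' k y = 0) \<Longrightarrow> g x = 0"
      by (rule smooth_approximation[OF F'C1 F'per ek c(1)]) blast
    have "g x = 0" if "\<forall>y. norm (x - y) \<le> c (Suc k) \<longrightarrow> F' k y = 0" for x
      using g(7)[of x] that g(4) by (meson order_trans)
    then show "\<exists>g. smooth_on g UNIV \<and> periodic g \<and> (\<forall>x. \<bar>g x - F' k x\<bar> \<le> e * c (Suc k)) \<and>
      (\<forall>x. norm (grad g x - grad (F' k) x) \<le> e * c (Suc k)) \<and>
      (\<forall>x. (\<forall>y. norm (x - y) \<le> c (Suc k) \<longrightarrow> F' k y = 0) \<longrightarrow> g x = 0)"
      using g by (intro exI[of _ g]) simp
  qed
  from choice[OF this] obtain G where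
    "\<forall>k. smooth_on (G k) UNIV \<and> periodic (G k) \<and> (\<forall>x. \<bar>G k x - F' k x\<bar> \<le> e * c (Suc k)) \<and>
      (\<forall>x. norm (grad (G k) x - grad (F' k) x) \<le> e * c (Suc k)) \<and>
      (\<forall>x. (\<forall>y. norm (x - y) \<le> c (Suc k) \<longrightarrow> F' k y = 0) \<longrightarrow> G k x = 0)" ..
  then have G: "smooth_on (G k) UNIV" "periodic (G k)" "\<bar>G k x - F' k x\<bar> \<le> e * c (Suc k)"
      "norm (grad (G k) x - grad (F' k) x) \<le> e * c (Suc k)"
      "(\<And>y. norm (x - y) \<le> c (Suc k) \<Longrightarrow> F' k y = 0) \<Longrightarrow> G k x = 0" for k x by auto
  define g where "g x = (\<Sum>k. G k x)" for x
  define O' where "O' n = {x. c n < bdist U x}" for n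
  have O'open: "open (O' n)" for n
    unfolding O'_def by (intro open_Collect_less continuous_on_bdist continuous_intros)
  have O'sub: "O' n \<subseteq> U" for n
    using bdist_pos[OF U(1)] c(1)[of n] unfolding O'_def by (auto intro: less_trans)
  have O'ex: "\<exists>n. x \<in> O' n" if "x \<in> U" for x
    using real_arch_pow_inv[of "bdist U x" "1/2"] bdist_pos[OF U(1)] that unfolding O'_def c_def by auto
  \<comment> \<open>On \<open>O' n\<close> only the first n + 2 pieces survive: for larger indices
    the smoothing radius is at most half of \<open>c n\<close>, so all points within that radius
    still have \<open>bdist\<close> at least \<open>c (k - 1)\<close>, where the k-th piece
    vanishes.\<close>
  have G0: "G k x = 0" if "x \<in> O' n" "n + 2 \<le> k" for k n x
  proof (rule G(5))
    fix y assume y: "norm (x - y) \<le> c (Suc k)"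
    have "c (k - 1) \<le> c (Suc n)" "c (Suc k) \<le> c (Suc n)" using that(2) by (auto intro: cmono)
    then have "c (k - 1) \<le> bdist U y"
      using y that(1) bdist_Lipschitz[of U x y] c(2)[of n] unfolding O'_def by auto
    then show "F' k y = 0" using F'0[of y k] that(2) by auto
  qed
  have gsum: "g x = (\<Sum>k<n + 2. G k x)" if "x \<in> O' n" for n x
    unfolding g_def using G0[OF that] by (intro suminf_finite) auto
  have fsum: "f x = (\<Sum>k<n + 2. F' k x)" if "x \<in> O' n" for n x
  proof -
    have "x \<in> U" using that O'sub by blast
    then have "(\<Sum>k<n + 2. F' k x) = (\<Sum>k<Suc (n + 1). \<theta> k x) * f x"
      unfolding F'_def sum_distrib_right by simp
    also have "\<dots> = X (n + 1) x * f x" by (simp only: \<theta>sum)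
    also have "X (n + 1) x = 1" using that cmono[of n "n + 1"] unfolding O'_def by (intro X(3)) auto
    finally show ?thesis by simp
  qed
  \<comment> \<open>The geometric series of the weights \<open>c (Suc k)\<close> has partial sums 1
    - c n, so the total error stays below e.\<close>
  have csum: "(\<Sum>k<n. e * c (Suc k)) \<le> e" for n
  proof -
    have "(\<Sum>k<n. c (Suc k)) = 1 - c n" by (induction n) (auto simp: c_def)
    then show ?thesis using e c(1)[of n] by (simp flip: sum_distrib_left)
  qed
  have GC1: "C1_on (G k) UNIV" for k by (rule smooth_on_C1_on[OF open_UNIV G(1)])
  show thesis
  proof
    show "smooth_on g U"
      unfolding smooth_on_def
    proof (intro allI Ck_on_local[OF U(1)])
      fix k x assume "x \<in> U"
      then obtain n where n: "x \<in> O' n" using O'ex by blast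
      have "Ck_on k (\<lambda>x. \<Sum>k<n + 2. G k x) (O' n)"
        using G(1) unfolding smooth_on_def by (intro Ck_on_sum) (blast intro: Ck_on_subset)
      then have "Ck_on k g (O' n)" by (rule Ck_on_cong[OF O'open]) (simp only: gsum)
      then show "\<exists>T. open T \<and> x \<in> T \<and> Ck_on k g T" using n O'open by blast
    qed
    show "periodic g" using G(2) unfolding periodic_def g_def by simp
    fix x assume "x \<in> U"
    then obtain n where n: "x \<in> O' n" using O'ex by blast
    have "\<bar>g x - f x\<bar> = \<bar>\<Sum>k<n + 2. G k x - F' k x\<bar>" by (simp only: gsum[OF n] fsum[OF n] sum_subtractf)
    also have "\<dots> \<le> (\<Sum>k<n + 2. e * c (Suc k))" by (intro order_trans[OF sum_abs] sum_mono G(3))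
    finally show "\<bar>g x - f x\<bar> \<le> e" using csum[of "n + 2"] by linarith
    have "grad g x = grad (\<lambda>x. \<Sum>k<n + 2. G k x) x" by (rule grad_cong[OF O'open n]) (rule gsum)
    also have "\<dots> = (\<Sum>k<n + 2. grad (G k) x)"
      by (intro grad_eqI has_derivative_sum_grad C1_on_deriv[OF GC1]) simp
    finally have gg: "grad g x = (\<Sum>k<n + 2. grad (G k) x)" .
    have "grad f x = grad (\<lambda>x. \<Sum>k<n + 2. F' k x) x" by (rule grad_cong[OF O'open n]) (rule fsum)
    also have "\<dots> = (\<Sum>k<n + 2. grad (F' k) x)"
      by (intro grad_eqI has_derivative_sum_grad C1_on_deriv[OF F'C1]) simp
    finally have gf: "grad f x = (\<Sum>k<n + 2. grad (F' k) x)" .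
    have "norm (grad g x - grad f x) = norm (\<Sum>k<n + 2. grad (G k) x - grad (F' k) x)"
      by (simp only: gg gf sum_subtractf)
    also have "\<dots> \<le> (\<Sum>k<n + 2. e * c (Suc k))" by (intro order_trans[OF norm_sum] sum_mono G(4))
    finally show "norm (grad g x - grad f x) \<le> e" using csum[of "n + 2"] by linarith
  qed
qed

section \<open>Agreement of the \<open>C^1\<close> closure with the smooth closure\<close>

context perforated_cell
begin

lemma L2v_bounded:
  fixes f :: "real^'n \<Rightarrow> 'b::euclidean_space"
  assumes "f \<in> borel_measurable M" "\<And>x. x \<in> P \<Longrightarrow> norm (f x) \<le> e" "0 \<le> e"
  shows "f \<in> L2v M" "L2n M f \<le> e * L2n M (\<lambda>x. 1::real)"
proof -
  have "AE x in M. norm (f x) \<le> e * norm (1::real)" using assms(2) by (intro AE_I2) simp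
  from L2v_dominated[OF const_L2v[of "1::real"] assms(1) this assms(3)]
  show "f \<in> L2v M" "L2n M f \<le> e * L2n M (\<lambda>x. 1::real)" by simp_all
qed

lemma continuous_on_measurable: "continuous_on P f \<Longrightarrow> f \<in> borel_measurable M"
  for f :: "real^'n \<Rightarrow> 'b::euclidean_space"
  using continuous_imp_measurable_on_sets_lebesgue[of P f] open_P by simp

text \<open>The \<open>C^1\<close> approximants are replaced by smooth ones. Meyers--Serrin
  smoothing gives a uniform error on the whole periodic extension, which is a small error in the
  square norm because \<open>P\<close> has finite measure.\<close>

lemma H1_per_sobolev_per:
  assumes H: "H1_per u v"
  shows "u \<in> sobolev_per 1 P"
proof -
  have L: "u \<in> L2v M" "v \<in> L2v M" using H by (auto simp: H1_per_def)
  have wg: "is_weak_grad P u v" by (rule H1_per_is_weak_grad[OF H])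
  have us: "u \<in> sobolev 1 P" unfolding sobolev_1_iff[OF open_P] using L wg by blast
  have "\<exists>\<phi>\<in>smooth_periodic P \<inter> sobolev 1 P. sobolev_norm 1 P (\<lambda>x. u x - \<phi> x) < e" if e: "e > 0" for e
  proof -
    define I where "I = L2n M (\<lambda>x. 1::real)"
    have I: "I \<ge> 0" by (simp add: I_def)
    \<comment> \<open>\<open>I\<close> is the square root of the measure of \<open>P\<close>, so
      that a uniform error \<open>d\<close> costs at most e/4 in the square norm.\<close>
    define d where "d = (e / 4) / (1 + I)"
    have d: "d > 0" "d * I \<le> e / 4"
    proof -
      show "d > 0" unfolding d_def using e I by (intro divide_pos_pos) auto
      have "d * (1 + I) = e / 4" using nonzero_eq_divide_eq[of "1 + I" d "e / 4"] d_def I by linarith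
      then show "d * I \<le> e / 4" using \<open>d > 0\<close> by (simp add: distrib_left)
    qed
    have e4: "e / 4 > 0" using e by simp
    obtain \<phi> where \<phi>: "C1_per \<phi>" "L2n M (\<lambda>x. \<phi> x - u x) < e / 4" "L2n M (\<lambda>x. grad \<phi> x - v x) < e / 4"
      using H e4 unfolding H1_per_def by blast
    obtain g where g: "smooth_on g (periodic_extension P)" "periodic g"
      "\<And>x. x \<in> periodic_extension P \<Longrightarrow> \<bar>g x - \<phi> x\<bar> \<le> d"
      "\<And>x. x \<in> periodic_extension P \<Longrightarrow> norm (grad g x - grad \<phi> x) \<le> d"
      by (rule periodic_smooth_approximation[OF open_extension extension_translate _ _ d(1), of \<phi>])
        (use \<phi>(1) in \<open>auto simp: C1_per_def\<close>)
    have gC1: "C1_on g P" by (rule C1_on_subset[OF smooth_on_C1_on[OF open_extension g(1)] P_subset_extension])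
    have \<phi>C1: "C1_on \<phi> P" by (rule C1_per_C1_on[OF \<phi>(1)])
    have c1: "continuous_on P (\<lambda>x. g x - \<phi> x)" "continuous_on P (\<lambda>x. grad g x - grad \<phi> x)"
      using gC1 \<phi>C1 C1_on_continuous by (auto simp: C1_on_def intro!: continuous_intros)
    have e1: "(\<lambda>x. g x - \<phi> x) \<in> L2v M" "L2n M (\<lambda>x. g x - \<phi> x) \<le> d * I"
      unfolding I_def using g(3) P_subset_extension
      by (auto intro!: L2v_bounded[OF continuous_on_measurable[OF c1(1)] _ less_imp_le[OF d(1)]])
    have e2: "(\<lambda>x. grad g x - grad \<phi> x) \<in> L2v M" "L2n M (\<lambda>x. grad g x - grad \<phi> x) \<le> d * I"
      unfolding I_def using g(4) P_subset_extension
      by (auto intro!: L2v_bounded[OF continuous_on_measurable[OF c1(2)] _ less_imp_le[OF d(1)]])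
    have \<phi>L: "\<phi> \<in> L2v M" "grad \<phi> \<in> L2v M" using \<phi>(1) by (auto simp: C1_per_def)
    have gL: "g \<in> L2v M" "grad g \<in> L2v M"
      using L2v_add[OF e1(1) \<phi>L(1)] L2v_add[OF e2(1) \<phi>L(2)] by simp_all
    have gw: "is_weak_grad P g (grad g)" by (rule is_weak_grad_classical[OF open_P gC1])
    have gs: "g \<in> sobolev 1 P" unfolding sobolev_1_iff[OF open_P] using gL gw by blast
    have "L2n M (\<lambda>x. u x - g x) \<le> L2n M (\<lambda>x. u x - \<phi> x) + L2n M (\<lambda>x. \<phi> x - g x)"
      "L2n M (\<lambda>x. v x - grad g x) \<le> L2n M (\<lambda>x. v x - grad \<phi> x) + L2n M (\<lambda>x. grad \<phi> x - grad g x)"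
      by (intro L2n_triangle L \<phi>L gL)+
    then have le: "L2n M (\<lambda>x. u x - g x) < e / 2" "L2n M (\<lambda>x. v x - grad g x) < e / 2"
      using \<phi>(2,3) e1(2) e2(2) d(2) L2n_minus_commute[of M u \<phi>] L2n_minus_commute[of M \<phi> g]
        L2n_minus_commute[of M v "grad \<phi>"] L2n_minus_commute[of M "grad \<phi>" "grad g"] by linarith+
    have "(sobolev_norm 1 P (\<lambda>x. u x - g x))\<^sup>2 = (L2n M (\<lambda>x. u x - g x))\<^sup>2 + (L2n M (\<lambda>x. v x - grad g x))\<^sup>2"
      by (intro sobolev_norm_1 open_P L2v_diff L gL is_weak_grad_diff wg gw)
    also have "\<dots> < (e / 2)\<^sup>2 + (e / 2)\<^sup>2"
      by (intro add_strict_mono power_strict_mono le L2n_nonneg) auto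
    also have "\<dots> \<le> e\<^sup>2" by (simp add: power2_eq_square)
    finally have "sobolev_norm 1 P (\<lambda>x. u x - g x) < e" by (rule power2_less_imp_less) (use e in simp)
    moreover have "g \<in> smooth_periodic P" using g(1,2) by (simp add: smooth_periodic_def periodic_def)
    ultimately show ?thesis using gs by blast
  qed
  then show ?thesis using us by (simp add: sobolev_per_def)
qed

end

section \<open>Change of variables\<close>

text \<open>The library proves the change of variables formula for \<open>real^'m\<close> with a well-ordered index type;
  reindexing by a bijection carries it over to an unordered index type of two or three elements.\<close>

definition reindex :: "('m \<Rightarrow> 'n) \<Rightarrow> real^'n \<Rightarrow> real^'m" where
  "reindex f x = (\<chi> i. x $ f i)"

lemma reindex_nth [simp]: "reindex f x $ i = x $ f i"
  by (simp add: reindex_def)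

lemma linear_reindex: "linear (reindex f)"
  by (rule linearI) (simp_all add: vec_eq_iff)

lemma bounded_linear_reindex: "bounded_linear (reindex f)"
  using linear_reindex linear_conv_bounded_linear by blast

lemma reindex_inv:
  assumes "bij f" shows "reindex f (reindex (inv f) x) = x" "reindex (inv f) (reindex f y) = y"
  using assms by (simp_all add: vec_eq_iff bij_is_inj bij_is_surj surj_f_inv_f)

lemma prod_Basis_cart: "(\<Prod>b\<in>Basis. x \<bullet> b) = (\<Prod>i\<in>UNIV. x $ i)" for x :: "real^'n"
proof -
  have e: "(Basis :: (real^'n) set) = (\<lambda>i. axis i 1) ` UNIV" by (auto simp: Basis_vec_def)
  have "inj (\<lambda>i::'n. axis i (1::real))" by (auto simp: inj_on_def axis_eq_axis)
  then show ?thesis unfolding e by (simp add: prod.reindex inner_axis)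
qed

text \<open>Preimages of boxes are boxes whose side lengths are the same up to order, so the volumes
  agree.\<close>

lemma distr_lborel_reindex:
  fixes f :: "'m::finite \<Rightarrow> 'n::finite"
  assumes "bij f"
  shows "distr lborel borel (reindex f) = lborel"
proof (rule lborel_eqI[symmetric])
  have m[measurable]: "reindex f \<in> borel \<rightarrow>\<^sub>M borel"
    using bounded_linear_reindex by (intro borel_measurable_continuous_onI linear_continuous_on)
  fix l u :: "real^'m" assume "\<And>b. b \<in> Basis \<Longrightarrow> l \<bullet> b \<le> u \<bullet> b"
  then have lu: "l $ i \<le> u $ i" for i
    using cart_eq_inner_axis[of l i] cart_eq_inner_axis[of u i] by (metis axis_in_Basis_iff Basis_real_def insertI1)
  define l' u' where "l' = reindex (inv f) l" and "u' = reindex (inv f) u"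
  have v: "reindex f -` box l u = box l' u'"
  proof -
    have "(\<forall>i. l $ i < x $ f i \<and> x $ f i < u $ i) \<longleftrightarrow> (\<forall>j. l $ inv f j < x $ j \<and> x $ j < u $ inv f j)" for x :: "real^'n"
      using assms by (metis bij_inv_eq_iff)
    then show ?thesis by (auto simp: mem_box_cart l'_def u'_def)
  qed
  have "emeasure (distr lborel borel (reindex f)) (box l u) = emeasure lborel (box l' u')"
    by (subst emeasure_distr) (auto simp: v)
  also have "\<dots> = (\<Prod>b\<in>Basis. (u' - l') \<bullet> b)"
    by (intro emeasure_lborel_box) (auto simp: l'_def u'_def Basis_vec_def inner_axis lu)
  also have "(\<Prod>b\<in>Basis. (u' - l') \<bullet> b) = (\<Prod>j\<in>UNIV. (u - l) $ inv f j)"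
    by (simp add: prod_Basis_cart l'_def u'_def)
  also have "\<dots> = (\<Prod>i\<in>UNIV. (u - l) $ i)"
    by (rule prod.reindex_bij_betw[OF bij_imp_bij_inv[OF assms]])
  finally show "emeasure (distr lborel borel (reindex f)) (box l u) = (\<Prod>b\<in>Basis. (u - l) \<bullet> b)"
    by (simp add: prod_Basis_cart)
qed simp

lemma reindex_lebesgue:
  fixes f :: "'m::finite \<Rightarrow> 'n::finite"
  assumes "bij f"
  shows "reindex f \<in> lebesgue \<rightarrow>\<^sub>M lebesgue" "distr lebesgue lebesgue (reindex f) = lebesgue"
proof -
  have m: "reindex f \<in> borel \<rightarrow>\<^sub>M borel"
    using bounded_linear_reindex by (intro borel_measurable_continuous_onI linear_continuous_on)
  then have m': "reindex f \<in> lebesgue \<rightarrow>\<^sub>M lborel" by (intro measurable_completion) simp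
  have d: "distr lebesgue lborel (reindex f) = lborel"
    using distr_completion[of "reindex f" lborel lborel] m distr_lborel_reindex[OF assms]
    by (simp cong: distr_cong)
  show "reindex f \<in> lebesgue \<rightarrow>\<^sub>M lebesgue"
    by (rule completion.measurable_completion2[OF m']) (simp add: d)
  show "distr lebesgue lebesgue (reindex f) = lebesgue"
    using completion.completion_distr_eq[OF m'] d by simp
qed

lemma reindex_integral:
  fixes f :: "'m::finite \<Rightarrow> 'n::finite" and q :: "real^'m \<Rightarrow> real"
  assumes "bij f"
  shows "integrable lebesgue (\<lambda>x. q (reindex f x)) \<longleftrightarrow> integrable lebesgue q"
    "(LINT x|lebesgue. q (reindex f x)) = (LINT y|lebesgue. q y)"
proof -
  have *: "q \<in> borel_measurable lebesgue" if "(\<lambda>x. q (reindex f x)) \<in> borel_measurable lebesgue"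
    using measurable_compose[OF reindex_lebesgue(1)[OF bij_imp_bij_inv[OF assms]] that]
    by (simp add: reindex_inv[OF assms])
  have **: "integrable lebesgue (\<lambda>x. q (reindex f x)) \<longleftrightarrow> integrable lebesgue q" if "q \<in> borel_measurable lebesgue"
    using integrable_distr_eq[OF reindex_lebesgue(1)[OF assms] that] by (simp add: reindex_lebesgue(2)[OF assms])
  show i: "integrable lebesgue (\<lambda>x. q (reindex f x)) \<longleftrightarrow> integrable lebesgue q"
    using * ** borel_measurable_integrable by blast
  show "(LINT x|lebesgue. q (reindex f x)) = (LINT y|lebesgue. q y)"
  proof (cases "integrable lebesgue q")
    case True
    then show ?thesis
      using integral_distr[OF reindex_lebesgue(1)[OF assms], of q] by (simp add: reindex_lebesgue(2)[OF assms])
  next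
    case False
    then show ?thesis using i by (simp add: not_integrable_integral_eq)
  qed
qed

text \<open>Relabelling turns a transposition into a transposition, so the induction over products
  of transpositions preserves the sign.\<close>

lemma sign_conjugate:
  fixes f :: "'m::finite \<Rightarrow> 'n::finite"
  assumes f: "bij f" and "p permutes UNIV"
  shows "sign (f \<circ> p \<circ> inv f) = sign p \<and> permutation (f \<circ> p \<circ> inv f)"
  using assms(2) finite_class.finite_UNIV
proof (induction p rule: permutes_induct)
  case id
  have "f \<circ> id \<circ> inv f = id" using f by (auto simp: fun_eq_iff bij_is_surj surj_f_inv_f)
  then show ?case by (simp add: permutation_id)
next
  case (swap a b p)
  have e: "f \<circ> (Transposition.transpose a b \<circ> p) \<circ> inv f = Transposition.transpose (f a) (f b) \<circ> (f \<circ> p \<circ> inv f)"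
    using f by (auto simp: fun_eq_iff Transposition.transpose_def inj_eq[OF bij_is_inj[OF f]])
  have "f a \<noteq> f b" using \<open>a \<noteq> b\<close> f by (simp add: bij_is_inj inj_eq)
  moreover have p: "permutation p" unfolding permutation_permutes using \<open>p permutes UNIV\<close> by (intro exI[of _ UNIV]) simp
  moreover from swap have IH: "sign (f \<circ> p \<circ> inv f) = sign p" "permutation (f \<circ> p \<circ> inv f)" by (auto simp: o_def)
  ultimately have "sign (Transposition.transpose (f a) (f b) \<circ> (f \<circ> p \<circ> inv f)) = sign (Transposition.transpose a b \<circ> p)"
    unfolding sign_compose[OF permutation_swap_id IH(2)] sign_compose[OF permutation_swap_id p]
    using \<open>a \<noteq> b\<close> by (simp add: sign_swap_id IH(1))
  then show ?case unfolding e using permutation_compose[OF permutation_swap_id IH(2)] by blast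
qed

text \<open>Conjugation by \<open>f\<close> is a sign preserving bijection between the permutations
  of the two index types; it matches the terms of the two determinants.\<close>

lemma det_reindex:
  fixes f :: "'m::finite \<Rightarrow> 'n::finite" and A :: "real^'n^'n"
  assumes f: "bij f"
  shows "det (\<chi> i j. A $ f i $ f j) = det A"
proof -
  have bij: "bij_betw (\<lambda>p. f \<circ> p \<circ> inv f) {p. p permutes UNIV} {p. p permutes UNIV}"
  proof (rule bij_betwI[where g="\<lambda>p. inv f \<circ> p \<circ> f"])
    show "(\<lambda>p. f \<circ> p \<circ> inv f) \<in> {p. p permutes UNIV} \<rightarrow> {p. p permutes UNIV}"
      "(\<lambda>p. inv f \<circ> p \<circ> f) \<in> {p. p permutes UNIV} \<rightarrow> {p. p permutes UNIV}"
      using f bij_imp_bij_inv[OF f] by (auto intro!: bij_imp_permutes bij_comp intro: permutes_bij)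
  qed (use f in \<open>auto simp: fun_eq_iff bij_is_surj surj_f_inv_f bij_is_inj\<close>)
  have "det A = (\<Sum>p | p permutes UNIV. of_int (sign (f \<circ> p \<circ> inv f)) * (\<Prod>i\<in>UNIV. A $ i $ (f \<circ> p \<circ> inv f) i))"
    unfolding det_def by (rule sum.reindex_bij_betw[OF bij, symmetric])
  also have "\<dots> = (\<Sum>p | p permutes UNIV. of_int (sign p) * (\<Prod>i\<in>UNIV. A $ f i $ f (p i)))"
  proof (intro sum.cong refl arg_cong2[of _ _ _ _ "(*)"])
    fix p :: "'m \<Rightarrow> 'm" assume "p \<in> {p. p permutes UNIV}"
    then show "of_int (sign (f \<circ> p \<circ> inv f)) = (of_int (sign p) :: real)" using sign_conjugate[OF f] by simp
    have "(\<Prod>i\<in>UNIV. A $ f i $ (f \<circ> p \<circ> inv f) (f i)) = (\<Prod>i\<in>UNIV. A $ i $ (f \<circ> p \<circ> inv f) i)"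
      by (rule prod.reindex_bij_betw[OF f])
    then show "(\<Prod>i\<in>UNIV. A $ i $ (f \<circ> p \<circ> inv f) i) = (\<Prod>i\<in>UNIV. A $ f i $ f (p i))"
      using f by (simp add: bij_is_inj)
  qed
  finally show ?thesis unfolding det_def by simp
qed

text \<open>The general theorem speaks of vector valued integrands and absolute integrability on a
  set; the real integrand enters it through \<open>real^1\<close>, and the result is translated to
  integrals over \<open>lebesgue_on\<close>.\<close>

lemma change_of_variables_wellorder:
  fixes g :: "real^'m::{finite,wellorder} \<Rightarrow> real^'m::{finite,wellorder}" and q :: "real^'m::{finite,wellorder} \<Rightarrow> real"
  assumes S: "open S" "open (g ` S)" and der: "\<And>x. x \<in> S \<Longrightarrow> (g has_derivative g' x) (at x)" and inj: "inj_on g S"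
  shows "integrable (lebesgue_on S) (\<lambda>x. \<bar>det (matrix (g' x))\<bar> * q (g x)) \<longleftrightarrow> integrable (lebesgue_on (g ` S)) q"
    "(LINT x|lebesgue_on S. \<bar>det (matrix (g' x))\<bar> * q (g x)) = (LINT y|lebesgue_on (g ` S). q y)"
proof -
  let ?D = "\<lambda>x. \<bar>det (matrix (g' x))\<bar> * q (g x)"
  have m: "S \<in> sets lebesgue" "g ` S \<in> sets lebesgue" using S by auto
  have int: "f absolutely_integrable_on T \<longleftrightarrow> integrable (lebesgue_on T) f"
    if "T \<in> sets lebesgue" for T and f :: "real^'m::{finite,wellorder} \<Rightarrow> real"
    using that by (simp add: set_integrable_def integrable_restrict_space)
  have cv: "(\<lambda>x. \<bar>det (matrix (g' x))\<bar> *\<^sub>R (vec (q (g x)) :: real^1)) absolutely_integrable_on S \<and>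
      integral S (\<lambda>x. \<bar>det (matrix (g' x))\<bar> *\<^sub>R (vec (q (g x)) :: real^1)) = b \<longleftrightarrow>
      (\<lambda>y. vec (q y) :: real^1) absolutely_integrable_on (g ` S) \<and> integral (g ` S) (\<lambda>y. vec (q y) :: real^1) = b" for b
    by (rule has_absolute_integral_change_of_variables[OF m(1) has_derivative_at_withinI[OF der] inj])
  have cv': "integrable (lebesgue_on S) ?D \<and> integral S ?D = b \<longleftrightarrow>
      integrable (lebesgue_on (g ` S)) q \<and> integral (g ` S) q = b" for b
    using cv[of "vec b"] m by (simp add: absolutely_integrable_on_1_iff integral_on_1_eq int vec_eq_iff)
  then show i: "integrable (lebesgue_on S) ?D \<longleftrightarrow> integrable (lebesgue_on (g ` S)) q" by blast
  show "(LINT x|lebesgue_on S. ?D x) = (LINT y|lebesgue_on (g ` S). q y)"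
  proof (cases "integrable (lebesgue_on (g ` S)) q")
    case True
    then show ?thesis using cv' i m by (simp add: lebesgue_integral_eq_integral)
  next
    case False
    then show ?thesis using i by (simp add: not_integrable_integral_eq)
  qed
qed

text \<open>Both integrals are moved to the well-ordered index type by the measure preserving map
  \<open>T\<close>; conjugating \<open>g\<close> with \<open>T\<close> leaves the Jacobian
  determinant unchanged.\<close>

lemma change_of_variables_reindex:
  fixes f :: "'m::{finite,wellorder} \<Rightarrow> 'n::finite" and g :: "real^'n \<Rightarrow> real^'n" and q :: "real^'n \<Rightarrow> real"
  assumes f: "bij f" and S: "open S" "open (g ` S)"
    and der: "\<And>x. x \<in> S \<Longrightarrow> (g has_derivative g' x) (at x)" and inj: "inj_on g S"
  shows "integrable (lebesgue_on S) (\<lambda>x. \<bar>det (matrix (g' x))\<bar> * q (g x)) \<longleftrightarrow> integrable (lebesgue_on (g ` S)) q"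
    "(LINT x|lebesgue_on S. \<bar>det (matrix (g' x))\<bar> * q (g x)) = (LINT y|lebesgue_on (g ` S). q y)"
proof -
  define T :: "real^'n \<Rightarrow> real^'m::{finite,wellorder}" where "T = reindex f"
  define T' :: "real^'m::{finite,wellorder} \<Rightarrow> real^'n" where "T' = reindex (inv f)"
  have TT': "T (T' x) = x" "T' (T y) = y" for x y unfolding T_def T'_def by (rule reindex_inv[OF f])+
  have bl: "bounded_linear T" "bounded_linear T'" unfolding T_def T'_def by (rule bounded_linear_reindex)+
  have img: "T ` X = T' -` X" for X using TT' by (auto simp: image_iff) metis+
  have opn: "open (T ` X)" if "open X" for X
    unfolding img using bl(2) that by (intro open_vimage linear_continuous_on)
  have tr: "integrable (lebesgue_on X) p \<longleftrightarrow> integrable (lebesgue_on (T ` X)) (\<lambda>y. p (T' y))"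
    "(LINT x|lebesgue_on X. p x) = (LINT y|lebesgue_on (T ` X). p (T' y))" if X: "open X" for X and p :: "real^'n \<Rightarrow> real"
  proof -
    have s: "X \<inter> space lebesgue \<in> sets lebesgue" "T ` X \<inter> space lebesgue \<in> sets lebesgue" using X opn by auto
    have e: "indicator (T ` X) (T x) *\<^sub>R p (T' (T x)) = indicator X x *\<^sub>R p x" for x
      by (simp add: TT' img indicator_def)
    show "integrable (lebesgue_on X) p \<longleftrightarrow> integrable (lebesgue_on (T ` X)) (\<lambda>y. p (T' y))"
      "(LINT x|lebesgue_on X. p x) = (LINT y|lebesgue_on (T ` X). p (T' y))"
      unfolding integrable_restrict_space[OF s(1)] integrable_restrict_space[OF s(2)]
        integral_restrict_space[OF s(1)] integral_restrict_space[OF s(2)]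
      using reindex_integral[OF f, of "\<lambda>y. indicator (T ` X) y *\<^sub>R p (T' y)"]
      unfolding T_def[symmetric] e by simp_all
  qed
  define G where "G = T \<circ> g \<circ> T'"
  define G' where "G' y = T \<circ> g' (T' y) \<circ> T'" for y
  have GT: "G ` (T ` S) = T ` (g ` S)" unfolding G_def image_image by (simp add: TT' image_image)
  have dG: "(G has_derivative G' y) (at y)" if "y \<in> T ` S" for y
  proof -
    have y: "T' y \<in> S" using that TT' by auto
    have "(g \<circ> T' has_derivative g' (T' y) \<circ> T') (at y)"
      by (rule diff_chain_at[OF bounded_linear_imp_has_derivative[OF bl(2)] der[OF y]])
    then show ?thesis unfolding G_def G'_def comp_assoc
      by (rule diff_chain_at[OF _ bounded_linear_imp_has_derivative[OF bl(1)]])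
  qed
  have injG: "inj_on G (T ` S)"
    unfolding G_def using inj TT' by (auto simp: inj_on_def) metis
  have detG: "det (matrix (G' (T x))) = det (matrix (g' x))" if "x \<in> S" for x
  proof -
    have "matrix (G' (T x)) = (\<chi> i j. matrix (g' x) $ f i $ f j)"
    proof -
      have "T' (axis j 1) = axis (f j) 1" for j
        unfolding T'_def using f by (auto simp: vec_eq_iff axis_def bij_is_inj bij_inv_eq_iff)
      then show ?thesis unfolding G'_def matrix_def TT' by (simp add: T_def)
    qed
    then show ?thesis by (simp add: det_reindex[OF f])
  qed
  have oG: "open (G ` (T ` S))" unfolding GT by (rule opn[OF S(2)])
  note cv = change_of_variables_wellorder[OF opn[OF S(1)] oG dG injG, of "\<lambda>y. q (T' y)"]
  have eq: "\<bar>det (matrix (G' y))\<bar> * q (T' (G y)) = \<bar>det (matrix (g' (T' y)))\<bar> * q (g (T' y))" if "y \<in> T ` S" for y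
    using that detG by (auto simp: G_def TT')
  have s: "space (lebesgue_on (T ` S)) = T ` S" by (simp add: space_restrict_space)
  have "integrable (lebesgue_on (T ` S)) (\<lambda>y. \<bar>det (matrix (g' (T' y)))\<bar> * q (g (T' y))) \<longleftrightarrow>
      integrable (lebesgue_on (T ` S)) (\<lambda>y. \<bar>det (matrix (G' y))\<bar> * q (T' (G y)))"
    by (rule Bochner_Integration.integrable_cong[OF refl]) (simp add: s eq)
  then show "integrable (lebesgue_on S) (\<lambda>x. \<bar>det (matrix (g' x))\<bar> * q (g x)) \<longleftrightarrow> integrable (lebesgue_on (g ` S)) q"
    unfolding tr(1)[OF S(1)] tr(1)[OF S(2)] using cv(1)[unfolded GT] by (simp only:)
  have "(LINT y|lebesgue_on (T ` S). \<bar>det (matrix (g' (T' y)))\<bar> * q (g (T' y))) =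
      (LINT y|lebesgue_on (T ` S). \<bar>det (matrix (G' y))\<bar> * q (T' (G y)))"
    by (rule Bochner_Integration.integral_cong[OF refl]) (simp add: s eq)
  then show "(LINT x|lebesgue_on S. \<bar>det (matrix (g' x))\<bar> * q (g x)) = (LINT y|lebesgue_on (g ` S). q y)"
    unfolding tr(2)[OF S(1)] tr(2)[OF S(2)] using cv(2)[unfolded GT] by (simp only:)
qed

theorem change_of_variables:
  fixes g :: "real^'n \<Rightarrow> real^'n" and q :: "real^'n \<Rightarrow> real"
  assumes dim: "CARD('n) \<in> {2, 3}" and S: "open S" "open (g ` S)"
    and der: "\<And>x. x \<in> S \<Longrightarrow> (g has_derivative g' x) (at x)" and inj: "inj_on g S"
  shows "integrable (lebesgue_on S) (\<lambda>x. \<bar>det (matrix (g' x))\<bar> * q (g x)) \<longleftrightarrow> integrable (lebesgue_on (g ` S)) q"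
    "(LINT x|lebesgue_on S. \<bar>det (matrix (g' x))\<bar> * q (g x)) = (LINT y|lebesgue_on (g ` S). q y)"
proof -
  \<comment> \<open>The numeral types \<open>2\<close> and \<open>3\<close> are well-ordered, and in
    the given dimensions one of them is equinumerous with the index type.\<close>
  have "(\<exists>f :: 2 \<Rightarrow> 'n. bij f) \<or> (\<exists>f :: 3 \<Rightarrow> 'n. bij f)"
  proof (cases "CARD('n) = 2")
    case True
    then have "\<exists>f. bij_betw f (UNIV :: 2 set) (UNIV :: 'n set)" by (intro finite_same_card_bij) auto
    then show ?thesis by blast
  next
    case False
    then have "CARD('n) = 3" using dim by auto
    then have "\<exists>f. bij_betw f (UNIV :: 3 set) (UNIV :: 'n set)" by (intro finite_same_card_bij) auto
    then show ?thesis by blast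
  qed
  then have "(integrable (lebesgue_on S) (\<lambda>x. \<bar>det (matrix (g' x))\<bar> * q (g x)) \<longleftrightarrow> integrable (lebesgue_on (g ` S)) q) \<and>
    (LINT x|lebesgue_on S. \<bar>det (matrix (g' x))\<bar> * q (g x)) = (LINT y|lebesgue_on (g ` S). q y)"
  proof (elim disjE exE)
    fix f :: "2 \<Rightarrow> 'n" assume f: "bij f"
    show ?thesis by (intro conjI change_of_variables_reindex[OF f S der inj])
  next
    fix f :: "3 \<Rightarrow> 'n" assume f: "bij f"
    show ?thesis by (intro conjI change_of_variables_reindex[OF f S der inj])
  qed
  then show "integrable (lebesgue_on S) (\<lambda>x. \<bar>det (matrix (g' x))\<bar> * q (g x)) \<longleftrightarrow> integrable (lebesgue_on (g ` S)) q"
    "(LINT x|lebesgue_on S. \<bar>det (matrix (g' x))\<bar> * q (g x)) = (LINT y|lebesgue_on (g ` S). q y)"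
    by simp_all
qed

section \<open>Transport by diffeomorphisms of the cell\<close>

lemma bounded_bilinear_vector_matrix:
  "bounded_bilinear ((v*) :: real^'n \<Rightarrow> real^'m^'n \<Rightarrow> real^'m)"
  unfolding bilinear_conv_bounded_bilinear[symmetric] bilinear_def
  by (auto intro!: linearI simp: vec_eq_iff vector_matrix_mult_def sum.distrib sum_distrib_left algebra_simps)

lemma bounded_bilinear_matrix_matrix:
  "bounded_bilinear ((**) :: real^'n^'m \<Rightarrow> real^'k^'n \<Rightarrow> real^'k^'m)"
  unfolding bilinear_conv_bounded_bilinear[symmetric] bilinear_def
  by (auto intro!: linearI simp: vec_eq_iff matrix_matrix_mult_def sum.distrib sum_distrib_left algebra_simps)

lemma continuous_on_det:
  fixes A :: "'a::topological_space \<Rightarrow> real^'n^'n"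
  shows "continuous_on S A \<Longrightarrow> continuous_on S (\<lambda>x. det (A x))"
  unfolding det_def by (intro continuous_intros)

lemma bounded_continuous_image:
  fixes A :: "'a \<Rightarrow> 'b::euclidean_space" and f :: "'b \<Rightarrow> 'c::real_normed_vector"
  assumes "bounded (A ` S)" "continuous_on UNIV f"
  shows "bounded ((\<lambda>x. f (A x)) ` S)"
proof -
  have "compact (f ` closure (A ` S))"
    using assms by (intro compact_continuous_image) (auto intro: continuous_on_subset)
  moreover have "(\<lambda>x. f (A x)) ` S \<subseteq> f ` closure (A ` S)" using closure_subset by fastforce
  ultimately show ?thesis using bounded_subset compact_imp_bounded by blast
qed

lemma open_cell: "open (cell :: (real^'n) set)" and bounded_cell: "bounded (cell :: (real^'n) set)"
  by (auto simp: cell_def)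

lemma connected_cell: "connected (cell :: (real^'n) set)"
  unfolding cell_def using convex_connected convex_box(2) by blast

lemma mem_closure_cell: "x \<in> closure (cell :: (real^'n) set) \<longleftrightarrow> (\<forall>i. - 1/2 \<le> x $ i \<and> x $ i \<le> 1/2)"
proof -
  have "0 \<in> (box (\<chi> i. - 1/2) (\<chi> i. 1/2) :: (real^'n) set)" by (simp add: mem_box_cart)
  then have "closure (cell :: (real^'n) set) = cbox (\<chi> i. - 1/2) (\<chi> i. 1/2)"
    unfolding cell_def by (intro closure_box) auto
  then show ?thesis by (simp add: mem_box_cart)
qed

lemma compact_closure_cell: "compact (closure (cell :: (real^'n) set))"
  using bounded_cell by (simp add: compact_closure)

lemma frontier_cell: "frontier (cell :: (real^'n) set) = closure cell - cell"
  by (simp add: frontier_def interior_open[OF open_cell])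

lemma interior_closure_cell: "interior (closure (cell :: (real^'n) set)) = cell"
  using convex_interior_closure[of "cell :: (real^'n) set"] interior_open[OF open_cell]
  by (simp add: cell_def convex_box)

text \<open>Only one direction is listed: \<open>cell_diffeo\<close> takes it twice with
  \<open>h\<close> and \<open>k\<close> exchanged, so that every fact has its counterpart for the
  inverse through \<open>swap\<close>. \<open>W\<close> is a neighbourhood of the outer boundary on
  whose part in the closed cell the maps are the identity.\<close>

locale half_cell_diffeo =
  fixes h k :: "real^'n \<Rightarrow> real^'n" and Dh :: "real^'n \<Rightarrow> real^'n^'n" and W :: "(real^'n) set"
  assumes h_mem: "\<And>x. x \<in> closure cell \<Longrightarrow> h x \<in> closure cell"
    and kh: "\<And>x. x \<in> closure cell \<Longrightarrow> k (h x) = x"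
    and h_cont: "continuous_on (closure cell) h"
    and h_deriv: "\<And>x. x \<in> cell \<Longrightarrow> (h has_derivative (\<lambda>v. Dh x *v v)) (at x)"
    and Dh_cont: "continuous_on cell Dh"
    and Dh_bdd: "bounded (Dh ` cell)"
    and open_W: "open W" and W_frontier: "frontier cell \<subseteq> W"
    and h_id: "\<And>x. x \<in> W \<Longrightarrow> x \<in> closure cell \<Longrightarrow> h x = x"

locale cell_diffeo =
  H: half_cell_diffeo h k Dh W + K: half_cell_diffeo k h Dk W
  for h k :: "real^'n \<Rightarrow> real^'n" and Dh Dk and W
begin

lemma swap: "cell_diffeo k h Dk Dh W"
  by unfold_locales

lemma inj: "inj_on h (closure cell)"
  by (rule inj_on_inverseI[where g=k]) (rule H.kh)

text \<open>A point sent to the frontier would have to be fixed, since \<open>k\<close> is the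
  identity there.\<close>

lemma h_cell: "x \<in> cell \<Longrightarrow> h x \<in> cell"
proof (rule ccontr)
  assume x: "x \<in> cell" and n: "h x \<notin> cell"
  have xc: "x \<in> closure cell" using x closure_subset by blast
  then have "h x \<in> frontier cell" using n H.h_mem frontier_cell by blast
  then have W: "h x \<in> W" using H.W_frontier by blast
  then have "k (h x) = h x" using K.h_id H.h_mem[OF xc] by blast
  then show False using H.kh[OF xc] x n by simp
qed

lemma cell_closure: "x \<in> cell \<Longrightarrow> x \<in> closure cell"
  using closure_subset by blast

end

context cell_diffeo
begin

lemma k_cell: "x \<in> cell \<Longrightarrow> k x \<in> cell"
  by (rule cell_diffeo.h_cell[OF swap])

lemma image_eq: "A \<subseteq> closure cell \<Longrightarrow> h ` A = {y \<in> closure cell. k y \<in> A}"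
proof
  assume A: "A \<subseteq> closure cell"
  show "h ` A \<subseteq> {y \<in> closure cell. k y \<in> A}"
  proof
    fix y assume "y \<in> h ` A"
    then obtain x where x: "x \<in> A" "y = h x" by blast
    then have "x \<in> closure cell" using A by blast
    then show "y \<in> {y \<in> closure cell. k y \<in> A}" using x H.h_mem H.kh by simp
  qed
  show "{y \<in> closure cell. k y \<in> A} \<subseteq> h ` A"
  proof
    fix y assume "y \<in> {y \<in> closure cell. k y \<in> A}"
    then have "h (k y) = y" "k y \<in> A" using K.kh by auto
    then show "y \<in> h ` A" by (metis imageI)
  qed
qed

lemma image_subset_cell: "A \<subseteq> cell \<Longrightarrow> h ` A \<subseteq> cell"
  using h_cell by blast

lemma image_cell_eq: "A \<subseteq> cell \<Longrightarrow> h ` A = {y \<in> cell. k y \<in> A}"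
proof
  assume A: "A \<subseteq> cell"
  then have Ac: "A \<subseteq> closure cell" using cell_closure by blast
  show "h ` A \<subseteq> {y \<in> cell. k y \<in> A}" using A Ac h_cell image_eq[OF Ac] by blast
  show "{y \<in> cell. k y \<in> A} \<subseteq> h ` A" using cell_closure image_eq[OF Ac] by blast
qed

lemma image_image_k: "A \<subseteq> closure cell \<Longrightarrow> k ` h ` A = A"
  using H.kh by (force simp: image_iff subset_iff)

lemma open_image: "open A \<Longrightarrow> A \<subseteq> cell \<Longrightarrow> open (h ` A)"
proof -
  assume A: "open A" "A \<subseteq> cell"
  have "h ` A = cell \<inter> k -` A" using image_cell_eq[OF A(2)] by auto
  moreover have "open (cell \<inter> k -` A)"
    by (rule continuous_open_preimage[OF continuous_on_subset[OF K.h_cont closure_subset] open_cell A(1)])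
  ultimately show ?thesis by simp
qed

lemma closure_image: "A \<subseteq> closure cell \<Longrightarrow> closure (h ` A) = h ` closure A"
proof
  assume A: "A \<subseteq> closure cell"
  then have cA: "closure A \<subseteq> closure cell" by (rule closure_minimal) simp
  have "compact (closure A)"
    using compact_Int_closed[OF compact_closure_cell closed_closure[of A]] cA by (simp add: Int_absorb1)
  then have "compact (h ` closure A)" by (intro compact_continuous_image continuous_on_subset[OF H.h_cont cA])
  moreover have "h ` A \<subseteq> h ` closure A" using closure_subset by blast
  ultimately show "closure (h ` A) \<subseteq> h ` closure A" by (intro closure_minimal compact_imp_closed)
  show "h ` closure A \<subseteq> closure (h ` A)"
    by (rule image_closure_subset[OF continuous_on_subset[OF H.h_cont cA]]) (auto simp: closure_subset)
qed

lemma image_Diff_cell: "A \<subseteq> closure cell \<Longrightarrow> h ` (cell - A) = cell - h ` A"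
proof -
  assume A: "A \<subseteq> closure cell"
  have "h ` (cell - A) = h ` cell - h ` A"
    using inj_on_image_set_diff[OF inj, of cell A] A cell_closure by blast
  moreover have "h ` cell = cell" using image_cell_eq[of cell] k_cell by auto
  ultimately show ?thesis by simp
qed

lemma perforated_image:
  assumes "perforated_cell P" shows "perforated_cell (h ` P)"
proof -
  interpret perforated_cell P by (rule assms)
  have Pc: "P \<subseteq> closure cell" using P_subset_cell cell_closure by blast
  then have cP: "closure P \<subseteq> closure cell" by (rule closure_minimal) simp
  have iP: "inclusion P \<subseteq> closure cell" using cell_closure by (auto simp: inclusion_def)
  have i: "inclusion (h ` P) = h ` inclusion P"
    unfolding inclusion_def closure_image[OF Pc] image_Diff_cell[OF cP] ..
  have ci: "closure (inclusion (h ` P)) = h ` closure (inclusion P)"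
    unfolding i by (rule closure_image[OF iP])
  have cic: "closure (inclusion P) \<subseteq> closure cell" using inclusion_subset cell_closure by blast
  show ?thesis
  proof
    show "open (h ` P)" by (rule open_image[OF open_P P_subset_cell])
    show "h ` P = cell - closure (inclusion (h ` P))"
      unfolding ci image_Diff_cell[OF cic, symmetric] P_eq[symmetric] ..
    show "closure (inclusion (h ` P)) \<subseteq> cell"
      unfolding ci by (rule image_subset_cell[OF inclusion_subset])
  qed
qed

lemma matrix_inverse: "x \<in> cell \<Longrightarrow> Dk (h x) ** Dh x = mat 1"
proof -
  assume x: "x \<in> cell"
  have "(k \<circ> h has_derivative (\<lambda>v. Dk (h x) *v v) \<circ> (\<lambda>v. Dh x *v v)) (at x)"
    by (rule diff_chain_at[OF H.h_deriv[OF x] K.h_deriv[OF h_cell[OF x]]])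
  moreover have "(k \<circ> h has_derivative (\<lambda>v. v)) (at x)"
    by (rule has_derivative_transform_within_open[OF _ open_cell x, where f="\<lambda>x. x"])
      (auto simp: H.kh cell_closure)
  ultimately have "(\<lambda>v. Dk (h x) *v v) \<circ> (\<lambda>v. Dh x *v v) = (\<lambda>v. v)" by (rule has_derivative_unique)
  then have "Dk (h x) *v (Dh x *v v) = v" for v by (metis comp_apply)
  then show ?thesis by (simp add: matrix_eq matrix_vector_mul_assoc)
qed

lemma matrix_inverse': "x \<in> cell \<Longrightarrow> Dh x ** Dk (h x) = mat 1"
  using matrix_inverse matrix_left_right_inverse by blast

lemma det_inverse: "x \<in> cell \<Longrightarrow> det (Dk (h x)) * det (Dh x) = 1"
  using arg_cong[OF matrix_inverse, of x det] by (simp add: det_mul)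

lemma det_nonzero: "x \<in> cell \<Longrightarrow> det (Dh x) \<noteq> 0"
  using det_inverse by fastforce

text \<open>The determinant is continuous without zeros on the connected cell, and it equals 1 near
  the frontier, where \<open>h\<close> is the identity.\<close>

lemma det_pos: "x \<in> cell \<Longrightarrow> det (Dh x) > 0"
proof -
  assume x: "x \<in> cell"
  obtain p where p: "p \<in> W \<inter> cell"
  proof -
    \<comment> \<open>The frontier is nonempty and contained in the open set \<open>W\<close>, so
      \<open>W\<close> also meets the cell itself.\<close>
    have "frontier (cell :: (real^'n) set) \<noteq> {}"
      by (rule frontier_not_empty) (use x in blast, metis bounded_cell not_bounded_UNIV)
    then obtain q :: "real^'n" where q: "q \<in> frontier cell" by blast
    then have "q \<in> W" "q \<in> closure cell" using H.W_frontier by (auto simp: frontier_cell)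
    then have "W \<inter> cell \<noteq> {}" using open_Int_closure_eq_empty[OF H.open_W, of cell] by blast
    then show thesis using that by blast
  qed
  have o: "open (W \<inter> cell)" using H.open_W open_cell by blast
  have "(h has_derivative (\<lambda>v. v)) (at p)"
    by (rule has_derivative_transform_within_open[OF _ o p, where f="\<lambda>x. x"])
      (auto simp: H.h_id cell_closure)
  from has_derivative_unique[OF H.h_deriv this] p have "(\<lambda>v. Dh p *v v) = (\<lambda>v. v)" by blast
  then have "Dh p = mat 1" by (simp add: matrix_eq fun_eq_iff)
  then have p1: "det (Dh p) = 1" by simp
  have "connected ((\<lambda>x. det (Dh x)) ` cell)"
    by (intro connected_continuous_image continuous_on_det H.Dh_cont connected_cell)
  moreover have "0 \<notin> (\<lambda>x. det (Dh x)) ` cell" using det_nonzero by force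
  moreover have "1 \<in> (\<lambda>x. det (Dh x)) ` cell" using p p1 by force
  ultimately show ?thesis
    using x connected_contains_Icc[of "(\<lambda>x. det (Dh x)) ` cell" "det (Dh x)" 1]
    by (cases "det (Dh x) > 0") (auto simp: subset_iff)
qed

lemma det_bound: "\<exists>C>0. \<forall>x\<in>cell. det (Dh x) \<le> C"
proof -
  have "bounded ((\<lambda>x. det (Dh x)) ` cell)"
    by (rule bounded_continuous_image[OF H.Dh_bdd continuous_on_det[OF continuous_on_id]])
  then obtain B where "\<forall>y\<in>(\<lambda>x. det (Dh x)) ` cell. norm y \<le> B" unfolding bounded_iff ..
  then have "det (Dh x) \<le> max B 1" if "x \<in> cell" for x using that by (auto simp: abs_le_iff max.coboundedI1)
  then show ?thesis by (intro exI[of _ "max B 1"]) auto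
qed

end

section \<open>Integrals and square integrable functions under transport\<close>

locale perforated_diffeo = cell_diffeo h k Dh Dk W + perforated_cell P
  for h k :: "real^'n \<Rightarrow> real^'n" and Dh Dk W and P :: "(real^'n) set" +
  assumes dim: "CARD('n) \<in> {2, 3}"
begin

sublocale Q: perforated_cell "h ` P"
  by (rule perforated_image) unfold_locales

lemma P_cell: "x \<in> P \<Longrightarrow> x \<in> cell"
  using P_subset_cell by blast

lemma inj_P: "inj_on h P"
  using inj P_cell cell_closure by (meson inj_on_subset subsetI)

lemma kP: "x \<in> P \<Longrightarrow> k (h x) = x"
  using H.kh P_cell cell_closure by blast

lemma kQ: "y \<in> h ` P \<Longrightarrow> k y \<in> P"
  using kP by auto

lemma hkQ: "y \<in> h ` P \<Longrightarrow> h (k y) = y"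
  using kP by auto

lemma matrix_Dh: "matrix (\<lambda>v. Dh x *v v) = Dh x"
  by (rule matrix_of_matrix_vector_mul)

lemma integral_image:
  "integrable M (\<lambda>x. det (Dh x) * q (h x)) \<longleftrightarrow> integrable Q.M q"
  "(LINT x|M. det (Dh x) * q (h x)) = (LINT y|Q.M. q y)"
proof -
  note cv = change_of_variables[OF dim open_P Q.open_P H.h_deriv[OF P_cell] inj_P, of q, unfolded matrix_Dh]
  have e: "\<bar>det (Dh x)\<bar> * q (h x) = det (Dh x) * q (h x)" if "x \<in> P" for x
    using det_pos[OF P_cell[OF that]] by simp
  have "integrable M (\<lambda>x. \<bar>det (Dh x)\<bar> * q (h x)) \<longleftrightarrow> integrable M (\<lambda>x. det (Dh x) * q (h x))"
    by (rule Bochner_Integration.integrable_cong[OF refl]) (simp add: e)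
  then show "integrable M (\<lambda>x. det (Dh x) * q (h x)) \<longleftrightarrow> integrable Q.M q" using cv(1) by blast
  have "(LINT x|M. \<bar>det (Dh x)\<bar> * q (h x)) = (LINT x|M. det (Dh x) * q (h x))"
    by (rule Bochner_Integration.integral_cong[OF refl]) (simp add: e)
  then show "(LINT x|M. det (Dh x) * q (h x)) = (LINT y|Q.M. q y)" using cv(2) by simp
qed

text \<open>The change of variables brings in the factor \<open>det (Dh x)\<close>, which is bounded
  below because the determinant of the inverse Jacobian is bounded above; \<open>C\<close> is the
  square root of that upper bound.\<close>

lemma L2v_pull_real:
  fixes q :: "real^'n \<Rightarrow> real"
  obtains C where "0 \<le> C"
    "\<forall>q :: real^'n \<Rightarrow> real. q \<in> L2v Q.M \<longrightarrow> (\<lambda>x. q (h x)) \<in> L2v M \<and> L2n M (\<lambda>x. q (h x)) \<le> C * L2n Q.M q"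
proof -
  obtain C0 where C0: "C0 > 0" "\<forall>x\<in>cell. det (Dk x) \<le> C0"
    using cell_diffeo.det_bound[OF swap] by blast
  have inv: "det (Dk (h x)) * det (Dh x) = 1" "det (Dk (h x)) > 0" "det (Dk (h x)) \<le> C0" if "x \<in> P" for x
    using det_inverse[OF P_cell[OF that]] C0(2) h_cell[OF P_cell[OF that]] cell_diffeo.det_pos[OF swap] by auto
  have "(\<lambda>x. q (h x)) \<in> L2v M \<and> L2n M (\<lambda>x. q (h x)) \<le> sqrt C0 * L2n Q.M q" if q: "q \<in> L2v Q.M" for q :: "real^'n \<Rightarrow> real"
  proof -
    have "integrable Q.M (\<lambda>x. q x \<bullet> 1)" by (rule L2v_inner(1)[OF q Q.const_L2v])
    then have i1: "integrable M (\<lambda>x. det (Dh x) * q (h x))" by (simp add: integral_image(1))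
    have cd: "continuous_on P (\<lambda>x. det (Dk (h x)))"
    proof -
      have "continuous_on P h" by (rule continuous_on_subset[OF H.h_cont]) (use P_cell cell_closure in blast)
      then have "continuous_on P (\<lambda>x. Dk (h x))"
        by (rule continuous_on_compose2[OF K.Dh_cont]) (use h_cell P_cell in auto)
      then show ?thesis by (rule continuous_on_det)
    qed
    \<comment> \<open>A Lebesgue measurable function composed with a continuous map may fail to be
      measurable. Here measurability is read off from the integrable function \<open>i1\<close> by
      multiplication with the reciprocal of the determinant.\<close>
    have "(\<lambda>x. det (Dk (h x)) * (det (Dh x) * q (h x))) \<in> borel_measurable M"
      by (rule borel_measurable_times[OF continuous_on_measurable[OF cd] borel_measurable_integrable[OF i1]])
    then have m: "(\<lambda>x. q (h x)) \<in> borel_measurable M"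
      by (rule measurable_cong[THEN iffD1, rotated]) (simp add: inv flip: mult.assoc)
    have i2: "integrable M (\<lambda>x. det (Dh x) * (norm (q (h x)))\<^sup>2)"
      using q integral_image(1)[of "\<lambda>x. (norm (q x))\<^sup>2"] by (simp add: L2v_def)
    have le: "(norm (q (h x)))\<^sup>2 \<le> C0 * (det (Dh x) * (norm (q (h x)))\<^sup>2)" if "x \<in> P" for x
    proof -
      have "(norm (q (h x)))\<^sup>2 = (det (Dk (h x)) * det (Dh x)) * (norm (q (h x)))\<^sup>2" using inv[OF that] by simp
      also have "\<dots> = det (Dk (h x)) * (det (Dh x) * (norm (q (h x)))\<^sup>2)" by simp
      also have "\<dots> \<le> C0 * (det (Dh x) * (norm (q (h x)))\<^sup>2)"
        using inv[OF that] det_pos[OF P_cell[OF that]] by (intro mult_right_mono) auto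
      finally show ?thesis .
    qed
    have i3: "integrable M (\<lambda>x. (norm (q (h x)))\<^sup>2)"
    proof (rule Bochner_Integration.integrable_bound[OF integrable_mult_right[OF i2, of C0]])
      show "AE x in M. norm ((norm (q (h x)))\<^sup>2) \<le> norm (C0 * (det (Dh x) * (norm (q (h x)))\<^sup>2))"
        using le by (intro AE_I2) (auto intro: order_trans[OF _ abs_ge_self])
    qed (use m in measurable)
    then have L: "(\<lambda>x. q (h x)) \<in> L2v M" using m by (simp add: L2v_def)
    have "(L2n M (\<lambda>x. q (h x)))\<^sup>2 \<le> (LINT x|M. C0 * (det (Dh x) * (norm (q (h x)))\<^sup>2))"
      unfolding L2n_power2 using i2 i3 le by (intro integral_mono) auto
    also have "\<dots> = C0 * (L2n Q.M q)\<^sup>2"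
      using integral_image(2)[of "\<lambda>x. (norm (q x))\<^sup>2"] by (simp add: L2n_power2)
    finally have "(L2n M (\<lambda>x. q (h x)))\<^sup>2 \<le> (sqrt C0 * L2n Q.M q)\<^sup>2" using C0(1) by (simp add: power_mult_distrib)
    then have "L2n M (\<lambda>x. q (h x)) \<le> sqrt C0 * L2n Q.M q"
      by (rule power2_le_imp_le) (use C0(1) in auto)
    then show ?thesis using L by blast
  qed
  then show thesis using that[of "sqrt C0"] C0(1) by auto
qed

lemma L2v_pull:
  obtains C where "0 \<le> C"
    "\<forall>q :: real^'n \<Rightarrow> real. q \<in> L2v Q.M \<longrightarrow> (\<lambda>x. q (h x)) \<in> L2v M \<and> L2n M (\<lambda>x. q (h x)) \<le> C * L2n Q.M q"
    "\<forall>q :: real^'n \<Rightarrow> real^'n. q \<in> L2v Q.M \<longrightarrow> (\<lambda>x. q (h x)) \<in> L2v M \<and> L2n M (\<lambda>x. q (h x)) \<le> C * L2n Q.M q"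
proof -
  obtain C where C: "0 \<le> C" and
    r: "\<forall>q :: real^'n \<Rightarrow> real. q \<in> L2v Q.M \<longrightarrow> (\<lambda>x. q (h x)) \<in> L2v M \<and> L2n M (\<lambda>x. q (h x)) \<le> C * L2n Q.M q"
    by (rule L2v_pull_real)
  have "(\<lambda>x. q (h x)) \<in> L2v M \<and> L2n M (\<lambda>x. q (h x)) \<le> C * L2n Q.M q" if q: "q \<in> L2v Q.M" for q :: "real^'n \<Rightarrow> real^'n"
  proof -
    have c: "(\<lambda>x. q (h x) $ i) \<in> L2v M \<and> L2n M (\<lambda>x. q (h x) $ i) \<le> C * L2n Q.M (\<lambda>x. q x $ i)" for i
      using r[rule_format, OF L2v_component(1)[OF q, of i]] .
    then have L: "(\<lambda>x. q (h x)) \<in> L2v M" unfolding L2v_vec_iff by blast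
    have "(L2n M (\<lambda>x. q (h x)))\<^sup>2 \<le> (\<Sum>i\<in>UNIV. (C * L2n Q.M (\<lambda>x. q x $ i))\<^sup>2)"
      unfolding L2n_vec[OF L] using c by (intro sum_mono power_mono) auto
    also have "\<dots> = (C * L2n Q.M q)\<^sup>2" by (simp add: L2n_vec[OF q] power_mult_distrib sum_distrib_left)
    finally show ?thesis using L power2_le_imp_le C by (metis L2n_nonneg mult_nonneg_nonneg)
  qed
  then show thesis using that C r by blast
qed

end

context perforated_cell
begin

lemma L2v_vector_matrix:
  fixes A :: "real^'n \<Rightarrow> real^'m^'n"
  assumes "continuous_on P A" "bounded (A ` P)"
  obtains C where "0 \<le> C" "\<forall>f. f \<in> L2v M \<longrightarrow> (\<lambda>x. f x v* A x) \<in> L2v M \<and> L2n M (\<lambda>x. f x v* A x) \<le> C * L2n M f"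
proof -
  obtain K where K: "0 \<le> K" "\<And>x (B :: real^'m^'n). norm (x v* B) \<le> norm x * norm B * K"
    using bounded_bilinear.nonneg_bounded[OF bounded_bilinear_vector_matrix] by blast
  obtain B0 where B0: "\<forall>y\<in>A ` P. norm y \<le> B0" using assms(2) unfolding bounded_iff ..
  define C where "C = max B0 0 * K"
  have C: "0 \<le> C" using K(1) by (simp add: C_def)
  have "(\<lambda>x. f x v* A x) \<in> L2v M \<and> L2n M (\<lambda>x. f x v* A x) \<le> C * L2n M f" if f: "f \<in> L2v M" for f
  proof -
    have fm: "f \<in> borel_measurable M" by (rule L2v_measurable[OF f])
    have m: "(\<lambda>x. f x v* A x) \<in> borel_measurable M"
      by (rule borel_measurable_continuous_Pair[OF fm continuous_on_measurable[OF assms(1)]])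
        (intro bounded_bilinear.continuous_on[OF bounded_bilinear_vector_matrix] continuous_intros)
    have ae: "AE x in M. norm (f x v* A x) \<le> C * norm (f x)"
    proof (rule AE_I2)
      fix x assume "x \<in> space M"
      then have "norm (A x) \<le> max B0 0" using B0 by auto
      then have "norm (f x) * norm (A x) * K \<le> norm (f x) * max B0 0 * K"
        using K(1) by (intro mult_right_mono mult_left_mono) auto
      then show "norm (f x v* A x) \<le> C * norm (f x)"
        using K(2)[of "f x" "A x"] by (simp add: C_def ac_simps)
    qed
    show ?thesis using L2v_dominated[OF f m ae C] by blast
  qed
  then show thesis using that C by blast
qed

text \<open>The lattice point \<open>z\<close> for which all coordinates of \<open>x - z\<close> lie
  in the half-open interval from -1/2 to 1/2.\<close>

definition cell_index :: "real^'n \<Rightarrow> real^'n" where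
  "cell_index x = (\<chi> i. of_int \<lfloor>x $ i + 1/2\<rfloor>)"

lemma cell_index_lattice: "cell_index x \<in> lattice_points"
  by (simp add: cell_index_def lattice_points_def)

lemma cell_index_bounds: "- 1/2 \<le> (x - cell_index x) $ i" "(x - cell_index x) $ i < 1/2"
  using floor_correct[of "x $ i + 1/2"] by (simp_all add: cell_index_def) linarith+

lemma cell_index_closure: "x - cell_index x \<in> closure cell"
  unfolding mem_closure_cell using cell_index_bounds[of x] by (auto intro: less_imp_le)

lemma cell_index_unique: "x - z \<in> cell \<Longrightarrow> z \<in> lattice_points \<Longrightarrow> cell_index x = z"
proof -
  assume *: "x - z \<in> cell" "z \<in> lattice_points"
  have "cell_index x $ i = z $ i" for i
  proof -
    obtain m where m: "z $ i = of_int m" using *(2) by (auto simp: lattice_points_def elim: Ints_cases)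
    have "- 1/2 < x $ i - z $ i" "x $ i - z $ i < 1/2" using *(1) by (auto simp: mem_cell)
    then have "\<lfloor>x $ i + 1/2\<rfloor> = m" unfolding m by (intro floor_unique) auto
    then show ?thesis by (simp add: cell_index_def m)
  qed
  then show ?thesis by (simp add: vec_eq_iff)
qed

lemma cell_index_translate: "z \<in> lattice_points \<Longrightarrow> cell_index (x + z) = cell_index x + z"
proof -
  assume z: "z \<in> lattice_points"
  have "cell_index (x + z) $ i = (cell_index x + z) $ i" for i
  proof -
    obtain m where m: "z $ i = of_int m" using z by (auto simp: lattice_points_def elim: Ints_cases)
    have "\<lfloor>x $ i + of_int m + 1/2\<rfloor> = \<lfloor>x $ i + 1/2\<rfloor> + m"
      using floor_correct[of "x $ i + 1/2"] by (intro floor_unique) auto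
    then show ?thesis unfolding cell_index_def by (simp add: m)
  qed
  then show ?thesis by (simp add: vec_eq_iff)
qed

text \<open>The translates of the inclusion stay inside open translated cells and therefore miss
  every face.\<close>

lemma boundary_in_extension:
  assumes "x $ i + 1/2 \<in> \<int>" shows "x \<in> periodic_extension P"
proof -
  have "x - z \<notin> closure (inclusion P)" if z: "z \<in> lattice_points" for z
  proof
    assume "x - z \<in> closure (inclusion P)"
    then have c: "x - z \<in> cell" using inclusion_subset by blast
    obtain m where m: "z $ i = of_int m" using z by (auto simp: lattice_points_def elim: Ints_cases)
    obtain l where l: "x $ i + 1/2 = of_int l" using assms by (elim Ints_cases)
    have "- 1/2 < x $ i - z $ i \<and> x $ i - z $ i < 1/2" using c by (auto simp: mem_cell)
    then have "0 < (of_int (l - m) :: real)" "(of_int (l - m) :: real) < 1" using l m by auto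
    then have "0 < l - m" "l - m < 1" by (simp_all only: of_int_0_less_iff of_int_less_1_iff)
    then show False by simp
  qed
  then show ?thesis by (simp add: periodic_extension_def)
qed

lemma not_cell_boundary:
  assumes "x - cell_index x \<notin> cell"
  obtains i where "(x - cell_index x) $ i = - 1/2"
proof -
  obtain i where "\<not> (- 1/2 < (x - cell_index x) $ i \<and> (x - cell_index x) $ i < 1/2)"
    using assms unfolding mem_cell by blast
  then have "(x - cell_index x) $ i = - 1/2" using cell_index_bounds[of x i] by linarith
  then show thesis by (rule that)
qed

end

section \<open>Periodic functions under transport\<close>

context perforated_diffeo
begin

lemma k_continuous_Q: "continuous_on (h ` P) k"
  by (rule continuous_on_subset[OF K.h_cont]) (use Q.P_subset_cell cell_closure in blast)

lemma Dk_continuous_Q: "continuous_on (h ` P) Dk"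
  by (rule continuous_on_subset[OF K.Dh_cont Q.P_subset_cell])

lemma Dk_bounded_Q: "bounded (Dk ` h ` P)"
  using K.Dh_bdd by (rule bounded_subset) (use Q.P_subset_cell in blast)

lemma compose_k_deriv:
  assumes "C1_on \<phi> P" "y \<in> h ` P"
  shows "((\<lambda>y. \<phi> (k y)) has_derivative (\<lambda>v. (grad \<phi> (k y) v* Dk y) \<bullet> v)) (at y)"
proof -
  have "(\<phi> has_derivative (\<lambda>v. grad \<phi> (k y) \<bullet> v)) (at (k y))"
    by (rule C1_on_deriv[OF assms(1) kQ[OF assms(2)]])
  moreover have "(k has_derivative (\<lambda>v. Dk y *v v)) (at y)"
    using Q.P_subset_cell assms(2) by (intro K.h_deriv) auto
  ultimately have "(\<phi> \<circ> k has_derivative (\<lambda>v. grad \<phi> (k y) \<bullet> v) \<circ> (\<lambda>v. Dk y *v v)) (at y)"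
    by (intro diff_chain_at)
  then show ?thesis by (simp add: o_def dot_lmul_matrix)
qed

lemma compose_k_C1:
  assumes "C1_on \<phi> P"
  shows "C1_on (\<lambda>y. \<phi> (k y)) (h ` P)" "y \<in> h ` P \<Longrightarrow> grad (\<lambda>y. \<phi> (k y)) y = grad \<phi> (k y) v* Dk y"
proof -
  have "continuous_on (h ` P) (\<lambda>y. grad \<phi> (k y))"
    by (rule continuous_on_compose2[OF _ k_continuous_Q]) (use assms kQ in \<open>auto simp: C1_on_def\<close>)
  then have "continuous_on (h ` P) (\<lambda>y. grad \<phi> (k y) v* Dk y)"
    by (intro bounded_bilinear.continuous_on[OF bounded_bilinear_vector_matrix] Dk_continuous_Q)
  then show "C1_on (\<lambda>y. \<phi> (k y)) (h ` P)"
    by (rule C1_onI[where G="\<lambda>y. grad \<phi> (k y) v* Dk y", rotated]) (rule compose_k_deriv[OF assms])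
  show "y \<in> h ` P \<Longrightarrow> grad (\<lambda>y. \<phi> (k y)) y = grad \<phi> (k y) v* Dk y"
    by (rule grad_eqI[OF compose_k_deriv[OF assms]])
qed

text \<open>\<open>k\<close> is meaningful on the closed cell only, so the argument is first reduced
  modulo the lattice.\<close>

definition per_push :: "(real^'n \<Rightarrow> real) \<Rightarrow> real^'n \<Rightarrow> real" where
  "per_push \<phi> x = \<phi> (k (x - cell_index x))"

lemma per_push_Q: "y \<in> h ` P \<Longrightarrow> per_push \<phi> y = \<phi> (k y)"
  using cell_index_unique[of y 0] Q.P_subset_cell by (auto simp: per_push_def lattice_points_def)

text \<open>Inside a translated open cell the function is locally a translate of \<phi> \<circ> k,
  and the chain rule applies. Near a face the reduced argument lies where \<open>k\<close> is the
  identity, so the function coincides with the periodic \<open>\<phi>\<close> and does not feel the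
  jump of \<open>cell_index\<close>.\<close>

lemma per_push_C1_on:
  assumes \<phi>: "C1_on \<phi> (periodic_extension P)" "\<And>x z. x \<in> periodic_extension P \<Longrightarrow> z \<in> lattice_points \<Longrightarrow> \<phi> (x + z) = \<phi> x"
  shows "C1_on (per_push \<phi>) (periodic_extension (h ` P))"
proof -
  have \<phi>P: "C1_on \<phi> P" by (rule C1_on_subset[OF \<phi>(1) P_subset_extension])
  have "Ck_on 1 (per_push \<phi>) (periodic_extension (h ` P))"
  proof (rule Ck_on_local[OF Q.open_extension])
    fix x assume x: "x \<in> periodic_extension (h ` P)"
    show "\<exists>T. open T \<and> x \<in> T \<and> Ck_on 1 (per_push \<phi>) T"
    proof (cases "x - cell_index x \<in> cell")
      case True
      define z where "z = cell_index x"
      have z: "z \<in> lattice_points" unfolding z_def by (rule cell_index_lattice)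
      define T where "T = {y. y + - z \<in> h ` P}"
      have o: "open T"
      proof -
        have "T = (\<lambda>y. y + - z) -` (h ` P)" by (auto simp: T_def)
        then show ?thesis using Q.open_P by (simp only:) (intro open_vimage continuous_intros)
      qed
      have "Ck_on 1 (\<lambda>y. \<phi> (k y)) (h ` P)"
        using compose_k_C1(1)[OF \<phi>P] by (simp only: Ck_on_1_iff_C1_on[OF Q.open_P])
      then have "Ck_on 1 (\<lambda>y. \<phi> (k (y + - z))) T" unfolding T_def by (rule Ck_on_translate)
      then have "Ck_on 1 (per_push \<phi>) T"
      proof (rule Ck_on_cong[OF o])
        fix y assume "y \<in> T"
        then have "y - z \<in> cell" using Q.P_subset_cell by (auto simp: T_def)
        then show "\<phi> (k (y + - z)) = per_push \<phi> y" using cell_index_unique[of y z] z by (simp add: per_push_def)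
      qed
      moreover have "x \<in> T"
      proof -
        have "x + - z \<in> periodic_extension (h ` P)"
          unfolding Q.extension_translate[OF lattice_minus[OF z]] by (rule x)
        then show ?thesis using True Q.extension_Int_cell unfolding T_def z_def by auto
      qed
      ultimately show ?thesis using o by blast
    next
      case False
      then obtain i where i: "(x - cell_index x) $ i = - 1/2" by (rule not_cell_boundary)
      have cf: "compact (frontier cell :: (real^'n) set)"
        using compact_closure_cell by (intro compact_frontier_bounded bounded_cell)
      \<comment> \<open>By compactness of the frontier, \<open>W\<close> contains a neighbourhood of
        it of uniform width e.\<close>
      obtain e where e: "e > 0" "\<And>p q. p \<in> frontier cell \<Longrightarrow> dist p q < e \<Longrightarrow> q \<in> W"
      proof -
        obtain e where "e > 0" "(\<Union>p\<in>frontier cell. ball p e) \<subseteq> W"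
          by (rule compact_subset_open_imp_ball_epsilon_subset[OF cf H.open_W H.W_frontier])
        then show thesis using that[of e] by (auto simp: subset_iff)
      qed
      define T where "T = periodic_extension (h ` P) \<inter> ball x (min e (1/4))"
      have o: "open T" unfolding T_def by (intro open_Int Q.open_extension open_ball)
      have inW: "y - cell_index y \<in> W" if y: "y \<in> ball x (min e (1/4))" for y
      proof -
        define r where "r = y - cell_index y"
        have rc: "r \<in> closure cell" unfolding r_def by (rule cell_index_closure)
        have d: "\<bar>x $ i - y $ i\<bar> < min e (1/4)"
          using component_le_norm_cart[of "x - y" i] y by (simp add: dist_norm)
        \<comment> \<open>\<open>a\<close> is the face value nearest to the i-th coordinate of
          \<open>r\<close>, and \<open>p\<close> is the projection of \<open>r\<close> onto that
          face. Within distance 1/4 of the face through \<open>x\<close> the integer part changes by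
          at most one, which gives the two cases below.\<close>
        define a :: real where "a = (if r $ i < 0 then - 1/2 else 1/2)"
        define p where "p = (\<chi> j. if j = i then a else r $ j)"
        have xi: "x $ i + 1/2 = of_int \<lfloor>x $ i + 1/2\<rfloor>" using i by (simp add: cell_index_def)
        have ri: "r $ i = y $ i - of_int \<lfloor>y $ i + 1/2\<rfloor>" by (simp add: r_def cell_index_def)
        have "\<bar>r $ i - a\<bar> < min e (1/4)"
        proof (cases "x $ i \<le> y $ i")
          case True
          then have "\<lfloor>y $ i + 1/2\<rfloor> = \<lfloor>x $ i + 1/2\<rfloor>" using d xi by (intro floor_unique) auto
          then show ?thesis using d True xi unfolding ri a_def by auto
        next
          case False
          then have "\<lfloor>y $ i + 1/2\<rfloor> = \<lfloor>x $ i + 1/2\<rfloor> - 1" using d xi by (intro floor_unique) auto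
          then show ?thesis using d False xi unfolding ri a_def by auto
        qed
        moreover have "norm (p - r) \<le> \<bar>a - r $ i\<bar>"
        proof -
          have "p - r = (a - r $ i) *\<^sub>R axis i 1" by (simp add: vec_eq_iff p_def axis_def)
          then show ?thesis by simp
        qed
        ultimately have "dist p r < e" by (simp add: dist_norm abs_minus_commute)
        moreover have "p \<in> frontier cell"
        proof -
          have "p \<in> closure cell" using rc unfolding mem_closure_cell by (auto simp: p_def a_def)
          moreover have "p $ i = a" by (simp add: p_def)
          then have "p \<notin> cell" using mem_cell[of p] unfolding a_def by (metis order.irrefl)
          ultimately show ?thesis by (simp add: frontier_cell)
        qed
        ultimately show ?thesis using e(2) unfolding r_def by blast
      qed
      have eq: "y \<in> periodic_extension P \<and> per_push \<phi> y = \<phi> y" if y: "y \<in> T" for y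
      proof -
        define r where "r = y - cell_index y"
        have rc: "r \<in> closure cell" unfolding r_def by (rule cell_index_closure)
        have kr: "k r = r" using K.h_id inW y rc unfolding T_def r_def by blast
        have zl: "- cell_index y \<in> lattice_points" by (rule lattice_minus[OF cell_index_lattice])
        have rQ: "r \<in> periodic_extension (h ` P)"
          using Q.extension_translate[OF zl, of y] y unfolding T_def r_def by simp
        have rP: "r \<in> periodic_extension P"
        proof (cases "r \<in> cell")
          case True
          then have "r \<in> h ` P" using rQ Q.extension_Int_cell by blast
          then have "r \<in> P" using kr kQ by metis
          then show ?thesis using P_subset_extension by blast
        next
          case False
          then obtain l where "(y - cell_index y) $ l = - 1/2" unfolding r_def by (rule not_cell_boundary)
          then have "r $ l + 1/2 \<in> \<int>" by (simp add: r_def)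
          then show ?thesis by (rule boundary_in_extension)
        qed
        then have yP: "y \<in> periodic_extension P" using extension_translate[OF zl, of y] by (simp add: r_def)
        have "\<phi> (r + cell_index y) = \<phi> r" by (rule \<phi>(2)[OF rP cell_index_lattice])
        then show ?thesis using yP kr by (simp add: per_push_def r_def)
      qed
      have "T \<subseteq> periodic_extension P" using eq by blast
      then have "C1_on \<phi> T" by (rule C1_on_subset[OF \<phi>(1)])
      then have "Ck_on 1 \<phi> T" by (simp only: Ck_on_1_iff_C1_on[OF o])
      then have "Ck_on 1 (per_push \<phi>) T" by (rule Ck_on_cong[OF o]) (simp add: eq)
      moreover have "x \<in> T" using x e(1) by (simp add: T_def)
      ultimately show ?thesis using o by blast
    qed
  qed
  then show ?thesis by (simp only: Ck_on_1_iff_C1_on[OF Q.open_extension])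
qed

text \<open>For the \<open>C^1\<close> approximants this is the chain rule, with gradients as row
  vectors times the Jacobian of \<open>k\<close>. Composition with \<open>k\<close> and
  multiplication by the bounded \<open>Dk\<close> are continuous in the square norm, so the relation
  passes to the limit.\<close>

lemma H1_per_push:
  assumes H: "H1_per u v"
  shows "Q.H1_per (\<lambda>y. u (k y)) (\<lambda>y. v (k y) v* Dk y)"
proof -
  interpret inv: perforated_diffeo k h Dk Dh W "h ` P"
    by (rule perforated_diffeo.intro[OF swap Q.perforated_cell_axioms]) (unfold_locales, rule dim)
  have kQP: "k ` h ` P = P" by (rule image_image_k) (use P_cell cell_closure in blast)
  obtain C where C: "0 \<le> C"
    "\<forall>q :: real^'n \<Rightarrow> real. q \<in> L2v M \<longrightarrow> (\<lambda>x. q (k x)) \<in> L2v Q.M \<and> L2n Q.M (\<lambda>x. q (k x)) \<le> C * L2n M q"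
    "\<forall>q :: real^'n \<Rightarrow> real^'n. q \<in> L2v M \<longrightarrow> (\<lambda>x. q (k x)) \<in> L2v Q.M \<and> L2n Q.M (\<lambda>x. q (k x)) \<le> C * L2n M q"
    by (rule inv.L2v_pull[unfolded kQP])
  obtain D where D: "0 \<le> D"
    "\<forall>f. f \<in> L2v Q.M \<longrightarrow> (\<lambda>x. f x v* Dk x) \<in> L2v Q.M \<and> L2n Q.M (\<lambda>x. f x v* Dk x) \<le> D * L2n Q.M f"
    by (rule Q.L2v_vector_matrix[OF Dk_continuous_Q Dk_bounded_Q])
  have push2: "(\<lambda>y. q (k y) v* Dk y) \<in> L2v Q.M \<and> L2n Q.M (\<lambda>y. q (k y) v* Dk y) \<le> D * (C * L2n M q)"
    if "q \<in> L2v M" for q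
    using C(3)[rule_format, OF that] D mult_left_mono[OF _ D(1)] by (meson order_trans)
  have L: "u \<in> L2v M" "v \<in> L2v M" using H by (auto simp: H1_per_def)
  obtain \<phi> where \<phi>: "\<And>n. C1_per (\<phi> n)" "(\<lambda>n. L2n M (\<lambda>x. \<phi> n x - u x)) \<longlonglongrightarrow> 0"
    "(\<lambda>n. L2n M (\<lambda>x. grad (\<phi> n) x - v x)) \<longlonglongrightarrow> 0" by (rule H1_per_sequence[OF H]) (rule that)
  have \<phi>L: "\<phi> n \<in> L2v M" "grad (\<phi> n) \<in> L2v M" for n using \<phi>(1) by (auto simp: C1_per_def)
  show ?thesis
  proof (rule Q.H1_perI)
    show "(\<lambda>y. u (k y)) \<in> L2v Q.M" using C(2) L(1) by blast
    show "(\<lambda>y. v (k y) v* Dk y) \<in> L2v Q.M" using push2[OF L(2)] by blast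
    show "(\<lambda>n. C * L2n M (\<lambda>x. \<phi> n x - u x)) \<longlonglongrightarrow> 0" "(\<lambda>n. D * (C * L2n M (\<lambda>x. grad (\<phi> n) x - v x))) \<longlonglongrightarrow> 0"
      by (intro tendsto_mult_right_zero \<phi>)+
    fix n
    define \<psi> where "\<psi> = per_push (\<phi> n)"
    have \<psi>1: "\<psi> y = \<phi> n (k y)" if "y \<in> h ` P" for y unfolding \<psi>_def by (rule per_push_Q[OF that])
    have \<psi>2: "grad \<psi> y = grad (\<phi> n) (k y) v* Dk y" if "y \<in> h ` P" for y
      using grad_cong[OF Q.open_P that \<psi>1] compose_k_C1(2)[OF C1_per_C1_on[OF \<phi>(1)] that] by simp
    have "\<psi> \<in> L2v Q.M"
      by (rule L2v_cong_AE_lebesgue_on(1)[of _ "\<lambda>y. \<phi> n (k y)"])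
        (use C(2) \<phi>L Q.open_P in \<open>auto intro!: AE_I2 simp: \<psi>1\<close>)
    moreover have "grad \<psi> \<in> L2v Q.M"
      by (rule L2v_cong_AE_lebesgue_on(1)[of _ "\<lambda>y. grad (\<phi> n) (k y) v* Dk y"])
        (use push2 \<phi>L Q.open_P in \<open>auto intro!: AE_I2 simp: \<psi>2\<close>)
    moreover have "C1_on \<psi> (periodic_extension (h ` P))"
      unfolding \<psi>_def by (rule per_push_C1_on) (use \<phi>(1) in \<open>auto simp: C1_per_def\<close>)
    moreover have "\<psi> (x + z) = \<psi> x" if "z \<in> lattice_points" for x z
      using cell_index_translate[OF that, of x] by (simp add: \<psi>_def per_push_def)
    ultimately show "Q.C1_per (per_push (\<phi> n))" by (simp add: Q.C1_per_def \<psi>_def)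
    have "L2n Q.M (\<lambda>y. \<psi> y - u (k y)) = L2n Q.M (\<lambda>y. (\<lambda>x. \<phi> n x - u x) (k y))"
      by (rule L2n_cong) (simp add: \<psi>1)
    also have "\<dots> \<le> C * L2n M (\<lambda>x. \<phi> n x - u x)" using C(2) L2v_diff[OF \<phi>L(1) L(1)] by blast
    finally show "L2n Q.M (\<lambda>y. per_push (\<phi> n) y - u (k y)) \<le> \<dots>" by (simp add: \<psi>_def)
    have "L2n Q.M (\<lambda>y. grad \<psi> y - v (k y) v* Dk y) = L2n Q.M (\<lambda>y. (\<lambda>x. grad (\<phi> n) x - v x) (k y) v* Dk y)"
      by (rule L2n_cong) (simp add: \<psi>2 bounded_bilinear.diff_left[OF bounded_bilinear_vector_matrix])
    also have "\<dots> \<le> D * (C * L2n M (\<lambda>x. grad (\<phi> n) x - v x))" using push2[OF L2v_diff[OF \<phi>L(2) L(2)]] by blast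
    finally show "L2n Q.M (\<lambda>y. grad (per_push (\<phi> n)) y - v (k y) v* Dk y) \<le> \<dots>" by (simp add: \<psi>_def)
  qed
qed

end

section \<open>The Poincare inequality\<close>

lemma nn_integral_affine:
  fixes g :: "'a::euclidean_space \<Rightarrow> ennreal"
  assumes [measurable]: "g \<in> borel_measurable borel" and "c \<noteq> 0"
  shows "(\<integral>\<^sup>+x. g (t + c *\<^sub>R x) \<partial>lborel) = ennreal ((1 / \<bar>c\<bar>) ^ DIM('a)) * (\<integral>\<^sup>+x. g x \<partial>lborel)"
proof -
  have "(\<integral>\<^sup>+x. g x \<partial>lborel) = (\<integral>\<^sup>+x. ennreal (\<bar>c\<bar> ^ DIM('a)) * g (t + c *\<^sub>R x) \<partial>lborel)"
    by (subst lborel_affine[OF assms(2), of t]) (simp add: nn_integral_density nn_integral_distr)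
  also have "\<dots> = ennreal (\<bar>c\<bar> ^ DIM('a)) * (\<integral>\<^sup>+x. g (t + c *\<^sub>R x) \<partial>lborel)"
    by (rule nn_integral_cmult) measurable
  finally have "ennreal ((1 / \<bar>c\<bar>) ^ DIM('a)) * (\<integral>\<^sup>+x. g x \<partial>lborel) =
      ennreal ((1 / \<bar>c\<bar>) ^ DIM('a) * \<bar>c\<bar> ^ DIM('a)) * (\<integral>\<^sup>+x. g (t + c *\<^sub>R x) \<partial>lborel)"
    by (simp add: ennreal_mult mult.assoc)
  also have "(1 / \<bar>c\<bar>) ^ DIM('a) * \<bar>c\<bar> ^ DIM('a) = 1"
    using assms(2) by (simp flip: power_mult_distrib)
  finally show ?thesis by simp
qed

definition energy_density :: "(real^'n) set \<Rightarrow> (real^'n \<Rightarrow> real) \<Rightarrow> real^'n \<Rightarrow> ennreal" where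
  "energy_density S \<phi> x = indicator S x * ennreal ((norm (grad \<phi> x))\<^sup>2)"

lemma energy_density_measurable:
  assumes "open S" "C1_on \<phi> S"
  shows "energy_density S \<phi> \<in> borel_measurable borel"
proof -
  have "(\<lambda>x. indicator S x *\<^sub>R grad \<phi> x) \<in> borel_measurable borel"
    using assms by (intro borel_measurable_continuous_on_indicator) (auto simp: C1_on_def)
  then have "(\<lambda>x. ennreal ((norm (indicator S x *\<^sub>R grad \<phi> x))\<^sup>2)) \<in> borel_measurable borel" by measurable
  moreover have "(\<lambda>x. ennreal ((norm (indicator S x *\<^sub>R grad \<phi> x))\<^sup>2)) = energy_density S \<phi>"
    by (auto simp: energy_density_def fun_eq_iff split: split_indicator)
  ultimately show ?thesis by (simp only:)
qed

text \<open>The fundamental theorem of calculus along the segment, followed by Cauchy--Schwarz on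
  the unit interval.\<close>

lemma segment_estimate:
  fixes y z :: "real^'n"
  assumes \<phi>: "C1_on \<phi> S" and seg: "\<And>t. 0 \<le> t \<Longrightarrow> t \<le> 1 \<Longrightarrow> y + t *\<^sub>R (z - y) \<in> S"
  shows "ennreal ((\<phi> y - \<phi> z)\<^sup>2) \<le> ennreal ((norm (z - y))\<^sup>2) *
    (\<integral>\<^sup>+t. indicator {0..1} t * energy_density S \<phi> (y + t *\<^sub>R (z - y)) \<partial>lborel)"
proof -
  define p where "p t = y + t *\<^sub>R (z - y)" for t :: real
  define f' where "f' t = grad \<phi> (p t) \<bullet> (z - y)" for t
  have pS: "p t \<in> S" if "t \<in> {0..1}" for t using seg that by (auto simp: p_def)
  have cg: "continuous_on {0..1} (\<lambda>t. grad \<phi> (p t))"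
    by (rule continuous_on_compose2[of S "grad \<phi>" "{0..1}" p])
      (use \<phi> pS in \<open>auto simp: C1_on_def p_def intro!: continuous_intros\<close>)
  have cf: "continuous_on {0..1} f'" unfolding f'_def by (intro continuous_intros cg)
  have d: "((\<lambda>t. \<phi> (p t)) has_vector_derivative f' t) (at t within {0..1})" if "0 \<le> t" "t \<le> 1" for t
  proof -
    have "(p has_derivative (\<lambda>s. s *\<^sub>R (z - y))) (at t)"
      unfolding p_def by (auto intro!: derivative_eq_intros)
    from diff_chain_at[OF this C1_on_deriv[OF \<phi> pS]] that
    have "((\<lambda>t. \<phi> (p t)) has_derivative (\<lambda>s. s *\<^sub>R f' t)) (at t)" by (simp add: o_def f'_def)
    then show ?thesis unfolding has_vector_derivative_def by (rule has_derivative_at_withinI)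
  qed
  have "(LINT t|lborel. indicator {0..1} t *\<^sub>R f' t) = \<phi> (p 1) - \<phi> (p 0)"
    by (rule integral_FTC_atLeastAtMost) (use d cf in auto)
  then have ftc: "(LINT t|lborel. indicator {0..1} t *\<^sub>R f' t) = \<phi> z - \<phi> y" by (simp add: p_def)
  have int: "integrable lborel (\<lambda>t. indicator {0..1} t *\<^sub>R f' t)"
    using borel_integrable_atLeastAtMost'[OF cf] by (simp add: set_integrable_def)
  then have fm: "(\<lambda>t. indicator {0..1} t *\<^sub>R f' t) \<in> borel_measurable lborel" by (rule borel_measurable_integrable)
  have "ennreal \<bar>\<phi> y - \<phi> z\<bar> \<le> (\<integral>\<^sup>+t. ennreal (norm (indicator {0..1} t *\<^sub>R f' t)) \<partial>lborel)"
    using integral_norm_bound_ennreal[OF int] ftc by (simp add: abs_minus_commute)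
  also have "\<dots> = (\<integral>\<^sup>+t. indicator {0..1} t * ennreal (norm (indicator {0..1} t *\<^sub>R f' t)) \<partial>lborel)"
    by (intro nn_integral_cong) (auto split: split_indicator)
  finally have "(ennreal \<bar>\<phi> y - \<phi> z\<bar>)\<^sup>2 \<le> \<dots>\<^sup>2" by (rule power_mono) simp
  also have "\<dots> \<le> (\<integral>\<^sup>+t. (indicator {0..1::real} t)\<^sup>2 \<partial>lborel) *
      (\<integral>\<^sup>+t. (ennreal (norm (indicator {0..1} t *\<^sub>R f' t)))\<^sup>2 \<partial>lborel)"
    by (rule Cauchy_Schwarz_nn_integral) (use fm in measurable)
  also have "(\<integral>\<^sup>+t. (indicator {0..1::real} t)\<^sup>2 \<partial>lborel) = (\<integral>\<^sup>+t. indicator {0..1::real} t \<partial>lborel)"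
    by (intro nn_integral_cong) (auto split: split_indicator)
  also have "(\<integral>\<^sup>+t. indicator {0..1::real} t \<partial>lborel) = 1" by simp
  also have "(\<integral>\<^sup>+t. (ennreal (norm (indicator {0..1} t *\<^sub>R f' t)))\<^sup>2 \<partial>lborel) \<le>
      (\<integral>\<^sup>+t. ennreal ((norm (z - y))\<^sup>2) * (indicator {0..1} t * ennreal ((norm (grad \<phi> (p t)))\<^sup>2)) \<partial>lborel)"
  proof (rule nn_integral_mono)
    fix t :: real
    have "(norm (f' t))\<^sup>2 \<le> (norm (grad \<phi> (p t)) * norm (z - y))\<^sup>2"
      unfolding f'_def by (intro power_mono) (auto simp: Cauchy_Schwarz_ineq2)
    then have "ennreal ((norm (f' t))\<^sup>2) \<le> ennreal ((norm (z - y))\<^sup>2) * ennreal ((norm (grad \<phi> (p t)))\<^sup>2)"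
      by (subst ennreal_mult[symmetric]) (auto simp: power_mult_distrib mult.commute intro!: ennreal_leI)
    then show "(ennreal (norm (indicator {0..1} t *\<^sub>R f' t)))\<^sup>2 \<le>
        ennreal ((norm (z - y))\<^sup>2) * (indicator {0..1} t * ennreal ((norm (grad \<phi> (p t)))\<^sup>2))"
      by (auto simp: ennreal_power split: split_indicator)
  qed
  also have "\<dots> = ennreal ((norm (z - y))\<^sup>2) * (\<integral>\<^sup>+t. indicator {0..1} t * ennreal ((norm (grad \<phi> (p t)))\<^sup>2) \<partial>lborel)"
  proof (rule nn_integral_cmult)
    have "(\<lambda>t. indicator {0..1} t *\<^sub>R grad \<phi> (p t)) \<in> borel_measurable borel"
      by (rule borel_measurable_continuous_on_indicator[OF _ cg]) simp
    then have "(\<lambda>t. ennreal ((norm (indicator {0..1} t *\<^sub>R grad \<phi> (p t)))\<^sup>2)) \<in> borel_measurable lborel" by measurable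
    moreover have "(\<lambda>t. ennreal ((norm (indicator {0..1} t *\<^sub>R grad \<phi> (p t)))\<^sup>2)) =
        (\<lambda>t. indicator {0..1} t * ennreal ((norm (grad \<phi> (p t)))\<^sup>2))"
      by (auto simp: fun_eq_iff split: split_indicator)
    ultimately show "(\<lambda>t. indicator {0..1} t * ennreal ((norm (grad \<phi> (p t)))\<^sup>2)) \<in> borel_measurable lborel"
      by (simp only:)
  qed
  also have "(\<integral>\<^sup>+t. indicator {0..1} t * ennreal ((norm (grad \<phi> (p t)))\<^sup>2) \<partial>lborel) =
      (\<integral>\<^sup>+t. indicator {0..1} t * energy_density S \<phi> (y + t *\<^sub>R (z - y)) \<partial>lborel)"
    by (intro nn_integral_cong) (use pS in \<open>auto simp: energy_density_def p_def split: split_indicator\<close>)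
  finally show ?thesis by (simp add: ennreal_power mult_left_mono)
qed

section \<open>Local Poincare estimates and their gluing\<close>

abbreviation deviation :: "(real^'n) set \<Rightarrow> (real^'n \<Rightarrow> real) \<Rightarrow> real \<Rightarrow> ennreal" where
  "deviation A \<phi> c \<equiv> \<integral>\<^sup>+x. indicator A x * ennreal ((\<phi> x - c)\<^sup>2) \<partial>lborel"

abbreviation energy :: "(real^'n) set \<Rightarrow> (real^'n \<Rightarrow> real) \<Rightarrow> ennreal" where
  "energy S \<phi> \<equiv> \<integral>\<^sup>+x. energy_density S \<phi> x \<partial>lborel"

definition poincare_set :: "(real^'n) set \<Rightarrow> (real^'n) set \<Rightarrow> bool" where
  "poincare_set S A \<longleftrightarrow> (\<exists>C>0. \<forall>\<phi>. C1_on \<phi> S \<longrightarrow>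
     (\<exists>c. deviation A \<phi> c \<le>
          ennreal C * energy S \<phi>))"

lemma C1_on_indicator_measurable:
  assumes "open S" "C1_on \<phi> S" "open A" "A \<subseteq> S"
  shows "(\<lambda>x. indicator A x * ennreal ((\<phi> x - c)\<^sup>2)) \<in> borel_measurable lborel"
proof -
  have "(\<lambda>x. indicator A x *\<^sub>R (\<phi> x - c)) \<in> borel_measurable borel"
    using assms by (intro borel_measurable_continuous_on_indicator)
      (auto intro!: continuous_intros continuous_on_subset[OF C1_on_continuous[OF assms(2)]])
  then have "(\<lambda>x. ennreal ((indicator A x *\<^sub>R (\<phi> x - c))\<^sup>2)) \<in> borel_measurable lborel" by measurable
  moreover have "(\<lambda>x. ennreal ((indicator A x *\<^sub>R (\<phi> x - c))\<^sup>2)) = (\<lambda>x. indicator A x * ennreal ((\<phi> x - c)\<^sup>2))"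
    by (auto simp: fun_eq_iff split: split_indicator)
  ultimately show ?thesis by (simp only:)
qed

lemma bounded_open_measure:
  fixes S :: "'a::euclidean_space set"
  assumes "open S" "bounded S"
  shows "emeasure lborel S = ennreal (measure lborel S)" "S \<noteq> {} \<Longrightarrow> measure lborel S > 0"
proof -
  show 1: "emeasure lborel S = ennreal (measure lborel S)"
    using emeasure_bounded_finite[OF assms(2)] by (auto intro!: emeasure_eq_ennreal_measure)
  assume "S \<noteq> {}"
  then have "S \<notin> null_sets lborel"
    using assms(1) open_not_negligible null_sets_completionI negligible_iff_null_sets by blast
  then show "measure lborel S > 0" using 1 assms(1) by (auto simp: null_sets_def zero_less_measure_iff)
qed

text \<open>The average of \<open>\<phi> y - \<phi> z\<close> over \<open>y \<in> A\<close>, \<open>z \<in> B\<close> is controlled by the energy on the segments from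
  \<open>y\<close> to \<open>z\<close>. The map \<open>(y, z) \<mapsto> y + t (z - y)\<close> contracts in \<open>y\<close> at most by the factor \<open>1/2\<close> if \<open>t \<le> 1/2\<close>,
  and in \<open>z\<close> otherwise.\<close>

lemma poincare_set_segments:
  fixes S :: "(real^'n) set"
  assumes S: "open S" and AB: "open A" "open B" "A \<subseteq> S" "B \<subseteq> S" "bounded A" "bounded B" "B \<noteq> {}"
    and seg: "\<And>y z t. y \<in> A \<Longrightarrow> z \<in> B \<Longrightarrow> 0 \<le> t \<Longrightarrow> t \<le> 1 \<Longrightarrow> y + t *\<^sub>R (z - y) \<in> S"
  shows "poincare_set S A"
proof -
  have [measurable]: "A \<in> sets borel" "B \<in> sets borel" using AB by auto
  obtain R where R: "R > 0" "\<And>y z. y \<in> A \<Longrightarrow> z \<in> B \<Longrightarrow> norm (z - y) \<le> R"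
  proof -
    obtain a b where ab: "\<And>y. y \<in> A \<Longrightarrow> norm y \<le> a" "\<And>z. z \<in> B \<Longrightarrow> norm z \<le> b"
      using AB(5,6) unfolding bounded_iff by blast
    have "norm (z - y) \<le> max 1 (a + b)" if "y \<in> A" "z \<in> B" for y z
      using ab(1)[OF that(1)] ab(2)[OF that(2)] norm_triangle_ineq4[of z y] by linarith
    then show thesis using that[of "max 1 (a + b)"] by auto
  qed
  define a b where "a = measure lborel A" and "b = measure lborel B"
  have ab: "emeasure lborel A = ennreal a" "emeasure lborel B = ennreal b" and b: "b > 0"
    unfolding a_def b_def using bounded_open_measure[of A] bounded_open_measure[of B] AB by auto
  have a: "a \<ge> 0" by (simp add: a_def)
  \<comment> \<open>\<open>R\<close> bounds the length of the segments, the power of 2 is the cost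
    of a contraction by a factor of at least 1/2, and the division by \<open>b\<close> turns an
    integral over \<open>B\<close> into an average.\<close>
  define C where "C = R\<^sup>2 * (2 ^ CARD('n) * (a + b)) / b"
  have Cpos: "C > 0" unfolding C_def using R(1) a b by (intro divide_pos_pos mult_pos_pos zero_less_power add_nonneg_pos) auto
  have "\<exists>c. deviation A \<phi> c \<le>
      ennreal C * energy S \<phi>" if \<phi>: "C1_on \<phi> S" for \<phi>
  proof -
    define g where "g = energy_density S \<phi>"
    have gm[measurable]: "g \<in> borel_measurable borel" unfolding g_def by (rule energy_density_measurable[OF S \<phi>])
    define E where "E = (\<integral>\<^sup>+x. g x \<partial>lborel)"
    let ?G = "\<lambda>t y z. indicator A y * indicator B z * g (y + t *\<^sub>R (z - y))"
    let ?H = "\<lambda>t y z. ennreal (R\<^sup>2) * (indicator {0..1} t * ?G t y z)"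
    define T where "T t = (\<integral>\<^sup>+y. \<integral>\<^sup>+z. ?G t y z \<partial>lborel \<partial>lborel)" for t :: real
    let ?D = "ennreal (2 ^ CARD('n))"
    have pw: "ennreal ((1 / \<bar>c\<bar>) ^ CARD('n)) \<le> ?D" if "1/2 \<le> \<bar>c\<bar>" for c :: real
      using that by (intro ennreal_leI power_mono) (auto simp: divide_simps)
    have T1: "T t \<le> ennreal (a * 2 ^ CARD('n)) * E" if t: "1/2 \<le> t" for t
    proof -
      have "T t \<le> (\<integral>\<^sup>+y. indicator A y * (?D * E) \<partial>lborel)"
        unfolding T_def
      proof (rule nn_integral_mono)
        fix y
        have "(\<integral>\<^sup>+z. ?G t y z \<partial>lborel) \<le>
            (\<integral>\<^sup>+z. indicator A y * g ((y - t *\<^sub>R y) + t *\<^sub>R z) \<partial>lborel)"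
          by (intro nn_integral_mono) (auto split: split_indicator simp: algebra_simps)
        also have "\<dots> = indicator A y * (ennreal ((1 / \<bar>t\<bar>) ^ CARD('n)) * E)"
          using t nn_integral_affine[OF gm, of t "y - t *\<^sub>R y"] unfolding E_def
          by (subst nn_integral_cmult) auto
        also have "\<dots> \<le> indicator A y * (?D * E)"
          using pw[of t] t by (intro mult_left_mono mult_right_mono) auto
        finally show "(\<integral>\<^sup>+z. ?G t y z \<partial>lborel) \<le>
            indicator A y * (?D * E)" .
      qed
      also have "\<dots> = ennreal (a * 2 ^ CARD('n)) * E"
        using a ab(1) by (subst nn_integral_multc) (auto simp: ennreal_mult mult.assoc)
      finally show ?thesis .
    qed
    have T2: "T t \<le> ennreal (b * 2 ^ CARD('n)) * E" if t: "t \<le> 1/2" for t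
    proof -
      \<comment> \<open>For these \<open>t\<close> the substitution is made in \<open>y\<close>, so
        the integral over \<open>y\<close> has to be the inner one.\<close>
      have "T t = (\<integral>\<^sup>+z. \<integral>\<^sup>+y. ?G t y z \<partial>lborel \<partial>lborel)"
        unfolding T_def by (rule lborel_pair.Fubini'[symmetric]) measurable
      also have "\<dots> \<le> (\<integral>\<^sup>+z. indicator B z * (?D * E) \<partial>lborel)"
      proof (rule nn_integral_mono)
        fix z
        have "(\<integral>\<^sup>+y. ?G t y z \<partial>lborel) \<le>
            (\<integral>\<^sup>+y. indicator B z * g (t *\<^sub>R z + (1 - t) *\<^sub>R y) \<partial>lborel)"
          by (intro nn_integral_mono) (auto split: split_indicator simp: algebra_simps)
        also have "\<dots> = indicator B z * (ennreal ((1 / \<bar>1 - t\<bar>) ^ CARD('n)) * E)"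
          using t nn_integral_affine[OF gm, of "1 - t" "t *\<^sub>R z"] unfolding E_def
          by (subst nn_integral_cmult) auto
        also have "\<dots> \<le> indicator B z * (?D * E)"
          using pw[of "1 - t"] t by (intro mult_left_mono mult_right_mono) auto
        finally show "(\<integral>\<^sup>+y. ?G t y z \<partial>lborel) \<le>
            indicator B z * (?D * E)" .
      qed
      also have "\<dots> = ennreal (b * 2 ^ CARD('n)) * E"
        using b ab(2) by (subst nn_integral_multc) (auto simp: ennreal_mult mult.assoc)
      finally show ?thesis .
    qed
    have T: "T t \<le> ennreal (2 ^ CARD('n) * (a + b)) * E" for t
    proof (cases "1/2 \<le> t")
      case True
      have "ennreal (a * 2 ^ CARD('n)) \<le> ennreal (2 ^ CARD('n) * (a + b))" using b by (intro ennreal_leI) simp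
      then show ?thesis using T1[OF True] mult_right_mono order_trans by (metis zero_le)
    next
      case False
      have "ennreal (b * 2 ^ CARD('n)) \<le> ennreal (2 ^ CARD('n) * (a + b))" using a by (intro ennreal_leI) simp
      moreover have "t \<le> 1/2" using False by simp
      ultimately show ?thesis using T2 mult_right_mono order_trans by (metis zero_le)
    qed
    define dd where "dd z = deviation A \<phi> (\<phi> z)" for z
    have dd: "(\<integral>\<^sup>+z. indicator B z * dd z \<partial>lborel) \<le> ennreal (R\<^sup>2 * (2 ^ CARD('n) * (a + b))) * E"
    proof -
      have "(\<integral>\<^sup>+z. indicator B z * dd z \<partial>lborel) \<le>
          (\<integral>\<^sup>+z. \<integral>\<^sup>+y. \<integral>\<^sup>+t. ?H t y z
            \<partial>lborel \<partial>lborel \<partial>lborel)"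
      proof (rule nn_integral_mono)
        fix z
        have "indicator B z * dd z = (\<integral>\<^sup>+y. indicator B z * (indicator A y * ennreal ((\<phi> y - \<phi> z)\<^sup>2)) \<partial>lborel)"
          unfolding dd_def using C1_on_indicator_measurable[OF S \<phi> AB(1,3)] by (subst nn_integral_cmult) auto
        also have "\<dots> \<le> (\<integral>\<^sup>+y. \<integral>\<^sup>+t. ?H t y z
            \<partial>lborel \<partial>lborel)"
        proof (rule nn_integral_mono)
          fix y
          show "indicator B z * (indicator A y * ennreal ((\<phi> y - \<phi> z)\<^sup>2)) \<le>
            (\<integral>\<^sup>+t. ?H t y z \<partial>lborel)"
          proof (cases "y \<in> A \<and> z \<in> B")
            case True
            have "ennreal ((\<phi> y - \<phi> z)\<^sup>2) \<le> ennreal ((norm (z - y))\<^sup>2) * (\<integral>\<^sup>+t. indicator {0..1} t * g (y + t *\<^sub>R (z - y)) \<partial>lborel)"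
              unfolding g_def using True seg by (intro segment_estimate \<phi>) auto
            also have "\<dots> \<le> ennreal (R\<^sup>2) * (\<integral>\<^sup>+t. indicator {0..1} t * g (y + t *\<^sub>R (z - y)) \<partial>lborel)"
              using R(2)[of y z] True by (intro mult_right_mono ennreal_leI power_mono) auto
            also have "\<dots> = (\<integral>\<^sup>+t. ennreal (R\<^sup>2) * (indicator {0..1} t * g (y + t *\<^sub>R (z - y))) \<partial>lborel)"
              by (rule nn_integral_cmult[symmetric]) measurable
            finally show ?thesis using True by simp
          qed auto
        qed
        finally show "indicator B z * dd z \<le> (\<integral>\<^sup>+y. \<integral>\<^sup>+t. ?H t y z
            \<partial>lborel \<partial>lborel)" .
      qed
      also have "\<dots> = (\<integral>\<^sup>+z. \<integral>\<^sup>+t. \<integral>\<^sup>+y. ?H t y z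
            \<partial>lborel \<partial>lborel \<partial>lborel)"
        by (intro nn_integral_cong lborel_pair.Fubini') measurable
      also have "\<dots> = (\<integral>\<^sup>+t. \<integral>\<^sup>+z. \<integral>\<^sup>+y. ?H t y z
            \<partial>lborel \<partial>lborel \<partial>lborel)"
        by (rule lborel_pair.Fubini') measurable
      also have "\<dots> = (\<integral>\<^sup>+t. ennreal (R\<^sup>2) * (indicator {0..1} t * T t) \<partial>lborel)"
      proof (rule nn_integral_cong)
        fix t :: real
        have "(\<integral>\<^sup>+z. \<integral>\<^sup>+y. ?H t y z \<partial>lborel \<partial>lborel) =
            (\<integral>\<^sup>+y. \<integral>\<^sup>+z. ?H t y z \<partial>lborel \<partial>lborel)"
          by (rule lborel_pair.Fubini') measurable
        also have "\<dots> = ennreal (R\<^sup>2) * (indicator {0..1} t * T t)"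
          unfolding T_def by (simp add: nn_integral_cmult)
        finally show "(\<integral>\<^sup>+z. \<integral>\<^sup>+y. ?H t y z \<partial>lborel \<partial>lborel) =
          ennreal (R\<^sup>2) * (indicator {0..1} t * T t)" .
      qed
      also have "\<dots> \<le> (\<integral>\<^sup>+t. (ennreal (R\<^sup>2) * (ennreal (2 ^ CARD('n) * (a + b)) * E)) * indicator {0..1::real} t \<partial>lborel)"
        by (intro nn_integral_mono) (auto split: split_indicator intro!: mult_left_mono T)
      also have "\<dots> = ennreal (R\<^sup>2 * (2 ^ CARD('n) * (a + b))) * E"
        using a b by (subst nn_integral_cmult) (auto simp: ennreal_mult mult.assoc)
      finally show ?thesis .
    qed
    \<comment> \<open>By \<open>dd\<close> the integral over \<open>B\<close> is at most
      \<open>b * C * E\<close>, so the integrand cannot exceed \<open>C * E\<close> on all of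
      \<open>B\<close>. The value of the function at a suitable \<open>z\<close> then serves as the
      constant.\<close>
    have "\<exists>z\<in>B. dd z \<le> ennreal C * E"
    proof (rule ccontr)
      assume "\<not> (\<exists>z\<in>B. dd z \<le> ennreal C * E)"
      then have gt: "ennreal C * E < dd z" if "z \<in> B" for z using that by (auto simp: not_le)
      have Efin: "E < \<infinity>"
      proof (rule ccontr)
        assume "\<not> E < \<infinity>"
        then have "ennreal C * E = \<infinity>" using Cpos by (simp add: less_top[symmetric] ennreal_mult_eq_top_iff)
        then show False using gt AB(7) by fastforce
      qed
      define K where "K = ennreal C * E"
      have Kfin: "K < \<infinity>" unfolding K_def using Efin by (simp add: ennreal_mult_less_top)
      have le: "(\<integral>\<^sup>+z. indicator B z * K \<partial>lborel) \<le> (\<integral>\<^sup>+z. indicator B z * dd z \<partial>lborel)"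
        using gt unfolding K_def by (intro nn_integral_mono) (auto split: split_indicator intro: less_imp_le)
      have Kb: "(\<integral>\<^sup>+z. indicator B z * K \<partial>lborel) = ennreal (R\<^sup>2 * (2 ^ CARD('n) * (a + b))) * E"
      proof -
        have "(\<integral>\<^sup>+z. indicator B z * K \<partial>lborel) = ennreal b * K" using ab(2) by (subst nn_integral_multc) auto
        also have "\<dots> = ennreal (b * C) * E" unfolding K_def using b Cpos by (simp add: ennreal_mult mult.assoc)
        also have "b * C = R\<^sup>2 * (2 ^ CARD('n) * (a + b))" using b by (simp add: C_def)
        finally show ?thesis .
      qed
      have ddm: "(\<lambda>z. indicator B z * dd z) \<in> borel_measurable lborel"
      proof -
        have "(\<lambda>x. indicator S x *\<^sub>R \<phi> x) \<in> borel_measurable borel"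
          using S \<phi> C1_on_continuous by (intro borel_measurable_continuous_on_indicator) auto
        note [measurable] = this
        have "(\<lambda>z. indicator B z * (\<integral>\<^sup>+y. indicator A y * ennreal ((indicator S y *\<^sub>R \<phi> y - indicator S z *\<^sub>R \<phi> z)\<^sup>2) \<partial>lborel)) \<in> borel_measurable lborel"
          by measurable
        moreover have "indicator B z * (\<integral>\<^sup>+y. indicator A y * ennreal ((indicator S y *\<^sub>R \<phi> y - indicator S z *\<^sub>R \<phi> z)\<^sup>2) \<partial>lborel) =
            indicator B z * dd z" for z
        proof (cases "z \<in> B")
          case True
          then have "z \<in> S" using AB(4) by blast
          then have "(\<integral>\<^sup>+y. indicator A y * ennreal ((indicator S y *\<^sub>R \<phi> y - indicator S z *\<^sub>R \<phi> z)\<^sup>2) \<partial>lborel) = dd z"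
            unfolding dd_def by (intro nn_integral_cong) (use AB(3) in \<open>auto split: split_indicator\<close>)
          then show ?thesis by simp
        qed simp
        ultimately show ?thesis by simp
      qed
      have "(\<integral>\<^sup>+z. indicator B z * K \<partial>lborel) < (\<integral>\<^sup>+z. indicator B z * dd z \<partial>lborel)"
      proof (rule nn_integral_less)
        show "(\<integral>\<^sup>+z. indicator B z * K \<partial>lborel) \<noteq> \<infinity>" using Kfin ab(2) by (subst nn_integral_multc) (auto simp: ennreal_mult_eq_top_iff)
        show "AE z in lborel. indicator B z * K \<le> indicator B z * dd z"
          using gt unfolding K_def by (intro AE_I2) (auto split: split_indicator intro: less_imp_le)
        show "\<not> (AE z in lborel. indicator B z * dd z \<le> indicator B z * K)"
        proof
          assume "AE z in lborel. indicator B z * dd z \<le> indicator B z * K"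
          then have "AE z in lborel. z \<notin> B"
            by eventually_elim (use gt in \<open>auto simp: K_def not_less[symmetric] split: split_indicator_asm\<close>)
          then have "emeasure lborel B = 0" by (subst (asm) AE_iff_measurable[of B]) auto
          then show False using ab(2) b by simp
        qed
      qed (use ddm in measurable)
      then show False using dd Kb by simp
    qed
    then obtain z where "dd z \<le> ennreal C * E" by blast
    then show ?thesis unfolding dd_def E_def g_def by blast
  qed
  then show ?thesis unfolding poincare_set_def using Cpos by blast
qed

text \<open>The constants \<open>cA\<close> and \<open>cB\<close> both approximate the function on
  the overlap \<open>I\<close>, so their squared difference times the measure of \<open>I\<close> is
  controlled by the energy. On \<open>B\<close> the constant \<open>cB\<close> can then be exchanged
  for \<open>cA\<close>.\<close>

lemma poincare_set_Un:
  fixes S :: "(real^'n) set"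
  assumes S: "open S" and A: "open A" "A \<subseteq> S" "poincare_set S A" and B: "open B" "B \<subseteq> S" "poincare_set S B"
    and "A \<inter> B \<noteq> {}" "bounded A" "bounded B"
  shows "poincare_set S (A \<union> B)"
proof -
  obtain CA where CA: "CA > 0" "\<And>\<phi>. C1_on \<phi> S \<Longrightarrow> \<exists>c. deviation A \<phi> c \<le>
      ennreal CA * energy S \<phi>" using A(3) unfolding poincare_set_def by blast
  obtain CB where CB: "CB > 0" "\<And>\<phi>. C1_on \<phi> S \<Longrightarrow> \<exists>c. deviation B \<phi> c \<le>
      ennreal CB * energy S \<phi>" using B(3) unfolding poincare_set_def by blast
  define I where "I = A \<inter> B"
  have Io: "open I" "I \<noteq> {}" using A B assms(8) by (auto simp: I_def)
  have [measurable]: "A \<in> sets borel" "B \<in> sets borel" "I \<in> sets borel" using A B Io by auto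
  define m b where "m = measure lborel I" and "b = measure lborel B"
  have bI: "bounded I" using assms(9) by (auto simp: I_def)
  have mb: "emeasure lborel I = ennreal m" "emeasure lborel B = ennreal b" and m: "m > 0"
    unfolding m_def b_def using bounded_open_measure[of I] bounded_open_measure[of B] Io bI B(1) assms(10) by auto
  have b: "b \<ge> 0" by (simp add: b_def)
  have sq: "ennreal ((p - q)\<^sup>2) \<le> 2 * ennreal ((p - r)\<^sup>2) + 2 * ennreal ((r - q)\<^sup>2)" for p q r :: real
  proof -
    have "(p - q)\<^sup>2 \<le> 2 * (p - r)\<^sup>2 + 2 * (r - q)\<^sup>2"
      using zero_le_power2[of "(p - r) - (r - q)"] by (simp add: power2_eq_square algebra_simps)
    then have "ennreal ((p - q)\<^sup>2) \<le> ennreal (2 * (p - r)\<^sup>2 + 2 * (r - q)\<^sup>2)" by (rule ennreal_leI)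
    then show ?thesis by (simp add: ennreal_mult)
  qed
  \<comment> \<open>The ratio \<open>b / m\<close> of the measures of \<open>B\<close> and of the
    overlap transfers the estimate for cB - cA from \<open>I\<close> to \<open>B\<close>; the
    factors 2 come from squaring a sum of two terms.\<close>
  define C where "C = CA + 2 * CB + 2 * (b / m) * (2 * CA + 2 * CB)"
  have Cpos: "C > 0" unfolding C_def using CA(1) CB(1) b m by (intro add_pos_nonneg mult_nonneg_nonneg) auto
  have "\<exists>c. deviation (A \<union> B) \<phi> c \<le>
      ennreal C * energy S \<phi>" if \<phi>: "C1_on \<phi> S" for \<phi>
  proof -
    define E where "E = energy S \<phi>"
    obtain cA where cA: "deviation A \<phi> cA \<le> ennreal CA * E"
      using CA(2)[OF \<phi>] unfolding E_def by blast
    obtain cB where cB: "deviation B \<phi> cB \<le> ennreal CB * E"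
      using CB(2)[OF \<phi>] unfolding E_def by blast
    note mA = C1_on_indicator_measurable[OF S \<phi> A(1,2)] and mB = C1_on_indicator_measurable[OF S \<phi> B(1,2)]
    have "ennreal m * ennreal ((cB - cA)\<^sup>2) = (\<integral>\<^sup>+x. indicator I x * ennreal ((cB - cA)\<^sup>2) \<partial>lborel)"
      using mb(1) by (subst nn_integral_multc) auto
    also have "\<dots> \<le> (\<integral>\<^sup>+x. 2 * (indicator A x * ennreal ((\<phi> x - cA)\<^sup>2)) + 2 * (indicator B x * ennreal ((\<phi> x - cB)\<^sup>2)) \<partial>lborel)"
    proof (rule nn_integral_mono)
      fix x
      have "ennreal ((cB - cA)\<^sup>2) \<le> 2 * ennreal ((\<phi> x - cA)\<^sup>2) + 2 * ennreal ((\<phi> x - cB)\<^sup>2)"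
        using sq[of cB cA "\<phi> x"] by (simp add: power2_commute add.commute)
      then show "indicator I x * ennreal ((cB - cA)\<^sup>2) \<le> 2 * (indicator A x * ennreal ((\<phi> x - cA)\<^sup>2)) + 2 * (indicator B x * ennreal ((\<phi> x - cB)\<^sup>2))"
        by (auto simp: I_def split: split_indicator)
    qed
    also have "\<dots> = 2 * deviation A \<phi> cA + 2 * deviation B \<phi> cB"
      using mA mB by (subst nn_integral_add) (auto simp: nn_integral_cmult)
    also have "\<dots> \<le> 2 * (ennreal CA * E) + 2 * (ennreal CB * E)" by (intro add_mono mult_left_mono cA cB) auto
    also have "\<dots> = ennreal (2 * CA + 2 * CB) * E"
      using CA(1) CB(1) by (simp add: ennreal_mult distrib_right mult.assoc)
    finally have mc: "ennreal m * ennreal ((cB - cA)\<^sup>2) \<le> ennreal (2 * CA + 2 * CB) * E" .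
    have bc: "ennreal b * ennreal ((cB - cA)\<^sup>2) \<le> ennreal ((b / m) * (2 * CA + 2 * CB)) * E"
    proof -
      have "ennreal b * ennreal ((cB - cA)\<^sup>2) = ennreal (b / m) * (ennreal m * ennreal ((cB - cA)\<^sup>2))"
        using m b by (simp flip: ennreal_mult mult.assoc)
      also have "\<dots> \<le> ennreal (b / m) * (ennreal (2 * CA + 2 * CB) * E)" by (intro mult_left_mono mc) simp
      also have "\<dots> = ennreal ((b / m) * (2 * CA + 2 * CB)) * E"
        using m b CA(1) CB(1) by (subst ennreal_mult[of "b / m" "2 * CA + 2 * CB"]) (auto simp: mult.assoc)
      finally show ?thesis .
    qed
    have "deviation (A \<union> B) \<phi> cA \<le>
        (\<integral>\<^sup>+x. indicator A x * ennreal ((\<phi> x - cA)\<^sup>2) + (2 * (indicator B x * ennreal ((\<phi> x - cB)\<^sup>2)) +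
          2 * (indicator B x * ennreal ((cB - cA)\<^sup>2))) \<partial>lborel)"
    proof (rule nn_integral_mono)
      fix x
      show "indicator (A \<union> B) x * ennreal ((\<phi> x - cA)\<^sup>2) \<le> indicator A x * ennreal ((\<phi> x - cA)\<^sup>2) +
          (2 * (indicator B x * ennreal ((\<phi> x - cB)\<^sup>2)) + 2 * (indicator B x * ennreal ((cB - cA)\<^sup>2)))"
        using sq[of "\<phi> x" cA cB] by (auto split: split_indicator)
    qed
    also have "\<dots> = deviation A \<phi> cA +
        (2 * deviation B \<phi> cB + 2 * (ennreal b * ennreal ((cB - cA)\<^sup>2)))"
      using mA mB mb(2) by (simp add: nn_integral_add nn_integral_cmult nn_integral_multc)
    also have "\<dots> \<le> ennreal CA * E + (2 * (ennreal CB * E) + 2 * (ennreal ((b / m) * (2 * CA + 2 * CB)) * E))"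
      by (intro add_mono mult_left_mono cA cB bc) auto
    also have "\<dots> = ennreal C * E"
    proof -
      define D where "D = (b / m) * (2 * CA + 2 * CB)"
      have D: "0 \<le> D" unfolding D_def using b m CA(1) CB(1) by (intro mult_nonneg_nonneg) auto
      have "C = CA + (2 * CB + 2 * D)" by (simp add: C_def D_def)
      then have "ennreal C = ennreal CA + (2 * ennreal CB + 2 * ennreal D)"
        using D CA(1) CB(1) by (simp add: ennreal_mult)
      then show ?thesis unfolding D_def by (simp add: distrib_right mult.assoc)
    qed
    finally show ?thesis unfolding E_def by blast
  qed
  then show ?thesis unfolding poincare_set_def using Cpos by blast
qed

text \<open>A subfamily of maximal size whose union is a Poincare set must cover \<open>S\<close>:
  otherwise connectedness yields a further member that meets the union, and gluing would enlarge the
  subfamily.\<close>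

lemma poincare_set_connected:
  fixes S :: "(real^'n) set"
  assumes S: "open S" "connected S" "S \<noteq> {}" "bounded S"
    and fin: "finite \<F>" "\<Union>\<F> = S"
    and \<F>: "\<And>A. A \<in> \<F> \<Longrightarrow> open A \<and> A \<noteq> {} \<and> poincare_set S A"
  shows "poincare_set S S"
proof -
  have \<F>S: "A \<subseteq> S" if "A \<in> \<F>" for A using that fin(2) by blast
  define good where "good \<G> \<longleftrightarrow> \<G> \<subseteq> \<F> \<and> \<G> \<noteq> {} \<and> poincare_set S (\<Union>\<G>)" for \<G>
  obtain A0 where "A0 \<in> \<F>" using S(3) fin(2) by blast
  then have g0: "good {A0}" using \<F> by (simp add: good_def)
  have "\<forall>\<G>. good \<G> \<longrightarrow> card \<G> < Suc (card \<F>)"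
    using fin(1) by (auto simp: good_def less_Suc_eq_le intro: card_mono)
  with g0 obtain \<G> where \<G>: "good \<G>" "\<And>\<H>. good \<H> \<Longrightarrow> card \<H> \<le> card \<G>"
    using ex_has_greatest_nat[of good "{A0}" card "Suc (card \<F>)"] by (metis less_imp_le)
  define U V where "U = \<Union>\<G>" and "V = \<Union>(\<F> - \<G>)"
  have G\<F>: "\<G> \<subseteq> \<F>" "\<G> \<noteq> {}" "poincare_set S U" using \<G>(1) by (auto simp: good_def U_def)
  have oU: "open U" "open V" using G\<F>(1) \<F> by (auto simp: U_def V_def)
  have US: "U \<subseteq> S" using G\<F>(1) \<F>S by (auto simp: U_def)
  have Une: "U \<noteq> {}" using G\<F> \<F> unfolding U_def by (metis Union_upper ex_in_conv subset_empty subset_iff)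
  have cov: "U \<union> V = S" using fin(2) G\<F>(1) by (auto simp: U_def V_def)
  have "U = S"
  proof (rule ccontr)
    assume "U \<noteq> S"
    then have "V \<inter> S \<noteq> {}" using cov by blast
    moreover have "U \<inter> S \<noteq> {}" using Une US by blast
    ultimately have "U \<inter> V \<inter> S \<noteq> {}"
      using connectedD[OF S(2) oU] cov by blast
    then obtain A where A: "A \<in> \<F>" "A \<notin> \<G>" "U \<inter> A \<noteq> {}" unfolding V_def by blast
    have "poincare_set S (U \<union> A)"
      by (rule poincare_set_Un[OF S(1) oU(1) US G\<F>(3) _ \<F>S[OF A(1)] _ A(3)])
        (use \<F>[OF A(1)] bounded_subset[OF S(4)] US \<F>S[OF A(1)] in auto)
    then have "good (insert A \<G>)" using A(1) G\<F>(1) by (simp add: good_def U_def Un_commute)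
    then have "card (insert A \<G>) \<le> card \<G>" by (rule \<G>(2))
    moreover have "finite \<G>" using G\<F>(1) fin(1) by (rule finite_subset)
    ultimately show False using A(2) by simp
  qed
  then show ?thesis using G\<F>(3) by simp
qed

lemma holder_space_partials_bounded:
  assumes "f \<in> holder_space k \<alpha> K" "compact K" "length is \<le> k"
  shows "bounded (partials is f ` interior K)"
proof -
  obtain e where e: "continuous_on K e" "\<forall>x\<in>interior K. e x = partials is f x"
    using assms(1,3) unfolding holder_space_def by blast
  have "bounded (e ` K)" by (intro compact_imp_bounded compact_continuous_image e assms)
  moreover have "partials is f ` interior K \<subseteq> e ` K"
  proof (rule image_subsetI)
    fix x assume "x \<in> interior K"
    then show "partials is f x \<in> e ` K" using e(2) interior_subset[of K] by (metis imageI subsetD)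
  qed
  ultimately show ?thesis by (rule bounded_subset)
qed

text \<open>The first partial derivatives extend continuously to the closed ball and are therefore
  bounded; convexity of the ball then gives the Lipschitz bound.\<close>

lemma holder_space_Lipschitz:
  fixes \<gamma> :: "real^'n \<Rightarrow> real"
  assumes \<gamma>: "\<gamma> \<in> holder_space 2 1 (cball x r)"
  obtains L where "0 \<le> L" "\<forall>y\<in>ball x r. \<forall>z\<in>ball x r. \<bar>\<gamma> y - \<gamma> z\<bar> \<le> L * norm (y - z)"
proof -
  have "Ck_on 2 \<gamma> (ball x r)" using \<gamma> by (simp add: holder_space_def interior_cball)
  then have "Ck_on 1 \<gamma> (ball x r)" by (rule Ck_on_mono[rotated]) simp
  then have C1: "C1_on \<gamma> (ball x r)" by (simp only: Ck_on_1_iff_C1_on[OF open_ball])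
  have "\<forall>i. \<exists>B. \<forall>y\<in>ball x r. \<bar>grad \<gamma> y $ i\<bar> \<le> B"
    using holder_space_partials_bounded[OF \<gamma> compact_cball, of "[_]"]
    unfolding bounded_iff interior_cball by (simp flip: partials_grad del: partials.simps)
  from choice[OF this] obtain B where B: "\<forall>i. \<forall>y\<in>ball x r. \<bar>grad \<gamma> y $ i\<bar> \<le> B i" ..
  define L where "L = (\<Sum>i\<in>UNIV. \<bar>B i\<bar>)"
  have "norm (grad \<gamma> y) \<le> L" if "y \<in> ball x r" for y
  proof -
    have "norm (grad \<gamma> y) \<le> (\<Sum>i\<in>UNIV. \<bar>grad \<gamma> y $ i\<bar>)" by (rule norm_le_l1_cart)
    also have "\<dots> \<le> L" unfolding L_def using B that by (intro sum_mono) (metis abs_ge_self order_trans)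
    finally show ?thesis .
  qed
  then have "\<bar>\<gamma> y - \<gamma> z\<bar> \<le> L * norm (y - z)" if "y \<in> ball x r" "z \<in> ball x r" for y z
    by (intro inner_derivative_bound[OF convex_ball has_derivative_at_withinI[OF C1_on_deriv[OF C1]] _ that])
  then show thesis using that[of L] by (simp add: L_def sum_nonneg)
qed

section \<open>The Poincare inequality on the fluid domain\<close>

context perforated_cell
begin

text \<open>Near the inclusion \<open>P\<close> is a Lipschitz hypograph, hence star-shaped with respect to a ball placed
  well below its boundary point.\<close>

lemma poincare_set_interior_boundary:
  assumes dom: "holder_domain 2 1 (inclusion P)" and x: "x \<in> frontier (inclusion P)"
  obtains \<rho> where "\<rho> > 0" "poincare_set P (P \<inter> ball x \<rho>)"
proof -
  define D where "D = inclusion P"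
  have Dop: "open D" unfolding D_def inclusion_def using open_cell by (intro open_Diff) auto
  obtain r0 n \<gamma> where r0: "r0 > 0" and n: "norm n = 1" and inv: "\<And>y t. \<gamma> (y + t *\<^sub>R n) = \<gamma> y"
    and \<gamma>: "\<gamma> \<in> holder_space 2 1 (cball x r0)" and D: "D \<inter> ball x r0 = {y \<in> ball x r0. \<gamma> y < y \<bullet> n}"
    using dom x unfolding holder_domain_def D_def[symmetric] by blast
  obtain L where L: "0 \<le> L" "\<forall>y\<in>ball x r0. \<forall>z\<in>ball x r0. \<bar>\<gamma> y - \<gamma> z\<bar> \<le> L * norm (y - z)"
    by (rule holder_space_Lipschitz[OF \<gamma>])
  have xcl: "x \<in> closure D" using x unfolding D_def frontier_def by blast
  have "x \<in> cell" using xcl inclusion_subset unfolding D_def by blast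
  then obtain r1 where r1: "r1 > 0" "ball x r1 \<subseteq> cell" using open_cell open_contains_ball by blast
  define r where "r = min r0 r1"
  have r: "r > 0" "ball x r \<subseteq> cell" "ball x r \<subseteq> ball x r0" using r0 r1 by (auto simp: r_def)
  have \<gamma>c: "continuous_on (ball x r0) \<gamma>"
    using \<gamma> unfolding holder_space_def by (auto intro: continuous_on_subset[OF _ ball_subset_cball])
  have nn: "n \<bullet> n = 1" using n by (simp add: norm_eq_1)
  \<comment> \<open>Passing to the closure turns the strict inequality into a weak one; conversely a
    boundary point is approached from within \<open>D\<close> by sliding upward along
    \<open>n\<close>, where \<open>\<gamma>\<close> is constant.\<close>
  have clD: "y \<in> closure D \<longleftrightarrow> \<gamma> y \<le> y \<bullet> n" if y: "y \<in> ball x r0" for y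
  proof
    assume "y \<in> closure D"
    show "\<gamma> y \<le> y \<bullet> n"
    proof (rule ccontr)
      assume "\<not> \<gamma> y \<le> y \<bullet> n"
      then have yS: "y \<in> {z \<in> ball x r0. \<gamma> z - z \<bullet> n \<in> {0<..}}" using y by simp
      have o: "open {z \<in> ball x r0. \<gamma> z - z \<bullet> n \<in> {0<..}}"
      proof -
        have "continuous_on (ball x r0) (\<lambda>z. \<gamma> z - z \<bullet> n)" by (intro continuous_intros \<gamma>c)
        then have "open (ball x r0 \<inter> (\<lambda>z. \<gamma> z - z \<bullet> n) -` {0<..})" by (rule continuous_open_preimage) auto
        moreover have "{z \<in> ball x r0. \<gamma> z - z \<bullet> n \<in> {0<..}} = ball x r0 \<inter> (\<lambda>z. \<gamma> z - z \<bullet> n) -` {0<..}" by blast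
        ultimately show ?thesis by simp
      qed
      have "{z \<in> ball x r0. \<gamma> z - z \<bullet> n \<in> {0<..}} \<inter> D \<noteq> {}"
        using open_Int_closure_eq_empty[OF o, of D] \<open>y \<in> closure D\<close> yS by blast
      then obtain z where "z \<in> D \<inter> ball x r0" "0 < \<gamma> z - z \<bullet> n" by auto
      then show False using D by auto
    qed
  next
    assume le: "\<gamma> y \<le> y \<bullet> n"
    show "y \<in> closure D"
      unfolding closure_approachable
    proof (intro allI impI)
      fix e :: real assume e: "e > 0"
      obtain d where d: "d > 0" "ball y d \<subseteq> ball x r0" using y open_ball open_contains_ball by blast
      define t where "t = min e d / 2"
      have t: "t > 0" "t < e" "t < d" using e d(1) by (auto simp: t_def)
      define z where "z = y + t *\<^sub>R n"
      have "dist y z = t" using t n by (simp add: z_def dist_norm)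
      then have "z \<in> ball x r0" using d(2) t by (auto simp: subset_iff)
      moreover have "\<gamma> z < z \<bullet> n" using le t by (simp add: z_def inv inner_add_left nn)
      ultimately have "z \<in> D" using D by blast
      then show "\<exists>z\<in>D. dist z y < e" using \<open>dist y z = t\<close> t by (auto simp: dist_commute)
    qed
  qed
  have inP: "y \<in> P \<longleftrightarrow> y \<bullet> n < \<gamma> y" if "y \<in> ball x r" for y
  proof -
    have "y \<in> cell" "y \<in> ball x r0" using r(2,3) that by blast+
    moreover from this(1) have "y \<in> P \<longleftrightarrow> y \<notin> closure D" unfolding D_def by (subst P_eq) simp
    ultimately show ?thesis using clD[of y] by (simp add: not_le)
  qed
  have \<gamma>x: "\<gamma> x = x \<bullet> n"
  proof -
    have "x \<notin> D" using x Dop unfolding D_def frontier_def by (simp add: interior_open)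
    have "\<not> \<gamma> x < x \<bullet> n"
    proof
      assume "\<gamma> x < x \<bullet> n"
      then have "x \<in> D \<inter> ball x r0" unfolding D using r0 by simp
      then show False using \<open>x \<notin> D\<close> by blast
    qed
    then show ?thesis using clD[of x] xcl r0 by simp
  qed
  \<comment> \<open>Chosen such that 2 (R + \<rho>) = r, so that the ball of radius \<rho> placed at
    depth \<open>R\<close> below \<open>x\<close> stays inside the ball of radius r around
    \<open>x\<close>.\<close>
  define \<rho> where "\<rho> = r / (2 * (2 * (1 + L) + 1))"
  have \<rho>: "\<rho> > 0" unfolding \<rho>_def using r(1) L(1) by (intro divide_pos_pos) auto
  \<comment> \<open>Walking a fraction t towards \<open>B\<close> lowers the height by at least t (R
    - 2 \<rho>) = 2 t \<rho> L, and this is the most by which \<open>\<gamma>\<close> can drop on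
    the way.\<close>
  define R where "R = 2 * \<rho> * (1 + L)"
  have R: "R + \<rho> < r" "R > 0" "\<rho> < r"
  proof -
    have "\<rho> * (2 * (2 * (1 + L) + 1)) = r" using L(1) by (simp add: \<rho>_def)
    then have two: "2 * (R + \<rho>) = r" by (simp add: R_def algebra_simps)
    show R0: "R > 0" unfolding R_def using \<rho> L(1) by (intro mult_pos_pos) auto
    show "R + \<rho> < r" using r(1) two by (simp add: field_simps)
    then show "\<rho> < r" using R0 by linarith
  qed
  define A B where "A = P \<inter> ball x \<rho>" and "B = ball (x - R *\<^sub>R n) \<rho>"
  have Bsub: "B \<subseteq> ball x r"
  proof
    fix z assume "z \<in> B"
    then have z: "norm (x - R *\<^sub>R n - z) < \<rho>" by (simp add: B_def dist_norm)
    have "norm (x - z) \<le> norm (x - R *\<^sub>R n - z) + norm (R *\<^sub>R n)"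
      using norm_triangle_ineq[of "x - R *\<^sub>R n - z" "R *\<^sub>R n"] by simp
    then show "z \<in> ball x r" using z R n by (simp add: dist_norm)
  qed
  have seg: "y + t *\<^sub>R (z - y) \<in> P" if y: "y \<in> A" and z: "z \<in> B" and t: "0 \<le> t" "t \<le> 1" for y z t
  proof -
    have yb: "y \<in> ball x \<rho>" "y \<in> P" using y by (auto simp: A_def)
    have yr: "y \<in> ball x r" using yb(1) R(3) by simp
    have yn: "y \<bullet> n < \<gamma> y" using inP[OF yr] yb(2) by simp
    define p where "p = y + t *\<^sub>R (z - y)"
    have pconv: "p = (1 - t) *\<^sub>R y + t *\<^sub>R z" by (simp add: p_def algebra_simps)
    have pr: "p \<in> ball x r"
      unfolding pconv using convex_ball[of x r] yr z Bsub t by (intro convexD) auto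
    \<comment> \<open>Lifting \<open>p\<close> by t R along \<open>n\<close> undoes the downward
      shift without changing \<open>\<gamma>\<close>. As \<open>q\<close> lies within 2 t \<rho> of
      \<open>y\<close>, the Lipschitz bound costs no more than 2 t \<rho> L.\<close>
    define q where "q = p + (t * R) *\<^sub>R n"
    have zR: "z + R *\<^sub>R n \<in> ball x \<rho>" using z by (simp add: B_def dist_norm algebra_simps)
    have "q = (1 - t) *\<^sub>R y + t *\<^sub>R (z + R *\<^sub>R n)" by (simp add: q_def pconv algebra_simps)
    then have "q \<in> ball x \<rho>" using convexD[OF convex_ball[of x \<rho>] yb(1) zR, of "1 - t" t] t by simp
    then have "q \<in> ball x r" using R(3) by simp
    then have qr: "q \<in> ball x r0" using r(3) by blast
    have dzy: "norm (z + R *\<^sub>R n - y) \<le> 2 * \<rho>"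
      using zR yb(1) norm_triangle_ineq4[of "x - y" "x - (z + R *\<^sub>R n)"] by (simp add: dist_norm)
    have "q - y = t *\<^sub>R (z + R *\<^sub>R n - y)" by (simp add: q_def p_def algebra_simps)
    then have qy: "norm (q - y) \<le> t * (2 * \<rho>)" using dzy t by (simp add: mult_left_mono)
    have "\<bar>\<gamma> q - \<gamma> y\<bar> \<le> L * norm (q - y)" using L(2) qr yr r(3) by blast
    also have "\<dots> \<le> L * (t * (2 * \<rho>))" using qy L(1) by (rule mult_left_mono)
    finally have gq: "\<gamma> y - L * (t * (2 * \<rho>)) \<le> \<gamma> q" by linarith
    have gp: "\<gamma> q = \<gamma> p" unfolding q_def by (rule inv)
    have "(z + R *\<^sub>R n - y) \<bullet> n \<le> norm (z + R *\<^sub>R n - y) * norm n" by (rule norm_cauchy_schwarz)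
    then have "(z - y) \<bullet> n \<le> 2 * \<rho> - R" using dzy n by (simp add: inner_diff_left inner_add_left nn)
    then have "t * ((z - y) \<bullet> n) \<le> t * (2 * \<rho> - R)" using t by (intro mult_left_mono) auto
    also have "\<dots> = - (L * (t * (2 * \<rho>)))" by (simp add: R_def algebra_simps)
    finally have "p \<bullet> n \<le> y \<bullet> n - L * (t * (2 * \<rho>))" by (simp add: p_def inner_add_left)
    then have "p \<bullet> n < \<gamma> p" using gq gp yn by linarith
    then show ?thesis using inP[OF pr] by (simp add: p_def)
  qed
  have BP: "B \<subseteq> P"
  proof
    fix z assume z: "z \<in> B"
    have zr: "z \<in> ball x r" using z Bsub by blast
    have zR: "z + R *\<^sub>R n \<in> ball x \<rho>" using z by (simp add: B_def dist_norm algebra_simps)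
    then have "norm (z + R *\<^sub>R n - x) < \<rho>" by (simp add: dist_norm norm_minus_commute)
    moreover have "\<bar>\<gamma> (z + R *\<^sub>R n) - \<gamma> x\<bar> \<le> L * norm (z + R *\<^sub>R n - x)"
    proof -
      have "z + R *\<^sub>R n \<in> ball x r" using zR R(3) by simp
      then show ?thesis using L(2) r(3) r0 by (meson centre_in_ball subsetD)
    qed
    moreover have "L * norm (z + R *\<^sub>R n - x) \<le> L * \<rho>" using calculation(1) L(1) by (intro mult_left_mono) auto
    ultimately have "\<gamma> x - L * \<rho> \<le> \<gamma> z" using inv[of z R] by linarith
    moreover have "(z + R *\<^sub>R n - x) \<bullet> n \<le> norm (z + R *\<^sub>R n - x) * norm n" by (rule norm_cauchy_schwarz)
    then have "z \<bullet> n + R - x \<bullet> n < \<rho>" using \<open>norm (z + R *\<^sub>R n - x) < \<rho>\<close> n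
      by (simp add: inner_diff_left inner_add_left nn)
    moreover have "R = 2 * \<rho> + 2 * (L * \<rho>)" by (simp add: R_def algebra_simps)
    moreover have "0 \<le> L * \<rho>" using L(1) \<rho> by simp
    ultimately have "z \<bullet> n < \<gamma> z" using \<gamma>x \<rho> by linarith
    then show "z \<in> P" using inP[OF zr] by simp
  qed
  have "poincare_set P A"
    by (rule poincare_set_segments[OF open_P _ _ _ BP _ _ _ seg])
      (use open_P \<rho> in \<open>auto simp: A_def B_def\<close>)
  then show thesis using that \<rho> by (simp add: A_def)
qed

text \<open>Every point of the compact closure has a ball whose part in \<open>P\<close> is a
  Poincare set: away from the inclusion it is a convex piece of the cell, at the inclusion
  \<open>poincare_set_interior_boundary\<close> applies. Finitely many balls suffice, and
  connectedness glues the estimates.\<close>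

theorem poincare_P:
  assumes dom: "holder_domain 2 1 (inclusion P)" and con: "connected P" and ne: "P \<noteq> {}"
  shows "poincare_set P P"
proof -
  have bP: "bounded P" using P_subset_cell bounded_cell bounded_subset by blast
  have "\<exists>\<rho>>0. P \<inter> ball x \<rho> = {} \<or> poincare_set P (P \<inter> ball x \<rho>)" if x: "x \<in> closure P" for x
  proof (cases "x \<in> closure (inclusion P)")
    case False
    then have "x \<in> - closure (inclusion P)" by blast
    then obtain \<rho> where \<rho>: "\<rho> > 0" "ball x \<rho> \<subseteq> - closure (inclusion P)"
      using open_contains_ball[of "- closure (inclusion P)"] by blast
    have e: "P \<inter> ball x \<rho> = cell \<inter> ball x \<rho>" using \<rho>(2) P_eq by blast
    show ?thesis
    proof (cases "P \<inter> ball x \<rho> = {}")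
      case False
      have c: "convex (P \<inter> ball x \<rho>)" unfolding e cell_def by (intro convex_Int convex_box(2) convex_ball)
      have "poincare_set P (P \<inter> ball x \<rho>)"
      proof (rule poincare_set_segments[OF open_P, of _ "P \<inter> ball x \<rho>"])
        fix y z and t :: real assume "y \<in> P \<inter> ball x \<rho>" "z \<in> P \<inter> ball x \<rho>" "0 \<le> t" "t \<le> 1"
        then have "(1 - t) *\<^sub>R y + t *\<^sub>R z \<in> P \<inter> ball x \<rho>" using c by (intro convexD) auto
        then show "y + t *\<^sub>R (z - y) \<in> P" by (simp add: algebra_simps)
      qed (use open_P False in \<open>auto intro: bounded_subset[OF bP]\<close>)
      then show ?thesis using \<rho>(1) by blast
    qed (use \<rho>(1) in blast)
  next
    case True
    have "x \<notin> inclusion P"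
    proof
      assume "x \<in> inclusion P"
      moreover have "open (inclusion P)" using open_cell by (auto simp: inclusion_def)
      ultimately have "inclusion P \<inter> P \<noteq> {}" using x open_Int_closure_eq_empty by blast
      then show False using closure_subset[of P] by (auto simp: inclusion_def)
    qed
    moreover have "interior (inclusion P) = inclusion P" using open_cell by (auto simp: inclusion_def intro!: interior_open)
    ultimately have "x \<in> frontier (inclusion P)" using True by (simp add: frontier_def)
    then show ?thesis using poincare_set_interior_boundary[OF dom] by metis
  qed
  then have "\<forall>x\<in>closure P. \<exists>\<rho>. \<rho> > 0 \<and> (P \<inter> ball x \<rho> = {} \<or> poincare_set P (P \<inter> ball x \<rho>))" by blast
  from bchoice[OF this] obtain \<rho> where \<rho>: "\<forall>x\<in>closure P. \<rho> x > 0 \<and> (P \<inter> ball x (\<rho> x) = {} \<or> poincare_set P (P \<inter> ball x (\<rho> x)))" ..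
  have cP: "compact (closure P)" using bP by (simp add: compact_closure)
  have "closure P \<subseteq> (\<Union>x\<in>closure P. ball x (\<rho> x))" using \<rho> by force
  then obtain T where T: "T \<subseteq> closure P" "finite T" "closure P \<subseteq> (\<Union>x\<in>T. ball x (\<rho> x))"
    by (rule compactE_image[OF cP, rotated]) auto
  define \<F> where "\<F> = (\<lambda>x. P \<inter> ball x (\<rho> x)) ` T - {{}}"
  have "finite \<F>" unfolding \<F>_def using T(2) by simp
  moreover have "\<Union>\<F> = P"
  proof -
    have "P \<subseteq> (\<Union>x\<in>T. ball x (\<rho> x))" using T(3) closure_subset by blast
    then show ?thesis unfolding \<F>_def by blast
  qed
  moreover have "open A \<and> A \<noteq> {} \<and> poincare_set P A" if "A \<in> \<F>" for A
    using that \<rho> T(1) open_P unfolding \<F>_def by auto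
  ultimately show ?thesis by (rule poincare_set_connected[OF open_P con ne bP])
qed

lemma nn_integral_M:
  "(\<integral>\<^sup>+x. f x \<partial>M) = (\<integral>\<^sup>+x. indicator P x * f x \<partial>lborel)"
proof -
  have "(\<integral>\<^sup>+x. f x \<partial>M) = (\<integral>\<^sup>+x. f x * indicator P x \<partial>lebesgue)"
    using open_P by (intro nn_integral_restrict_space) auto
  also have "\<dots> = (\<integral>\<^sup>+x. indicator P x * f x \<partial>lebesgue)" by (simp add: mult.commute)
  also have "\<dots> = (\<integral>\<^sup>+x. indicator P x * f x \<partial>lborel)" by (rule nn_integral_completion)
  finally show ?thesis .
qed

text \<open>For \<open>C^1\<close> functions the deviation from a suitable constant is controlled by
  the gradient; the approximation by such functions carries this over to \<open>u\<close>, whose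
  zero mean removes the constant.\<close>

theorem Poincare_H1_per:
  assumes "poincare_set P P"
  obtains C where "0 \<le> C" "\<forall>u v. H1_per u v \<longrightarrow> (LINT x|M. u x) = 0 \<longrightarrow> L2n M u \<le> C * L2n M v"
proof -
  obtain C0 where C0: "C0 > 0" "\<forall>\<phi>. C1_on \<phi> P \<longrightarrow> (\<exists>c. deviation P \<phi> c \<le> ennreal C0 * energy P \<phi>)"
    using assms unfolding poincare_set_def by blast
  define C where "C = sqrt C0"
  have C: "0 \<le> C" "C\<^sup>2 = C0" using C0(1) by (auto simp: C_def)
  have smooth: "\<exists>c. L2n M (\<lambda>x. \<phi> x - c) \<le> C * L2n M (grad \<phi>)" if \<phi>: "C1_per \<phi>" for \<phi>
  proof -
    have L: "\<phi> \<in> L2v M" "grad \<phi> \<in> L2v M" using \<phi> by (auto simp: C1_per_def)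
    obtain c where c: "deviation P \<phi> c \<le> ennreal C0 * energy P \<phi>" using C0(2) C1_per_C1_on[OF \<phi>] by blast
    have 1: "deviation P \<phi> c = ennreal ((L2n M (\<lambda>x. \<phi> x - c))\<^sup>2)"
      using nn_integral_L2n[OF L2v_diff[OF L(1) const_L2v]] unfolding nn_integral_M by simp
    have 2: "energy P \<phi> = ennreal ((L2n M (grad \<phi>))\<^sup>2)"
      using nn_integral_L2n[OF L(2)] unfolding nn_integral_M energy_density_def .
    have "ennreal ((L2n M (\<lambda>x. \<phi> x - c))\<^sup>2) \<le> ennreal ((C * L2n M (grad \<phi>))\<^sup>2)"
      using c C0(1) unfolding 1 2 by (simp add: power_mult_distrib C(2) ennreal_mult)
    then have "L2n M (\<lambda>x. \<phi> x - c) \<le> C * L2n M (grad \<phi>)"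
      using C(1) by (intro power2_le_imp_le[of "L2n M (\<lambda>x. \<phi> x - c)"]) (auto simp: ennreal_le_iff)
    then show ?thesis ..
  qed
  have "L2n M u \<le> C * L2n M v" if H: "H1_per u v" and u0: "(LINT x|M. u x) = 0" for u v
  proof (rule field_le_epsilon)
    have L: "u \<in> L2v M" "v \<in> L2v M" using H by (auto simp: H1_per_def)
    \<comment> \<open>A function of zero mean is orthogonal to the constants, so 0 is its best
      approximation by a constant.\<close>
    have mean: "L2n M u \<le> L2n M (\<lambda>x. u x - c)" for c
    proof -
      have i: "integrable M u" using L2v_inner(1)[OF L(1) const_L2v[of 1]] by simp
      have "L2n M u * L2n M u = (LINT x|M. (norm (u x))\<^sup>2 - c * u x)"
        unfolding power2_eq_square[of "L2n M u", symmetric] L2n_power2 using i L(1) u0 by (simp add: L2v_def)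
      also have "\<dots> = (LINT x|M. u x \<bullet> (u x - c))" by (simp add: power2_eq_square algebra_simps)
      also have "\<dots> \<le> L2n M u * L2n M (\<lambda>x. u x - c)" using L2v_inner(2)[OF L(1) L2v_diff[OF L(1) const_L2v[of c]]] by linarith
      finally show ?thesis by (cases "L2n M u = 0") (auto simp: mult_le_cancel_left less_le)
    qed
    fix e :: real assume e: "e > 0"
    define d where "d = e / (1 + C)"
    have d: "d > 0" "d + C * d = e"
      using e C(1) by (simp_all add: d_def add_pos_nonneg add_divide_distrib[symmetric] distrib_right[symmetric] divide_eq_eq algebra_simps)
    obtain \<phi> where \<phi>: "C1_per \<phi>" "L2n M (\<lambda>x. \<phi> x - u x) < d" "L2n M (\<lambda>x. grad \<phi> x - v x) < d"
      using H d(1) unfolding H1_per_def by blast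
    have \<phi>L: "\<phi> \<in> L2v M" "grad \<phi> \<in> L2v M" using \<phi>(1) by (auto simp: C1_per_def)
    obtain c where c: "L2n M (\<lambda>x. \<phi> x - c) \<le> C * L2n M (grad \<phi>)" using smooth[OF \<phi>(1)] ..
    have "L2n M u \<le> L2n M (\<lambda>x. u x - \<phi> x) + L2n M (\<lambda>x. \<phi> x - c)"
      by (rule order_trans[OF mean L2n_triangle[OF L(1) \<phi>L(1) const_L2v]])
    also have "\<dots> \<le> d + C * (L2n M v + d)"
      using \<phi>(2) L2n_minus_commute[of M u \<phi>] order_trans[OF c mult_left_mono[OF _ C(1)]]
        L2n_add[OF L(2) L2v_diff[OF \<phi>L(2) L(2)]] \<phi>(3) by (intro add_mono) auto
    also have "\<dots> = C * L2n M v + e" using d(2) by (simp add: algebra_simps)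
    finally show "L2n M u \<le> C * L2n M v + e" .
  qed
  then show thesis using that C(1) by blast
qed

end

section \<open>Operations on curves\<close>

lemma Cm_curve_mono:
  "X \<subseteq> Y \<Longrightarrow> J' \<subseteq> J \<Longrightarrow> Cm_curve m X N J c \<Longrightarrow> Cm_curve m Y N J' c"
proof (induction m arbitrary: c)
  case (Suc m)
  then show ?case unfolding Cm_curve.simps by blast
qed auto

text \<open>Linearity and boundedness of \<open>T\<close> are encoded in one inequality for the
  combination a (f - g) - b k: with a = 1, b = 0 it is an increment, with a = 1 / (t - s), b = 1 it
  is the error of a difference quotient. The laws of a seminorm are asked of the target
  only.\<close>

lemma Cm_curve_image:
  fixes X :: "('a \<Rightarrow> 'b::real_vector) set" and X' :: "('c \<Rightarrow> 'd::real_vector) set"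
  assumes J: "open J" and X': "seminormed_space X' N'" and T: "\<And>f. f \<in> X \<Longrightarrow> T f \<in> X'"
    and bound: "\<And>f g k a b. f \<in> X \<Longrightarrow> g \<in> X \<Longrightarrow> k \<in> X \<Longrightarrow>
      N' (\<lambda>y. a *\<^sub>R (T f y - T g y) - b *\<^sub>R T k y) \<le> C * N (\<lambda>x. a *\<^sub>R (f x - g x) - b *\<^sub>R k x)"
  shows "Cm_curve m X N J c \<Longrightarrow> Cm_curve m X' N' J (\<lambda>s. T (c s))"
proof (induction m arbitrary: c)
  interpret S: seminormed_space X' N' by (rule X')
  {
    case 0
    then have c: "\<forall>s\<in>J. c s \<in> X" by simp
    show ?case
    proof (rule S.Cm_curve_0I)
      fix s assume s: "s \<in> J"
      show "T (c s) \<in> X'" using c s T by blast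
      show "S.null (\<lambda>t x. T (c t) x - T (c s) x) s"
      proof (rule S.null_bound)
        show "((\<lambda>t. C * N (\<lambda>x. c t x - c s x)) \<longlongrightarrow> 0) (at s)"
          using 0 s by (intro tendsto_mult_right_zero) simp
        show "\<forall>\<^sub>F t in at s. (\<lambda>x. T (c t) x - T (c s) x) \<in> X' \<and> N' (\<lambda>x. T (c t) x - T (c s) x) \<le> C * N (\<lambda>x. c t x - c s x)"
          using eventually_at_in_open'[OF J s]
          by eventually_elim (use c s bound[of _ "c s" "c s" 1 0] in \<open>auto intro!: S.diff T\<close>)
      qed
    qed
  next
    case (Suc m)
    then obtain c' where c: "\<forall>s\<in>J. c s \<in> X" and c': "Cm_curve m X N J c'"
      "\<forall>s\<in>J. ((\<lambda>t. N (\<lambda>x. (c t x - c s x) /\<^sub>R (t - s) - c' s x)) \<longlongrightarrow> 0) (at s)"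
      by auto
    show ?case
    proof (rule S.Cm_curve_SucI[OF _ Suc.IH[OF c'(1)]])
      fix s assume s: "s \<in> J"
      have c's: "c' s \<in> X" using c'(1) s by (cases m) auto
      show "T (c s) \<in> X'" using c s T by blast
      show "S.null (\<lambda>t x. (T (c t) x - T (c s) x) /\<^sub>R (t - s) - T (c' s) x) s"
      proof (rule S.null_bound)
        show "((\<lambda>t. C * N (\<lambda>x. (c t x - c s x) /\<^sub>R (t - s) - c' s x)) \<longlongrightarrow> 0) (at s)"
          using c'(2) s by (intro tendsto_mult_right_zero) simp
        show "\<forall>\<^sub>F t in at s. (\<lambda>x. (T (c t) x - T (c s) x) /\<^sub>R (t - s) - T (c' s) x) \<in> X' \<and>
            N' (\<lambda>x. (T (c t) x - T (c s) x) /\<^sub>R (t - s) - T (c' s) x) \<le> C * N (\<lambda>x. (c t x - c s x) /\<^sub>R (t - s) - c' s x)"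
          using eventually_at_in_open'[OF J s]
          by eventually_elim (use c s c's bound[of _ "c s" "c' s" "inverse (_ - s)" 1] in \<open>auto intro!: S.diff S.scale T\<close>)
      qed
    qed
  }
qed

text \<open>The counterpart of \<open>Cm_curve_image\<close> for functionals, where the abstract
  notion of a \<open>C^m\<close> curve turns into classical differentiability.\<close>

lemma Cm_curve_functional:
  fixes l :: "('a \<Rightarrow> 'b::real_vector) \<Rightarrow> 'c::real_normed_vector"
  assumes J: "open J"
    and bound: "\<And>f g k a b. f \<in> X \<Longrightarrow> g \<in> X \<Longrightarrow> k \<in> X \<Longrightarrow>
      norm (a *\<^sub>R (l f - l g) - b *\<^sub>R l k) \<le> C * N (\<lambda>x. a *\<^sub>R (f x - g x) - b *\<^sub>R k x)"
  shows "Cm_curve m X N J c \<Longrightarrow> Ck_on m (\<lambda>s. l (c s)) J"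
proof (induction m arbitrary: c)
  case 0
  have "((\<lambda>t. l (c t)) \<longlongrightarrow> l (c s)) (at s)" if s: "s \<in> J" for s
  proof (rule LIM_zero_cancel, rule Lim_null_comparison)
    show "((\<lambda>t. C * N (\<lambda>x. c t x - c s x)) \<longlongrightarrow> 0) (at s)"
      using 0 s by (intro tendsto_mult_right_zero) simp
    show "\<forall>\<^sub>F t in at s. norm (l (c t) - l (c s)) \<le> C * N (\<lambda>x. c t x - c s x)"
      using eventually_at_in_open'[OF J s] by eventually_elim (use 0 s bound[of _ "c s" "c s" 1 0] in auto)
  qed
  then show ?case using J by (simp add: continuous_on_eq_continuous_at isCont_def)
next
  case (Suc m)
  then obtain c' where c: "\<forall>s\<in>J. c s \<in> X" and c': "Cm_curve m X N J c'"
    "\<forall>s\<in>J. ((\<lambda>t. N (\<lambda>x. (c t x - c s x) /\<^sub>R (t - s) - c' s x)) \<longlongrightarrow> 0) (at s)"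
    by auto
  show ?case
  proof (rule Ck_on_SucI)
    show "Ck_on m (\<lambda>s. v *\<^sub>R l (c' s)) J" for v :: real
      by (rule Ck_on_linear_compose[OF bounded_linear_scaleR_right Suc.IH[OF c'(1)]])
    fix s assume s: "s \<in> J"
    have c's: "c' s \<in> X" using c'(1) s by (cases m) auto
    have "((\<lambda>t. norm ((l (c t) - l (c s)) - (t - s) *\<^sub>R l (c' s)) / norm (t - s)) \<longlongrightarrow> 0) (at s)"
    proof (rule Lim_null_comparison)
      show "((\<lambda>t. C * N (\<lambda>x. (c t x - c s x) /\<^sub>R (t - s) - c' s x)) \<longlongrightarrow> 0) (at s)"
        using c'(2) s by (intro tendsto_mult_right_zero) simp
      show "\<forall>\<^sub>F t in at s. norm (norm ((l (c t) - l (c s)) - (t - s) *\<^sub>R l (c' s)) / norm (t - s))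
          \<le> C * N (\<lambda>x. (c t x - c s x) /\<^sub>R (t - s) - c' s x)"
        using eventually_at_in_open'[OF J s] eventually_neq_at_within[of s s UNIV]
      proof eventually_elim
        case (elim t)
        then have "inverse (t - s) *\<^sub>R (l (c t) - l (c s)) - 1 *\<^sub>R l (c' s) =
            inverse (t - s) *\<^sub>R ((l (c t) - l (c s)) - (t - s) *\<^sub>R l (c' s))"
          by (simp add: scaleR_right_diff_distrib)
        with bound[of "c t" "c s" "c' s" "inverse (t - s)" 1] c c's s elim show ?case
          by (simp add: divide_inverse mult.commute abs_inverse)
      qed
    qed
    then show "((\<lambda>s. l (c s)) has_derivative (\<lambda>v. v *\<^sub>R l (c' s))) (at s)"
      by (simp add: has_derivative_iff_norm bounded_linear_scaleR_left)
  qed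
qed

section \<open>Solving symmetric coercive variational problems\<close>

text \<open>Direct method: a minimiser of a(f, f) - 2 l(f) solves the equation. The argument works
  with a seminorm, since the minimising sequence is shown to be Cauchy and completeness provides
  some limit.\<close>

lemma riesz_coercive:
  fixes X :: "('a \<Rightarrow> 'b::real_vector) set" and a :: "('a \<Rightarrow> 'b) \<Rightarrow> ('a \<Rightarrow> 'b) \<Rightarrow> real"
  assumes X: "seminormed_space X N"
    and a_left: "\<And>f g k t. f \<in> X \<Longrightarrow> g \<in> X \<Longrightarrow> k \<in> X \<Longrightarrow> a (\<lambda>x. f x + t *\<^sub>R g x) k = a f k + t * a g k"
    and a_sym: "\<And>f g. f \<in> X \<Longrightarrow> g \<in> X \<Longrightarrow> a f g = a g f"
    and a_bound: "\<And>f g. f \<in> X \<Longrightarrow> g \<in> X \<Longrightarrow> \<bar>a f g\<bar> \<le> K * N f * N g"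
    and c: "c > 0" and a_coercive: "\<And>f. f \<in> X \<Longrightarrow> c * (N f)\<^sup>2 \<le> a f f"
    and l_lin: "\<And>f g t. f \<in> X \<Longrightarrow> g \<in> X \<Longrightarrow> l (\<lambda>x. f x + t *\<^sub>R g x) = l f + t * l g"
    and l_bound: "\<And>f. f \<in> X \<Longrightarrow> \<bar>l f\<bar> \<le> L * N f"
    and complete: "\<And>f. (\<And>n. f n \<in> X) \<Longrightarrow> (\<And>e. e > 0 \<Longrightarrow> \<exists>n0. \<forall>m\<ge>n0. \<forall>n\<ge>n0. N (\<lambda>x. f m x - f n x) < e) \<Longrightarrow>
      \<exists>g\<in>X. (\<lambda>n::nat. N (\<lambda>x. f n x - g x)) \<longlonglongrightarrow> 0"
  shows "\<exists>v\<in>X. \<forall>\<psi>\<in>X. a v \<psi> = l \<psi>"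
proof -
  interpret S: seminormed_space X N by (rule X)
  define J where "J f = a f f - 2 * l f" for f
  have expand: "J (\<lambda>x. f x + t *\<^sub>R g x) = J f + 2 * t * (a f g - l g) + t\<^sup>2 * a g g"
    if "f \<in> X" "g \<in> X" for f g t
  proof -
    note fg = S.add_scale[OF that, of t]
    have "a (\<lambda>x. f x + t *\<^sub>R g x) (\<lambda>x. f x + t *\<^sub>R g x) = a f (\<lambda>x. f x + t *\<^sub>R g x) + t * a g (\<lambda>x. f x + t *\<^sub>R g x)"
      by (rule a_left[OF that fg])
    also have "a f (\<lambda>x. f x + t *\<^sub>R g x) = a f f + t * a f g"
      using a_left[OF that that(1), of t] a_sym[OF that(1) fg] a_sym[OF that] by simp
    also have "a g (\<lambda>x. f x + t *\<^sub>R g x) = a f g + t * a g g"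
      using a_left[OF that that(2), of t] a_sym[OF that(2) fg] a_sym[OF that] by simp
    finally show ?thesis by (simp add: J_def l_lin[OF that] power2_eq_square algebra_simps)
  qed
  have lower: "- (L\<^sup>2 / c) \<le> J f" if f: "f \<in> X" for f
  proof -
    have "0 \<le> (c * N f - L)\<^sup>2 / c" using c by simp
    also have "\<dots> = c * (N f)\<^sup>2 - 2 * (L * N f) + L\<^sup>2 / c" using c by (simp add: power2_eq_square field_simps)
    also have "\<dots> \<le> a f f - 2 * l f + L\<^sup>2 / c" using a_coercive[OF f] l_bound[OF f] by simp
    finally show ?thesis by (simp add: J_def)
  qed
  have ne: "J ` X \<noteq> {}" using S.zero by blast
  have bdd: "bdd_below (J ` X)" using lower by (intro bdd_belowI2)
  define I where "I = Inf (J ` X)"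
  have I: "I \<le> J f" if "f \<in> X" for f unfolding I_def by (rule cINF_lower[OF bdd that])
  have "\<forall>n. \<exists>f. f \<in> X \<and> J f < I + 1 / real (Suc n)"
  proof
    fix n
    have "I < I + 1 / real (Suc n)" by simp
    then show "\<exists>f. f \<in> X \<and> J f < I + 1 / real (Suc n)"
      unfolding I_def using cInf_less_iff[OF ne bdd] by blast
  qed
  from choice[OF this] obtain f where f: "\<forall>n. f n \<in> X \<and> J (f n) < I + 1 / real (Suc n)" ..
  have fX: "f n \<in> X" and fJ: "J (f n) < I + 1 / real (Suc n)" for n using f by auto
  \<comment> \<open>Parallelogram argument: comparing the values of \<open>J\<close> at
    \<open>f m\<close>, \<open>f n\<close> and their midpoint with the infimum bounds
    \<open>a g g\<close> for the difference \<open>g\<close>.\<close>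
  have diff_bound: "c * (N (\<lambda>x. f m x - f n x))\<^sup>2 \<le> 2 / real (Suc m) + 2 / real (Suc n)" for m n
  proof -
    define g where "g = (\<lambda>x. f m x - f n x)"
    have g: "g \<in> X" unfolding g_def by (intro S.diff fX)
    have 1: "J (f m) = J (f n) + 2 * (a (f n) g - l g) + a g g"
      using expand[OF fX[of n] g, of 1] by (simp add: g_def)
    have 2: "I \<le> J (f n) + (a (f n) g - l g) + a g g / 4"
      using I[OF S.add_scale[OF fX[of n] g, of "1/2"]] expand[OF fX[of n] g, of "1/2"] by (simp add: power2_eq_square)
    have "a g g \<le> 2 * J (f m) + 2 * J (f n) - 4 * I" using 1 2 by simp
    also have "\<dots> \<le> 2 / real (Suc m) + 2 / real (Suc n)" using fJ[of m] fJ[of n] by simp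
    finally show ?thesis using a_coercive[OF g] unfolding g_def by linarith
  qed
  have "\<exists>g\<in>X. (\<lambda>n. N (\<lambda>x. f n x - g x)) \<longlonglongrightarrow> 0"
  proof (rule complete[OF fX])
    fix e :: real assume e: "e > 0"
    then have "4 / (c * e\<^sup>2) > 0" using c by simp
    obtain n0 :: nat where n0: "4 / (c * e\<^sup>2) < real n0" using reals_Archimedean2 by blast
    have "N (\<lambda>x. f m x - f n x) < e" if mn: "m \<ge> n0" "n \<ge> n0" for m n
    proof (rule power_less_imp_less_base)
      have n0p: "real (Suc n0) > 0" by simp
      have "2 / real (Suc m) \<le> 2 / real (Suc n0)" "2 / real (Suc n) \<le> 2 / real (Suc n0)"
        using mn by (intro divide_left_mono; simp)+
      then have "c * (N (\<lambda>x. f m x - f n x))\<^sup>2 \<le> 4 / real (Suc n0)" using diff_bound[of m n] by simp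
      also have "\<dots> < c * e\<^sup>2"
      proof -
        have "4 / (c * e\<^sup>2) < real (Suc n0)" using n0 by simp
        then have "4 < real (Suc n0) * (c * e\<^sup>2)" using c e by (subst (asm) pos_divide_less_eq) auto
        then show ?thesis using n0p by (subst pos_divide_less_eq) (auto simp: mult.commute)
      qed
      finally show "(N (\<lambda>x. f m x - f n x))\<^sup>2 < e\<^sup>2" using c by simp
      show "0 \<le> e" using e by simp
    qed
    then show "\<exists>n0. \<forall>m\<ge>n0. \<forall>n\<ge>n0. N (\<lambda>x. f m x - f n x) < e" by blast
  qed
  then obtain v where v: "v \<in> X" "(\<lambda>n. N (\<lambda>x. f n x - v x)) \<longlonglongrightarrow> 0" by blast
  have "a v \<psi> = l \<psi>" if \<psi>: "\<psi> \<in> X" for \<psi>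
  proof -
    have lim: "(\<lambda>n. a (f n) \<psi>) \<longlonglongrightarrow> a v \<psi>"
    proof (rule LIM_zero_cancel, rule Lim_null_comparison)
      have "(\<lambda>n. K * N (\<lambda>x. f n x - v x) * N \<psi>) \<longlonglongrightarrow> K * 0 * N \<psi>" by (intro tendsto_intros v(2))
      then show "(\<lambda>n. K * N (\<lambda>x. f n x - v x) * N \<psi>) \<longlonglongrightarrow> 0" by simp
      have "norm (a (f n) \<psi> - a v \<psi>) \<le> K * N (\<lambda>x. f n x - v x) * N \<psi>" for n
        using a_bound[OF S.diff[OF fX[of n] v(1)] \<psi>] a_left[OF fX[of n] v(1) \<psi>, of "-1"] by simp
      then show "\<forall>\<^sub>F n in sequentially. norm (a (f n) \<psi> - a v \<psi>) \<le> K * N (\<lambda>x. f n x - v x) * N \<psi>" by simp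
    qed
    have quad: "0 \<le> 2 * t * (a v \<psi> - l \<psi>) + t\<^sup>2 * a \<psi> \<psi>" for t
    proof (rule tendsto_lowerbound)
      show "(\<lambda>n. 2 * t * (a (f n) \<psi> - l \<psi>) + t\<^sup>2 * a \<psi> \<psi> + 1 / real (Suc n)) \<longlonglongrightarrow> 2 * t * (a v \<psi> - l \<psi>) + t\<^sup>2 * a \<psi> \<psi>"
        using tendsto_add[OF tendsto_add[OF tendsto_mult[OF tendsto_const[of "2 * t"] tendsto_diff[OF lim tendsto_const[of "l \<psi>"]]]
            tendsto_const[of "t\<^sup>2 * a \<psi> \<psi>"]] LIMSEQ_Suc[OF lim_1_over_n]] by simp
      show "\<forall>\<^sub>F n in sequentially. 0 \<le> 2 * t * (a (f n) \<psi> - l \<psi>) + t\<^sup>2 * a \<psi> \<psi> + 1 / real (Suc n)"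
      proof (rule always_eventually, rule allI)
        fix n
        show "0 \<le> 2 * t * (a (f n) \<psi> - l \<psi>) + t\<^sup>2 * a \<psi> \<psi> + 1 / real (Suc n)"
          using I[OF S.add_scale[OF fX[of n] \<psi>, of t]] expand[OF fX[of n] \<psi>, of t] fJ[of n] by simp
      qed
    qed simp
    \<comment> \<open>The nonnegative quadratic is evaluated at t = - d / b. The coefficient
      \<open>b\<close> is increased by 1 so that it is positive even if
      \<open>a \<psi> \<psi>\<close> vanishes.\<close>
    define d b where "d = a v \<psi> - l \<psi>" and "b = a \<psi> \<psi> + 1"
    have "0 \<le> c * (N \<psi>)\<^sup>2" using c by simp
    then have b: "b > 0" using a_coercive[OF \<psi>] unfolding b_def by linarith
    have "0 \<le> 2 * (- d / b) * d + (- d / b)\<^sup>2 * a \<psi> \<psi>" using quad[of "- d / b"] by (simp add: d_def)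
    also have "\<dots> \<le> 2 * (- d / b) * d + (- d / b)\<^sup>2 * b" by (simp add: b_def mult_left_mono)
    also have "\<dots> = - (d\<^sup>2 / b)" using b by (simp add: power2_eq_square field_simps)
    finally have "d\<^sup>2 / b \<le> 0" by simp
    then have "d\<^sup>2 \<le> 0" using b by (simp add: divide_le_0_iff)
    then show ?thesis by (simp add: d_def)
  qed
  then show ?thesis using v(1) by blast
qed

section \<open>Bounded continuous coefficient functions\<close>

definition sup_space :: "'a::topological_space set \<Rightarrow> ('a \<Rightarrow> 'b::real_normed_vector) set" where
  "sup_space S = {f. continuous_on S f \<and> bounded (f ` S)}"

definition sup_norm :: "'a set \<Rightarrow> ('a \<Rightarrow> 'b::real_normed_vector) \<Rightarrow> real" where
  "sup_norm S f = (SUP x\<in>S. norm (f x))"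

lemma sup_norm_upper_bounded:
  assumes "bounded (f ` S)" "x \<in> S" shows "norm (f x) \<le> sup_norm S f"
proof -
  obtain B where "\<forall>y\<in>f ` S. norm y \<le> B" using assms(1) unfolding bounded_iff by blast
  then have "bdd_above ((\<lambda>x. norm (f x)) ` S)" by (intro bdd_aboveI2[where M = B]) auto
  then show ?thesis unfolding sup_norm_def using assms(2) by (intro cSUP_upper)
qed

lemma sup_norm_upper: "f \<in> sup_space S \<Longrightarrow> x \<in> S \<Longrightarrow> norm (f x) \<le> sup_norm S f"
  by (rule sup_norm_upper_bounded) (simp_all add: sup_space_def)

lemma sup_norm_least: "S \<noteq> {} \<Longrightarrow> (\<And>x. x \<in> S \<Longrightarrow> norm (f x) \<le> c) \<Longrightarrow> sup_norm S f \<le> c"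
  unfolding sup_norm_def by (rule cSUP_least)

lemma sup_norm_eq_0: "S \<noteq> {} \<Longrightarrow> (\<And>x. x \<in> S \<Longrightarrow> f x = 0) \<Longrightarrow> sup_norm S f = 0"
  unfolding sup_norm_def by simp

lemma sup_space_bilinear:
  assumes b: "bounded_bilinear b" and fg: "f \<in> sup_space S" "g \<in> sup_space S"
  shows "(\<lambda>x. b (f x) (g x)) \<in> sup_space S"
proof -
  obtain K where K: "0 \<le> K" "\<forall>x y. norm (b x y) \<le> norm x * norm y * K"
    using bounded_bilinear.nonneg_bounded[OF b] by blast
  have "norm (b (f x) (g x)) \<le> sup_norm S f * sup_norm S g * K" if x: "x \<in> S" for x
  proof -
    have "norm (b (f x) (g x)) \<le> norm (f x) * norm (g x) * K" using K(2) by blast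
    also have "\<dots> \<le> sup_norm S f * sup_norm S g * K"
      using sup_norm_upper[OF fg(1) x] sup_norm_upper[OF fg(2) x] K(1)
      by (intro mult_mono mult_right_mono) (auto intro: order_trans[OF norm_ge_zero])
    finally show ?thesis .
  qed
  then have "bounded ((\<lambda>x. b (f x) (g x)) ` S)" unfolding bounded_iff by blast
  then show ?thesis using fg bounded_bilinear.continuous_on[OF b] unfolding sup_space_def by auto
qed

lemma sup_space_compose:
  fixes f :: "'a::topological_space \<Rightarrow> 'b::euclidean_space" and L :: "'b \<Rightarrow> 'c::real_normed_vector"
  assumes "f \<in> sup_space S" "continuous_on UNIV L"
  shows "(\<lambda>x. L (f x)) \<in> sup_space S"
  using assms bounded_continuous_image[of f S L] continuous_on_compose2[of UNIV L S f]
  unfolding sup_space_def by auto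

lemma sup_space_const: "(\<lambda>x. c) \<in> sup_space S"
  unfolding sup_space_def bounded_iff by auto

text \<open>Stated for bounded functions on a bare set because it also serves functionals on
  \<open>unit_grads\<close>, a set of functions without topology.\<close>

lemma seminormed_bounded:
  assumes S: "S \<noteq> {}"
  shows "seminormed_space {f :: 'a \<Rightarrow> 'b::real_normed_vector. bounded (f ` S)} (sup_norm S)"
proof
  fix f g :: "'a \<Rightarrow> 'b" and c :: real
  have sc: "bounded ((\<lambda>x. c *\<^sub>R f x) ` S)" if "bounded (f ` S)" for f :: "'a \<Rightarrow> 'b" and c
    using bounded_scaling[OF that, of c] by (simp add: image_image)
  have le: "sup_norm S (\<lambda>x. c *\<^sub>R f x) \<le> \<bar>c\<bar> * sup_norm S f" if "bounded (f ` S)" for f :: "'a \<Rightarrow> 'b" and c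
    using sup_norm_upper_bounded[OF that] by (intro sup_norm_least S) (simp add: mult_left_mono)
  assume "f \<in> {f. bounded (f ` S)}"
  then have f: "bounded (f ` S)" by simp
  show "sup_norm S (\<lambda>x. c *\<^sub>R f x) = \<bar>c\<bar> * sup_norm S f"
  proof (cases "c = 0")
    case True
    then show ?thesis using S by (simp add: sup_norm_def)
  next
    case False
    have "sup_norm S f \<le> \<bar>inverse c\<bar> * sup_norm S (\<lambda>x. c *\<^sub>R f x)"
      using le[OF sc[OF f, of c], of "inverse c"] False by simp
    then have "\<bar>c\<bar> * sup_norm S f \<le> sup_norm S (\<lambda>x. c *\<^sub>R f x)" using False by (simp add: field_simps abs_inverse)
    then show ?thesis using le[OF f, of c] by simp
  qed
  assume "g \<in> {f. bounded (f ` S)}"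
  then have g: "bounded (g ` S)" by simp
  show "sup_norm S (\<lambda>x. f x + g x) \<le> sup_norm S f + sup_norm S g"
    by (intro sup_norm_least S order_trans[OF norm_triangle_ineq] add_mono sup_norm_upper_bounded f g)
  show "(\<lambda>x. f x + c *\<^sub>R g x) \<in> {f. bounded (f ` S)}"
    using bounded_plus_comp[OF f sc[OF g, of c]] by simp
qed (auto simp: bounded_iff)

lemma seminormed_subspace:
  assumes "seminormed_space X N" "Y \<subseteq> X" "(\<lambda>x. 0) \<in> Y"
    and "\<And>f g c. f \<in> Y \<Longrightarrow> g \<in> Y \<Longrightarrow> (\<lambda>x. f x + c *\<^sub>R g x) \<in> Y"
  shows "seminormed_space Y N"
proof -
  interpret seminormed_space X N by (rule assms(1))
  show ?thesis by unfold_locales (use assms triangle homogeneous in blast)+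
qed

lemma seminormed_sup_space:
  assumes S: "S \<noteq> {}"
  shows "seminormed_space (sup_space S :: ('a::topological_space \<Rightarrow> 'b::real_normed_vector) set) (sup_norm S)"
proof (rule seminormed_subspace[OF seminormed_bounded[OF S]])
  fix f g :: "'a \<Rightarrow> 'b" and c :: real
  assume f: "f \<in> sup_space S" and g: "g \<in> sup_space S"
  have g': "(\<lambda>x. c *\<^sub>R g x) \<in> sup_space S" by (rule sup_space_bilinear[OF bounded_bilinear_scaleR sup_space_const g])
  show "(\<lambda>x. f x + c *\<^sub>R g x) \<in> sup_space S"
    using f g' bounded_plus_comp[of f S "\<lambda>x. c *\<^sub>R g x"] unfolding sup_space_def by (auto intro!: continuous_on_add)
qed (auto simp: sup_space_def sup_space_const bounded_iff)

lemma bilinear_sup_spaces: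
  fixes b :: "'b::real_normed_vector \<Rightarrow> 'c::real_normed_vector \<Rightarrow> 'd::real_normed_vector"
    and S :: "'a::topological_space set"
  assumes b: "bounded_bilinear b" and S: "S \<noteq> {}"
  shows "\<exists>K. bilinear_spaces (sup_space S) (sup_norm S) (sup_space S) (sup_norm S) (sup_space S) (sup_norm S)
    (\<lambda>f g x. b (f x) (g x)) K"
proof -
  interpret bounded_bilinear b by (rule b)
  obtain K where K: "0 \<le> K" "\<forall>x y. norm (b x y) \<le> norm x * norm y * K" using nonneg_bounded by blast
  have "bilinear_spaces (sup_space S) (sup_norm S) (sup_space S) (sup_norm S) (sup_space S) (sup_norm S)
    (\<lambda>f g (x::'a). b (f x) (g x)) K"
  proof (intro bilinear_spaces.intro seminormed_sup_space S bilinear_spaces_axioms.intro)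
    fix f :: "'a \<Rightarrow> 'b" and g :: "'a \<Rightarrow> 'c" assume fg: "f \<in> sup_space S" "g \<in> sup_space S"
    show "sup_norm S (\<lambda>x. b (f x) (g x)) \<le> K * sup_norm S f * sup_norm S g"
    proof (rule sup_norm_least[OF S])
      fix x assume x: "x \<in> S"
      have "norm (b (f x) (g x)) \<le> norm (f x) * norm (g x) * K" using K(2) by blast
      also have "\<dots> \<le> sup_norm S f * sup_norm S g * K"
        using sup_norm_upper[OF fg(1) x] sup_norm_upper[OF fg(2) x] K(1)
        by (intro mult_mono mult_right_mono) (auto intro: order_trans[OF norm_ge_zero])
      finally show "norm (b (f x) (g x)) \<le> K * sup_norm S f * sup_norm S g" by (simp add: mult_ac)
    qed
  qed (auto simp: add_left add_right scaleR_left scaleR_right K(1) intro: sup_space_bilinear[OF b])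
  then show ?thesis by blast
qed

lemma Cm_curve_sup_bilinear:
  fixes b :: "'b::real_normed_vector \<Rightarrow> 'c::real_normed_vector \<Rightarrow> 'd::real_normed_vector" and S :: "'a::topological_space set"
  assumes "bounded_bilinear b" "S \<noteq> {}" "open J"
    and "Cm_curve m (sup_space S) (sup_norm S) J c" "Cm_curve m (sup_space S) (sup_norm S) J d"
  shows "Cm_curve m (sup_space S) (sup_norm S) J (\<lambda>s x. b (c s x) (d s x))"
proof -
  obtain K where "bilinear_spaces (sup_space S) (sup_norm S) (sup_space S) (sup_norm S) (sup_space S) (sup_norm S)
    (\<lambda>f g x. b (f x) (g x)) K" using bilinear_sup_spaces[OF assms(1,2)] by blast
  from bilinear_spaces.Cm_curve_bilinear[OF this assms(3-5)] show ?thesis .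
qed

lemma Cm_curve_sup_linear:
  fixes L :: "'b::euclidean_space \<Rightarrow> 'c::real_normed_vector"
  assumes L: "bounded_linear L" and S: "S \<noteq> {}" and J: "open J"
    and c: "Cm_curve m (sup_space S) (sup_norm S) J c"
  shows "Cm_curve m (sup_space S) (sup_norm S) J (\<lambda>s x. L (c s x))"
proof -
  interpret bounded_linear L by (rule L)
  interpret S: seminormed_space "sup_space S :: (_ \<Rightarrow> 'b) set" "sup_norm S" by (rule seminormed_sup_space[OF S])
  obtain K where K: "0 \<le> K" "\<forall>x. norm (L x) \<le> norm x * K" using nonneg_bounded by blast
  show ?thesis
  proof (rule Cm_curve_image[OF J seminormed_sup_space[OF S] _ _ c, where C = K and T = "\<lambda>f x. L (f x)"])
    fix f g k :: "'a \<Rightarrow> 'b" and a b :: real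
    assume f: "f \<in> sup_space S"
    show "(\<lambda>x. L (f x)) \<in> sup_space S"
      by (rule sup_space_compose[OF f]) (intro linear_continuous_on L)
    assume "g \<in> sup_space S" "k \<in> sup_space S"
    then have q: "(\<lambda>x. a *\<^sub>R (f x - g x) - b *\<^sub>R k x) \<in> sup_space S" by (intro S.diff S.scale f)
    show "sup_norm S (\<lambda>y. a *\<^sub>R (L (f y) - L (g y)) - b *\<^sub>R L (k y)) \<le> K * sup_norm S (\<lambda>x. a *\<^sub>R (f x - g x) - b *\<^sub>R k x)"
    proof (rule sup_norm_least[OF S])
      fix x assume x: "x \<in> S"
      have "norm (a *\<^sub>R (L (f x) - L (g x)) - b *\<^sub>R L (k x)) \<le> norm (a *\<^sub>R (f x - g x) - b *\<^sub>R k x) * K"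
        using K(2)[rule_format, of "a *\<^sub>R (f x - g x) - b *\<^sub>R k x"] by (simp add: diff scaleR)
      also have "\<dots> \<le> sup_norm S (\<lambda>x. a *\<^sub>R (f x - g x) - b *\<^sub>R k x) * K" by (intro mult_right_mono sup_norm_upper[OF q x] K(1))
      finally show "norm (a *\<^sub>R (L (f x) - L (g x)) - b *\<^sub>R L (k x)) \<le> K * sup_norm S (\<lambda>x. a *\<^sub>R (f x - g x) - b *\<^sub>R k x)"
        by (simp add: mult.commute)
    qed
  qed
qed

lemma Cm_curve_sup_sum:
  assumes S: "S \<noteq> {}" and J: "open J" and "finite I"
    and "\<And>i. i \<in> I \<Longrightarrow> Cm_curve m (sup_space S) (sup_norm S) J (c i)"
  shows "Cm_curve m (sup_space S) (sup_norm S) J (\<lambda>s x. \<Sum>i\<in>I. c i s x)"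
  using assms(3,4)
proof (induction I)
  interpret S: seminormed_space "sup_space S :: (_ \<Rightarrow> 'c) set" "sup_norm S" by (rule seminormed_sup_space[OF S])
  case empty
  then show ?case using S.Cm_curve_const[OF S.zero] by simp
next
  interpret S: seminormed_space "sup_space S :: (_ \<Rightarrow> 'c) set" "sup_norm S" by (rule seminormed_sup_space[OF S])
  case (insert i I)
  from S.Cm_curve_add_scale[OF J, of m "c i" "\<lambda>s x. \<Sum>i\<in>I. c i s x" 1] insert show ?case by simp
qed

lemma Cm_curve_sup_prod:
  fixes c :: "'i \<Rightarrow> real \<Rightarrow> 'a::topological_space \<Rightarrow> real"
  assumes S: "S \<noteq> {}" and J: "open J" and "finite I"
    and "\<And>i. i \<in> I \<Longrightarrow> Cm_curve m (sup_space S) (sup_norm S) J (c i)"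
  shows "Cm_curve m (sup_space S) (sup_norm S) J (\<lambda>s x. \<Prod>i\<in>I. c i s x)"
  using assms(3,4)
proof (induction I)
  interpret S: seminormed_space "sup_space S :: (_ \<Rightarrow> real) set" "sup_norm S" by (rule seminormed_sup_space[OF S])
  case empty
  then show ?case using S.Cm_curve_const[OF sup_space_const] by simp
next
  case (insert i I)
  from Cm_curve_sup_bilinear[OF bounded_bilinear_mult S J insert(4)[of i] insert(3)] insert show ?case by simp
qed

lemma Cm_curve_sup_det:
  fixes A :: "real \<Rightarrow> 'a::topological_space \<Rightarrow> real^'n^'n"
  assumes S: "S \<noteq> {}" and J: "open J" and A: "Cm_curve m (sup_space S) (sup_norm S) J A"
  shows "Cm_curve m (sup_space S) (sup_norm S) J (\<lambda>s x. det (A s x))"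
proof -
  have entry: "Cm_curve m (sup_space S) (sup_norm S) J (\<lambda>s x. A s x $ i $ j)" for i j
    by (rule Cm_curve_sup_linear[OF bounded_linear_compose[OF bounded_linear_vec_nth bounded_linear_vec_nth] S J A])
  have "Cm_curve m (sup_space S) (sup_norm S) J (\<lambda>s x. of_int (sign p) * (\<Prod>i\<in>UNIV. A s x $ i $ p i))" for p
    by (rule Cm_curve_sup_linear[OF bounded_linear_mult_right S J], rule Cm_curve_sup_prod[OF S J finite], rule entry)
  then show ?thesis unfolding det_def by (intro Cm_curve_sup_sum S J finite_permutations finite)
qed

text \<open>Multiplication by \<open>B s\<close> from the left bounds a field by its product with
  \<open>A s\<close>, and applied to a right-hand side it gives a solution; so \<open>B\<close>
  falls under \<open>Cm_curve_solve\<close> with constant right-hand side.\<close>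

theorem Cm_curve_sup_inverse:
  fixes A :: "real \<Rightarrow> 'a::topological_space \<Rightarrow> real^'n^'n"
  assumes S: "S \<noteq> {}" and J: "open J" and A: "Cm_curve m (sup_space S) (sup_norm S) J A"
    and B: "\<And>s. s \<in> J \<Longrightarrow> B s \<in> sup_space S"
    and inv: "\<And>s x. s \<in> J \<Longrightarrow> x \<in> S \<Longrightarrow> A s x ** B s x = mat 1"
  shows "Cm_curve m (sup_space S) (sup_norm S) J B"
proof -
  have inv': "B s x ** A s x = mat 1" if "s \<in> J" "x \<in> S" for s x
    using inv[OF that] matrix_left_right_inverse by blast
  interpret S: seminormed_space "sup_space S :: (_ \<Rightarrow> real^'n^'n) set" "sup_norm S" by (rule seminormed_sup_space[OF S])
  obtain K where "bilinear_spaces (sup_space S) (sup_norm S) (sup_space S) (sup_norm S) (sup_space S) (sup_norm S)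
    (\<lambda>f g (x::'a). f x ** (g x :: real^'n^'n) :: real^'n^'n) K"
    using bilinear_sup_spaces[OF bounded_bilinear_matrix_matrix S] by blast
  then interpret Bi: bilinear_spaces "sup_space S" "sup_norm S" "sup_space S" "sup_norm S" "sup_space S" "sup_norm S"
    "\<lambda>f g (x::'a). f x ** (g x :: real^'n^'n) :: real^'n^'n" K .
  have congS: "sup_norm S f = sup_norm S g" if "\<And>x. x \<in> S \<Longrightarrow> f x = g x" for f g :: "'a \<Rightarrow> real^'n^'n"
    unfolding sup_norm_def using that by (intro SUP_cong) auto
  have mem: "(\<lambda>x. f x ** g x) \<in> sup_space S" if "f \<in> sup_space S" "g \<in> sup_space S" for f g :: "'a \<Rightarrow> real^'n^'n"
    by (rule sup_space_bilinear[OF bounded_bilinear_matrix_matrix that])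
  show ?thesis
  proof (rule Bi.Cm_curve_solve[OF J _ _ A S.Cm_curve_const[OF sup_space_const[of "mat 1"]]])
    fix s assume s: "s \<in> J"
    show "B s \<in> sup_space S" by (rule B[OF s])
    show "sup_norm S (\<lambda>y. A s y ** B s y - mat 1) = 0" by (rule sup_norm_eq_0[OF S]) (simp add: inv[OF s])
    have "sup_norm S v \<le> (K * sup_norm S (B s)) * sup_norm S (\<lambda>x. A s x ** v x)" if v: "v \<in> sup_space S"
      for v :: "'a \<Rightarrow> real^'n^'n"
    proof -
      have "sup_norm S v = sup_norm S (\<lambda>x. B s x ** (A s x ** v x))"
        by (rule congS) (simp add: matrix_mul_assoc inv'[OF s])
      then show ?thesis using Bi.p_bound[OF B[OF s] mem[OF S.Cm_curve_mem[OF A s] v]] by simp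
    qed
    then show "\<exists>C. \<forall>v\<in>(sup_space S :: ('a \<Rightarrow> real^'n^'n) set). sup_norm S v \<le> C * sup_norm S (\<lambda>x. A s x ** v x)"
      by blast
    fix b :: "'a \<Rightarrow> real^'n^'n" assume b: "b \<in> sup_space S"
    show "\<exists>v\<in>(sup_space S :: ('a \<Rightarrow> real^'n^'n) set). sup_norm S (\<lambda>y. A s y ** v y - b y) = 0"
      by (rule bexI[OF _ mem[OF B[OF s] b]], rule sup_norm_eq_0[OF S]) (simp add: matrix_mul_assoc inv[OF s])
  qed
qed

section \<open>Jacobians of curves of diffeomorphisms\<close>

lemma Ck_on_partials:
  assumes "open S"
  shows "Ck_on (length is + k) f S \<Longrightarrow> Ck_on k (partials is f) S"
proof (induction "is" arbitrary: k)
  case (Cons i "is")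
  then have "Ck_on (Suc k) (partials is f) S" by simp
  then show ?case unfolding Ck_on_Suc_iff[OF assms] by simp
qed simp

lemma partials_has_derivative:
  assumes "open S" "Ck_on k f S" "length is < k" "x \<in> S"
  shows "(partials is f has_derivative frechet_derivative (partials is f) (at x)) (at x)"
proof -
  have "Ck_on (length is + 1) f S" using assms(2,3) by (intro Ck_on_mono[OF _ assms(2)]) simp
  from Ck_on_partials[OF assms(1) this] have "partials is f differentiable (at x)"
    unfolding One_nat_def Ck_on_Suc_iff[OF assms(1)] using assms(4) by blast
  then show ?thesis by (simp add: frechet_derivative_works)
qed

lemma partials_linear:
  assumes S: "open S" and f: "Ck_on k f S" and g: "Ck_on k g S"
  shows "length is \<le> k \<Longrightarrow> x \<in> S \<Longrightarrow>
    partials is (\<lambda>x. a *\<^sub>R f x + b *\<^sub>R g x) x = a *\<^sub>R partials is f x + b *\<^sub>R partials is g x"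
proof (induction "is" arbitrary: x)
  case (Cons i "is")
  then have len: "length is < k" by simp
  have "((\<lambda>x. a *\<^sub>R partials is f x + b *\<^sub>R partials is g x) has_derivative
      (\<lambda>v. a *\<^sub>R frechet_derivative (partials is f) (at x) v + b *\<^sub>R frechet_derivative (partials is g) (at x) v)) (at x)"
    by (intro derivative_intros partials_has_derivative[OF S f len Cons.prems(2)] partials_has_derivative[OF S g len Cons.prems(2)])
  then have "(partials is (\<lambda>x. a *\<^sub>R f x + b *\<^sub>R g x) has_derivative
      (\<lambda>v. a *\<^sub>R frechet_derivative (partials is f) (at x) v + b *\<^sub>R frechet_derivative (partials is g) (at x) v)) (at x)"
    by (rule has_derivative_transform_within_open[OF _ S Cons.prems(2)]) (use Cons in simp)
  from frechet_derivative_at[OF this] show ?case by (simp add: fun_eq_iff)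
qed simp

lemma holder_space_linear:
  fixes f g :: "real^'n \<Rightarrow> 'b::real_normed_vector"
  assumes f: "f \<in> holder_space k \<alpha> K" and g: "g \<in> holder_space k \<alpha> K"
  shows "(\<lambda>x. a *\<^sub>R f x + b *\<^sub>R g x) \<in> holder_space k \<alpha> K"
proof -
  have C: "Ck_on k f (interior K)" "Ck_on k g (interior K)" "continuous_on K f" "continuous_on K g"
    using f g by (auto simp: holder_space_def)
  note lin = partials_linear[OF open_interior C(1,2), of _ _ a b]
  have "\<exists>e. continuous_on K e \<and> (\<forall>x\<in>interior K. e x = partials is (\<lambda>x. a *\<^sub>R f x + b *\<^sub>R g x) x)"
    if len: "length is \<le> k" for "is"
  proof -
    obtain e1 where e1: "continuous_on K e1" "\<forall>x\<in>interior K. e1 x = partials is f x"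
      using f len unfolding holder_space_def by blast
    obtain e2 where e2: "continuous_on K e2" "\<forall>x\<in>interior K. e2 x = partials is g x"
      using g len unfolding holder_space_def by blast
    show ?thesis
      by (intro exI[of _ "\<lambda>x. a *\<^sub>R e1 x + b *\<^sub>R e2 x"] conjI ballI continuous_intros e1(1) e2(1))
        (simp add: lin[OF len] e1(2) e2(2))
  qed
  moreover have "\<exists>L. \<forall>x\<in>interior K. \<forall>y\<in>interior K. norm (partials is (\<lambda>x. a *\<^sub>R f x + b *\<^sub>R g x) x -
      partials is (\<lambda>x. a *\<^sub>R f x + b *\<^sub>R g x) y) \<le> L * dist x y powr \<alpha>"
    if len: "length is = k" for "is"
  proof -
    obtain L1 where L1: "\<forall>x\<in>interior K. \<forall>y\<in>interior K. norm (partials is f x - partials is f y) \<le> L1 * dist x y powr \<alpha>"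
      using f len unfolding holder_space_def by blast
    obtain L2 where L2: "\<forall>x\<in>interior K. \<forall>y\<in>interior K. norm (partials is g x - partials is g y) \<le> L2 * dist x y powr \<alpha>"
      using g len unfolding holder_space_def by blast
    have "norm (partials is (\<lambda>x. a *\<^sub>R f x + b *\<^sub>R g x) x - partials is (\<lambda>x. a *\<^sub>R f x + b *\<^sub>R g x) y)
        \<le> (\<bar>a\<bar> * L1 + \<bar>b\<bar> * L2) * dist x y powr \<alpha>" if xy: "x \<in> interior K" "y \<in> interior K" for x y
    proof -
      have len': "length is \<le> k" using len by simp
      have "partials is (\<lambda>x. a *\<^sub>R f x + b *\<^sub>R g x) x - partials is (\<lambda>x. a *\<^sub>R f x + b *\<^sub>R g x) y =
          a *\<^sub>R (partials is f x - partials is f y) + b *\<^sub>R (partials is g x - partials is g y)"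
        unfolding lin[OF len' xy(1)] lin[OF len' xy(2)] by (simp add: algebra_simps)
      also have "norm \<dots> \<le> \<bar>a\<bar> * norm (partials is f x - partials is f y) + \<bar>b\<bar> * norm (partials is g x - partials is g y)"
        by (rule order_trans[OF norm_triangle_ineq]) simp
      also have "\<dots> \<le> \<bar>a\<bar> * (L1 * dist x y powr \<alpha>) + \<bar>b\<bar> * (L2 * dist x y powr \<alpha>)"
        using L1 L2 xy by (intro add_mono mult_left_mono) auto
      finally show ?thesis by (simp add: algebra_simps)
    qed
    then show ?thesis by blast
  qed
  moreover have "Ck_on k (\<lambda>x. a *\<^sub>R f x + b *\<^sub>R g x) (interior K)"
    by (intro Ck_on_add Ck_on_linear_compose[OF bounded_linear_scaleR_right] C)
  ultimately show ?thesis using C unfolding holder_space_def by (auto intro!: continuous_intros)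
qed

lemma holder_space_partials_sup_space:
  assumes "f \<in> holder_space k \<alpha> K" "compact K" "length is \<le> k"
  shows "partials is f \<in> sup_space (interior K)"
proof -
  have "Ck_on k f (interior K)" using assms(1) by (simp add: holder_space_def)
  then have "Ck_on (length is + 0) f (interior K)" by (rule Ck_on_mono[rotated]) (simp add: assms(3))
  from Ck_on_partials[OF open_interior this] have "continuous_on (interior K) (partials is f)" by simp
  with holder_space_partials_bounded[OF assms] show ?thesis unfolding sup_space_def by blast
qed

lemma sup_norm_partials_le_holder_norm:
  fixes f :: "real^'n \<Rightarrow> 'b::real_normed_vector"
  assumes f: "f \<in> holder_space k \<alpha> K" and K: "compact K" and len: "length is \<le> k"
    and ab: "a \<in> interior K" "b \<in> interior K" "a \<noteq> b"
  shows "sup_norm (interior K) (partials is f) \<le> holder_norm k \<alpha> K f"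
proof -
  have fin: "finite {is :: 'n list. length is \<le> k}" using finite_lists_length_le[of "UNIV :: 'n set" k] by simp
  have nn: "0 \<le> (SUP x\<in>interior K. norm (partials js f x))" if "length js \<le> k" for js
    using sup_norm_upper[OF holder_space_partials_sup_space[OF f K that] ab(1)]
    unfolding sup_norm_def by (rule order_trans[OF norm_ge_zero])
  have "sup_norm (interior K) (partials is f) \<le> (\<Sum>is | length is \<le> k. SUP x\<in>interior K. norm (partials is f x))"
    unfolding sup_norm_def
    by (rule member_le_sum[of "is" _ "\<lambda>is. SUP x\<in>interior K. norm (partials is f x)", OF _ _ fin]) (use nn len in auto)
  moreover have "0 \<le> (\<Sum>is | length is = k.
        SUP (x, y)\<in>{(x, y). x \<in> interior K \<and> y \<in> interior K \<and> x \<noteq> y}.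
          norm (partials is f x - partials is f y) / dist x y powr \<alpha>)"
  proof (rule sum_nonneg)
    fix js :: "'n list" assume "js \<in> {is. length is = k}"
    then obtain L where L: "\<forall>x\<in>interior K. \<forall>y\<in>interior K. norm (partials js f x - partials js f y) \<le> L * dist x y powr \<alpha>"
      using f unfolding holder_space_def by blast
    let ?q = "\<lambda>(x, y). norm (partials js f x - partials js f y) / dist x y powr \<alpha>"
    let ?A = "{(x, y). x \<in> interior K \<and> y \<in> interior K \<and> x \<noteq> y}"
    have "?q p \<le> L" if "p \<in> ?A" for p
    proof -
      obtain x y where pp: "p = (x, y)" by (cases p)
      then have p: "p = (x, y)" "x \<in> interior K" "y \<in> interior K" "x \<noteq> y" using that by simp_all
      then have "dist x y powr \<alpha> > 0" by simp
      then show ?thesis using L p by (simp add: divide_le_eq)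
    qed
    then have bdd: "bdd_above (?q ` ?A)" by (intro bdd_aboveI2[where M = L])
    have "0 \<le> ?q (a, b)" by simp
    also have "\<dots> \<le> (SUP p\<in>?A. ?q p)" using ab by (intro cSUP_upper bdd) auto
    finally show "0 \<le> (SUP p\<in>?A. ?q p)" .
  qed
  ultimately show ?thesis unfolding holder_norm_def by simp
qed

definition jac :: "(real^'n \<Rightarrow> real^'n) \<Rightarrow> real^'n \<Rightarrow> real^'n^'n" where
  "jac f x = (\<chi> i j. partials [j] f x $ i)"

lemma jac_matrix: "jac f x = matrix (frechet_derivative f (at x))"
  by (simp add: jac_def matrix_def)

lemma norm_matrix_le:
  fixes A :: "real^'n^'n"
  assumes "\<And>i j. \<bar>A $ i $ j\<bar> \<le> c"
  shows "norm A \<le> (real CARD('n))\<^sup>2 * c"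
proof -
  have "norm A \<le> (\<Sum>i\<in>UNIV. norm (A $ i))" unfolding norm_vec_def by (rule L2_set_le_sum) simp
  also have "\<dots> \<le> (\<Sum>i\<in>(UNIV::'n set). \<Sum>j\<in>(UNIV::'n set). c)"
    using assms by (intro sum_mono order_trans[OF norm_le_l1_cart]) auto
  finally show ?thesis by (simp add: power2_eq_square)
qed

lemma cell_two_points: "(0 :: real^'n) \<in> cell" "(\<chi> i. 1 / 4) \<in> (cell :: (real^'n) set)"
  "(0 :: real^'n) \<noteq> (\<chi> i. 1 / 4)" "(cell :: (real^'n) set) \<noteq> {}"
proof -
  show 1: "(0 :: real^'n) \<in> cell" "(\<chi> i. 1 / 4) \<in> (cell :: (real^'n) set)"
    by (auto simp: cell_def mem_box_cart)
  show "(0 :: real^'n) \<noteq> (\<chi> i. 1 / 4)" by (simp add: vec_eq_iff)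
  show "(cell :: (real^'n) set) \<noteq> {}" using 1 by blast
qed

lemma holder_space_jac:
  fixes f :: "real^'n \<Rightarrow> real^'n"
  assumes f: "f \<in> holder_space 2 1 (closure cell)"
  shows "continuous_on (closure cell) f"
    and "x \<in> cell \<Longrightarrow> (f has_derivative (\<lambda>v. jac f x *v v)) (at x)"
    and "jac f \<in> sup_space cell"
    and "sup_norm cell (jac f) \<le> (real CARD('n))\<^sup>2 * holder_norm 2 1 (closure cell) f"
proof -
  have C: "Ck_on 2 f cell" using f by (simp add: holder_space_def interior_closure_cell)
  show "continuous_on (closure cell) f" using f by (simp add: holder_space_def)
  show "(f has_derivative (\<lambda>v. jac f x *v v)) (at x)" if x: "x \<in> cell"
  proof -
    have "(f has_derivative frechet_derivative f (at x)) (at x)"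
      using partials_has_derivative[OF open_cell C, of "[]"] x by simp
    moreover from this have "linear (frechet_derivative f (at x))" by (rule has_derivative_linear)
    ultimately show ?thesis by (simp add: jac_matrix matrix_works)
  qed
  have p: "partials [j] f \<in> sup_space cell" for j
    using holder_space_partials_sup_space[OF f compact_closure_cell, of "[j]"] by (simp add: interior_closure_cell)
  have n: "sup_norm cell (partials [j] f) \<le> holder_norm 2 1 (closure cell) f" for j
    using sup_norm_partials_le_holder_norm[OF f compact_closure_cell, of "[j]" 0 "\<chi> i. 1/4"] cell_two_points
    by (simp add: interior_closure_cell)
  have b: "norm (jac f x) \<le> (real CARD('n))\<^sup>2 * holder_norm 2 1 (closure cell) f" if x: "x \<in> cell" for x
  proof (rule norm_matrix_le)
    fix i j
    have "\<bar>jac f x $ i $ j\<bar> \<le> norm (partials [j] f x)" unfolding jac_def vec_lambda_beta by (rule component_le_norm_cart)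
    also have "\<dots> \<le> holder_norm 2 1 (closure cell) f" by (rule order_trans[OF sup_norm_upper[OF p x] n])
    finally show "\<bar>jac f x $ i $ j\<bar> \<le> holder_norm 2 1 (closure cell) f" .
  qed
  then show "sup_norm cell (jac f) \<le> (real CARD('n))\<^sup>2 * holder_norm 2 1 (closure cell) f"
    by (intro sup_norm_least cell_two_points)
  have "continuous_on cell (jac f)" unfolding jac_def[abs_def]
    using p by (intro continuous_on_vec_lambda continuous_on_component) (simp add: sup_space_def)
  moreover have "bounded (jac f ` cell)" using b unfolding bounded_iff by blast
  ultimately show "jac f \<in> sup_space cell" by (simp add: sup_space_def)
qed

lemma Cm_curve_jac:
  fixes h :: "real \<Rightarrow> real^'n \<Rightarrow> real^'n"
  assumes J: "open J" and h: "Cm_curve m (holder_space 2 1 (closure cell)) (holder_norm 2 1 (closure cell)) J h"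
  shows "Cm_curve m (sup_space cell) (sup_norm cell) J (\<lambda>s. jac (h s))"
proof (rule Cm_curve_image[OF J seminormed_sup_space _ _ h])
  fix f g k :: "real^'n \<Rightarrow> real^'n" and a b :: real
  assume f: "f \<in> holder_space 2 1 (closure cell)"
  show "jac f \<in> sup_space cell" by (rule holder_space_jac(3)[OF f])
  assume g: "g \<in> holder_space 2 1 (closure cell)" and k: "k \<in> holder_space 2 1 (closure cell)"
  \<comment> \<open>The combination is nested in binary sums with explicit coefficients so that
    \<open>holder_space_linear\<close> and \<open>partials_linear\<close> apply.\<close>
  define q where "q = (\<lambda>x. 1 *\<^sub>R (a *\<^sub>R f x + (- a) *\<^sub>R g x) + (- b) *\<^sub>R k x)"
  have q: "q \<in> holder_space 2 1 (closure cell)" unfolding q_def by (intro holder_space_linear f g k)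
  have C: "Ck_on 2 f cell" "Ck_on 2 g cell" "Ck_on 2 k cell" using f g k by (auto simp: holder_space_def interior_closure_cell)
  have C': "Ck_on 2 (\<lambda>x. a *\<^sub>R f x + (- a) *\<^sub>R g x) cell"
    by (intro Ck_on_add Ck_on_linear_compose[OF bounded_linear_scaleR_right] C)
  have "a *\<^sub>R (jac f x - jac g x) - b *\<^sub>R jac k x = jac q x" if x: "x \<in> cell" for x
  proof -
    have len: "length [j] \<le> 2" for j :: 'n by simp
    have "partials [j] q x = 1 *\<^sub>R (a *\<^sub>R partials [j] f x + (- a) *\<^sub>R partials [j] g x) + (- b) *\<^sub>R partials [j] k x" for j
      unfolding q_def by (simp only: partials_linear[OF open_cell C' C(3) len x] partials_linear[OF open_cell C(1,2) len x])
    then show ?thesis unfolding jac_def vec_eq_iff by (simp add: algebra_simps del: partials.simps)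
  qed
  then have "sup_norm cell (\<lambda>x. a *\<^sub>R (jac f x - jac g x) - b *\<^sub>R jac k x) = sup_norm cell (jac q)"
    unfolding sup_norm_def by (intro SUP_cong) auto
  also have "\<dots> \<le> (real CARD('n))\<^sup>2 * holder_norm 2 1 (closure cell) q" by (rule holder_space_jac(4)[OF q])
  also have "q = (\<lambda>x. a *\<^sub>R (f x - g x) - b *\<^sub>R k x)" by (simp add: q_def algebra_simps)
  finally show "sup_norm cell (\<lambda>x. a *\<^sub>R (jac f x - jac g x) - b *\<^sub>R jac k x) \<le>
    (real CARD('n))\<^sup>2 * holder_norm 2 1 (closure cell) (\<lambda>x. a *\<^sub>R (f x - g x) - b *\<^sub>R k x)" .
qed (rule cell_two_points)

lemma Diff_box_cell_diffeo:
  fixes h :: "real^'n \<Rightarrow> real^'n"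
  assumes h: "h \<in> Diff_box 2 1 U" and W: "open W" "frontier cell \<subseteq> W" "W \<inter> closure cell \<subseteq> U"
  shows "cell_diffeo h (cell_inverse h) (jac h) (jac (cell_inverse h)) W"
proof -
  have inj: "inj_on h (closure cell)" and hs: "h \<in> holder_space 2 1 (closure cell)"
    and im: "h ` closure cell = closure cell" and hU: "\<And>x. x \<in> U \<Longrightarrow> h x = x"
    and ks: "cell_inverse h \<in> holder_space 2 1 (closure cell)"
    using h by (auto simp: Diff_box_def Diff_def)
  show ?thesis
  proof (intro cell_diffeo.intro half_cell_diffeo.intro)
    fix x
    show "h x \<in> closure cell" if "x \<in> closure cell" using im that by blast
    show "cell_inverse h x \<in> closure cell" if "x \<in> closure cell" using im that by (metis inv_into_into)
    show "cell_inverse h (h x) = x" if "x \<in> closure cell" using inv_into_f_f[OF inj that] .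
    show "h (cell_inverse h x) = x" if "x \<in> closure cell" using im that by (metis f_inv_into_f)
    show hx: "h x = x" if "x \<in> W" "x \<in> closure cell" using hU W(3) that by blast
    show "cell_inverse h x = x" if "x \<in> W" "x \<in> closure cell"
      using inv_into_f_f[OF inj that(2)] hx[OF that] by simp
  qed (use W holder_space_jac[OF hs] holder_space_jac[OF ks] in \<open>simp_all add: sup_space_def\<close>)
qed

section \<open>Variational problems on the perforated cell\<close>

lemma is_weak_grad_linear:
  assumes "open U" "is_weak_grad U u v" "is_weak_grad U u' v'"
  shows "is_weak_grad U (\<lambda>x. a * u x + b * u' x) (\<lambda>x. a *\<^sub>R v x + b *\<^sub>R v' x)"
proof -
  have "is_weak_deriv U [i] (\<lambda>x. a * u x + b * u' x) (\<lambda>x. a * v x $ i + b * v' x $ i)" for i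
  proof -
    have w: "is_weak_deriv U [i] u (\<lambda>x. v x $ i)" "is_weak_deriv U [i] u' (\<lambda>x. v' x $ i)"
      using assms(2,3) by (auto simp: is_weak_grad_def)
    have "is_weak_deriv U [i] (\<lambda>x. u x + (a - 1) * u x) (\<lambda>x. v x $ i + (a - 1) * v x $ i)"
      by (rule is_weak_deriv_add_scale[OF assms(1) w(1) w(1)])
    from is_weak_deriv_add_scale[OF assms(1) this w(2), of b] show ?thesis by (simp add: algebra_simps)
  qed
  then show ?thesis by (simp add: is_weak_grad_def)
qed

section \<open>The space of gradients and its completeness\<close>

context perforated_cell
begin

lemma P_nonempty: "P \<noteq> {}"
proof
  assume "P = {}"
  \<comment> \<open>The bounded nonempty cell would then be both open and closed.\<close>
  then have "cell \<subseteq> closure (inclusion P)" using P_eq by blast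
  then have "cell = closure (inclusion P)" using inclusion_subset by blast
  then have "closed (cell :: (real^'n) set)" by (metis closed_closure)
  then have "(cell :: (real^'n) set) = UNIV" using clopen[of "cell :: (real^'n) set"] open_cell cell_two_points(4) by blast
  then show False using bounded_cell not_bounded_UNIV by metis
qed

lemma integral_1_pos: "(LINT x|M. 1::real) > 0"
proof -
  have lm: "P \<in> lmeasurable"
    by (rule bounded_set_imp_lmeasurable[OF bounded_subset[OF bounded_cell P_subset_cell]]) (simp add: open_P)
  have "(LINT x|M. 1::real) = measure lebesgue P"
    using lm by (simp add: measure_restrict_space fmeasurableD)
  moreover have "measure lebesgue P \<noteq> 0"
    using open_not_negligible[OF open_P P_nonempty] lm by (simp add: negligible_iff_measure)
  ultimately show ?thesis by (simp add: zero_less_measure_iff)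
qed

lemma
  fixes f :: "real^'n \<Rightarrow> 'b::euclidean_space"
  assumes f: "f \<in> L2v M"
  shows L2v_integrable: "integrable M f"
    and norm_integral_L2v: "norm (LINT x|M. f x) \<le> L2n M (\<lambda>x. 1::real) * L2n M f"
proof -
  note fm = L2v_measurable[OF f]
  have n: "(\<lambda>x. norm (f x)) \<in> L2v M" "L2n M (\<lambda>x. norm (f x)) \<le> 1 * L2n M f"
    using L2v_dominated[OF f measurable_compose[OF fm borel_measurable_norm], of 1] by auto
  have 1: "integrable M (\<lambda>x. norm (f x))" using L2v_inner(1)[OF n(1) const_L2v[of 1]] by simp
  then show i: "integrable M f" using integrable_norm_iff[OF fm] by simp
  have "norm (LINT x|M. f x) \<le> (LINT x|M. norm (f x) \<bullet> (1::real))" using integral_norm_bound[of M f] by simp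
  also have "\<dots> \<le> L2n M (\<lambda>x. norm (f x)) * L2n M (\<lambda>x. 1::real)"
    using L2v_inner(2)[OF n(1) const_L2v[of 1]] by simp
  also have "\<dots> \<le> L2n M f * L2n M (\<lambda>x. 1::real)" using n(2) by (intro mult_right_mono) auto
  finally show "norm (LINT x|M. f x) \<le> L2n M (\<lambda>x. 1::real) * L2n M f" by (simp add: mult.commute)
qed

lemma H1_per_zero_mean:
  assumes H: "H1_per u v"
  obtains c where "H1_per (\<lambda>x. u x + c) v" "(LINT x|M. u x + c) = 0"
proof -
  define I where "I = (LINT x|M. 1::real)"
  define c where "c = - (LINT x|M. u x) / I"
  have u: "u \<in> L2v M" using H by (simp add: H1_per_def)
  have "H1_per (\<lambda>x. u x + c * 1) (\<lambda>x. v x + c *\<^sub>R grad (\<lambda>x. 1) x)"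
    by (rule H1_per_add_scale[OF H C1_per_H1_per[OF C1_per_const]])
  then have "H1_per (\<lambda>x. u x + c) v" by (simp add: grad_const)
  moreover have "(LINT x|M. u x + c) = (LINT x|M. u x) + (LINT x|M. c * 1)"
    using Bochner_Integration.integral_add[OF L2v_integrable[OF u] L2v_integrable[OF const_L2v[of c]]] by simp
  then have "(LINT x|M. u x + c) = (LINT x|M. u x) + c * I" unfolding I_def by (simp only: integral_mult_right_zero)
  then have "(LINT x|M. u x + c) = 0" using integral_1_pos by (simp add: c_def I_def)
  ultimately show thesis by (rule that)
qed

text \<open>Passing from functions to gradients removes the additive constant: the square norm then
  vanishes only on null functions, and the cell problem is coercive with respect to it.\<close>

definition grads :: "(real^'n \<Rightarrow> real^'n) set" where
  "grads = {v. \<exists>w. H1_per w v}"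

lemma grads_L2v: "grads \<subseteq> L2v M"
  by (auto simp: grads_def H1_per_def)

lemma seminormed_L2v: "seminormed_space (L2v M :: (real^'n \<Rightarrow> 'b::euclidean_space) set) (L2n M)"
  by unfold_locales (auto intro!: L2v_add L2v_scale L2n_add simp: L2n_scale)

lemma seminormed_grads: "seminormed_space grads (L2n M)"
proof (rule seminormed_subspace[OF seminormed_L2v grads_L2v])
  show "(\<lambda>x. 0) \<in> grads" using C1_per_H1_per[OF C1_per_const[of 0]] by (auto simp: grads_def grad_const)
  show "(\<lambda>x. f x + c *\<^sub>R g x) \<in> grads" if "f \<in> grads" "g \<in> grads" for f g c
    using that H1_per_add_scale unfolding grads_def by blast
qed

text \<open>The potentials are normalised to zero mean. The Poincare inequality makes them a Cauchy
  sequence along with their gradients, and the two limits are again related by the closed relation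
  \<open>H1_per\<close>.\<close>

theorem grads_complete:
  assumes P: "poincare_set P P" and f: "\<And>n::nat. f n \<in> grads"
    and cauchy: "\<And>e. e > 0 \<Longrightarrow> \<exists>n0. \<forall>m\<ge>n0. \<forall>n\<ge>n0. L2n M (\<lambda>x. f m x - f n x) < e"
  shows "\<exists>g\<in>grads. (\<lambda>n. L2n M (\<lambda>x. f n x - g x)) \<longlonglongrightarrow> 0"
proof -
  obtain C where C: "0 \<le> C" "\<forall>u v. H1_per u v \<longrightarrow> (LINT x|M. u x) = 0 \<longrightarrow> L2n M u \<le> C * L2n M v"
    by (rule Poincare_H1_per[OF P]) (rule that)
  have "\<forall>n. \<exists>w. H1_per w (f n) \<and> (LINT x|M. w x) = 0"
  proof
    fix n
    obtain u where u: "H1_per u (f n)" using f[of n] by (auto simp: grads_def)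
    obtain c where "H1_per (\<lambda>x. u x + c) (f n)" "(LINT x|M. u x + c) = 0" by (rule H1_per_zero_mean[OF u]) (rule that)
    then show "\<exists>w. H1_per w (f n) \<and> (LINT x|M. w x) = 0" by blast
  qed
  from choice[OF this] obtain w where w: "\<forall>n. H1_per (w n) (f n) \<and> (LINT x|M. w n x) = 0" ..
  have wL: "w n \<in> L2v M" and fL: "f n \<in> L2v M" and wH: "H1_per (w n) (f n)" for n
    using w by (auto simp: H1_per_def)
  have wC: "L2n M (\<lambda>x. w m x - w n x) \<le> C * L2n M (\<lambda>x. f m x - f n x)" for m n
  proof -
    have "H1_per (\<lambda>x. w m x - w n x) (\<lambda>x. f m x - f n x)"
      using H1_per_add_scale[OF wH[of m] wH[of n], of "-1"] by simp
    moreover have "(LINT x|M. w m x - w n x) = 0"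
      using Bochner_Integration.integral_diff[OF L2v_integrable[OF wL[of m]] L2v_integrable[OF wL[of n]]] w by simp
    ultimately show ?thesis using C(2) by blast
  qed
  obtain g where g: "g \<in> L2v M" "(\<lambda>n. L2n M (\<lambda>x. f n x - g x)) \<longlonglongrightarrow> 0"
    by (rule L2v_complete[OF finite_measure_M fL cauchy], assumption) (rule that)
  have wcauchy: "\<exists>n0. \<forall>m\<ge>n0. \<forall>n\<ge>n0. L2n M (\<lambda>x. w m x - w n x) < e" if "e > 0" for e
  proof -
    have "e / (C + 1) > 0" using that C(1) by simp
    from cauchy[OF this] obtain n0 where n0: "\<forall>m\<ge>n0. \<forall>n\<ge>n0. L2n M (\<lambda>x. f m x - f n x) < e / (C + 1)" ..
    have "L2n M (\<lambda>x. w m x - w n x) < e" if mn: "m \<ge> n0" "n \<ge> n0" for m n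
    proof -
      have "L2n M (\<lambda>x. w m x - w n x) \<le> (C + 1) * L2n M (\<lambda>x. f m x - f n x)"
        using wC[of m n] L2n_nonneg[of M "\<lambda>x. f m x - f n x"] unfolding distrib_right by linarith
      also have "\<dots> < (C + 1) * (e / (C + 1))" using n0 mn C(1) by (intro mult_strict_left_mono) auto
      finally show ?thesis using C(1) by simp
    qed
    then show ?thesis by blast
  qed
  obtain u where u: "u \<in> L2v M" "(\<lambda>n. L2n M (\<lambda>x. w n x - u x)) \<longlonglongrightarrow> 0"
    by (rule L2v_complete[OF finite_measure_M wL wcauchy], assumption) (rule that)
  have "H1_per u g"
  proof (rule H1_per_closed[OF u(1) g(1)])
    fix e :: real assume "e > 0"
    then have "\<forall>\<^sub>F n in sequentially. L2n M (\<lambda>x. w n x - u x) < e \<and> L2n M (\<lambda>x. f n x - g x) < e"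
      by (intro eventually_conj order_tendstoD(2)[OF u(2)] order_tendstoD(2)[OF g(2)])
    then obtain n where "L2n M (\<lambda>x. w n x - u x) < e \<and> L2n M (\<lambda>x. f n x - g x) < e"
      using eventually_happens' sequentially_bot by blast
    then show "\<exists>u' v'. H1_per u' v' \<and> L2n M (\<lambda>x. u' x - u x) < e \<and> L2n M (\<lambda>x. v' x - g x) < e"
      using wH by blast
  qed
  then show ?thesis using g(2) by (auto simp: grads_def)
qed

section \<open>Coefficient fields on the cell acting on square integrable fields\<close>

lemma L2v_sup_bilinear:
  fixes b :: "'b::euclidean_space \<Rightarrow> 'c::euclidean_space \<Rightarrow> 'd::euclidean_space"
  assumes b: "bounded_bilinear b"
  shows "\<exists>K. bilinear_spaces (sup_space cell) (sup_norm cell) (L2v M) (L2n M) (L2v M) (L2n M) (\<lambda>f g x. b (f x) (g x)) K"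
proof -
  interpret bounded_bilinear b by (rule b)
  obtain K where K: "0 \<le> K" "\<forall>x y. norm (b x y) \<le> norm x * norm y * K" using nonneg_bounded by blast
  have 1: "(\<lambda>x. b (A x) (f x)) \<in> L2v M \<and> L2n M (\<lambda>x. b (A x) (f x)) \<le> (K * sup_norm cell A) * L2n M f"
    if A: "A \<in> sup_space cell" and f: "f \<in> L2v M" for A f
  proof -
    have Ac: "continuous_on P A" using A P_subset_cell by (auto simp: sup_space_def intro: continuous_on_subset)
    have m: "(\<lambda>x. b (A x) (f x)) \<in> borel_measurable M"
      by (rule borel_measurable_continuous_Pair[OF continuous_on_measurable[OF Ac] L2v_measurable[OF f]])
        (intro continuous_on continuous_intros)
    have "norm (b (A x) (f x)) \<le> (K * sup_norm cell A) * norm (f x)" if "x \<in> P" for x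
    proof -
      have "norm (b (A x) (f x)) \<le> norm (A x) * norm (f x) * K" using K(2) by blast
      also have "\<dots> \<le> sup_norm cell A * norm (f x) * K"
        using sup_norm_upper[OF A, of x] that P_subset_cell K(1) by (intro mult_right_mono) auto
      finally show ?thesis by (simp add: ac_simps)
    qed
    then have ae: "AE x in M. norm (b (A x) (f x)) \<le> (K * sup_norm cell A) * norm (f x)" by (intro AE_I2) simp
    have "0 \<le> sup_norm cell A"
      using sup_norm_upper[OF A cell_two_points(1)] norm_ge_zero order_trans by blast
    then have "0 \<le> K * sup_norm cell A" using K(1) by simp
    from L2v_dominated[OF f m ae this] show ?thesis by blast
  qed
  have "bilinear_spaces (sup_space cell) (sup_norm cell) (L2v M) (L2n M) (L2v M) (L2n M) (\<lambda>f g x. b (f x) (g x)) K"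
    by (intro bilinear_spaces.intro seminormed_sup_space seminormed_L2v bilinear_spaces_axioms.intro cell_two_points)
      (use 1 in \<open>auto simp: add_left add_right scaleR_left scaleR_right K(1)\<close>)
  then show ?thesis by blast
qed

lemma Cm_curve_sup_L2v:
  fixes b :: "'b::euclidean_space \<Rightarrow> 'c::euclidean_space \<Rightarrow> 'd::euclidean_space"
  assumes "bounded_bilinear b" "open J" "Cm_curve m (sup_space cell) (sup_norm cell) J A" "Cm_curve m (L2v M) (L2n M) J v"
  shows "Cm_curve m (L2v M) (L2n M) J (\<lambda>s x. b (A s x) (v s x))"
proof -
  obtain K where "bilinear_spaces (sup_space cell) (sup_norm cell) (L2v M) (L2n M) (L2v M) (L2n M) (\<lambda>f g x. b (f x) (g x)) K"
    using L2v_sup_bilinear[OF assms(1)] by blast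
  from bilinear_spaces.Cm_curve_bilinear[OF this assms(2-4)] show ?thesis .
qed

lemma Ck_on_integral_curve:
  fixes v :: "real \<Rightarrow> real^'n \<Rightarrow> 'b::euclidean_space"
  assumes "open J" "Cm_curve m (L2v M) (L2n M) J v"
  shows "Ck_on m (\<lambda>s. LINT x|M. v s x) J"
proof (rule Cm_curve_functional[OF assms(1) _ assms(2)])
  fix f g k :: "real^'n \<Rightarrow> 'b" and a b :: real
  assume f: "f \<in> L2v M" and g: "g \<in> L2v M" and k: "k \<in> L2v M"
  have "a *\<^sub>R ((LINT x|M. f x) - (LINT x|M. g x)) - b *\<^sub>R (LINT x|M. k x) = (LINT x|M. a *\<^sub>R (f x - g x) - b *\<^sub>R k x)"
    using L2v_integrable[OF f] L2v_integrable[OF g] L2v_integrable[OF k] by simp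
  then show "norm (a *\<^sub>R ((LINT x|M. f x) - (LINT x|M. g x)) - b *\<^sub>R (LINT x|M. k x)) \<le>
      L2n M (\<lambda>x. 1::real) * L2n M (\<lambda>x. a *\<^sub>R (f x - g x) - b *\<^sub>R k x)"
    using norm_integral_L2v[OF L2v_diff[OF L2v_scale[OF L2v_diff[OF f g], of a] L2v_scale[OF k, of b]]] by simp
qed

lemma Cm_curve_weak_grad:
  assumes J: "open J" and g: "Cm_curve m (sobolev_per0 2 P) (sobolev_norm 2 P) J g"
  shows "Cm_curve m (L2v M) (L2n M) J (\<lambda>s. weak_grad P (g s))"
proof (rule Cm_curve_image[OF J seminormed_L2v, where T = "weak_grad P" and c = g])
  \<comment> \<open>Only first derivatives matter, so the curve is regarded in the larger set
    \<open>sobolev 1 P\<close>, while its norm stays that of second order.\<close>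
  have "sobolev_per0 2 P \<subseteq> sobolev 1 P"
    using sobolev_mono[of 1 2 P] by (auto simp: sobolev_per0_def sobolev_per_def)
  from Cm_curve_mono[OF this order_refl g] show "Cm_curve m (sobolev 1 P) (sobolev_norm 2 P) J g" .
  fix f e k :: "real^'n \<Rightarrow> real" and a b :: real
  assume "f \<in> sobolev 1 P"
  note f = sobolev_weak_grad[OF open_P this order_refl]
  show "weak_grad P f \<in> L2v M" by (rule f(2))
  assume "e \<in> sobolev 1 P" "k \<in> sobolev 1 P"
  note e = sobolev_weak_grad[OF open_P this(1) order_refl] and k = sobolev_weak_grad[OF open_P this(2) order_refl]
  let ?q = "\<lambda>x. a *\<^sub>R (f x - e x) - b *\<^sub>R k x"
  let ?G = "\<lambda>x. a *\<^sub>R (weak_grad P f x - weak_grad P e x) - b *\<^sub>R weak_grad P k x"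
  have L: "?q \<in> L2v M" "?G \<in> L2v M" by (intro L2v_diff L2v_scale f e k)+
  have "is_weak_grad P ?q ?G"
    using is_weak_grad_linear[OF open_P is_weak_grad_diff[OF open_P f(3) e(3)] k(3), of a "- b"] by simp
  from L2n_le_sobolev_norm_1(2)[OF open_P L this]
  show "L2n M ?G \<le> 1 * sobolev_norm 2 P ?q" using sobolev_norm_mono[of 1 2 P ?q] by simp
qed

text \<open>The functional of integration against \<open>w\<close> as a function of the test
  gradient, so that the dual space is again a seminormed function space. The value 0 off
  \<open>grads\<close> makes linearity in \<open>w\<close> an identity of functions, and the
  supremum over \<open>unit_grads\<close> is the dual norm.\<close>

definition dual_fun :: "(real^'n \<Rightarrow> real^'n) \<Rightarrow> (real^'n \<Rightarrow> real^'n) \<Rightarrow> real" where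
  "dual_fun w \<psi> = (if \<psi> \<in> grads then LINT x|M. w x \<bullet> \<psi> x else 0)"

abbreviation "unit_grads \<equiv> {\<psi> \<in> grads. L2n M \<psi> \<le> 1}"

lemma dual_fun_bound:
  assumes "w \<in> L2v M" "\<psi> \<in> grads" shows "\<bar>dual_fun w \<psi>\<bar> \<le> L2n M w * L2n M \<psi>"
  using L2v_inner(2)[of w M \<psi>] assms grads_L2v by (auto simp: dual_fun_def)

lemma dual_fun_add_scale:
  assumes "w \<in> L2v M" "w' \<in> L2v M"
  shows "dual_fun (\<lambda>x. w x + c *\<^sub>R w' x) = (\<lambda>\<psi>. dual_fun w \<psi> + c *\<^sub>R dual_fun w' \<psi>)"
proof
  fix \<psi>
  show "dual_fun (\<lambda>x. w x + c *\<^sub>R w' x) \<psi> = dual_fun w \<psi> + c *\<^sub>R dual_fun w' \<psi>"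
  proof (cases "\<psi> \<in> grads")
    case True
    then have "\<psi> \<in> L2v M" using grads_L2v by blast
    note i = L2v_inner(1)[OF assms(1) this] L2v_inner(1)[OF assms(2) this]
    have "(LINT x|M. w x \<bullet> \<psi> x + c * (w' x \<bullet> \<psi> x)) = (LINT x|M. w x \<bullet> \<psi> x) + c * (LINT x|M. w' x \<bullet> \<psi> x)"
      using i by (subst Bochner_Integration.integral_add) auto
    with True show ?thesis by (simp add: dual_fun_def inner_add_left)
  qed (simp add: dual_fun_def)
qed

lemma dual_fun_sup_norm: "w \<in> L2v M \<Longrightarrow> bounded (dual_fun w ` unit_grads) \<and> sup_norm unit_grads (dual_fun w) \<le> L2n M w"
proof
  assume w: "w \<in> L2v M"
  have 1: "norm (dual_fun w \<psi>) \<le> L2n M w" if "\<psi> \<in> unit_grads" for \<psi>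
    using dual_fun_bound[OF w, of \<psi>] that mult_left_mono[of "L2n M \<psi>" 1 "L2n M w"] by auto
  then show "bounded (dual_fun w ` unit_grads)" unfolding bounded_iff by blast
  have "(\<lambda>x. 0) \<in> unit_grads" using seminormed_space.zero[OF seminormed_grads] by simp
  then show "sup_norm unit_grads (dual_fun w) \<le> L2n M w" using 1 by (intro sup_norm_least) blast
qed

lemma seminormed_dual: "seminormed_space (dual_fun ` L2v M) (sup_norm unit_grads)"
proof (rule seminormed_subspace[OF seminormed_bounded])
  have "(\<lambda>x. 0) \<in> unit_grads" using seminormed_space.zero[OF seminormed_grads] by simp
  then show "unit_grads \<noteq> {}" by blast
  show "dual_fun ` L2v M \<subseteq> {f. bounded (f ` unit_grads)}" using dual_fun_sup_norm by blast
  have "dual_fun (\<lambda>x. 0) = (\<lambda>x. 0)" by (auto simp: dual_fun_def)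
  then show "(\<lambda>x. 0) \<in> dual_fun ` L2v M" using L2v_zero by (metis image_eqI)
  fix f g c assume "f \<in> dual_fun ` L2v M" "g \<in> dual_fun ` L2v M"
  then obtain w w' where "w \<in> L2v M" "f = dual_fun w" "w' \<in> L2v M" "g = dual_fun w'" by blast
  note w = this
  have "(\<lambda>x. f x + c *\<^sub>R g x) = dual_fun (\<lambda>x. w x + c *\<^sub>R w' x)"
    unfolding w(2,4) by (rule dual_fun_add_scale[OF w(1,3), symmetric])
  moreover have "(\<lambda>x. w x + c *\<^sub>R w' x) \<in> L2v M" by (intro L2v_add L2v_scale w(1,3))
  ultimately show "(\<lambda>x. f x + c *\<^sub>R g x) \<in> dual_fun ` L2v M" by (rule image_eqI)
qed

text \<open>Rescaling to the unit ball works unless \<open>\<psi>\<close> has seminorm zero, in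
  which case the functional vanishes on it.\<close>

lemma dual_fun_le:
  assumes w: "w \<in> L2v M" and \<psi>: "\<psi> \<in> grads"
  shows "\<bar>dual_fun w \<psi>\<bar> \<le> sup_norm unit_grads (dual_fun w) * L2n M \<psi>"
proof (cases "L2n M \<psi> = 0")
  case True
  then show ?thesis using dual_fun_bound[OF w \<psi>] by simp
next
  case False
  then have n: "L2n M \<psi> > 0" using L2n_nonneg[of M \<psi>] by linarith
  define \<phi> where "\<phi> = (\<lambda>x. inverse (L2n M \<psi>) *\<^sub>R \<psi> x)"
  have \<phi>g: "\<phi> \<in> grads" unfolding \<phi>_def by (rule seminormed_space.scale[OF seminormed_grads \<psi>])
  have "\<phi> \<in> unit_grads" using \<phi>g n unfolding \<phi>_def by (simp add: L2n_scale)
  from sup_norm_upper_bounded[OF conjunct1[OF dual_fun_sup_norm[OF w]] this]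
  have "\<bar>dual_fun w \<phi>\<bar> \<le> sup_norm unit_grads (dual_fun w)" by simp
  moreover have "dual_fun w \<phi> = inverse (L2n M \<psi>) * dual_fun w \<psi>"
    using \<phi>g \<psi> by (simp add: dual_fun_def \<phi>_def)
  ultimately show ?thesis using n by (simp add: abs_mult field_simps)
qed

lemma Cm_curve_dual_fun:
  assumes "open J" "Cm_curve m (L2v M) (L2n M) J w"
  shows "Cm_curve m (dual_fun ` L2v M) (sup_norm unit_grads) J (\<lambda>s. dual_fun (w s))"
proof (rule Cm_curve_image[OF assms(1) seminormed_dual _ _ assms(2)])
  fix f g k :: "real^'n \<Rightarrow> real^'n" and a b :: real
  assume f: "f \<in> L2v M"
  then show "dual_fun f \<in> dual_fun ` L2v M" by blast
  assume g: "g \<in> L2v M" and k: "k \<in> L2v M"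
  have q: "(\<lambda>x. a *\<^sub>R (f x - g x) - b *\<^sub>R k x) \<in> L2v M" by (intro L2v_diff L2v_scale f g k)
  have d: "dual_fun (\<lambda>x. f x - g x) = (\<lambda>\<psi>. dual_fun f \<psi> - dual_fun g \<psi>)" if "f \<in> L2v M" "g \<in> L2v M" for f g
    using dual_fun_add_scale[OF that, of "-1"] by simp
  have s: "dual_fun (\<lambda>x. c *\<^sub>R f x) = (\<lambda>\<psi>. c *\<^sub>R dual_fun f \<psi>)" if "f \<in> L2v M" for f c
    using dual_fun_add_scale[OF that that, of "c - 1"] by (simp add: algebra_simps)
  have "dual_fun (\<lambda>x. a *\<^sub>R (f x - g x) - b *\<^sub>R k x) = (\<lambda>\<psi>. a *\<^sub>R (dual_fun f \<psi> - dual_fun g \<psi>) - b *\<^sub>R dual_fun k \<psi>)"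
    by (simp only: d[OF L2v_scale[OF L2v_diff[OF f g]] L2v_scale[OF k]] s[OF L2v_diff[OF f g]] s[OF k] d[OF f g])
  then show "sup_norm unit_grads (\<lambda>\<psi>. a *\<^sub>R (dual_fun f \<psi> - dual_fun g \<psi>) - b *\<^sub>R dual_fun k \<psi>) \<le>
      1 * L2n M (\<lambda>x. a *\<^sub>R (f x - g x) - b *\<^sub>R k x)"
    using dual_fun_sup_norm[OF q] by simp
qed

lemma variational_solution:
  fixes A :: "real^'n \<Rightarrow> real^'n^'n"
  assumes P: "poincare_set P P" and A: "A \<in> sup_space cell" and sym: "\<And>x. x \<in> P \<Longrightarrow> transpose (A x) = A x"
    and c: "c > 0" "\<And>x y. x \<in> P \<Longrightarrow> c * (norm y)\<^sup>2 \<le> (y v* A x) \<bullet> y" and w: "w \<in> L2v M"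
  shows "\<exists>v\<in>grads. \<forall>\<psi>\<in>grads. (LINT x|M. (v x v* A x) \<bullet> \<psi> x) = (LINT x|M. w x \<bullet> \<psi> x)"
proof -
  obtain K where "bilinear_spaces (sup_space cell) (sup_norm cell) (L2v M) (L2n M) (L2v M) (L2n M)
      (\<lambda>f g (x::real^'n). g x v* (f x :: real^'n^'n)) K"
    using L2v_sup_bilinear[OF bounded_bilinear.flip[OF bounded_bilinear_vector_matrix]] by blast
  then interpret B: bilinear_spaces "sup_space cell" "sup_norm cell" "L2v M" "L2n M" "L2v M" "L2n M"
    "\<lambda>f g (x::real^'n). g x v* (f x :: real^'n^'n)" K .
  note mem = B.p_mem[OF A]
  have gL: "f \<in> L2v M" if "f \<in> grads" for f using that grads_L2v by blast
  define a where "a f g = (LINT x|M. (f x v* A x) \<bullet> g x)" for f g :: "real^'n \<Rightarrow> real^'n"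
  define l where "l g = (LINT x|M. w x \<bullet> g x)" for g :: "real^'n \<Rightarrow> real^'n"
  have "\<exists>v\<in>grads. \<forall>\<psi>\<in>grads. a v \<psi> = l \<psi>"
  proof (rule riesz_coercive[OF seminormed_grads _ _ _ c(1)])
    fix f g k t assume f: "f \<in> grads"
    show "c * (L2n M f)\<^sup>2 \<le> a f f"
    proof -
      have "c * (L2n M f)\<^sup>2 = (LINT x|M. c * (norm (f x))\<^sup>2)" unfolding L2n_power2 by simp
      also have "\<dots> \<le> a f f"
        unfolding a_def
        by (rule integral_mono[OF _ L2v_inner(1)[OF mem[OF gL[OF f]] gL[OF f]]])
          (use gL[OF f] c(2) in \<open>auto simp: L2v_def\<close>)
      finally show ?thesis .
    qed
    show "\<bar>l f\<bar> \<le> L2n M w * L2n M f" unfolding l_def by (rule L2v_inner(2)[OF w gL[OF f]])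
    assume g: "g \<in> grads"
    show "a f g = a g f"
      unfolding a_def
    proof (rule Bochner_Integration.integral_cong[OF refl])
      fix x assume "x \<in> space M"
      then have "transpose (A x) = A x" using sym by simp
      then have "f x v* A x = A x *v f x" by (metis vector_transpose_matrix)
      then show "(f x v* A x) \<bullet> g x = (g x v* A x) \<bullet> f x" by (metis dot_lmul_matrix inner_commute)
    qed
    show "\<bar>a f g\<bar> \<le> (K * sup_norm cell A) * L2n M f * L2n M g"
      using L2v_inner(2)[OF mem[OF gL[OF f]] gL[OF g]]
        mult_right_mono[OF B.p_bound[OF A gL[OF f]] L2n_nonneg[of M g]] unfolding a_def by linarith
    show "l (\<lambda>x. f x + t *\<^sub>R g x) = l f + t * l g"
      unfolding l_def inner_add_right inner_scaleR_right
      using L2v_inner(1)[OF w gL[OF f]] L2v_inner(1)[OF w gL[OF g]] by (subst Bochner_Integration.integral_add) auto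
    assume k: "k \<in> grads"
    show "a (\<lambda>x. f x + t *\<^sub>R g x) k = a f k + t * a g k"
      unfolding a_def B.p_right[OF A gL[OF f] gL[OF g], THEN fun_cong] inner_add_left inner_scaleR_left
      using L2v_inner(1)[OF mem[OF gL[OF f]] gL[OF k]] L2v_inner(1)[OF mem[OF gL[OF g]] gL[OF k]]
      by (subst Bochner_Integration.integral_add) auto
  next
    fix f :: "nat \<Rightarrow> real^'n \<Rightarrow> real^'n"
    assume "\<And>n. f n \<in> grads" "\<And>e. 0 < e \<Longrightarrow> \<exists>n0. \<forall>m\<ge>n0. \<forall>n\<ge>n0. L2n M (\<lambda>x. f m x - f n x) < e"
    then show "\<exists>g\<in>grads. (\<lambda>n. L2n M (\<lambda>x. f n x - g x)) \<longlonglongrightarrow> 0" by (rule grads_complete[OF P])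
  qed
  then show ?thesis unfolding a_def l_def .
qed

text \<open>The weak equation reads \<open>p (A s) (v s) = dual_fun (w s)\<close>, an equation
  between functionals to which \<open>Cm_curve_solve\<close> applies. Coercivity in the dual norm
  comes from testing \<open>p (A s) u\<close> with \<open>u\<close> itself, solvability from
  \<open>variational_solution\<close>.\<close>

theorem Cm_curve_variational:
  fixes A :: "real \<Rightarrow> real^'n \<Rightarrow> real^'n^'n"
  assumes P: "poincare_set P P" and J: "open J"
    and A: "Cm_curve m (sup_space cell) (sup_norm cell) J A"
    and sym: "\<And>s x. s \<in> J \<Longrightarrow> x \<in> P \<Longrightarrow> transpose (A s x) = A s x"
    and coercive: "\<And>s. s \<in> J \<Longrightarrow> \<exists>c>0. \<forall>x\<in>P. \<forall>y. c * (norm y)\<^sup>2 \<le> (y v* A s x) \<bullet> y"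
    and w: "Cm_curve m (L2v M) (L2n M) J w"
    and v: "\<And>s. s \<in> J \<Longrightarrow> v s \<in> grads"
      "\<And>s \<psi>. s \<in> J \<Longrightarrow> \<psi> \<in> grads \<Longrightarrow> (LINT x|M. (v s x v* A s x) \<bullet> \<psi> x) = (LINT x|M. w s x \<bullet> \<psi> x)"
  shows "Cm_curve m (L2v M) (L2n M) J v"
proof -
  obtain K where "bilinear_spaces (sup_space cell) (sup_norm cell) (L2v M) (L2n M) (L2v M) (L2n M)
      (\<lambda>f g (x::real^'n). g x v* (f x :: real^'n^'n)) K"
    using L2v_sup_bilinear[OF bounded_bilinear.flip[OF bounded_bilinear_vector_matrix]] by blast
  then interpret B: bilinear_spaces "sup_space cell" "sup_norm cell" "L2v M" "L2n M" "L2v M" "L2n M"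
    "\<lambda>f g (x::real^'n). g x v* (f x :: real^'n^'n)" K .
  have gL: "f \<in> L2v M" if "f \<in> grads" for f using that grads_L2v by blast
  define p where "p = (\<lambda>(f :: real^'n \<Rightarrow> real^'n^'n) g. dual_fun (\<lambda>x. g x v* f x))"
  interpret D: bilinear_spaces "sup_space cell" "sup_norm cell" grads "L2n M" "dual_fun ` L2v M" "sup_norm unit_grads" p K
  proof (intro bilinear_spaces.intro seminormed_sup_space seminormed_grads seminormed_dual bilinear_spaces_axioms.intro cell_two_points B.K_nonneg)
    fix f f' :: "real^'n \<Rightarrow> real^'n^'n" and g g' c
    assume f: "f \<in> sup_space cell" and g: "g \<in> grads"
    note fg = B.p_mem[OF f gL[OF g]]
    show "p f g \<in> dual_fun ` L2v M" unfolding p_def using fg by blast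
    show "sup_norm unit_grads (p f g) \<le> K * sup_norm cell f * L2n M g"
      unfolding p_def using dual_fun_sup_norm[OF fg] B.p_bound[OF f gL[OF g]] by linarith
    show "p f (\<lambda>x. g x + c *\<^sub>R g' x) = (\<lambda>y. p f g y + c *\<^sub>R p f g' y)" if "g' \<in> grads"
      unfolding p_def B.p_right[OF f gL[OF g] gL[OF that]] by (rule dual_fun_add_scale[OF fg B.p_mem[OF f gL[OF that]]])
    show "p (\<lambda>x. f x + c *\<^sub>R f' x) g = (\<lambda>y. p f g y + c *\<^sub>R p f' g y)" if "f' \<in> sup_space cell"
      unfolding p_def B.p_left[OF f that gL[OF g]] by (rule dual_fun_add_scale[OF fg B.p_mem[OF that gL[OF g]]])
  qed
  have "Cm_curve m grads (L2n M) J v"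
  proof (rule D.Cm_curve_solve[OF J _ _ A Cm_curve_dual_fun[OF J w] v(1)])
    fix s assume s: "s \<in> J"
    obtain c where c: "c > 0" "\<forall>x\<in>P. \<forall>y. c * (norm y)\<^sup>2 \<le> (y v* A s x) \<bullet> y" using coercive[OF s] by blast
    have As: "A s \<in> sup_space cell" by (rule B.S1.Cm_curve_mem[OF A s])
    have eq0: "sup_norm unit_grads (\<lambda>y. p (A s) u y - dual_fun b y) = 0"
      if "\<forall>\<psi>\<in>grads. (LINT x|M. (u x v* A s x) \<bullet> \<psi> x) = (LINT x|M. b x \<bullet> \<psi> x)" for u b
    proof -
      have "(\<lambda>y. p (A s) u y - dual_fun b y) = (\<lambda>y. 0)"
        using that by (auto simp: p_def dual_fun_def fun_eq_iff)
      then show ?thesis using D.S3.N_zero by simp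
    qed
    show "sup_norm unit_grads (\<lambda>y. p (A s) (v s) y - dual_fun (w s) y) = 0"
      by (rule eq0) (use v(2)[OF s] in blast)
    show "\<exists>u\<in>grads. sup_norm unit_grads (\<lambda>y. p (A s) u y - b y) = 0" if b: "b \<in> dual_fun ` L2v M" for b
    proof -
      obtain w' where w': "w' \<in> L2v M" "b = dual_fun w'" using b by blast
      obtain u where "u \<in> grads" "\<forall>\<psi>\<in>grads. (LINT x|M. (u x v* A s x) \<bullet> \<psi> x) = (LINT x|M. w' x \<bullet> \<psi> x)"
        using variational_solution[OF P As sym[OF s] c(1) _ w'(1)] c(2) by blast
      then show ?thesis using eq0 w'(2) by blast
    qed
    have "L2n M u \<le> inverse c * sup_norm unit_grads (p (A s) u)" if u: "u \<in> grads" for u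
    proof (cases "L2n M u = 0")
      case True
      then show ?thesis using D.S3.nonneg[OF D.p_mem[OF As u]] c(1) by simp
    next
      case False
      then have n: "L2n M u > 0" using L2n_nonneg[of M u] by linarith
      note Au = B.p_mem[OF As gL[OF u]]
      have "c * (L2n M u)\<^sup>2 = (LINT x|M. c * (norm (u x))\<^sup>2)" unfolding L2n_power2 by simp
      also have "\<dots> \<le> (LINT x|M. (u x v* A s x) \<bullet> u x)"
        by (rule integral_mono[OF _ L2v_inner(1)[OF Au gL[OF u]]]) (use gL[OF u] c(2) in \<open>auto simp: L2v_def\<close>)
      also have "\<dots> = p (A s) u u" using u by (simp add: p_def dual_fun_def)
      also have "\<dots> \<le> sup_norm unit_grads (p (A s) u) * L2n M u"
        using dual_fun_le[OF Au u] unfolding p_def by linarith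
      finally show ?thesis using n c(1) by (simp add: power2_eq_square field_simps)
    qed
    then show "\<exists>C. \<forall>u\<in>grads. L2n M u \<le> C * sup_norm unit_grads (p (A s) u)" by blast
  qed
  from Cm_curve_mono[OF grads_L2v order_refl this] show ?thesis .
qed

end

section \<open>The transported cell problem\<close>

lemma Ck_on_vec_lambda:
  fixes f :: "'i::finite \<Rightarrow> 'a::euclidean_space \<Rightarrow> 'b::euclidean_space"
  assumes "\<And>i. Ck_on k (f i) S"
  shows "Ck_on k (\<lambda>s. \<chi> i. f i s) S"
proof -
  have ax: "bounded_linear (axis i :: 'b \<Rightarrow> 'b^'i)" for i :: 'i
    by (rule iffD1[OF linear_conv_bounded_linear], rule linearI) (simp_all add: axis_def vec_eq_iff)
  have "Ck_on k (\<lambda>s. \<Sum>i\<in>UNIV. axis i (f i s)) S"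
    by (rule Ck_on_sum, rule Ck_on_linear_compose[OF ax assms])
  moreover have "(\<Sum>i\<in>UNIV. axis i (f i s)) = (\<chi> i. f i s)" for s
    unfolding vec_eq_iff by (simp add: axis_def if_distrib sum.delta cong: if_cong)
  ultimately show ?thesis by simp
qed

lemma vector_matrix_scaleR: "(y :: real^'n) v* (c *\<^sub>R B) = c *\<^sub>R (y v* (B :: real^'m^'n))"
  by (rule bounded_bilinear.scaleR_right[OF bounded_bilinear_vector_matrix])

lemma bounded_linear_transpose: "bounded_linear (transpose :: real^'n^'m \<Rightarrow> real^'m^'n)"
  by (rule iffD1[OF linear_conv_bounded_linear], rule linearI) (simp_all add: transpose_def vec_eq_iff)

text \<open>For the Jacobian \<open>B\<close> of a diffeomorphism and its inverse matrix
  \<open>N\<close> this is the coefficient of the transported Dirichlet form: the two gradients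
  contribute \<open>N\<close> and its transpose, the volume element the determinant; see
  \<open>diffusion_matrix_inner\<close>.\<close>

definition diffusion_matrix :: "real^'n^'n \<Rightarrow> real^'n^'n \<Rightarrow> real^'n^'n" where
  "diffusion_matrix B N = det B *\<^sub>R (N ** transpose N)"

lemma transpose_diffusion_matrix: "transpose (diffusion_matrix B N) = diffusion_matrix B N"
  unfolding diffusion_matrix_def
  by (simp add: linear_cmul[OF bounded_linear.linear[OF bounded_linear_transpose]] matrix_transpose_mul)

lemma diffusion_matrix_inner:
  "(y v* diffusion_matrix B N) \<bullet> z = det B * ((y v* N) \<bullet> (z v* N))"
proof -
  have "y v* diffusion_matrix B N = det B *\<^sub>R (N *v (y v* N))"
    unfolding diffusion_matrix_def by (simp add: vector_matrix_scaleR flip: vector_matrix_mul_assoc)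
  then show ?thesis using dot_lmul_matrix[of z N "y v* N"] by (simp add: inner_commute)
qed

context cell_diffeo
begin

lemma Dh_sup_space: "Dh \<in> sup_space cell"
  by (simp add: sup_space_def H.Dh_cont H.Dh_bdd)

lemma Dk_sup_space: "(\<lambda>x. Dk (h x)) \<in> sup_space cell"
proof -
  have "continuous_on cell (\<lambda>x. Dk (h x))"
    by (rule continuous_on_compose2[OF K.Dh_cont continuous_on_subset[OF H.h_cont closure_subset]]) (use h_cell in blast)
  moreover have "(\<lambda>x. Dk (h x)) ` cell \<subseteq> Dk ` cell" using h_cell by blast
  ultimately show ?thesis using bounded_subset[OF K.Dh_bdd] by (auto simp: sup_space_def)
qed

lemma det_sup_space: "(\<lambda>x. det (Dh x)) \<in> sup_space cell"
  by (rule sup_space_compose[OF Dh_sup_space]) (rule continuous_on_det[OF continuous_on_id])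

lemma diffusion_matrix_sup_space: "(\<lambda>x. diffusion_matrix (Dh x) (Dk (h x))) \<in> sup_space cell"
  unfolding diffusion_matrix_def
  by (intro sup_space_bilinear[OF bounded_bilinear_scaleR det_sup_space]
      sup_space_bilinear[OF bounded_bilinear_matrix_matrix Dk_sup_space]
      sup_space_compose[OF Dk_sup_space linear_continuous_on[OF bounded_linear_transpose]])

text \<open>A row vector \<open>y\<close> is recovered from \<open>z = y v* Dk (h x)\<close> by
  multiplication with the bounded \<open>Dh x\<close>, which bounds \<open>z\<close> from below. The
  determinant is bounded below because that of the inverse Jacobian is bounded above.\<close>

lemma diffusion_matrix_coercive:
  "\<exists>c>0. \<forall>x\<in>cell. \<forall>y. c * (norm y)\<^sup>2 \<le> (y v* diffusion_matrix (Dh x) (Dk (h x))) \<bullet> y"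
proof -
  obtain C where C: "C > 0" "\<forall>x\<in>cell. det (Dk x) \<le> C" using cell_diffeo.det_bound[OF swap] by blast
  obtain K where K: "0 \<le> K" "\<forall>x (B :: real^'n^'n). norm (x v* B) \<le> norm x * norm B * K"
    using bounded_bilinear.nonneg_bounded[OF bounded_bilinear_vector_matrix] by blast
  define B where "B = sup_norm cell Dh * K + 1"
  have sn: "0 \<le> sup_norm cell Dh" using sup_norm_upper[OF Dh_sup_space cell_two_points(1)] by (rule order_trans[OF norm_ge_zero])
  then have B: "B > 0" using K(1) unfolding B_def by (simp add: add_nonneg_pos)
  have "1 / (C * B\<^sup>2) * (norm y)\<^sup>2 \<le> (y v* diffusion_matrix (Dh x) (Dk (h x))) \<bullet> y" if x: "x \<in> cell" for x y
  proof -
    define z where "z = y v* Dk (h x)"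
    have "y = z v* Dh x" unfolding z_def vector_matrix_mul_assoc matrix_inverse[OF x] by simp
    then have "norm y \<le> norm z * norm (Dh x) * K" using K(2) by simp
    also have "\<dots> \<le> norm z * sup_norm cell Dh * K"
      by (intro mult_right_mono mult_left_mono sup_norm_upper[OF Dh_sup_space x] K(1)) auto
    also have "\<dots> \<le> norm z * B" unfolding B_def by (simp add: algebra_simps)
    finally have "(norm y)\<^sup>2 \<le> (norm z * B)\<^sup>2" by (intro power_mono) auto
    then have 1: "(norm y)\<^sup>2 / B\<^sup>2 \<le> (norm z)\<^sup>2" using B by (simp add: power_mult_distrib divide_le_eq)
    have "1 \<le> C * det (Dh x)"
      using det_inverse[OF x] C(2) h_cell[OF x] mult_right_mono[of "det (Dk (h x))" C "det (Dh x)"] det_pos[OF x] by simp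
    then have 2: "1 / C \<le> det (Dh x)" using C(1) by (simp add: divide_le_eq mult.commute)
    have "1 / (C * B\<^sup>2) * (norm y)\<^sup>2 = 1 / C * ((norm y)\<^sup>2 / B\<^sup>2)" by simp
    also have "\<dots> \<le> det (Dh x) * (norm z)\<^sup>2"
      using 1 2 C(1) det_pos[OF x] by (intro mult_mono) auto
    finally show ?thesis unfolding diffusion_matrix_inner z_def[symmetric] by (simp add: power2_norm_eq_inner)
  qed
  moreover have "1 / (C * B\<^sup>2) > 0" using C(1) B by simp
  ultimately show ?thesis by blast
qed

end

context perforated_diffeo
begin

lemma L2v_sup_mem:
  fixes b :: "'b::euclidean_space \<Rightarrow> 'c::euclidean_space \<Rightarrow> 'd::euclidean_space"
  assumes "bounded_bilinear b" "A \<in> sup_space cell" "f \<in> L2v M"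
  shows "(\<lambda>x. b (A x) (f x)) \<in> L2v M"
  using L2v_sup_bilinear[OF assms(1)] bilinear_spaces.p_mem[OF _ assms(2,3)] by blast

lemma H1_per_pull:
  assumes "Q.H1_per u v"
  shows "H1_per (\<lambda>x. u (h x)) (\<lambda>x. v (h x) v* Dh x)"
proof -
  interpret I: perforated_diffeo k h Dk Dh W "h ` P"
    by (intro perforated_diffeo.intro swap Q.perforated_cell_axioms perforated_diffeo_axioms.intro dim)
  have "k ` h ` P = P" using P_subset_cell closure_subset by (intro image_image_k) blast
  with I.H1_per_push[OF assms] show ?thesis by simp
qed

lemma integral_image_vec:
  fixes q :: "real^'n \<Rightarrow> real^'n"
  assumes q: "q \<in> L2v Q.M"
  shows "(LINT x|M. det (Dh x) *\<^sub>R q (h x)) = (LINT y|Q.M. q y)"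
proof -
  obtain C where "\<forall>q :: real^'n \<Rightarrow> real^'n. q \<in> L2v Q.M \<longrightarrow> (\<lambda>x. q (h x)) \<in> L2v M \<and> L2n M (\<lambda>x. q (h x)) \<le> C * L2n Q.M q"
    by (rule L2v_pull) (rule that)
  with q have "(\<lambda>x. q (h x)) \<in> L2v M" by blast
  from L2v_integrable[OF L2v_sup_mem[OF bounded_bilinear_scaleR det_sup_space this]]
  have i: "integrable M (\<lambda>x. det (Dh x) *\<^sub>R q (h x))" .
  have "(LINT x|M. det (Dh x) *\<^sub>R q (h x)) $ i = (LINT y|Q.M. q y) $ i" for i
    using integral_bounded_linear[OF bounded_linear_vec_nth i, of i]
      integral_bounded_linear[OF bounded_linear_vec_nth Q.L2v_integrable[OF q], of i] integral_image(2)[of "\<lambda>y. q y $ i"]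
    by simp
  then show ?thesis by (simp add: vec_eq_iff)
qed

text \<open>The term of the cell problem that contains the unit vector, transported to
  \<open>P\<close> and moved to the right-hand side, whence the minus sign. The transpose shifts the
  inverse Jacobian from the test gradient to the unit vector.\<close>

definition cell_load :: "'n \<Rightarrow> real^'n \<Rightarrow> real^'n" where
  "cell_load j x = (- det (Dh x)) *\<^sub>R (axis j 1 v* transpose (Dk (h x)))"

abbreviation "A \<equiv> (\<lambda>x. diffusion_matrix (Dh x) (Dk (h x)))"

lemma cell_load_L2v: "cell_load j \<in> L2v M"
  unfolding cell_load_def[abs_def]
proof (rule L2v_sup_mem[OF bounded_bilinear_scaleR])
  show "(\<lambda>x. - det (Dh x)) \<in> sup_space cell"
    by (rule sup_space_compose[OF det_sup_space]) (intro continuous_intros)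
  show "(\<lambda>x. axis j 1 v* transpose (Dk (h x))) \<in> L2v M"
    by (rule L2v_sup_mem[OF bounded_bilinear.flip[OF bounded_bilinear_vector_matrix]
        sup_space_compose[OF Dk_sup_space linear_continuous_on[OF bounded_linear_transpose]] const_L2v])
qed

lemma A_L2v: "v \<in> L2v M \<Longrightarrow> (\<lambda>x. v x v* A x) \<in> L2v M"
  by (rule L2v_sup_mem[OF bounded_bilinear.flip[OF bounded_bilinear_vector_matrix] diffusion_matrix_sup_space])

text \<open>Stated for a field \<open>z\<close> that is pointwise the transported \<open>v\<close>
  and for the chain rule formula of the test gradient, because the weak gradients of the pushed
  functions are given by such formulas only almost everywhere.\<close>

lemma cell_problem_transport:
  assumes v: "v \<in> L2v M" and \<psi>: "\<psi> \<in> L2v M" and z: "\<And>x. x \<in> P \<Longrightarrow> z (h x) = v x v* Dk (h x)"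
  shows "(LINT y|Q.M. (z y + axis j 1) \<bullet> (\<psi> (k y) v* Dk y)) =
    (LINT x|M. (v x v* A x) \<bullet> \<psi> x) - (LINT x|M. cell_load j x \<bullet> \<psi> x)"
proof -
  have "(LINT y|Q.M. (z y + axis j 1) \<bullet> (\<psi> (k y) v* Dk y)) =
      (LINT x|M. det (Dh x) * ((z (h x) + axis j 1) \<bullet> (\<psi> (k (h x)) v* Dk (h x))))"
    using integral_image(2)[of "\<lambda>y. (z y + axis j 1) \<bullet> (\<psi> (k y) v* Dk y)"] by simp
  also have "\<dots> = (LINT x|M. (v x v* A x) \<bullet> \<psi> x - cell_load j x \<bullet> \<psi> x)"
  proof (rule Bochner_Integration.integral_cong[OF refl])
    fix x assume "x \<in> space M"
    then have x: "x \<in> P" by simp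
    have "cell_load j x \<bullet> \<psi> x = - det (Dh x) * (axis j 1 \<bullet> (\<psi> x v* Dk (h x)))"
      using dot_lmul_matrix[of "\<psi> x" "Dk (h x)" "axis j 1"] by (simp add: cell_load_def inner_commute)
    then show "det (Dh x) * ((z (h x) + axis j 1) \<bullet> (\<psi> (k (h x)) v* Dk (h x))) = (v x v* A x) \<bullet> \<psi> x - cell_load j x \<bullet> \<psi> x"
      unfolding diffusion_matrix_inner z[OF x] kP[OF x] by (simp add: inner_add_left algebra_simps)
  qed
  also have "\<dots> = (LINT x|M. (v x v* A x) \<bullet> \<psi> x) - (LINT x|M. cell_load j x \<bullet> \<psi> x)"
    by (intro Bochner_Integration.integral_diff L2v_inner(1) A_L2v v \<psi> cell_load_L2v)
  finally show ?thesis .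
qed

text \<open>Chain rule formula for the gradient of \<zeta> \<circ> h; its values are fixed pointwise
  by the representative that \<open>weak_grad\<close> chooses.\<close>

definition pulled_grad :: "(real^'n \<Rightarrow> real) \<Rightarrow> real^'n \<Rightarrow> real^'n" where
  "pulled_grad \<zeta> x = weak_grad (h ` P) \<zeta> (h x) v* Dh x"

lemma pulled_grad_Dk: "x \<in> P \<Longrightarrow> pulled_grad \<zeta> x v* Dk (h x) = weak_grad (h ` P) \<zeta> (h x)"
  using P_cell by (simp add: pulled_grad_def vector_matrix_mul_assoc matrix_inverse')

text \<open>Test functions on the image domain correspond to gradients on \<open>P\<close>. A
  potential \<open>w\<close> of \<open>\<psi>\<close> is tested as w \<circ> k, which belongs to the
  smooth closure by \<open>H1_per_sobolev_per\<close>; conversely a test function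
  \<open>\<phi>\<close> is pulled back to \<phi> \<circ> h.\<close>

lemma is_cell_solution_iff:
  "is_cell_solution (h ` P) j \<zeta> \<longleftrightarrow> \<zeta> \<in> sobolev_per0 1 (h ` P) \<and> pulled_grad \<zeta> \<in> grads \<and>
    (\<forall>\<psi>\<in>grads. (LINT x|M. (pulled_grad \<zeta> x v* A x) \<bullet> \<psi> x) = (LINT x|M. cell_load j x \<bullet> \<psi> x))"
proof (cases "\<zeta> \<in> sobolev_per0 1 (h ` P)")
  case True
  then have HQ: "Q.H1_per \<zeta> (weak_grad (h ` P) \<zeta>)"
    by (intro Q.sobolev_per_H1_per[of _ 1]) (auto simp: sobolev_per0_def)
  have pg: "pulled_grad \<zeta> \<in> grads"
    using H1_per_pull[OF HQ] unfolding pulled_grad_def[abs_def] grads_def by blast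
  then have pgL: "pulled_grad \<zeta> \<in> L2v M" using grads_L2v by blast
  have gQ: "(\<lambda>y. weak_grad (h ` P) \<zeta> y + axis j 1) \<in> L2v Q.M"
    using HQ Q.const_L2v by (intro L2v_add) (auto simp: Q.H1_per_def)
  have key: "(LINT y|Q.M. (weak_grad (h ` P) \<zeta> y + axis j 1) \<bullet> weak_grad (h ` P) (\<lambda>y. w (k y)) y) =
      (LINT x|M. (pulled_grad \<zeta> x v* A x) \<bullet> \<psi> x) - (LINT x|M. cell_load j x \<bullet> \<psi> x)"
    if H: "H1_per w \<psi>" for w \<psi>
  proof -
    have HP: "Q.H1_per (\<lambda>y. w (k y)) (\<lambda>y. \<psi> (k y) v* Dk y)" by (rule H1_per_push[OF H])
    have \<psi>: "\<psi> \<in> L2v M" and pL: "(\<lambda>y. \<psi> (k y) v* Dk y) \<in> L2v Q.M"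
      using H HP by (auto simp: H1_per_def Q.H1_per_def)
    have ae: "AE y in Q.M. weak_grad (h ` P) (\<lambda>y. w (k y)) y = \<psi> (k y) v* Dk y"
      by (rule weak_grad_AE[OF Q.open_P Q.H1_per_is_weak_grad[OF HP]])
    then have wL: "weak_grad (h ` P) (\<lambda>y. w (k y)) \<in> L2v Q.M"
      by (intro L2v_cong_AE_lebesgue_on(1)[OF _ pL]) (auto simp: Q.open_P)
    have "(LINT y|Q.M. (weak_grad (h ` P) \<zeta> y + axis j 1) \<bullet> weak_grad (h ` P) (\<lambda>y. w (k y)) y) =
        (LINT y|Q.M. (weak_grad (h ` P) \<zeta> y + axis j 1) \<bullet> (\<psi> (k y) v* Dk y))"
    proof (rule integral_cong_AE)
      show "AE y in Q.M. (weak_grad (h ` P) \<zeta> y + axis j 1) \<bullet> weak_grad (h ` P) (\<lambda>y. w (k y)) y =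
          (weak_grad (h ` P) \<zeta> y + axis j 1) \<bullet> (\<psi> (k y) v* Dk y)" using ae by eventually_elim simp
    qed (rule borel_measurable_integrable[OF L2v_inner(1)[OF gQ wL]], rule borel_measurable_integrable[OF L2v_inner(1)[OF gQ pL]])
    also have "\<dots> = (LINT x|M. (pulled_grad \<zeta> x v* A x) \<bullet> \<psi> x) - (LINT x|M. cell_load j x \<bullet> \<psi> x)"
      by (rule cell_problem_transport[OF pgL \<psi>]) (simp add: pulled_grad_Dk)
    finally show ?thesis .
  qed
  show ?thesis
  proof
    assume sol: "is_cell_solution (h ` P) j \<zeta>"
    have "(LINT x|M. (pulled_grad \<zeta> x v* A x) \<bullet> \<psi> x) = (LINT x|M. cell_load j x \<bullet> \<psi> x)" if \<psi>: "\<psi> \<in> grads" for \<psi>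
    proof -
      obtain w where w: "H1_per w \<psi>" using \<psi> by (auto simp: grads_def)
      have "(\<lambda>y. w (k y)) \<in> sobolev_per 1 (h ` P)" by (rule Q.H1_per_sobolev_per[OF H1_per_push[OF w]])
      with sol key[OF w] show ?thesis by (simp add: is_cell_solution_def)
    qed
    with True pg show "\<zeta> \<in> sobolev_per0 1 (h ` P) \<and> pulled_grad \<zeta> \<in> grads \<and>
      (\<forall>\<psi>\<in>grads. (LINT x|M. (pulled_grad \<zeta> x v* A x) \<bullet> \<psi> x) = (LINT x|M. cell_load j x \<bullet> \<psi> x))" by blast
  next
    assume r: "\<zeta> \<in> sobolev_per0 1 (h ` P) \<and> pulled_grad \<zeta> \<in> grads \<and>
      (\<forall>\<psi>\<in>grads. (LINT x|M. (pulled_grad \<zeta> x v* A x) \<bullet> \<psi> x) = (LINT x|M. cell_load j x \<bullet> \<psi> x))"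
    have "(LINT y|Q.M. (weak_grad (h ` P) \<zeta> y + axis j 1) \<bullet> weak_grad (h ` P) \<phi> y) = 0"
      if \<phi>: "\<phi> \<in> sobolev_per 1 (h ` P)" for \<phi>
    proof -
      have Hphi: "Q.H1_per \<phi> (weak_grad (h ` P) \<phi>)" by (rule Q.sobolev_per_H1_per[OF \<phi> order_refl])
      define \<psi> where "\<psi> x = weak_grad (h ` P) \<phi> (h x) v* Dh x" for x
      have H: "H1_per (\<lambda>x. \<phi> (h x)) \<psi>" using H1_per_pull[OF Hphi] unfolding \<psi>_def[abs_def] .
      have HP: "Q.H1_per (\<lambda>y. \<phi> (h (k y))) (\<lambda>y. \<psi> (k y) v* Dk y)" by (rule H1_per_push[OF H])
      have e: "\<psi> (k y) v* Dk y = weak_grad (h ` P) \<phi> y" if "y \<in> h ` P" for y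
      proof -
        have "h (k y) = y" "k y \<in> cell" using hkQ[OF that] kQ[OF that] P_cell by auto
        then show ?thesis unfolding \<psi>_def vector_matrix_mul_assoc using matrix_inverse'[of "k y"] by simp
      qed
      have "(LINT y|Q.M. (weak_grad (h ` P) \<zeta> y + axis j 1) \<bullet> weak_grad (h ` P) \<phi> y) =
          (LINT y|Q.M. (weak_grad (h ` P) \<zeta> y + axis j 1) \<bullet> (\<psi> (k y) v* Dk y))"
        by (rule Bochner_Integration.integral_cong[OF refl]) (simp add: e)
      also have "\<dots> = (LINT x|M. (pulled_grad \<zeta> x v* A x) \<bullet> \<psi> x) - (LINT x|M. cell_load j x \<bullet> \<psi> x)"
        by (rule cell_problem_transport[OF pgL]) (use H in \<open>auto simp: H1_per_def pulled_grad_Dk\<close>)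
      also have "\<dots> = 0" using r H by (auto simp: grads_def)
      finally show ?thesis .
    qed
    then show "is_cell_solution (h ` P) j \<zeta>" using True by (simp add: is_cell_solution_def)
  qed
qed (simp add: is_cell_solution_def)

text \<open>The variational problem on the fixed domain is solved first; a potential of its solution
  is pushed forward and shifted to zero mean on the image domain. The Poincare inequality enters for
  \<open>P\<close> alone.\<close>

lemma cell_solution_exists:
  assumes P: "poincare_set P P"
  shows "is_cell_solution (h ` P) j (cell_solution (h ` P) j)"
proof -
  obtain c where c: "c > 0" "\<forall>x\<in>cell. \<forall>y. c * (norm y)\<^sup>2 \<le> (y v* A x) \<bullet> y" using diffusion_matrix_coercive by blast
  obtain v where v: "v \<in> grads" "\<forall>\<psi>\<in>grads. (LINT x|M. (v x v* A x) \<bullet> \<psi> x) = (LINT x|M. cell_load j x \<bullet> \<psi> x)"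
    using variational_solution[OF P diffusion_matrix_sup_space transpose_diffusion_matrix c(1) _ cell_load_L2v] c(2) P_cell by blast
  obtain w where w: "H1_per w v" using v(1) by (auto simp: grads_def)
  obtain b where b: "Q.H1_per (\<lambda>y. w (k y) + b) (\<lambda>y. v (k y) v* Dk y)" "(LINT y|Q.M. w (k y) + b) = 0"
    by (rule Q.H1_per_zero_mean[OF H1_per_push[OF w]]) (rule that)
  define \<zeta> where "\<zeta> y = w (k y) + b" for y
  have \<zeta>: "\<zeta> \<in> sobolev_per0 1 (h ` P)"
    using b(2) Q.H1_per_sobolev_per[OF b(1)] by (simp add: sobolev_per0_def \<zeta>_def[abs_def])
  have HQ: "Q.H1_per \<zeta> (weak_grad (h ` P) \<zeta>)"
    using \<zeta> by (intro Q.sobolev_per_H1_per[of _ 1]) (auto simp: sobolev_per0_def)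
  have pg: "H1_per (\<lambda>x. \<zeta> (h x)) (pulled_grad \<zeta>)"
    using H1_per_pull[OF HQ] unfolding pulled_grad_def[abs_def] .
  \<comment> \<open>\<open>pulled_grad\<close> uses the representative chosen by
    \<open>weak_grad\<close>, so it agrees with \<open>v\<close> almost everywhere only; both are
    weak gradients of the same function on \<open>P\<close>.\<close>
  have ae: "AE x in M. v x = pulled_grad \<zeta> x"
  proof -
    have 1: "is_weak_grad P (\<lambda>x. \<zeta> (h x)) (\<lambda>x. (v (k (h x)) v* Dk (h x)) v* Dh x)"
      by (rule H1_per_is_weak_grad, rule H1_per_pull) (use b(1) in \<open>simp add: \<zeta>_def[abs_def]\<close>)
    have "AE x in M. (v (k (h x)) v* Dk (h x)) v* Dh x = pulled_grad \<zeta> x"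
      by (rule is_weak_grad_unique[OF open_P 1 H1_per_is_weak_grad[OF pg]])
    with AE_space show ?thesis
    proof eventually_elim
      case (elim x)
      then have x: "x \<in> P" by simp
      with elim(2) show ?case by (simp add: kP vector_matrix_mul_assoc matrix_inverse[OF P_cell[OF x]])
    qed
  qed
  have vL: "v \<in> L2v M" and pL: "pulled_grad \<zeta> \<in> L2v M" using w pg by (auto simp: H1_per_def)
  have "(LINT x|M. (pulled_grad \<zeta> x v* A x) \<bullet> \<psi> x) = (LINT x|M. cell_load j x \<bullet> \<psi> x)" if \<psi>: "\<psi> \<in> grads" for \<psi>
  proof -
    have \<psi>L: "\<psi> \<in> L2v M" using \<psi> grads_L2v by blast
    have "(LINT x|M. (pulled_grad \<zeta> x v* A x) \<bullet> \<psi> x) = (LINT x|M. (v x v* A x) \<bullet> \<psi> x)"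
    proof (rule integral_cong_AE)
      show "AE x in M. (pulled_grad \<zeta> x v* A x) \<bullet> \<psi> x = (v x v* A x) \<bullet> \<psi> x" using ae by eventually_elim simp
    qed (rule borel_measurable_integrable[OF L2v_inner(1)[OF A_L2v[OF pL] \<psi>L]],
        rule borel_measurable_integrable[OF L2v_inner(1)[OF A_L2v[OF vL] \<psi>L]])
    then show ?thesis using v(2) \<psi> by simp
  qed
  then have "is_cell_solution (h ` P) j \<zeta>"
    unfolding is_cell_solution_iff using \<zeta> pg by (auto simp: grads_def)
  then show ?thesis unfolding cell_solution_def by (rule someI[of "is_cell_solution (h ` P) j"])
qed

end

theorem corollary3p6:
  fixes m :: nat and S :: real and U P :: "(real^'n) set"
    and h :: "real \<Rightarrow> real^'n \<Rightarrow> real^'n"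
    and j :: 'n and u :: "real^'n \<Rightarrow> real" and V :: "real set" and g :: "real \<Rightarrow> real^'n \<Rightarrow> real"
  assumes dim: "CARD('n) \<in> {2, 3}"
    and m: "m \<ge> 1" and S: "S > 0"
    and U: "U \<subseteq> closure cell" "\<exists>W. open W \<and> frontier cell \<subseteq> W \<and> W \<inter> closure cell \<subseteq> U"
    and h_diff: "\<And>s. s \<in> {-S<..<S} \<Longrightarrow> h s \<in> Diff_box 2 1 U"
    and h_curve: "Cm_curve m (holder_space 2 1 (closure cell)) (holder_norm 2 1 (closure cell))
                    {-S<..<S} h"
    and h_0: "\<And>y. y \<in> closure cell \<Longrightarrow> h 0 y = y"
    and P: "fluid_domain 2 1 P"
    and u: "u \<in> sobolev_per0 2 P" "is_zero_pair P (F P j u (h 0))"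
    and V: "open V" "0 \<in> V" "V \<subseteq> {-S<..<S}"
    and g_curve: "Cm_curve m (sobolev_per0 2 P) (sobolev_norm 2 P) V g"
    and g_0: "AE y in lebesgue_on P. g 0 y = u y"
    and g_zero: "\<And>s. s \<in> V \<Longrightarrow> is_zero_pair P (F P j (g s) (h s))"
  shows "Ck_on m (\<lambda>s. LINT y|lebesgue_on (h s ` P). weak_grad (h s ` P) (push (h s) (g s)) y) V \<and>
    (\<exists>W. open W \<and> 0 \<in> W \<and> W \<subseteq> {-S<..<S} \<and> Ck_on m (\<lambda>s. diffusion_tensor (h s ` P)) W)"
proof -
  \<comment> \<open>The argument for the tensor works at every parameter, so the whole interval
    serves as the neighbourhood of zero in the second claim.\<close>
  define J where "J = {-S<..<S}"
  have J: "open J" "0 \<in> J" using S by (auto simp: J_def)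
  obtain W where W: "open W" "frontier cell \<subseteq> W" "W \<inter> closure cell \<subseteq> U" using U(2) by blast
  interpret perforated_cell P by (rule fluid_domain_perforated_cell[OF P])
  define k D E where "k s = cell_inverse (h s)" and "D s = jac (h s)" and "E s = jac (k s)" for s
  have pd: "perforated_diffeo (h s) (k s) (D s) (E s) W P" if "s \<in> J" for s
    unfolding k_def D_def E_def
    by (intro perforated_diffeo.intro Diff_box_cell_diffeo[OF h_diff W] perforated_cell_axioms
        perforated_diffeo_axioms.intro dim) (use that in \<open>simp add: J_def\<close>)
  have cd: "cell_diffeo (h s) (k s) (D s) (E s) W" if "s \<in> J" for s
    using pd[OF that] by (simp add: perforated_diffeo_def)
  note ne = cell_two_points(4)
  \<comment> \<open>Read at \<open>h s x\<close>, the Jacobian of the inverse map is the inverse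
    matrix of \<open>D s x\<close>. Its regularity in \<open>s\<close> thus follows from that of
    \<open>D\<close>, without differentiating the inverse diffeomorphism in the parameter.\<close>
  define N where "N s x = E s (h s x)" for s x
  have D: "Cm_curve m (sup_space cell) (sup_norm cell) J D"
    unfolding D_def[abs_def] using h_curve by (intro Cm_curve_jac J) (simp add: J_def)
  have N: "Cm_curve m (sup_space cell) (sup_norm cell) J N"
  proof (rule Cm_curve_sup_inverse[OF ne J(1) D])
    show "N s \<in> sup_space cell" if "s \<in> J" for s
      using cell_diffeo.Dk_sup_space[OF cd[OF that]] by (simp add: N_def[abs_def])
    show "D s x ** N s x = mat 1" if "s \<in> J" "x \<in> cell" for s x
      using cell_diffeo.matrix_inverse'[OF cd[OF that(1)] that(2)] by (simp add: N_def)
  qed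
  have dD: "Cm_curve m (sup_space cell) (sup_norm cell) J (\<lambda>s x. det (D s x))" by (rule Cm_curve_sup_det[OF ne J(1) D])
  have Nt: "Cm_curve m (sup_space cell) (sup_norm cell) J (\<lambda>s x. transpose (N s x))"
    by (rule Cm_curve_sup_linear[OF bounded_linear_transpose ne J(1) N])
  have A: "Cm_curve m (sup_space cell) (sup_norm cell) J (\<lambda>s x. diffusion_matrix (D s x) (N s x))"
    unfolding diffusion_matrix_def
    by (rule Cm_curve_sup_bilinear[OF bounded_bilinear_scaleR ne J(1) dD
          Cm_curve_sup_bilinear[OF bounded_bilinear_matrix_matrix ne J(1) N Nt]])
  note flip = bounded_bilinear.flip[OF bounded_bilinear_vector_matrix]
  have "Ck_on m (\<lambda>s. LINT y|lebesgue_on (h s ` P). weak_grad (h s ` P) (push (h s) (g s)) y) V"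
  proof (rule Ck_on_cong[OF V(1)])
    have VJ: "V \<subseteq> J" using V(3) by (simp add: J_def)
    note mono = Cm_curve_mono[OF order_refl VJ]
    \<comment> \<open>After the change of variables the domain of integration is fixed, and the
      integrand is a product of \<open>C^m\<close> curves: the volume element, the inverse Jacobian
      and the gradient of \<open>g s\<close>.\<close>
    show "Ck_on m (\<lambda>s. LINT x|M. det (D s x) *\<^sub>R (weak_grad P (g s) x v* N s x)) V"
      by (rule Ck_on_integral_curve[OF V(1)
            Cm_curve_sup_L2v[OF bounded_bilinear_scaleR V(1) mono[OF dD]
              Cm_curve_sup_L2v[OF flip V(1) mono[OF N] Cm_curve_weak_grad[OF V(1) g_curve]]]])
    fix s assume s: "s \<in> V"
    then interpret T: perforated_diffeo "h s" "k s" "D s" "E s" W P using pd VJ by blast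
    have "g s \<in> sobolev_per 2 P" using g_curve s by (cases m) (auto simp: sobolev_per0_def)
    then have H: "H1_per (g s) (weak_grad P (g s))" by (rule sobolev_per_H1_per) simp
    have HP: "T.Q.H1_per (push (h s) (g s)) (\<lambda>y. weak_grad P (g s) (k s y) v* E s y)"
      using T.H1_per_push[OF H] by (simp add: push_def k_def comp_def)
    then have L: "(\<lambda>y. weak_grad P (g s) (k s y) v* E s y) \<in> L2v T.Q.M" by (simp add: T.Q.H1_per_def)
    have ae: "AE y in T.Q.M. weak_grad (h s ` P) (push (h s) (g s)) y = weak_grad P (g s) (k s y) v* E s y"
      by (rule weak_grad_AE[OF T.Q.open_P T.Q.H1_per_is_weak_grad[OF HP]])
    have L': "weak_grad (h s ` P) (push (h s) (g s)) \<in> L2v T.Q.M"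
      by (rule L2v_cong_AE_lebesgue_on(1)[OF _ L]) (use ae in \<open>auto simp: T.Q.open_P\<close>)
    have "(LINT y|T.Q.M. weak_grad (h s ` P) (push (h s) (g s)) y) = (LINT y|T.Q.M. weak_grad P (g s) (k s y) v* E s y)"
      by (rule integral_cong_AE[OF L2v_measurable[OF L'] L2v_measurable[OF L] ae])
    also have "\<dots> = (LINT x|M. det (D s x) *\<^sub>R (weak_grad P (g s) (k s (h s x)) v* E s (h s x)))"
      by (rule T.integral_image_vec[OF L, symmetric])
    also have "\<dots> = (LINT x|M. det (D s x) *\<^sub>R (weak_grad P (g s) x v* N s x))"
      by (rule Bochner_Integration.integral_cong[OF refl]) (simp add: T.kP N_def)
    finally show "(LINT x|M. det (D s x) *\<^sub>R (weak_grad P (g s) x v* N s x)) =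
      (LINT y|lebesgue_on (h s ` P). weak_grad (h s ` P) (push (h s) (g s)) y)" by simp
  qed
  moreover have "Ck_on m (\<lambda>s. diffusion_tensor (h s ` P)) J"
  proof (rule Ck_on_cong[OF J(1)])
    have PP: "poincare_set P P"
      using P by (intro poincare_P P_nonempty) (auto simp: fluid_domain_def)
    define v where "v i s = perforated_diffeo.pulled_grad (h s) (D s) P (cell_solution (h s ` P) i)" for i s
    \<comment> \<open>The cell problem on the moving domain becomes an equation on \<open>P\<close>
      whose coefficient and right-hand side are the \<open>C^m\<close> curves of \<open>A\<close>
      and \<open>load\<close>.\<close>
    have sol: "v i s \<in> grads \<and> (\<forall>\<psi>\<in>grads. (LINT x|M. (v i s x v* diffusion_matrix (D s x) (N s x)) \<bullet> \<psi> x) =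
        (LINT x|M. ((- det (D s x)) *\<^sub>R (axis i 1 v* transpose (N s x))) \<bullet> \<psi> x))" if s: "s \<in> J" for s i
    proof -
      interpret T: perforated_diffeo "h s" "k s" "D s" "E s" W P by (rule pd[OF s])
      show ?thesis
        using T.cell_solution_exists[OF PP, of i] unfolding T.is_cell_solution_iff v_def N_def T.cell_load_def by blast
    qed
    have load: "Cm_curve m (L2v M) (L2n M) J (\<lambda>s x. (- det (D s x)) *\<^sub>R (axis i 1 v* transpose (N s x)))" for i
      by (rule Cm_curve_sup_L2v[OF bounded_bilinear_scaleR J(1)
            Cm_curve_sup_linear[OF bounded_linear_minus[OF bounded_linear_ident] ne J(1) dD]
            Cm_curve_sup_L2v[OF flip J(1) Nt seminormed_space.Cm_curve_const[OF seminormed_L2v const_L2v]]])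
    have vc: "Cm_curve m (L2v M) (L2n M) J (v i)" for i
    proof (rule Cm_curve_variational[OF PP J(1) A transpose_diffusion_matrix _ load])
      fix s assume s: "s \<in> J"
      show "\<exists>c>0. \<forall>x\<in>P. \<forall>y. c * (norm y)\<^sup>2 \<le> (y v* diffusion_matrix (D s x) (N s x)) \<bullet> y"
        using cell_diffeo.diffusion_matrix_coercive[OF cd[OF s]] P_subset_cell unfolding N_def by blast
    qed (use sol in blast)+
    have col: "Cm_curve m (L2v M) (L2n M) J (\<lambda>s x. det (D s x) *\<^sub>R (v i s x v* N s x + axis i 1))" for i
    proof -
      have "Cm_curve m (L2v M) (L2n M) J (\<lambda>s x. v i s x v* N s x + 1 *\<^sub>R axis i 1)"
        by (rule seminormed_space.Cm_curve_add_scale[OF seminormed_L2v J(1) Cm_curve_sup_L2v[OF flip J(1) N vc]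
            seminormed_space.Cm_curve_const[OF seminormed_L2v const_L2v]])
      then show ?thesis using Cm_curve_sup_L2v[OF bounded_bilinear_scaleR J(1) dD] by simp
    qed
    \<comment> \<open>The column index of the tensor selects the cell problem, the row index a
      component of its integrated field.\<close>
    show "Ck_on m (\<lambda>s. \<chi> i j. (LINT x|M. det (D s x) *\<^sub>R (v j s x v* N s x + axis j 1)) $ i) J"
      by (rule Ck_on_vec_lambda, rule Ck_on_vec_lambda,
          rule Ck_on_linear_compose[OF bounded_linear_vec_nth Ck_on_integral_curve[OF J(1) col]])
    fix s assume s: "s \<in> J"
    interpret T: perforated_diffeo "h s" "k s" "D s" "E s" W P by (rule pd[OF s])
    have "(LINT x|M. det (D s x) *\<^sub>R (v j s x v* N s x + axis j 1)) $ i = diffusion_tensor (h s ` P) $ i $ j" for i j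
    proof -
      define \<zeta> where "\<zeta> = cell_solution (h s ` P) j"
      have "\<zeta> \<in> sobolev_per0 1 (h s ` P)"
        using T.cell_solution_exists[OF PP, of j] by (simp add: is_cell_solution_def \<zeta>_def)
      then have "T.Q.H1_per \<zeta> (weak_grad (h s ` P) \<zeta>)"
        by (intro T.Q.sobolev_per_H1_per[of _ 1]) (auto simp: sobolev_per0_def)
      then have L: "(\<lambda>y. weak_grad (h s ` P) \<zeta> y + axis j 1) \<in> L2v T.Q.M"
        by (intro L2v_add T.Q.const_L2v) (simp add: T.Q.H1_per_def)
      have "(LINT x|M. det (D s x) *\<^sub>R (v j s x v* N s x + axis j 1)) =
          (LINT x|M. det (D s x) *\<^sub>R (weak_grad (h s ` P) \<zeta> (h s x) + axis j 1))"
        by (rule Bochner_Integration.integral_cong[OF refl]) (simp add: v_def N_def T.pulled_grad_Dk \<zeta>_def)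
      also have "\<dots> = (LINT y|T.Q.M. weak_grad (h s ` P) \<zeta> y + axis j 1)" by (rule T.integral_image_vec[OF L])
      also have "\<dots> $ i = (LINT y|T.Q.M. (weak_grad (h s ` P) \<zeta> y + axis j 1) $ i)"
        by (rule integral_bounded_linear[OF bounded_linear_vec_nth T.Q.L2v_integrable[OF L], symmetric])
      also have "\<dots> = diffusion_tensor (h s ` P) $ i $ j"
        by (simp add: diffusion_tensor_def weak_grad_def axis_def \<zeta>_def)
      finally show ?thesis .
    qed
    then show "(\<chi> i j. (LINT x|M. det (D s x) *\<^sub>R (v j s x v* N s x + axis j 1)) $ i) = diffusion_tensor (h s ` P)"
      by (simp add: vec_eq_iff)
  qed
  ultimately show ?thesis using J unfolding J_def by blast
qed

end
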